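(* Let $d\in\{2,3\}$, let $(\rho_0,u_0)\in L^\infty(\mathbb{R}^d)\times L^2_\sigma(\mathbb{R}^d;\mathbb{R}^d)$ and assume that there exist two constants $c_0,C_0$ such that $0<c_0\le\rho_0(x)\le C_0$ for almost every $x\in\mathbb{R}^d$. Let $(\rho,u)$ be a Leray-Hopf weak solution of the inhomogeneous Navier-Stokes equations (INS) with initial data $(\rho_0,u_0)$. Then, for almost every $(t,x)\in[0,\infty)\times\mathbb{R}^d$, $$0<c_0\le\rho(t,x)\le C_0.$$
   Context: The system (INS), with viscosity $\nu>0$, is $$\partial_t\rho+\operatorname{div}(\rho u)=0,\quad \partial_t(\rho u)+\operatorname{div}(\rho u\otimes u)-\nu\Delta u+\nabla P=0,\quad \operatorname{div}u=0\quad\text{on }(0,\infty)\times\mathbb{R}^d,$$ with $\rho(0)=\rho_0$, $u(0)=u_0$; here $\rho\ge0$ is the density, $u$ the $\mathbb{R}^d$-valued velocity and $P$ the pressure. $L^2_\sigma$ denotes the space of divergence-free $L^2$ vector fields, and $C^\infty_{c,\sigma}$ the space of divergence-free smooth compactly supported vector fields (divergence with respect to $x$). Convention: $v\otimes w:\nabla z=\sum_{i,j}v_iw_j\partial_iz_j$. **Leray-Hopf weak solution.** For $(\rho_0,u_0)$ with $0<c_0\le\rho_0\le C_0<\infty$ a.e. and $u_0\in L^2_\sigma$, $(\rho,u)$ is a Leray-Hopf weak solution of (INS) with initial data $(\rho_0,u_0)$ if: (i) $\sqrt\rho\,u\in L^\infty((0,\infty);L^2(\mathbb{R}^d))$, $\rho\in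 L^\infty((0,\infty)\times\mathbb{R}^d)$, $u\in L^2_{\rm loc}((0,\infty)\times\mathbb{R}^d)$, $\nabla u\in L^2((0,\infty);L^2(\mathbb{R}^d))$. (ii) For every $\varphi\in C_c^\infty([0,\infty)\times\mathbb{R}^d;\mathbb{R})$: $-\int_0^\infty\!\int\rho\,\partial_s\varphi\,dx\,ds=\int_0^\infty\!\int\rho u\cdot\nabla\varphi\,dx\,ds+\int\rho_0\varphi(0)\,dx$; for every $\varphi\in C^\infty_{c,\sigma}([0,\infty)\times\mathbb{R}^d;\mathbb{R}^d)$: $-\int_0^\infty\!\int(\rho\,\partial_t\varphi\cdot u+\rho u\otimes u:\nabla\varphi)\,dx\,ds+\nu\int_0^\infty\!\int\nabla u:\nabla\varphi\,dx\,ds=\int\rho_0u_0\cdot\varphi(0)\,dx$; for every $\varphi\in C_c^\infty([0,\infty)\times\mathbb{R}^d;\mathbb{R})$: $\int_0^\infty\!\int u\cdot\nabla\varphi\,dx\,ds=0$. (iii) For every $t\in(0,\infty)$: $\frac12\int\rho(t)|u(t)|^2dx+\nu\int_0^t\!\int|\nabla u|^2dx\,ds\le\frac12\int\rho_0|u_0|^2dx$. The density of a Leray-Hopf weak solution is always taken to be (its representative) in $C_{w^*}([0,\infty);L^\infty(\mathbb{R}^d))$, i.e. weak-$*$ continuous in time. *)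

theory Defs
  imports "HOL-Analysis.Analysis"
begin

subsection \<open>Smooth functions, gradients, test functions\<close>

text \<open>In finite dimension a function is of class C^(k+1) iff it is differentiable everywhere and
  all its directional derivatives are of class C^k.\<close>

primrec C_k :: "nat \<Rightarrow> ('a::euclidean_space \<Rightarrow> 'b::euclidean_space) \<Rightarrow> bool" where
  "C_k 0 f \<longleftrightarrow> continuous_on UNIV f"
| "C_k (Suc k) f \<longleftrightarrow>
     (\<forall>x. f differentiable (at x)) \<and> (\<forall>v. C_k k (\<lambda>x. frechet_derivative f (at x) v))"

definition smooth :: "('a::euclidean_space \<Rightarrow> 'b::euclidean_space) \<Rightarrow> bool" where
  "smooth f \<longleftrightarrow> (\<forall>k. C_k k f)"

definition Cc_infinity :: "('a::euclidean_space \<Rightarrow> 'b::euclidean_space) \<Rightarrow> bool" where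
  "Cc_infinity f \<longleftrightarrow> smooth f \<and> compact (closure {x. f x \<noteq> 0})"

text \<open>The i-th entry of the gradient is the partial derivative in direction i, which for a vector
  field z is itself a vector: \<open>grad z x $ i $ j\<close> is the i-th partial derivative of the j-th
  component of z.\<close>

definition grad :: "(real^'n \<Rightarrow> 'b::real_normed_vector) \<Rightarrow> real^'n \<Rightarrow> 'b^'n" where
  "grad f x = (\<chi> i. frechet_derivative f (at x) (axis i 1))"

definition divergence :: "(real^'n \<Rightarrow> real^'n) \<Rightarrow> real^'n \<Rightarrow> real" where
  "divergence f x = (\<Sum>i\<in>UNIV. grad f x $ i $ i)"

definition dt :: "(real \<Rightarrow> real^'n \<Rightarrow> 'b::real_normed_vector) \<Rightarrow> real \<Rightarrow> real^'n \<Rightarrow> 'b" where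
  "dt f t x = vector_derivative (\<lambda>s. f s x) (at t)"

text \<open>With this and the inner product of \<open>real^'n^'n\<close> (the Frobenius product), the contraction
  \<open>v \<otimes> w : \<nabla>z\<close>, that is, the sum of \<open>v_i w_j \<partial>_i z_j\<close>, is \<open>tensor v w \<bullet> grad z x\<close>.\<close>

definition tensor :: "real^'n \<Rightarrow> real^'n \<Rightarrow> real^'n^'n" where
  "tensor v w = (\<chi> i j. v $ i * w $ j)"

text \<open>Smooth functions on the closed half-space \<open>[0,\<infinity>) \<times> R^d\<close> are restrictions of smooth functions
  on \<open>R \<times> R^d\<close>, so test functions on the former are represented by compactly supported smooth
  functions on the latter that need not vanish at negative times. Only their values at times
  \<open>t \<ge> 0\<close> are used, and only there is the divergence required to vanish.\<close>

definition test_closed :: "(real \<Rightarrow> real^'n \<Rightarrow> 'b::euclidean_space) \<Rightarrow> bool" where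
  "test_closed \<phi> \<longleftrightarrow> Cc_infinity (\<lambda>(t, x). \<phi> t x)"

definition test_closed_sigma :: "(real \<Rightarrow> real^'n \<Rightarrow> real^'n) \<Rightarrow> bool" where
  "test_closed_sigma \<phi> \<longleftrightarrow> test_closed \<phi> \<and> (\<forall>t\<ge>0. \<forall>x. divergence (\<phi> t) x = 0)"

definition test_open :: "(real \<Rightarrow> real^'n \<Rightarrow> 'b::euclidean_space) \<Rightarrow> bool" where
  "test_open \<phi> \<longleftrightarrow> Cc_infinity (\<lambda>(t, x). \<phi> t x) \<and>
     closure {(t, x). \<phi> t x \<noteq> 0} \<subseteq> {0<..} \<times> UNIV"


subsection \<open>Function spaces\<close>

definition L2 :: "'a measure \<Rightarrow> ('a \<Rightarrow> 'b::euclidean_space) \<Rightarrow> bool" where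
  "L2 M f \<longleftrightarrow> f \<in> borel_measurable M \<and> integrable M (\<lambda>x. (norm (f x))\<^sup>2)"

definition L_infinity :: "'a measure \<Rightarrow> ('a \<Rightarrow> 'b::euclidean_space) \<Rightarrow> bool" where
  "L_infinity M f \<longleftrightarrow> f \<in> borel_measurable M \<and> (\<exists>B. AE x in M. norm (f x) \<le> B)"

abbreviation spacetime :: "(real \<times> (real^'n)) measure" where
  "spacetime \<equiv> lebesgue_on ({0<..} \<times> UNIV)"

definition L2_loc :: "(real \<Rightarrow> real^'n \<Rightarrow> 'b::euclidean_space) \<Rightarrow> bool" where
  "L2_loc f \<longleftrightarrow> (\<forall>K. compact K \<and> K \<subseteq> {0<..} \<times> UNIV \<longrightarrow> L2 (lebesgue_on K) (\<lambda>(t, x). f t x))"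

definition L_infinity_L2 :: "(real \<Rightarrow> real^'n \<Rightarrow> 'b::euclidean_space) \<Rightarrow> bool" where
  "L_infinity_L2 f \<longleftrightarrow> (\<lambda>(t, x). f t x) \<in> borel_measurable spacetime \<and>
     (\<exists>B. AE t in lebesgue_on {0<..}.
        L2 lebesgue (f t) \<and> (LINT x|lebesgue. (norm (f t x))\<^sup>2) \<le> B)"

definition weak_star_continuous :: "(real \<Rightarrow> real^'n \<Rightarrow> real) \<Rightarrow> bool" where
  "weak_star_continuous \<rho> \<longleftrightarrow> (\<forall>t\<ge>0. L_infinity lebesgue (\<rho> t)) \<and>
     (\<forall>g. integrable lebesgue g \<longrightarrow> continuous_on {0..} (\<lambda>t. LINT x|lebesgue. \<rho> t x * g x))"

definition L2_sigma :: "(real^'n \<Rightarrow> real^'n) \<Rightarrow> bool" where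
  "L2_sigma v \<longleftrightarrow> L2 lebesgue v \<and>
     (\<forall>\<phi>::real^'n \<Rightarrow> real. Cc_infinity \<phi> \<longrightarrow> (LINT x|lebesgue. v x \<bullet> grad \<phi> x) = 0)"

definition has_weak_gradient ::
    "(real \<Rightarrow> real^'n \<Rightarrow> real^'n) \<Rightarrow> (real \<Rightarrow> real^'n \<Rightarrow> real^'n^'n) \<Rightarrow> bool" where
  "has_weak_gradient u G \<longleftrightarrow> (\<forall>\<phi>::real \<Rightarrow> real^'n \<Rightarrow> real. test_open \<phi> \<longrightarrow>
     (\<forall>i j. (LINT (t, x)|spacetime. u t x $ j * grad (\<phi> t) x $ i) =
            - (LINT (t, x)|spacetime. G t x $ i $ j * \<phi> t x)))"


subsection \<open>The weak formulation\<close>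

definition weak_mass ::
    "(real^'n \<Rightarrow> real) \<Rightarrow> (real \<Rightarrow> real^'n \<Rightarrow> real) \<Rightarrow> (real \<Rightarrow> real^'n \<Rightarrow> real^'n) \<Rightarrow> bool" where
  "weak_mass \<rho>\<^sub>0 \<rho> u \<longleftrightarrow> (\<forall>\<phi>::real \<Rightarrow> real^'n \<Rightarrow> real. test_closed \<phi> \<longrightarrow>
     - (LINT (s, x)|spacetime. \<rho> s x * dt \<phi> s x) =
       (LINT (s, x)|spacetime. \<rho> s x * (u s x \<bullet> grad (\<phi> s) x))
       + (LINT x|lebesgue. \<rho>\<^sub>0 x * \<phi> 0 x))"

definition weak_momentum ::
    "real \<Rightarrow> (real^'n \<Rightarrow> real) \<Rightarrow> (real^'n \<Rightarrow> real^'n) \<Rightarrow> (real \<Rightarrow> real^'n \<Rightarrow> real) \<Rightarrow>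
     (real \<Rightarrow> real^'n \<Rightarrow> real^'n) \<Rightarrow> (real \<Rightarrow> real^'n \<Rightarrow> real^'n^'n) \<Rightarrow> bool" where
  "weak_momentum \<nu> \<rho>\<^sub>0 u\<^sub>0 \<rho> u G \<longleftrightarrow> (\<forall>\<phi>::real \<Rightarrow> real^'n \<Rightarrow> real^'n. test_closed_sigma \<phi> \<longrightarrow>
     - (LINT (s, x)|spacetime. \<rho> s x * (dt \<phi> s x \<bullet> u s x)
          + \<rho> s x * (tensor (u s x) (u s x) \<bullet> grad (\<phi> s) x))
     + \<nu> * (LINT (s, x)|spacetime. G s x \<bullet> grad (\<phi> s) x) =
     (LINT x|lebesgue. \<rho>\<^sub>0 x * (u\<^sub>0 x \<bullet> \<phi> 0 x)))"

text \<open>Since u is only required to be locally square integrable away from \<open>t = 0\<close>, the existence of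
  the integral is part of the condition (an undefined Bochner integral would be 0).\<close>

definition weak_incompressible :: "(real \<Rightarrow> real^'n \<Rightarrow> real^'n) \<Rightarrow> bool" where
  "weak_incompressible u \<longleftrightarrow> (\<forall>\<phi>::real \<Rightarrow> real^'n \<Rightarrow> real. test_closed \<phi> \<longrightarrow>
     integrable spacetime (\<lambda>(s, x). u s x \<bullet> grad (\<phi> s) x) \<and>
     (LINT (s, x)|spacetime. u s x \<bullet> grad (\<phi> s) x) = 0)"

definition energy_inequality ::
    "real \<Rightarrow> (real^'n \<Rightarrow> real) \<Rightarrow> (real^'n \<Rightarrow> real^'n) \<Rightarrow> (real \<Rightarrow> real^'n \<Rightarrow> real) \<Rightarrow>
     (real \<Rightarrow> real^'n \<Rightarrow> real^'n) \<Rightarrow> (real \<Rightarrow> real^'n \<Rightarrow> real^'n^'n) \<Rightarrow> bool" where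
  "energy_inequality \<nu> \<rho>\<^sub>0 u\<^sub>0 \<rho> u G \<longleftrightarrow> (\<forall>t>0.
     integrable lebesgue (\<lambda>x. \<rho> t x * (norm (u t x))\<^sup>2) \<and>
     1/2 * (LINT x|lebesgue. \<rho> t x * (norm (u t x))\<^sup>2)
       + \<nu> * (LINT (s, x)|lebesgue_on ({0<..<t} \<times> UNIV). (norm (G s x))\<^sup>2)
     \<le> 1/2 * (LINT x|lebesgue. \<rho>\<^sub>0 x * (norm (u\<^sub>0 x))\<^sup>2))"

text \<open>The density is the representative that is weak-* continuous in time. G is the weak spatial
  gradient of u, unique up to a null set. The velocity is a function, not a class, so that the
  energy inequality is meaningful at every positive time.\<close>

definition Leray_Hopf ::
    "real \<Rightarrow> (real^'n \<Rightarrow> real) \<Rightarrow> (real^'n \<Rightarrow> real^'n) \<Rightarrow> (real \<Rightarrow> real^'n \<Rightarrow> real) \<Rightarrow>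
     (real \<Rightarrow> real^'n \<Rightarrow> real^'n) \<Rightarrow> bool" where
  "Leray_Hopf \<nu> \<rho>\<^sub>0 u\<^sub>0 \<rho> u \<longleftrightarrow>
     (AE (t, x) in spacetime. 0 \<le> \<rho> t x) \<and>
     weak_star_continuous \<rho> \<and>
     L_infinity_L2 (\<lambda>t x. sqrt (\<rho> t x) *\<^sub>R u t x) \<and>
     L_infinity spacetime (\<lambda>(t, x). \<rho> t x) \<and>
     L2_loc u \<and>
     (\<exists>G. has_weak_gradient u G \<and> L2 spacetime (\<lambda>(t, x). G t x) \<and>
        weak_mass \<rho>\<^sub>0 \<rho> u \<and>
        weak_momentum \<nu> \<rho>\<^sub>0 u\<^sub>0 \<rho> u G \<and>
        weak_incompressible u \<and>
        energy_inequality \<nu> \<rho>\<^sub>0 u\<^sub>0 \<rho> u G)"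

end

theory Submission
  imports Defs
begin

text \<open>DiPerna--Lions renormalisation. The density is extended to negative times by its initial value
  and the velocity by zero, which absorbs the initial condition into a transport equation on the
  whole of \<open>\<real> \<times> \<real>\<^sup>d\<close>. Incompressibility, tested with cut-off coordinate functions, makes the velocity
  locally integrable up to the initial time. No lower bound on the density is available beforehand,
  so the bound on \<open>\<rho> |u|\<^sup>2\<close> does not directly control the velocity; but the density mollified at a large scale
  moves slowly and stays above half of its initial lower bound on a bounded time interval, and
  with the square integrable gradient this gives \<open>u \<in> L\<^sup>2\<close> on that interval. The commutator in the
  equation of the mollified density is the integral of
  \<open>(\<rho>(y) - \<rho>(x)) (u(y) - u(x)) \<bullet> \<nabla>k(y - x)\<close> and tends to zero, hence a convex function \<open>\<beta>\<close> of the
  density is transported. For \<open>\<beta>\<close> the squared distance to \<open>[c\<^sub>0, C\<^sub>0]\<close>, which vanishes initially, the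
  cut-off \<open>\<phi> = (1 - |x|\<^sup>2/R\<^sup>2)\<^sub>+\<^sup>2\<close> satisfies \<open>|\<nabla>\<phi>| \<le> (4/R) \<surd>\<phi>\<close>; by the Cauchy--Schwarz inequality the
  weighted integral of \<open>\<beta>(\<rho>)\<close> is at most of order \<open>1/R\<^sup>2\<close>, so it vanishes.\<close>

subsection \<open>Smooth functions\<close>

text \<open>The gradient of the kernel puts a factor 1/\<epsilon> into the commutator. Square
  integrability of the velocity gradient makes the L2 norm of the velocity increment of order
  \<epsilon>, which absorbs this factor. The smallness comes from the density increment: it is
  bounded, and its L1 norm on bounded sets tends to 0 with the shift, whatever the regularity of the
  density. Convexity of \<beta> reduces the chain rule along the mollified density to an inequality,
  and one sign is all that is used. Since \<beta>(\<rho>) is not known to be integrable over space,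
  the flux through the cut-off does not vanish merely because the cut-off moves away; the bound of
  its gradient by its square root makes the estimate close on itself, N \<le> (const/R) sqrt N for
  the weighted integral N. This requires a velocity that is square integrable over the whole space,
  hence the detour through a large scale: there the mass flux is controlled by the energy alone, and
  comparing u(x) with u at neighbouring points costs only the gradient.\<close>

lemma C_k_lower: "C_k (Suc k) f \<Longrightarrow> C_k k f"
proof (induction k arbitrary: f)
  case 0
  then show ?case
    by (auto simp: continuous_on_eq_continuous_at intro!: differentiable_imp_continuous_within)
next
  case (Suc k)
  show ?case
    unfolding C_k.simps(2)[of k]
  proof (intro conjI allI)
    fix x v
    show "f differentiable at x" using Suc.prems by simp
    show "C_k k (\<lambda>x. frechet_derivative f (at x) v)"
      by (rule Suc.IH) (use Suc.prems in \<open>unfold C_k.simps(2)[of "Suc k"], blast\<close>)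
  qed
qed

text \<open>Allows any explicit derivative in place of the chosen \<open>frechet_derivative\<close>;
  uniqueness of derivatives identifies the two.\<close>

lemma C_k_SucI:
  assumes "\<And>x. (f has_derivative f' x) (at x)" "\<And>v. C_k k (\<lambda>x. f' x v)"
  shows "C_k (Suc k) f"
  using assms frechet_derivative_at[OF assms(1)] unfolding C_k.simps
  by (auto simp: differentiable_def)

lemma C_k_SucD:
  assumes "C_k (Suc k) f"
  shows "(f has_derivative frechet_derivative f (at x)) (at x)"
    "C_k k (\<lambda>x. frechet_derivative f (at x) v)"
  using assms by (auto simp: frechet_derivative_works)

lemma C_k_const: "C_k k (\<lambda>x. c)"
  by (induction k arbitrary: c) (auto intro!: C_k_SucI derivative_eq_intros simp del: C_k.simps(2))

lemma C_k_bounded_linear: "bounded_linear f \<Longrightarrow> C_k k f"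
proof (cases k)
  case (Suc m)
  assume "bounded_linear f"
  then have "(f has_derivative f) (at x)" for x by (rule bounded_linear_imp_has_derivative)
  then show ?thesis unfolding Suc by (rule C_k_SucI) (rule C_k_const)
qed (auto intro: linear_continuous_on)

lemma C_k_add:
  assumes "C_k k f" "C_k k g"
  shows "C_k k (\<lambda>x. f x + g x)"
  using assms
proof (induction k arbitrary: f g)
  case (Suc k)
  show ?case
    by (rule C_k_SucI[OF has_derivative_add[OF C_k_SucD(1)[OF Suc.prems(1)] C_k_SucD(1)[OF Suc.prems(2)]]])
       (intro Suc.IH C_k_SucD(2) Suc.prems)
qed (auto intro: continuous_on_add)

lemma C_k_mult:
  fixes f g :: "'a::euclidean_space \<Rightarrow> real"
  assumes "C_k k f" "C_k k g"
  shows "C_k k (\<lambda>x. f x * g x)"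
  using assms
proof (induction k arbitrary: f g)
  case (Suc k)
  show ?case
    by (rule C_k_SucI[OF has_derivative_mult[OF C_k_SucD(1)[OF Suc.prems(1)] C_k_SucD(1)[OF Suc.prems(2)]]])
       (intro C_k_add Suc.IH C_k_SucD(2) Suc.prems C_k_lower)
qed (auto intro: continuous_on_mult)

lemma C_k_affine:
  fixes f :: "'b::euclidean_space \<Rightarrow> 'c::euclidean_space" and L :: "'a::euclidean_space \<Rightarrow> 'b"
  assumes "C_k k f" "bounded_linear L"
  shows "C_k k (\<lambda>x. f (a + L x))"
  using assms(1)
proof (induction k arbitrary: f)
  case 0
  then have "continuous_on UNIV f" by simp
  then show ?case
    by (auto intro!: continuous_on_compose2[of UNIV f] continuous_on_add linear_continuous_on[OF assms(2)])
next
  case (Suc k)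
  have L: "((\<lambda>x. a + L x) has_derivative L) (at x)" for x
    by (auto intro!: derivative_eq_intros bounded_linear_imp_has_derivative assms)
  show ?case
    by (rule C_k_SucI[OF has_derivative_compose[OF L C_k_SucD(1)[OF Suc.prems]]])
       (intro Suc.IH C_k_SucD(2) Suc.prems)
qed

text \<open>The derivative of 1/f is the derivative of f times two factors 1/f, up to sign, so the
  induction hypothesis for 1/f itself closes the induction.\<close>

lemma C_k_inverse:
  fixes f :: "'a::euclidean_space \<Rightarrow> real"
  assumes "C_k k f" "\<And>x. f x \<noteq> 0"
  shows "C_k k (\<lambda>x. inverse (f x))"
  using assms(1)
proof (induction k)
  case 0
  then show ?case using assms(2) by (auto intro!: continuous_on_inverse)
next
  case (Suc k)
  have IH: "C_k k (\<lambda>x. inverse (f x))" by (rule Suc.IH[OF C_k_lower[OF Suc.prems]])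
  have "C_k k (\<lambda>x. (-1) * (inverse (f x) * frechet_derivative f (at x) v * inverse (f x)))" for v
    by (intro C_k_mult C_k_const IH C_k_SucD(2) Suc.prems)
  then show ?case
    by (intro C_k_SucI[OF Deriv.has_derivative_inverse[OF assms(2) C_k_SucD(1)[OF Suc.prems]]]) simp_all
qed

section \<open>A smooth transition function\<close>

lemma C_k_Suc_real:
  fixes f :: "real \<Rightarrow> real"
  assumes "\<And>x. (f has_real_derivative f' x) (at x)" "C_k k f'"
  shows "C_k (Suc k) f"
  by (rule C_k_SucI[OF has_field_derivative_imp_has_derivative[OF assms(1)]])
     (intro C_k_mult C_k_const assms)

text \<open>The powers of 1/t are carried along because they make the family closed under
  differentiation up to linear combinations. Smoothness at 0 is then one induction over the order of
  differentiation, for all n at once.\<close>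

definition exp_flat :: "nat \<Rightarrow> real \<Rightarrow> real" where
  "exp_flat n t = (if t \<le> 0 then 0 else inverse t ^ n * exp (- inverse t))"

text \<open>From the right, s = 1/t turns the claim into the decay of s^n / exp s at
  infinity.\<close>

lemma exp_flat_tendsto: "(exp_flat n \<longlongrightarrow> 0) (at 0)"
proof (rule filterlim_split_at)
  have "((\<lambda>t. 0) \<longlongrightarrow> (0::real)) (at_left 0)" by simp
  then show "(exp_flat n \<longlongrightarrow> 0) (at_left 0)"
    by (rule Lim_transform_eventually) (auto simp: eventually_at_filter exp_flat_def)
  have "((\<lambda>t::real. inverse t ^ n / exp (inverse t)) \<longlongrightarrow> 0) (at_right 0)"
    by (rule filterlim_compose[OF tendsto_power_div_exp_0 filterlim_inverse_at_top_right])
  then show "(exp_flat n \<longlongrightarrow> 0) (at_right 0)"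
    by (rule Lim_transform_eventually)
       (auto simp: eventually_at_filter exp_flat_def exp_minus divide_inverse)
qed

lemma exp_flat_deriv:
  "(exp_flat n has_real_derivative exp_flat (n + 2) t + (- real n) * exp_flat (n + 1) t) (at t)"
proof -
  consider "t < 0" | "t = 0" | "t > 0" by linarith
  then show ?thesis
  proof cases
    case 1
    have "((\<lambda>t. 0) has_real_derivative 0) (at t)" by simp
    then have "(exp_flat n has_real_derivative 0) (at t)"
      by (rule DERIV_cong_ev[THEN iffD1, rotated 3])
         (use 1 in \<open>auto simp: exp_flat_def eventually_nhds intro!: exI[of _ "{..<0}"]\<close>)
    then show ?thesis using 1 by (simp add: exp_flat_def)
  next
    case 2
    \<comment> \<open>At 0 the difference quotient of \<open>exp_flat n\<close> is
      \<open>exp_flat (Suc n)\<close>, whose limit is known.\<close>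
    have "((\<lambda>h. (exp_flat n (0 + h) - exp_flat n 0) / h) \<longlongrightarrow> 0) (at 0)"
      by (rule Lim_transform_eventually[OF exp_flat_tendsto[of "Suc n"]])
         (auto simp: exp_flat_def eventually_at_filter divide_inverse)
    then show ?thesis using 2 by (simp add: DERIV_def exp_flat_def)
  next
    case 3
    have inv: "((\<lambda>t. inverse t) has_real_derivative - (inverse t ^ 2)) (at t)"
      using DERIV_inverse[of t UNIV] 3 by (simp add: power2_eq_square power_inverse)
    have "((\<lambda>t. inverse t ^ n * exp (- inverse t)) has_real_derivative
        exp_flat (n + 2) t + (- real n) * exp_flat (n + 1) t) (at t)"
    proof (rule DERIV_cong[OF DERIV_mult[OF DERIV_power[OF inv]
            DERIV_chain2[OF DERIV_exp DERIV_minus[OF inv]]]])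
    qed (use 3 in \<open>cases n; simp add: exp_flat_def power2_eq_square algebra_simps\<close>)
    then show ?thesis
      by (rule DERIV_cong_ev[THEN iffD1, rotated 3])
         (use 3 in \<open>auto simp: exp_flat_def eventually_nhds intro!: exI[of _ "{0<..}"]\<close>)
  qed
qed

lemma C_k_exp_flat: "C_k k (exp_flat n)"
proof (induction k arbitrary: n)
  case 0
  then show ?case
    using exp_flat_deriv by (auto simp: continuous_on_eq_continuous_at intro: DERIV_isCont)
next
  case (Suc k)
  show ?case
    by (rule C_k_Suc_real[OF exp_flat_deriv]) (intro C_k_add C_k_mult C_k_const Suc.IH)
qed

lemma smooth_const: "smooth (\<lambda>x. c)"
  by (simp add: smooth_def C_k_const)

lemma smooth_bounded_linear: "bounded_linear f \<Longrightarrow> smooth f"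
  by (simp add: smooth_def C_k_bounded_linear)

lemma smooth_add: "smooth f \<Longrightarrow> smooth g \<Longrightarrow> smooth (\<lambda>x. f x + g x)"
  by (simp add: smooth_def C_k_add)

lemma smooth_mult:
  "smooth f \<Longrightarrow> smooth g \<Longrightarrow> smooth (\<lambda>x. f x * g x)" for f g :: "'a::euclidean_space \<Rightarrow> real"
  by (simp add: smooth_def C_k_mult)

lemma smooth_affine:
  "smooth f \<Longrightarrow> bounded_linear L \<Longrightarrow> smooth (\<lambda>x. f (a + L x))"
  for f :: "'b::euclidean_space \<Rightarrow> 'c::euclidean_space" and L :: "'a::euclidean_space \<Rightarrow> 'b"
  by (simp add: smooth_def C_k_affine)

lemma smooth_translate: "smooth f \<Longrightarrow> smooth (\<lambda>x. f (x + a))"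
  using smooth_affine[of f "\<lambda>x. x" a] by (simp add: bounded_linear_ident add.commute)

lemma smooth_inverse:
  "smooth f \<Longrightarrow> (\<And>x. f x \<noteq> 0) \<Longrightarrow> smooth (\<lambda>x. inverse (f x))"
  for f :: "'a::euclidean_space \<Rightarrow> real"
  by (simp add: smooth_def C_k_inverse)

lemma smooth_prod:
  fixes f :: "'i \<Rightarrow> 'a::euclidean_space \<Rightarrow> real"
  shows "(\<And>i. i \<in> I \<Longrightarrow> smooth (f i)) \<Longrightarrow> smooth (\<lambda>x. \<Prod>i\<in>I. f i x)"
  by (induction I rule: infinite_finite_induct) (auto intro: smooth_const smooth_mult)

lemma smooth_exp_flat: "smooth (exp_flat n)"
  by (simp add: smooth_def C_k_exp_flat)

lemma smooth_has_derivative: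
  "smooth f \<Longrightarrow> (f has_derivative frechet_derivative f (at x)) (at x)"
  by (meson C_k_SucD(1) smooth_def)

lemma smooth_continuous_on: "smooth f \<Longrightarrow> continuous_on A f"
  using C_k.simps(1)[of f] continuous_on_subset[of UNIV f A] unfolding smooth_def by blast

lemma smooth_continuous_on_derivative:
  "smooth f \<Longrightarrow> continuous_on A (\<lambda>x. frechet_derivative f (at x) v)"
  using C_k_SucD(2)[of 0 f v] continuous_on_subset[of UNIV _ A] unfolding smooth_def C_k.simps(1) by blast

lemma smooth_measurable: "smooth f \<Longrightarrow> f \<in> borel_measurable borel"
  by (intro borel_measurable_continuous_onI smooth_continuous_on)

lemma smooth_measurable_derivative:
  "smooth f \<Longrightarrow> (\<lambda>x. frechet_derivative f (at x) v) \<in> borel_measurable borel"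
  by (intro borel_measurable_continuous_onI smooth_continuous_on_derivative)

text \<open>The standard smooth transition from 0 on t \<le> 0 to 1 on t \<ge> 1. The denominator is
  positive because t and 1 - t are never both nonpositive.\<close>

definition smooth_step :: "real \<Rightarrow> real" where
  "smooth_step t = exp_flat 0 t * inverse (exp_flat 0 t + exp_flat 0 (1 - t))"

lemma exp_flat_nonneg: "0 \<le> exp_flat n t"
  by (simp add: exp_flat_def)

lemma exp_flat_pos: "0 < t \<Longrightarrow> 0 < exp_flat n t"
  by (simp add: exp_flat_def)

lemma smooth_step_denom: "exp_flat 0 t + exp_flat 0 (1 - t) > 0"
  by (cases "t > 0") (simp_all add: add_pos_nonneg add_nonneg_pos exp_flat_nonneg exp_flat_pos)

lemma smooth_smooth_step: "smooth smooth_step"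
proof -
  have *: "smooth (\<lambda>t. exp_flat 0 (1 - t))"
    using smooth_affine[OF smooth_exp_flat[of 0] bounded_linear_minus[OF bounded_linear_ident], of 1]
    by simp
  show ?thesis
    unfolding smooth_step_def[abs_def]
    by (intro smooth_mult smooth_inverse smooth_add smooth_exp_flat *)
       (use smooth_step_denom in \<open>metis less_irrefl\<close>)
qed

lemma smooth_step_eq_0: "t \<le> 0 \<Longrightarrow> smooth_step t = 0"
  by (simp add: smooth_step_def exp_flat_def)

lemma smooth_step_eq_1: "1 \<le> t \<Longrightarrow> smooth_step t = 1"
  using smooth_step_denom[of t] by (simp add: smooth_step_def exp_flat_def)

lemma smooth_step_nonneg: "0 \<le> smooth_step t"
  using smooth_step_denom[of t] by (simp add: smooth_step_def exp_flat_nonneg)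

lemma smooth_step_le_1: "smooth_step t \<le> 1"
  using smooth_step_denom[of t] exp_flat_nonneg[of 0 "1 - t"]
  by (simp add: smooth_step_def field_simps)

section \<open>Compactly supported smooth functions\<close>

lemma Cc_infinity_iff: "Cc_infinity f \<longleftrightarrow> smooth f \<and> bounded {x. f x \<noteq> 0}"
  by (simp add: Cc_infinity_def compact_closure)

lemma Cc_infinityI:
  assumes "smooth f" "\<And>x. x \<notin> S \<Longrightarrow> f x = 0" "bounded S"
  shows "Cc_infinity f"
  using assms bounded_subset[of S "{x. f x \<noteq> 0}"] by (auto simp: Cc_infinity_iff)

lemma Cc_infinity_smooth: "Cc_infinity f \<Longrightarrow> smooth f"
  by (simp add: Cc_infinity_def)

lemma Cc_infinity_translate:
  assumes "Cc_infinity f"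
  shows "Cc_infinity (\<lambda>x. f (x + a))"
proof -
  have eq: "{x. f (x + a) \<noteq> 0} = (\<lambda>x. - a + x) ` {x. f x \<noteq> 0}"
  proof (intro set_eqI iffI)
    fix x assume "x \<in> {x. f (x + a) \<noteq> 0}"
    then show "x \<in> (\<lambda>x. - a + x) ` {x. f x \<noteq> 0}" by (intro image_eqI[of _ _ "x + a"]) auto
  qed auto
  show ?thesis
    using assms unfolding Cc_infinity_iff eq
    by (blast intro: smooth_translate bounded_translation)
qed

lemma Cc_infinity_support:
  assumes "Cc_infinity f"
  obtains R where "R > 0" "\<And>x. R < norm x \<Longrightarrow> f x = 0"
    "\<And>x v. R < norm x \<Longrightarrow> frechet_derivative f (at x) v = 0"
proof -
  from assms obtain R where R: "R > 0" "\<And>x. f x \<noteq> 0 \<Longrightarrow> norm x \<le> R"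
    by (auto simp: Cc_infinity_iff bounded_pos)
  have "frechet_derivative f (at x) v = 0" if "R < norm x" for x v
  proof -
    have "((\<lambda>_. 0) has_derivative (\<lambda>_. 0)) (at x)" by simp
    then have "(f has_derivative (\<lambda>_. 0)) (at x)"
    proof (rule has_derivative_transform_within_open[of _ _ _ _ "{x. R < norm x}"])
      show "open {x::'a. R < norm x}" by (intro open_Collect_less continuous_intros)
    qed (use that R(2) in \<open>auto simp: not_le[symmetric]\<close>)
    from frechet_derivative_at[OF this] show ?thesis by (metis (full_types))
  qed
  with R show ?thesis by (intro that[of R]) (auto simp: not_le[symmetric])
qed

text \<open>\<open>smooth\<close> yields continuity of each directional derivative separately. The
  uniform bound on the derivative as a linear map comes from expanding v in the basis and adding the
  finitely many directional bounds.\<close>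

lemma Cc_infinity_bounded:
  fixes f :: "'a::euclidean_space \<Rightarrow> 'b::euclidean_space"
  assumes "Cc_infinity f"
  obtains M where "M > 0" "\<And>x. norm (f x) \<le> M" "\<And>x v. norm (frechet_derivative f (at x) v) \<le> M * norm v"
proof -
  obtain R where R: "R > 0" "\<And>x. R < norm x \<Longrightarrow> f x = 0"
    "\<And>x v. R < norm x \<Longrightarrow> frechet_derivative f (at x) v = 0"
    using Cc_infinity_support[OF assms] by blast
  note sm = Cc_infinity_smooth[OF assms]
  have "\<exists>B>0. \<forall>x. norm (f x) \<le> B"
  proof -
    have "bounded (f ` cball 0 R)"
      by (intro compact_imp_bounded compact_continuous_image smooth_continuous_on sm) auto
    then obtain B where "B > 0" "\<forall>x\<in>cball 0 R. norm (f x) \<le> B" by (auto simp: bounded_pos)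
    moreover have "norm (f x) \<le> B" if "x \<notin> cball 0 R" for x
      using that \<open>B > 0\<close> by (simp add: R(2))
    ultimately show ?thesis by blast
  qed
  then obtain B where B: "B > 0" "\<And>x. norm (f x) \<le> B" by auto
  have "\<exists>B. \<forall>x. norm (frechet_derivative f (at x) i) \<le> B" for i
  proof -
    have "bounded ((\<lambda>x. frechet_derivative f (at x) i) ` cball 0 R)"
      by (intro compact_imp_bounded compact_continuous_image smooth_continuous_on_derivative sm) auto
    then obtain B where "B > 0" "\<forall>x\<in>cball 0 R. norm (frechet_derivative f (at x) i) \<le> B"
      by (auto simp: bounded_pos)
    moreover have "norm (frechet_derivative f (at x) i) \<le> B" if "x \<notin> cball 0 R" for x
      using that \<open>B > 0\<close> by (simp add: R(3))
    ultimately show ?thesis by blast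
  qed
  then obtain D where D: "\<And>i x. norm (frechet_derivative f (at x) i) \<le> D i" by metis
  have D0: "0 \<le> D i" for i using norm_ge_zero D order_trans by blast
  have "norm (frechet_derivative f (at x) v) \<le> (\<Sum>i\<in>Basis. D i) * norm v" for x v
  proof -
    interpret bounded_linear "frechet_derivative f (at x)"
      by (rule has_derivative_bounded_linear[OF smooth_has_derivative[OF sm]])
    have "frechet_derivative f (at x) v = frechet_derivative f (at x) (\<Sum>i\<in>Basis. (v \<bullet> i) *\<^sub>R i)"
      by (simp add: euclidean_representation)
    also have "\<dots> = (\<Sum>i\<in>Basis. (v \<bullet> i) *\<^sub>R frechet_derivative f (at x) i)"
      by (simp add: sum scale)
    also have "norm \<dots> \<le> (\<Sum>i\<in>Basis. D i * norm v)"
      by (rule sum_norm_le)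
         (auto intro!: mult_mono D simp: mult.commute[of "D _"] Basis_le_norm)
    finally show ?thesis by (simp add: sum_distrib_right)
  qed
  moreover have "(\<Sum>i\<in>Basis. D i) * norm v \<le> max B (\<Sum>i\<in>Basis. D i) * norm v" for v :: 'a
    by (intro mult_right_mono) auto
  ultimately show ?thesis using B
    by (intro that[of "max B (\<Sum>i\<in>Basis. D i)"])
       (auto intro: order_trans simp: less_max_iff_disj le_max_iff_disj)
qed

lemma smooth_box_bump:
  fixes a b :: "'a::euclidean_space"
  shows "smooth (\<lambda>x. \<Prod>i\<in>Basis. smooth_step (n * (x \<bullet> i - a \<bullet> i)) * smooth_step (n * (b \<bullet> i - x \<bullet> i)))"
proof (intro smooth_prod smooth_mult)
  fix i :: 'a
  have "bounded_linear (\<lambda>x. n * (x \<bullet> i))" "bounded_linear (\<lambda>x. - (n * (x \<bullet> i)))"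
    by (intro bounded_linear_minus bounded_linear_const_mult bounded_linear_inner_left)+
  note L = smooth_affine[OF smooth_smooth_step this(1), of "- (n * (a \<bullet> i))"]
    smooth_affine[OF smooth_smooth_step this(2), of "n * (b \<bullet> i)"]
  show "smooth (\<lambda>x. smooth_step (n * (x \<bullet> i - a \<bullet> i)))" "smooth (\<lambda>x. smooth_step (n * (b \<bullet> i - x \<bullet> i)))"
    using L by (simp_all add: algebra_simps)
qed

text \<open>A smooth plateau with steepness n: it vanishes off the open box and equals 1 at depth at
  least 1/n below every face.\<close>

definition box_bump :: "'a::euclidean_space \<Rightarrow> 'a \<Rightarrow> real \<Rightarrow> 'a \<Rightarrow> real" where
  "box_bump a b n x = (\<Prod>i\<in>Basis. smooth_step (n * (x \<bullet> i - a \<bullet> i)) * smooth_step (n * (b \<bullet> i - x \<bullet> i)))"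

lemma box_bump_bounds: "0 \<le> box_bump a b n x" "box_bump a b n x \<le> 1"
  unfolding box_bump_def
  by (auto intro!: prod_nonneg prod_le_1 mult_nonneg_nonneg mult_le_one smooth_step_nonneg smooth_step_le_1)

lemma box_bump_eq_0:
  assumes "n \<ge> 0" "x \<notin> box a b"
  shows "box_bump a b n x = 0"
proof -
  from assms(2) obtain i where i: "i \<in> Basis" "x \<bullet> i \<le> a \<bullet> i \<or> b \<bullet> i \<le> x \<bullet> i"
    by (auto simp: mem_box)
  then have "smooth_step (n * (x \<bullet> i - a \<bullet> i)) * smooth_step (n * (b \<bullet> i - x \<bullet> i)) = 0"
    using assms(1) by (auto intro!: smooth_step_eq_0 mult_nonneg_nonpos)
  then show ?thesis using i(1) by (auto simp: box_bump_def)
qed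

lemma box_bump_eq_1:
  assumes "\<And>i. i \<in> Basis \<Longrightarrow> 1 \<le> n * (x \<bullet> i - a \<bullet> i) \<and> 1 \<le> n * (b \<bullet> i - x \<bullet> i)"
  shows "box_bump a b n x = 1"
  unfolding box_bump_def by (rule prod.neutral) (simp add: assms smooth_step_eq_1)

lemma Cc_infinity_box_bump: "n \<ge> 0 \<Longrightarrow> Cc_infinity (box_bump a b n)"
  by (rule Cc_infinityI[where S = "box a b"])
     (simp_all add: box_bump_eq_0 smooth_box_bump[folded box_bump_def] bounded_box)

text \<open>A point of the open box has positive distance to each of the finitely many faces, so it
  lies on the plateau for all large n.\<close>

lemma box_bump_tendsto: "(\<lambda>n. box_bump a b (real n) x) \<longlonglongrightarrow> indicator (box a b) x"
proof (cases "x \<in> box a b")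
  case True
  have "\<forall>\<^sub>F n in sequentially. \<forall>i\<in>Basis. 1 \<le> real n * (x \<bullet> i - a \<bullet> i) \<and> 1 \<le> real n * (b \<bullet> i - x \<bullet> i)"
  proof (rule eventually_ball_finite, simp, rule ballI)
    fix i :: 'a assume i: "i \<in> Basis"
    have *: "\<forall>\<^sub>F n in sequentially. 1 \<le> real n * c" if "c > 0" for c :: real
    proof -
      have "\<forall>\<^sub>F n in sequentially. inverse c \<le> real n"
        using eventually_ge_at_top[of "nat \<lceil>inverse c\<rceil>"] by eventually_elim linarith
      then show ?thesis by eventually_elim (use that in \<open>simp add: field_simps\<close>)
    qed
    show "\<forall>\<^sub>F n in sequentially. 1 \<le> real n * (x \<bullet> i - a \<bullet> i) \<and> 1 \<le> real n * (b \<bullet> i - x \<bullet> i)"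
      using True i by (intro eventually_conj *) (auto simp: mem_box)
  qed
  then have "\<forall>\<^sub>F n in sequentially. box_bump a b (real n) x = 1"
    by eventually_elim (auto intro: box_bump_eq_1)
  then show ?thesis using True by (simp add: tendsto_eventually)
qed (simp add: box_bump_eq_0)

subsection \<open>Locally integrable functions\<close>

lemma borel_cball_measurable [measurable]: "cball a r \<in> sets borel"
  by (rule borel_closed[OF closed_cball])

lemma borel_box_measurable [measurable]: "box a b \<in> sets borel" for a :: "'a::euclidean_space"
  by (rule borel_open[OF open_box])

text \<open>Borel rather than Lebesgue measurability, so that slices, shifts and compositions stay
  measurable; balls about the origin exhaust the bounded sets.\<close>

definition L1_loc :: "('a::euclidean_space \<Rightarrow> 'b::euclidean_space) \<Rightarrow> bool" where
  "L1_loc f \<longleftrightarrow> f \<in> borel_measurable borel \<and>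
     (\<forall>R. integrable lborel (\<lambda>x. indicator (cball 0 R) x *\<^sub>R f x))"

lemma L1_loc_measurable: "L1_loc f \<Longrightarrow> f \<in> borel_measurable borel"
  by (simp add: L1_loc_def)

lemma L1_loc_integrable: "L1_loc f \<Longrightarrow> integrable lborel (\<lambda>x. indicator (cball 0 R) x *\<^sub>R f x)"
  by (simp add: L1_loc_def)

lemma L1_loc_mult:
  fixes f :: "'a::euclidean_space \<Rightarrow> 'b::euclidean_space" and \<phi> :: "'a \<Rightarrow> real"
  assumes f: "L1_loc f" and [measurable]: "\<phi> \<in> borel_measurable borel"
    and "\<And>x. \<bar>\<phi> x\<bar> \<le> M" "\<And>x. R < norm x \<Longrightarrow> \<phi> x = 0"
  shows "integrable lborel (\<lambda>x. \<phi> x *\<^sub>R f x)"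
proof (rule Bochner_Integration.integrable_bound)
  note [measurable] = L1_loc_measurable[OF f]
  show "integrable lborel (\<lambda>x. M *\<^sub>R (indicator (cball 0 R) x *\<^sub>R f x))"
    by (intro integrable_scaleR_right L1_loc_integrable f)
  show "(\<lambda>x. \<phi> x *\<^sub>R f x) \<in> borel_measurable lborel" by measurable
  show "AE x in lborel. norm (\<phi> x *\<^sub>R f x) \<le> norm (M *\<^sub>R (indicator (cball 0 R) x *\<^sub>R f x))"
  proof (rule AE_I2)
    fix x
    have "\<bar>\<phi> x\<bar> * norm (f x) \<le> \<bar>M\<bar> * norm (f x)"
      using assms(3)[of x] by (intro mult_right_mono) auto
    then show "norm (\<phi> x *\<^sub>R f x) \<le> norm (M *\<^sub>R (indicator (cball 0 R) x *\<^sub>R f x))"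
      using assms(4)[of x] by (auto split: split_indicator)
  qed
qed

lemma L1_loc_mult_real:
  fixes f :: "'a::euclidean_space \<Rightarrow> real"
  shows "L1_loc f \<Longrightarrow> \<phi> \<in> borel_measurable borel \<Longrightarrow> (\<And>x. \<bar>\<phi> x\<bar> \<le> M) \<Longrightarrow>
    (\<And>x. R < norm x \<Longrightarrow> \<phi> x = 0) \<Longrightarrow> integrable lborel (\<lambda>x. f x * \<phi> x)"
  using L1_loc_mult[of f \<phi> M R] by (simp add: mult.commute)

lemma L1_loc_bound:
  fixes f :: "'a::euclidean_space \<Rightarrow> 'b::euclidean_space" and g :: "'a \<Rightarrow> 'c::euclidean_space"
  assumes g: "L1_loc g" and [measurable]: "f \<in> borel_measurable borel" and "\<And>x. norm (f x) \<le> norm (g x)"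
  shows "L1_loc f"
proof -
  have "integrable lborel (\<lambda>x. indicator (cball 0 R) x *\<^sub>R f x)" for R
    by (rule Bochner_Integration.integrable_bound[OF L1_loc_integrable[OF g, of R]])
       (measurable, auto intro!: AE_I2 mult_left_mono assms)
  then show ?thesis by (simp add: L1_loc_def)
qed

lemma L1_loc_inner: "L1_loc f \<Longrightarrow> L1_loc (\<lambda>x. f x \<bullet> j)"
  unfolding L1_loc_def by (auto simp flip: inner_scaleR_left)

lemma L1_loc_add: "L1_loc f \<Longrightarrow> L1_loc g \<Longrightarrow> L1_loc (\<lambda>x. f x + g x)"
  by (auto simp: L1_loc_def scaleR_right_distrib)

lemma L1_loc_diff: "L1_loc f \<Longrightarrow> L1_loc g \<Longrightarrow> L1_loc (\<lambda>x. f x - g x)"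
  by (auto simp: L1_loc_def scaleR_right_diff_distrib)

lemma L1_loc_scaleR: "L1_loc f \<Longrightarrow> L1_loc (\<lambda>x. c *\<^sub>R f x)"
  by (auto simp add: L1_loc_def scaleR_left_commute[of _ c] simp del: scaleR_scaleR)

lemma L1_loc_sum: "finite I \<Longrightarrow> (\<And>i. i \<in> I \<Longrightarrow> L1_loc (f i)) \<Longrightarrow> L1_loc (\<lambda>x. \<Sum>i\<in>I. f i x)"
proof (induction I rule: finite_induct)
  case (insert i I)
  then show ?case using L1_loc_add[of "f i" "\<lambda>x. \<Sum>i\<in>I. f i x"] by simp
qed (simp add: L1_loc_def)

lemma L1_locI_L2:
  fixes f :: "'a::euclidean_space \<Rightarrow> 'b::euclidean_space"
  assumes [measurable]: "f \<in> borel_measurable borel" and "integrable lborel (\<lambda>x. (norm (f x))\<^sup>2)"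
  shows "L1_loc f"
proof -
  have "integrable lborel (\<lambda>x. indicator (cball 0 R) x *\<^sub>R f x)" for R
  proof (rule Bochner_Integration.integrable_bound)
    show "integrable lborel (\<lambda>x. indicat_real (cball 0 R) x + (norm (f x))\<^sup>2)"
      by (intro Bochner_Integration.integrable_add assms)
         (simp add: integrable_indicator_iff emeasure_lborel_cball_finite[simplified])
    show "AE x in lborel. norm (indicator (cball 0 R) x *\<^sub>R f x)
        \<le> norm (indicat_real (cball 0 R) x + (norm (f x))\<^sup>2)"
    proof (rule AE_I2)
      fix x
      have "norm (f x) \<le> 1 + (norm (f x))\<^sup>2"
        using zero_le_power2[of "norm (f x) - 1"] norm_ge_zero[of "f x"]
        unfolding power2_diff one_power2 mult_1_right by linarith
      then show "norm (indicator (cball 0 R) x *\<^sub>R f x)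
        \<le> norm (indicat_real (cball 0 R) x + (norm (f x))\<^sup>2)"
        by (auto split: split_indicator)
    qed
  qed measurable
  then show ?thesis by (simp add: L1_loc_def assms)
qed

section \<open>Translation invariance and the fundamental lemma of the calculus of
  variations\<close>

lemma nn_integral_lborel_translate:
  fixes f :: "'a::euclidean_space \<Rightarrow> ennreal"
  assumes [measurable]: "f \<in> borel_measurable borel"
  shows "(\<integral>\<^sup>+x. f (x + a) \<partial>lborel) = (\<integral>\<^sup>+x. f x \<partial>lborel)"
  by (subst (2) lborel_distr_plus[of a, symmetric]) (simp add: nn_integral_distr add.commute)

lemma integrable_lborel_translate_iff:
  fixes f :: "'a::euclidean_space \<Rightarrow> 'b::{banach, second_countable_topology}"
  assumes [measurable]: "f \<in> borel_measurable borel"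
  shows "integrable lborel (\<lambda>x. f (x + a)) \<longleftrightarrow> integrable lborel f"
  by (subst (2) lborel_distr_plus[of a, symmetric]) (simp add: integrable_distr_eq add.commute)

lemma integral_lborel_translate:
  fixes f :: "'a::euclidean_space \<Rightarrow> 'b::{banach, second_countable_topology}"
  assumes [measurable]: "f \<in> borel_measurable borel"
  shows "(\<integral>x. f (x + a) \<partial>lborel) = (\<integral>x. f x \<partial>lborel)"
  by (subst (2) lborel_distr_plus[of a, symmetric]) (simp add: integral_distr add.commute)

lemma AE_lborel_translate:
  fixes a :: "'a::euclidean_space"
  assumes "AE x in lborel. P x"
  shows "AE x in lborel. P (x + a)"
proof -
  from assms obtain N where N: "N \<in> null_sets lborel" "{x. \<not> P x} \<subseteq> N" by (elim AE_E3) auto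
  have [measurable]: "N \<in> sets borel" using N(1) by auto
  have "(\<integral>\<^sup>+x. indicator N (x + a) \<partial>lborel) = emeasure lborel N"
    by (subst nn_integral_lborel_translate) auto
  then have "AE x in lborel. indicator N (x + a) = (0::ennreal)"
    using N(1) by (subst nn_integral_0_iff_AE[symmetric]) auto
  then show ?thesis by eventually_elim (use N(2) in \<open>auto split: split_indicator_asm\<close>)
qed

lemma L1_loc_translate:
  assumes "L1_loc f"
  shows "L1_loc (\<lambda>x. f (x + a))"
proof -
  note [measurable] = L1_loc_measurable[OF assms]
  have "integrable lborel (\<lambda>x. indicator (cball 0 R) x *\<^sub>R f (x + a))" for R
  proof -
    have "integrable lborel (\<lambda>x. indicat_real (cball a R) x *\<^sub>R f x)"
      by (rule L1_loc_mult[OF assms, of _ 1 "norm a + R"])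
         (measurable, auto split: split_indicator simp: dist_norm,
           use norm_triangle_ineq2[of _ a] in \<open>simp add: norm_minus_commute, smt (verit)\<close>)
    then have "integrable lborel (\<lambda>x. indicat_real (cball a R) (x + a) *\<^sub>R f (x + a))"
      by (subst integrable_lborel_translate_iff) auto
    moreover have "indicat_real (cball a R) (x + a) = indicat_real (cball 0 R) x" for x
      by (auto split: split_indicator simp: dist_norm)
    ultimately show ?thesis by simp
  qed
  then show ?thesis by (simp add: L1_loc_def)
qed

text \<open>Boxes are stable under intersection and generate the Borel sets, and the sets over which
  w integrates to 0 form a Dynkin system. Intersecting with the bounded boxes \<open>Q N\<close>
  makes w integrable, as complements and disjoint unions require.\<close>

lemma box_integrals_zero_imp_AE_zero:
  fixes w :: "'a::euclidean_space \<Rightarrow> real"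
  assumes w: "L1_loc w"
    and zero: "\<And>a b. (\<integral>x. indicator (box a b) x * w x \<partial>lborel) = 0"
  shows "AE x in lborel. w x = 0"
proof -
  note [measurable] = L1_loc_measurable[OF w]
  define Q :: "nat \<Rightarrow> 'a set" where "Q N = box (- (real N *\<^sub>R One)) (real N *\<^sub>R One)" for N
  have Q_UN: "\<exists>N. x \<in> Q N" for x :: 'a
    using UN_box_eq_UNIV[where ?'a = 'a] unfolding Q_def by blast
  have [measurable]: "Q N \<in> sets borel" for N by (simp add: Q_def)
  have int: "integrable lborel (\<lambda>x. indicat_real (Q N \<inter> A) x * w x)" if [measurable]: "A \<in> sets borel" for N A
  proof -
    have "bounded (Q N)" by (simp add: Q_def)
    then obtain R where "\<forall>x\<in>Q N. norm x \<le> R" by (auto simp: bounded_iff)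
    then show ?thesis
      using L1_loc_mult[OF w, of "indicator (Q N \<inter> A)" 1 R] by (force split: split_indicator)
  qed
  have A0: "(\<integral>x. indicat_real (Q N \<inter> A) x * w x \<partial>lborel) = 0" if "A \<in> sets borel" for N A
  proof -
    let ?G = "range (\<lambda>(a, b). box a b :: 'a set)"
    have "Int_stable ?G"
      unfolding Int_stable_def by (clarsimp simp: box_Int_box) blast
    moreover have "?G \<subseteq> Pow UNIV" by auto
    moreover have "A \<in> sigma_sets UNIV ?G"
      using that unfolding borel_eq_box by simp
    ultimately show ?thesis
    proof (induction rule: sigma_sets_induct_disjoint)
      case (basic A)
      then show ?case by (auto simp: Q_def box_Int_box zero)
    next
      case empty
      then show ?case by simp
    next
      case (compl A)
      have [measurable]: "A \<in> sets borel" unfolding borel_eq_box using compl(1) by simp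
      have "indicat_real (Q N \<inter> (UNIV - A)) x * w x
          = indicat_real (Q N \<inter> UNIV) x * w x - indicat_real (Q N \<inter> A) x * w x" for x
        by (auto split: split_indicator)
      then show ?case
        using compl int[of A N] int[of UNIV N] zero[of "- (real N *\<^sub>R One)" "real N *\<^sub>R One"]
        by (simp add: Q_def)
    next
      case (union A)
      have [measurable]: "A i \<in> sets borel" for i unfolding borel_eq_box using union(2) by auto
      have "(\<lambda>n. \<integral>x. indicat_real (Q N \<inter> (\<Union>i<n. A i)) x * w x \<partial>lborel)
         \<longlonglongrightarrow> (\<integral>x. indicat_real (Q N \<inter> (\<Union>i. A i)) x * w x \<partial>lborel)"
      proof (rule integral_dominated_convergence[where w = "\<lambda>x. norm (indicat_real (Q N \<inter> UNIV) x * w x)"])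
        show "AE x in lborel. (\<lambda>n. indicat_real (Q N \<inter> (\<Union>i<n. A i)) x * w x)
            \<longlonglongrightarrow> indicat_real (Q N \<inter> (\<Union>i. A i)) x * w x"
        proof (intro AE_I2 tendsto_mult_right)
          fix x
          show "(\<lambda>n. indicat_real (Q N \<inter> (\<Union>i<n. A i)) x) \<longlonglongrightarrow> indicat_real (Q N \<inter> (\<Union>i. A i)) x"
            unfolding Int_UN_distrib by (rule LIMSEQ_indicator_UN)
        qed
      next
        show "integrable lborel (\<lambda>x. norm (indicat_real (Q N \<inter> UNIV) x * w x))"
          by (rule integrable_norm[OF int]) simp
      qed (auto split: split_indicator)
      moreover have "(\<integral>x. indicat_real (Q N \<inter> (\<Union>i<n. A i)) x * w x \<partial>lborel) = 0" for n
      proof -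
        have "disjoint_family_on (\<lambda>i. Q N \<inter> A i) {..<n}"
          using union(1) unfolding disjoint_family_on_def by blast
        then have "indicat_real (Q N \<inter> (\<Union>i<n. A i)) x = (\<Sum>i<n. indicat_real (Q N \<inter> A i) x)" for x
          unfolding Int_UN_distrib by (intro indicator_UN_disjoint) simp_all
        then have "(\<integral>x. indicat_real (Q N \<inter> (\<Union>i<n. A i)) x * w x \<partial>lborel)
            = (\<Sum>i<n. \<integral>x. indicat_real (Q N \<inter> A i) x * w x \<partial>lborel)"
          by (simp only: sum_distrib_right) (intro Bochner_Integration.integral_sum int, simp)
        then show ?thesis by (simp only: union(3) sum.neutral_const)
      qed
      ultimately show ?case by (simp add: LIMSEQ_const_iff)
    qed
  qed
  have "AE x in lborel. indicat_real (Q N) x * w x = 0" for N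
  proof (rule sigma_finite_measure.density_zero[OF lborel.sigma_finite_measure_axioms])
    fix A :: "'a set" assume "A \<in> sets lborel"
    moreover have "indicat_real A x *\<^sub>R (indicat_real (Q N) x * w x) = indicat_real (Q N \<inter> A) x * w x" for x
      by (simp split: split_indicator)
    ultimately show "set_lebesgue_integral lborel A (\<lambda>x. indicat_real (Q N) x * w x) = 0"
      unfolding set_lebesgue_integral_def using A0[of A N] by (simp only: sets_lborel)
  qed (use int[of UNIV N] in simp)
  then have "AE x in lborel. \<forall>N. indicat_real (Q N) x * w x = 0"
    unfolding AE_all_countable by blast
  then show ?thesis
    by eventually_elim (use Q_UN in \<open>force split: split_indicator_asm\<close>)
qed

text \<open>Smooth plateaus converge to indicators of boxes under a common integrable bound, so
  integrals over boxes vanish.\<close>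

lemma fundamental_lemma:
  fixes w :: "'a::euclidean_space \<Rightarrow> real"
  assumes w: "L1_loc w"
    and zero: "\<And>\<phi>. Cc_infinity \<phi> \<Longrightarrow> (\<integral>x. w x * \<phi> x \<partial>lborel) = 0"
  shows "AE x in lborel. w x = 0"
proof (rule box_integrals_zero_imp_AE_zero[OF w])
  fix a b :: 'a
  note [measurable] = L1_loc_measurable[OF w] smooth_measurable[OF Cc_infinity_smooth[OF Cc_infinity_box_bump]]
  have "bounded (box a b)" by simp
  then obtain R where R: "\<And>x. x \<in> box a b \<Longrightarrow> norm x \<le> R" by (auto simp: bounded_iff)
  have "(\<lambda>n. \<integral>x. w x * box_bump a b (real n) x \<partial>lborel) \<longlonglongrightarrow> (\<integral>x. w x * indicator (box a b) x \<partial>lborel)"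
  proof (rule integral_dominated_convergence[where w = "\<lambda>x. norm (indicat_real (cball 0 R) x *\<^sub>R w x)"])
    show "AE x in lborel. (\<lambda>n. w x * box_bump a b (real n) x) \<longlonglongrightarrow> w x * indicator (box a b) x"
      by (intro AE_I2 tendsto_mult_left box_bump_tendsto)
    show "AE x in lborel. norm (w x * box_bump a b (real n) x) \<le> norm (indicat_real (cball 0 R) x *\<^sub>R w x)" for n
    proof (rule AE_I2)
      fix x
      have "box_bump a b (real n) x = 0" if "\<not> norm x \<le> R"
        using R[of x] that by (intro box_bump_eq_0) auto
      then show "norm (w x * box_bump a b (real n) x) \<le> norm (indicat_real (cball 0 R) x *\<^sub>R w x)"
        using box_bump_bounds[of a b "real n" x]
        by (auto split: split_indicator simp: abs_mult mult_left_le)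
    qed
  next
    show "integrable lborel (\<lambda>x. norm (indicat_real (cball 0 R) x *\<^sub>R w x))"
      by (intro integrable_norm L1_loc_integrable w)
  qed measurable
  then show "(\<integral>x. indicator (box a b) x * w x \<partial>lborel) = 0"
    using zero[OF Cc_infinity_box_bump[of "real _" a b]] by (simp add: LIMSEQ_const_iff mult.commute)
qed

subsection \<open>Difference quotients of functions with a weak derivative\<close>

text \<open>The uniform distribution on [0,1]. Treating the average along a segment as an integral
  over this measure makes Fubini and Jensen type arguments available.\<close>

abbreviation unit_meas :: "real measure" where
  "unit_meas \<equiv> density lborel (indicator {0..1})"

lemma emeasure_unit_meas: "emeasure unit_meas (space unit_meas) = 1"
  by (simp add: emeasure_density)

interpretation unit_meas: finite_measure unit_meas
  by (rule finite_measureI) (simp only: emeasure_unit_meas, simp)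

interpretation lborel_unit: pair_sigma_finite "lborel :: 'a::euclidean_space measure" unit_meas
  by unfold_locales

lemma AE_unit_meas: "AE \<theta> in unit_meas. \<theta> \<in> {0..1}"
  by (simp add: AE_density indicator_def)

text \<open>If f is not integrable, the left side is 0 by the default value of the Bochner
  integral.\<close>

lemma norm_integral_le_nn_integral:
  fixes f :: "'a \<Rightarrow> 'b::{banach, second_countable_topology}"
  shows "ennreal (norm (integral\<^sup>L M f)) \<le> (\<integral>\<^sup>+x. norm (f x) \<partial>M)"
  by (cases "integrable M f") (simp_all add: integral_norm_bound_ennreal not_integrable_integral_eq)

lemma nn_integral_unit_const: "(\<integral>\<^sup>+\<theta>. c \<partial>unit_meas) = c"
  by (simp only: nn_integral_const emeasure_unit_meas mult_1_right)

lemma integral_unit_meas: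
  fixes f :: "real \<Rightarrow> 'b::{banach, second_countable_topology}"
  assumes [measurable]: "f \<in> borel_measurable borel"
  shows "(\<integral>\<theta>. f \<theta> \<partial>unit_meas) = (LBINT \<theta>:{0..1}. f \<theta>)"
proof -
  have "(\<integral>\<theta>. f \<theta> \<partial>density lborel (\<lambda>x. ennreal (indicat_real {0..1} x))) = (LBINT \<theta>:{0..1}. f \<theta>)"
    unfolding set_lebesgue_integral_def by (rule integral_density) auto
  then show ?thesis by (simp add: ennreal_indicator)
qed

lemma integrable_unit_bounded:
  fixes f :: "'a::euclidean_space \<Rightarrow> 'b::euclidean_space" and \<psi> :: "'a \<Rightarrow> real \<Rightarrow> real"
  assumes f: "L1_loc f" and [measurable]: "(\<lambda>(x, \<theta>). \<psi> x \<theta>) \<in> borel_measurable (borel \<Otimes>\<^sub>M borel)"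
    and M: "\<And>x \<theta>. \<theta> \<in> {0..1} \<Longrightarrow> \<bar>\<psi> x \<theta>\<bar> \<le> M"
    and R: "\<And>x \<theta>. \<theta> \<in> {0..1} \<Longrightarrow> R < norm x \<Longrightarrow> \<psi> x \<theta> = 0"
  shows "integrable (lborel \<Otimes>\<^sub>M unit_meas) (\<lambda>(x, \<theta>). \<psi> x \<theta> *\<^sub>R f x)"
proof -
  note [measurable] = L1_loc_measurable[OF f]
  have le: "norm (\<psi> x \<theta> *\<^sub>R f x) \<le> norm (M *\<^sub>R indicat_real (cball 0 R) x *\<^sub>R f x)" if "\<theta> \<in> {0..1}" for x \<theta>
  proof -
    have "\<bar>\<psi> x \<theta>\<bar> * norm (f x) \<le> \<bar>M\<bar> * norm (f x)"
      using M[OF that, of x] by (intro mult_right_mono) auto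
    then show ?thesis using R[OF that, of x] by (auto split: split_indicator)
  qed
  have "(\<integral>\<^sup>+x. \<integral>\<^sup>+\<theta>. norm (\<psi> x \<theta> *\<^sub>R f x) \<partial>unit_meas \<partial>lborel)
      \<le> (\<integral>\<^sup>+x. \<integral>\<^sup>+\<theta>. norm (M *\<^sub>R indicat_real (cball 0 R) x *\<^sub>R f x) \<partial>unit_meas \<partial>lborel)"
    by (intro nn_integral_mono nn_integral_mono_AE eventually_mono[OF AE_unit_meas] ennreal_leI le)
  also have "\<dots> = (\<integral>\<^sup>+x. norm (M *\<^sub>R indicat_real (cball 0 R) x *\<^sub>R f x) \<partial>lborel)"
    by (simp only: nn_integral_unit_const)
  also have "\<dots> < \<infinity>"
    using integrable_scaleR_right[OF L1_loc_integrable[OF f, of R], of M]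
    by (simp add: integrable_iff_bounded)
  finally show ?thesis
    by (auto simp: integrable_iff_bounded unit_meas.nn_integral_fst[symmetric] split_beta')
qed

text \<open>With x integrated first, each shift can be moved from f to \<phi>; the shifted \<phi>
  are uniformly bounded and have a common bounded support.\<close>

lemma integrable_unit_shift:
  fixes f :: "'a::euclidean_space \<Rightarrow> 'b::euclidean_space" and \<phi> :: "'a \<Rightarrow> real"
  assumes f: "L1_loc f" and [measurable]: "\<phi> \<in> borel_measurable borel"
    and M: "\<And>x. \<bar>\<phi> x\<bar> \<le> M" and R: "\<And>x. R < norm x \<Longrightarrow> \<phi> x = 0"
  shows "integrable (lborel \<Otimes>\<^sub>M unit_meas) (\<lambda>(x, \<theta>). \<phi> x *\<^sub>R f (x + \<theta> *\<^sub>R e))"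
proof -
  note [measurable] = L1_loc_measurable[OF f]
  have "integrable (lborel \<Otimes>\<^sub>M unit_meas) (\<lambda>(x, \<theta>). \<phi> (x - \<theta> *\<^sub>R e) *\<^sub>R f x)"
  proof (rule integrable_unit_bounded[OF f _ M])
    fix x :: 'a and \<theta> :: real assume \<theta>: "\<theta> \<in> {0..1}" and x: "R + norm e < norm x"
    have "norm (\<theta> *\<^sub>R e) \<le> norm e" using \<theta> by (simp add: mult_left_le_one_le)
    then have "R < norm (x - \<theta> *\<^sub>R e)" using x norm_triangle_ineq2[of x "\<theta> *\<^sub>R e"] by linarith
    then show "\<phi> (x - \<theta> *\<^sub>R e) = 0" by (rule R)
  qed measurable
  then have "(\<integral>\<^sup>+\<theta>. \<integral>\<^sup>+x. norm (\<phi> (x - \<theta> *\<^sub>R e) *\<^sub>R f x) \<partial>lborel \<partial>unit_meas) < \<infinity>"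
    by (auto simp: integrable_iff_bounded lborel_unit.nn_integral_snd[symmetric] split_beta')
  moreover have "(\<integral>\<^sup>+x. norm (\<phi> (x - \<theta> *\<^sub>R e) *\<^sub>R f x) \<partial>lborel) = (\<integral>\<^sup>+x. norm (\<phi> x *\<^sub>R f (x + \<theta> *\<^sub>R e)) \<partial>lborel)" for \<theta> :: real
    by (subst nn_integral_lborel_translate[symmetric, where a = "\<theta> *\<^sub>R e"]) auto
  ultimately have "(\<integral>\<^sup>+\<theta>. \<integral>\<^sup>+x. norm (\<phi> x *\<^sub>R f (x + \<theta> *\<^sub>R e)) \<partial>lborel \<partial>unit_meas) < \<infinity>"
    by (simp only:)
  then show ?thesis
    by (auto simp: integrable_iff_bounded lborel_unit.nn_integral_snd[symmetric] split_beta')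
qed

lemma L1_loc_unit_average:
  fixes f :: "'a::euclidean_space \<Rightarrow> 'b::euclidean_space"
  assumes f: "L1_loc f"
  shows "L1_loc (\<lambda>x. \<integral>\<theta>. f (x + \<theta> *\<^sub>R e) \<partial>unit_meas)"
    and "AE x in lborel. integrable unit_meas (\<lambda>\<theta>. f (x + \<theta> *\<^sub>R e))"
proof -
  note [measurable] = L1_loc_measurable[OF f]
  have int: "integrable (lborel \<Otimes>\<^sub>M unit_meas) (\<lambda>(x, \<theta>). indicat_real (cball 0 R) x *\<^sub>R f (x + \<theta> *\<^sub>R e))" for R
    by (rule integrable_unit_shift[OF f, of _ 1 R]) (auto split: split_indicator)
  show "L1_loc (\<lambda>x. \<integral>\<theta>. f (x + \<theta> *\<^sub>R e) \<partial>unit_meas)"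
    unfolding L1_loc_def
  proof safe
    show "(\<lambda>x. \<integral>\<theta>. f (x + \<theta> *\<^sub>R e) \<partial>unit_meas) \<in> borel_measurable borel"
      using unit_meas.borel_measurable_lebesgue_integral[of "\<lambda>x \<theta>. f (x + \<theta> *\<^sub>R e)" borel] by simp
    show "integrable lborel (\<lambda>x. indicat_real (cball 0 R) x *\<^sub>R (\<integral>\<theta>. f (x + \<theta> *\<^sub>R e) \<partial>unit_meas))" for R
      using lborel_unit.integrable_fst'[OF int[of R]] by simp
  qed
  \<comment> \<open>Integer radii, so that the exceptional sets of all balls form one null
    set.\<close>
  have "AE x in lborel. \<forall>n. integrable unit_meas (\<lambda>\<theta>. indicat_real (cball 0 (real n)) x *\<^sub>R f (x + \<theta> *\<^sub>R e))"
    unfolding AE_all_countable using lborel_unit.AE_integrable_fst'[OF int] by simp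
  then show "AE x in lborel. integrable unit_meas (\<lambda>\<theta>. f (x + \<theta> *\<^sub>R e))"
  proof eventually_elim
    case (elim x)
    obtain n where "norm x \<le> real n" using real_arch_simple by blast
    then show ?case using elim[rule_format, of n] by simp
  qed
qed

text \<open>The fundamental theorem of calculus along the segment from x to x - e, put as an average
  so that it can be exchanged with the integral over x.\<close>

lemma smooth_diff_eq_integral:
  fixes \<phi> :: "'a::euclidean_space \<Rightarrow> real"
  assumes "smooth \<phi>"
  shows "\<phi> (x - e) - \<phi> x = (\<integral>\<theta>. - frechet_derivative \<phi> (at (x - \<theta> *\<^sub>R e)) e \<partial>unit_meas)"
proof -
  have lin: "linear (frechet_derivative \<phi> (at y))" for y
    by (rule has_derivative_linear[OF smooth_has_derivative[OF assms]])
  have der: "((\<lambda>\<theta>. \<phi> (x - \<theta> *\<^sub>R e)) has_real_derivative - frechet_derivative \<phi> (at (x - \<theta> *\<^sub>R e)) e) (at \<theta>)" for \<theta>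
  proof -
    have "((\<lambda>\<theta>. x - \<theta> *\<^sub>R e) has_derivative (\<lambda>h. - (h *\<^sub>R e))) (at \<theta>)"
      by (auto intro!: derivative_eq_intros)
    from has_derivative_compose[OF this smooth_has_derivative[OF assms]]
    show ?thesis
      by (rule has_derivative_imp_has_field_derivative)
         (simp add: linear_neg[OF lin] linear_scale[OF lin] mult.commute)
  qed
  have cont: "continuous_on UNIV (\<lambda>\<theta>. - frechet_derivative \<phi> (at (x - \<theta> *\<^sub>R e)) e)"
    by (intro continuous_intros continuous_on_compose2[OF smooth_continuous_on_derivative[OF assms, of UNIV]]) auto
  have "(LBINT \<theta>:{0..1}. - frechet_derivative \<phi> (at (x - \<theta> *\<^sub>R e)) e) = \<phi> (x - 1 *\<^sub>R e) - \<phi> (x - 0 *\<^sub>R e)"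
    unfolding set_lebesgue_integral_def
    by (rule integral_FTC_atLeastAtMost[where F = "\<lambda>\<theta>. \<phi> (x - \<theta> *\<^sub>R e)"])
       (auto simp flip: has_real_derivative_iff_has_vector_derivative
             intro!: has_field_derivative_at_within[OF der] continuous_on_subset[OF cont])
  then show ?thesis
    by (subst integral_unit_meas) (rule borel_measurable_continuous_onI[OF cont], simp)
qed

text \<open>The increment is moved to the test function, where it is an average of derivatives along
  the segment. The weak identity is applied to each shifted test function, and the shift is moved
  back to g.\<close>

lemma weak_derivative_difference_real:
  fixes w g :: "'a::euclidean_space \<Rightarrow> real"
  assumes w: "L1_loc w" and g: "L1_loc g"
    and weak: "\<And>\<phi>. Cc_infinity \<phi> \<Longrightarrow>
      (\<integral>x. w x * frechet_derivative \<phi> (at x) e \<partial>lborel) = - (\<integral>x. g x * \<phi> x \<partial>lborel)"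
  shows "AE x in lborel. w (x + e) - w x = (\<integral>\<theta>. g (x + \<theta> *\<^sub>R e) \<partial>unit_meas)"
proof -
  note [measurable] = L1_loc_measurable[OF w] L1_loc_measurable[OF g]
  define G where "G x = (\<integral>\<theta>. g (x + \<theta> *\<^sub>R e) \<partial>unit_meas)" for x
  have G: "L1_loc G" unfolding G_def[abs_def] by (rule L1_loc_unit_average[OF g])
  have we: "L1_loc (\<lambda>x. w (x + e))" by (rule L1_loc_translate[OF w])
  have "AE x in lborel. (w (x + e) - w x) - G x = 0"
  proof (rule fundamental_lemma)
    show "L1_loc (\<lambda>x. w (x + e) - w x - G x)" by (intro L1_loc_diff we w G)
    fix \<phi> :: "'a \<Rightarrow> real" assume \<phi>: "Cc_infinity \<phi>"
    note sm = Cc_infinity_smooth[OF \<phi>]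
    note [measurable] = smooth_measurable[OF sm] smooth_measurable_derivative[OF sm]
    obtain R where R: "R > 0" "\<And>x. R < norm x \<Longrightarrow> \<phi> x = 0"
      "\<And>x v. R < norm x \<Longrightarrow> frechet_derivative \<phi> (at x) v = 0"
      using Cc_infinity_support[OF \<phi>] by blast
    obtain M where M: "M > 0" "\<And>x. norm (\<phi> x) \<le> M" "\<And>x v. norm (frechet_derivative \<phi> (at x) v) \<le> M * norm v"
      using Cc_infinity_bounded[OF \<phi>] by blast
    have iw: "integrable lborel (\<lambda>x. w x * \<phi> x)" and iwe: "integrable lborel (\<lambda>x. w (x + e) * \<phi> x)"
      and iG: "integrable lborel (\<lambda>x. G x * \<phi> x)"
      by (rule L1_loc_mult_real[where M = M and R = R]; use w we G M R in \<open>simp\<close>)+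
    have shift_out: "R < norm (x - \<theta> *\<^sub>R e)" if "R + norm e < norm x" "\<theta> \<in> {0..1}" for x \<theta>
    proof -
      have "norm (\<theta> *\<^sub>R e) \<le> norm e" using that by (simp add: mult_left_le_one_le)
      then show ?thesis using that norm_triangle_ineq2[of x "\<theta> *\<^sub>R e"] by linarith
    qed
    have iw2: "integrable lborel (\<lambda>x. w x * \<phi> (x - e))"
      using iwe integrable_lborel_translate_iff[of "\<lambda>x. w x * \<phi> (x - e)" e] by simp
    have der: "frechet_derivative (\<lambda>x. \<phi> (x - \<theta> *\<^sub>R e)) (at x) e = frechet_derivative \<phi> (at (x - \<theta> *\<^sub>R e)) e" for x \<theta>
    proof -
      have "((\<lambda>x. x - \<theta> *\<^sub>R e) has_derivative (\<lambda>h. h)) (at x)" by (auto intro!: derivative_eq_intros)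
      from frechet_derivative_at[OF has_derivative_compose[OF this smooth_has_derivative[OF sm]]]
      show ?thesis by simp
    qed
    have weak': "(\<integral>x. w x * frechet_derivative \<phi> (at (x - \<theta> *\<^sub>R e)) e \<partial>lborel) = - (\<integral>x. g x * \<phi> (x - \<theta> *\<^sub>R e) \<partial>lborel)" for \<theta>
      using weak[OF Cc_infinity_translate[OF \<phi>, of "- (\<theta> *\<^sub>R e)"]] by (simp add: der)
    have i1: "integrable (lborel \<Otimes>\<^sub>M unit_meas) (\<lambda>(x, \<theta>). frechet_derivative \<phi> (at (x - \<theta> *\<^sub>R e)) e *\<^sub>R w x)"
      by (rule integrable_unit_bounded[OF w, of _ "M * norm e" "R + norm e"])
         (use M(3)[of _ e] R(3) shift_out in auto)
    have i2: "integrable (lborel \<Otimes>\<^sub>M unit_meas) (\<lambda>(x, \<theta>). \<phi> x *\<^sub>R g (x + \<theta> *\<^sub>R e))"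
      by (rule integrable_unit_shift[OF g]) (use M R in auto)
    have "(\<integral>x. w (x + e) * \<phi> x \<partial>lborel) - (\<integral>x. w x * \<phi> x \<partial>lborel)
        = (\<integral>x. w x * \<phi> (x - e) \<partial>lborel) - (\<integral>x. w x * \<phi> x \<partial>lborel)"
      using integral_lborel_translate[of "\<lambda>x. w x * \<phi> (x - e)" e] by simp
    also have "\<dots> = (\<integral>x. w x * (\<phi> (x - e) - \<phi> x) \<partial>lborel)"
      using iw iw2 by (simp add: right_diff_distrib)
    also have "\<dots> = (\<integral>x. \<integral>\<theta>. - (w x * frechet_derivative \<phi> (at (x - \<theta> *\<^sub>R e)) e) \<partial>unit_meas \<partial>lborel)"
      by (simp add: smooth_diff_eq_integral[OF sm])
    also have "\<dots> = (\<integral>\<theta>. \<integral>x. - (w x * frechet_derivative \<phi> (at (x - \<theta> *\<^sub>R e)) e) \<partial>lborel \<partial>unit_meas)"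
      by (rule lborel_unit.Fubini_integral[symmetric])
         (use integrable_minus[OF i1] in \<open>simp add: split_beta' mult.commute\<close>)
    also have "\<dots> = (\<integral>\<theta>. \<integral>x. g x * \<phi> (x - \<theta> *\<^sub>R e) \<partial>lborel \<partial>unit_meas)"
      by (simp add: weak')
    also have "\<dots> = (\<integral>\<theta>. \<integral>x. \<phi> x * g (x + \<theta> *\<^sub>R e) \<partial>lborel \<partial>unit_meas)"
    proof (rule Bochner_Integration.integral_cong[OF refl])
      fix \<theta> :: real
      show "(\<integral>x. g x * \<phi> (x - \<theta> *\<^sub>R e) \<partial>lborel) = (\<integral>x. \<phi> x * g (x + \<theta> *\<^sub>R e) \<partial>lborel)"
        by (subst integral_lborel_translate[symmetric, where a = "\<theta> *\<^sub>R e"]) (auto simp: mult.commute)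
    qed
    also have "\<dots> = (\<integral>x. \<integral>\<theta>. \<phi> x * g (x + \<theta> *\<^sub>R e) \<partial>unit_meas \<partial>lborel)"
      by (rule lborel_unit.Fubini_integral) (use i2 in simp)
    also have "\<dots> = (\<integral>x. G x * \<phi> x \<partial>lborel)"
      by (simp add: G_def mult.commute)
    finally show "(\<integral>x. (w (x + e) - w x - G x) * \<phi> x \<partial>lborel) = 0"
      using iw iwe iG by (simp add: left_diff_distrib)
  qed
  then show ?thesis by eventually_elim (simp add: G_def)
qed

lemma weak_derivative_difference:
  fixes w g :: "'a::euclidean_space \<Rightarrow> 'b::euclidean_space"
  assumes w: "L1_loc w" and g: "L1_loc g"
    and weak: "\<And>\<phi> j. Cc_infinity \<phi> \<Longrightarrow> j \<in> Basis \<Longrightarrow>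
      (\<integral>x. (w x \<bullet> j) * frechet_derivative \<phi> (at x) e \<partial>lborel) = - (\<integral>x. (g x \<bullet> j) * \<phi> x \<partial>lborel)"
  shows "AE x in lborel. w (x + e) - w x = (\<integral>\<theta>. g (x + \<theta> *\<^sub>R e) \<partial>unit_meas)"
proof -
  have "AE x in lborel. \<forall>j\<in>Basis. w (x + e) \<bullet> j - w x \<bullet> j = (\<integral>\<theta>. g (x + \<theta> *\<^sub>R e) \<bullet> j \<partial>unit_meas)"
    by (rule AE_finite_allI, simp, rule weak_derivative_difference_real)
       (auto intro!: L1_loc_inner w g weak)
  moreover have "AE x in lborel. integrable unit_meas (\<lambda>\<theta>. g (x + \<theta> *\<^sub>R e))"
    by (rule L1_loc_unit_average[OF g])
  ultimately show ?thesis
    by eventually_elim (auto intro!: euclidean_eqI[where 'a = 'b] simp: inner_diff_left integral_inner_left)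
qed

text \<open>The increment is an average of g along the segment. Cauchy-Schwarz on a probability
  measure gives Jensen's inequality for the square, and translation invariance removes the
  shifts.\<close>

lemma nn_integral_translate_diff_le:
  fixes w g :: "'a::euclidean_space \<Rightarrow> 'b::euclidean_space"
  assumes w: "L1_loc w" and g: "L1_loc g"
    and weak: "\<And>\<phi> j. Cc_infinity \<phi> \<Longrightarrow> j \<in> Basis \<Longrightarrow>
      (\<integral>x. (w x \<bullet> j) * frechet_derivative \<phi> (at x) e \<partial>lborel) = - (\<integral>x. (g x \<bullet> j) * \<phi> x \<partial>lborel)"
  shows "(\<integral>\<^sup>+x. ennreal ((norm (w (x + e) - w x))\<^sup>2) \<partial>lborel) \<le> (\<integral>\<^sup>+x. ennreal ((norm (g x))\<^sup>2) \<partial>lborel)"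
proof -
  note [measurable] = L1_loc_measurable[OF w] L1_loc_measurable[OF g]
  have "AE x in lborel. w (x + e) - w x = (\<integral>\<theta>. g (x + \<theta> *\<^sub>R e) \<partial>unit_meas)"
    by (rule weak_derivative_difference[OF w g weak])
  then have "AE x in lborel. ennreal ((norm (w (x + e) - w x))\<^sup>2)
      \<le> (\<integral>\<^sup>+\<theta>. ennreal ((norm (g (x + \<theta> *\<^sub>R e)))\<^sup>2) \<partial>unit_meas)"
  proof eventually_elim
    case (elim x)
    have "ennreal (norm (w (x + e) - w x)) \<le> (\<integral>\<^sup>+\<theta>. ennreal (norm (g (x + \<theta> *\<^sub>R e))) \<partial>unit_meas)"
      unfolding elim by (rule norm_integral_le_nn_integral)
    then have "ennreal (norm (w (x + e) - w x)) ^ 2 \<le> (\<integral>\<^sup>+\<theta>. ennreal (norm (g (x + \<theta> *\<^sub>R e))) * 1 \<partial>unit_meas) ^ 2"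
      by (simp add: power_mono)
    also have "\<dots> \<le> (\<integral>\<^sup>+\<theta>. ennreal (norm (g (x + \<theta> *\<^sub>R e))) ^ 2 \<partial>unit_meas) * (\<integral>\<^sup>+\<theta>. 1 ^ 2 \<partial>unit_meas)"
      by (rule Cauchy_Schwarz_nn_integral) auto
    finally show ?case by (simp only: nn_integral_unit_const power_one mult_1_right ennreal_power norm_ge_zero)
  qed
  then have "(\<integral>\<^sup>+x. ennreal ((norm (w (x + e) - w x))\<^sup>2) \<partial>lborel)
      \<le> (\<integral>\<^sup>+x. \<integral>\<^sup>+\<theta>. ennreal ((norm (g (x + \<theta> *\<^sub>R e)))\<^sup>2) \<partial>unit_meas \<partial>lborel)"
    by (rule nn_integral_mono_AE)
  also have "\<dots> = (\<integral>\<^sup>+\<theta>. \<integral>\<^sup>+x. ennreal ((norm (g (x + \<theta> *\<^sub>R e)))\<^sup>2) \<partial>lborel \<partial>unit_meas)"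
    by (rule lborel_unit.Fubini'[symmetric]) simp
  also have "\<dots> = (\<integral>\<^sup>+\<theta>. \<integral>\<^sup>+x. ennreal ((norm (g x))\<^sup>2) \<partial>lborel \<partial>unit_meas)"
    by (subst nn_integral_lborel_translate[of "\<lambda>x. ennreal ((norm (g x))\<^sup>2)"]) auto
  finally show ?thesis by (simp only: nn_integral_unit_const)
qed

subsection \<open>Continuity of translations in the mean\<close>

text \<open>Formulated with sequences of shifts because dominated convergence is applied to
  sequences; integrability is included so that the closure properties can be chained.\<close>

definition L1_translation_continuous :: "('a::euclidean_space \<Rightarrow> real) \<Rightarrow> bool" where
  "L1_translation_continuous f \<longleftrightarrow> integrable lborel f \<and>
     (\<forall>h. h \<longlonglongrightarrow> 0 \<longrightarrow> (\<lambda>n. \<integral>x. \<bar>f (x + h n) - f x\<bar> \<partial>lborel) \<longlonglongrightarrow> 0)"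

lemma L1_translation_triangle:
  fixes f g :: "'a::euclidean_space \<Rightarrow> real"
  assumes f: "integrable lborel f" and g: "integrable lborel g"
  shows "(\<integral>x. \<bar>f (x + h) - f x\<bar> \<partial>lborel)
    \<le> (\<integral>x. \<bar>g (x + h) - g x\<bar> \<partial>lborel) + 2 * (\<integral>x. \<bar>f x - g x\<bar> \<partial>lborel)"
proof -
  have [measurable]: "f \<in> borel_measurable borel" "g \<in> borel_measurable borel"
    using f g by (auto dest: borel_measurable_integrable)
  have fh: "integrable lborel (\<lambda>x. f (x + h))" and gh: "integrable lborel (\<lambda>x. g (x + h))"
    using f g by (simp_all add: integrable_lborel_translate_iff)
  have "(\<integral>x. \<bar>f (x + h) - f x\<bar> \<partial>lborel)
      \<le> (\<integral>x. \<bar>g (x + h) - g x\<bar> + (\<bar>f (x + h) - g (x + h)\<bar> + \<bar>f x - g x\<bar>) \<partial>lborel)"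
    by (intro integral_mono Bochner_Integration.integrable_add integrable_abs Bochner_Integration.integrable_diff f g fh gh)
       linarith
  also have "\<dots> = (\<integral>x. \<bar>g (x + h) - g x\<bar> \<partial>lborel)
      + ((\<integral>x. \<bar>f (x + h) - g (x + h)\<bar> \<partial>lborel) + (\<integral>x. \<bar>f x - g x\<bar> \<partial>lborel))"
    using f g fh gh by simp
  \<comment> \<open>Translation invariance turns the shifted error into the unshifted one, whence
    the factor 2.\<close>
  also have "(\<integral>x. \<bar>f (x + h) - g (x + h)\<bar> \<partial>lborel) = (\<integral>x. \<bar>f x - g x\<bar> \<partial>lborel)"
    using integral_lborel_translate[of "\<lambda>x. \<bar>f x - g x\<bar>" h] by simp
  finally show ?thesis by simp
qed

lemma L1_translation_continuous_limit:
  fixes f :: "'a::euclidean_space \<Rightarrow> real"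
  assumes f: "integrable lborel f"
    and g: "\<And>i. L1_translation_continuous (g i)" "(\<lambda>i. \<integral>x. \<bar>f x - g i x\<bar> \<partial>lborel) \<longlonglongrightarrow> 0"
  shows "L1_translation_continuous f"
  unfolding L1_translation_continuous_def
proof (intro conjI f allI impI LIMSEQ_I)
  fix h :: "nat \<Rightarrow> 'a" and e :: real assume h: "h \<longlonglongrightarrow> 0" and "e > 0"
  then obtain i where i: "norm ((\<integral>x. \<bar>f x - g i x\<bar> \<partial>lborel) - 0) < e / 3"
    using LIMSEQ_D[OF g(2), of "e / 3"] by auto
  have "(\<lambda>n. \<integral>x. \<bar>g i (x + h n) - g i x\<bar> \<partial>lborel) \<longlonglongrightarrow> 0"
    using g(1) h unfolding L1_translation_continuous_def by blast
  from LIMSEQ_D[OF this, of "e / 3"] \<open>e > 0\<close> obtain N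
    where N: "\<And>n. N \<le> n \<Longrightarrow> norm ((\<integral>x. \<bar>g i (x + h n) - g i x\<bar> \<partial>lborel) - 0) < e / 3" by auto
  have "norm ((\<integral>x. \<bar>f (x + h n) - f x\<bar> \<partial>lborel) - 0) < e" if "N \<le> n" for n
  proof -
    have "0 \<le> (\<integral>x. \<bar>f (x + h n) - f x\<bar> \<partial>lborel)" by simp
    moreover have "integrable lborel (g i)" using g(1) by (simp add: L1_translation_continuous_def)
    ultimately show ?thesis
      using N[OF that] i L1_translation_triangle[OF f, of "g i" "h n"] by simp
  qed
  then show "\<exists>N. \<forall>n\<ge>N. norm ((\<integral>x. \<bar>f (x + h n) - f x\<bar> \<partial>lborel) - 0) < e" by blast
qed

lemma L1_translation_continuous_add:
  fixes f g :: "'a::euclidean_space \<Rightarrow> real"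
  assumes f: "L1_translation_continuous f" and g: "L1_translation_continuous g"
  shows "L1_translation_continuous (\<lambda>x. f x + g x)"
proof -
  have i: "integrable lborel f" "integrable lborel g"
    using f g by (auto simp: L1_translation_continuous_def)
  then have [measurable]: "f \<in> borel_measurable borel" "g \<in> borel_measurable borel"
    by (auto dest: borel_measurable_integrable)
  have ih: "integrable lborel (\<lambda>x. f (x + h))" "integrable lborel (\<lambda>x. g (x + h))" for h
    using i by (simp_all add: integrable_lborel_translate_iff)
  have "(\<lambda>n. \<integral>x. \<bar>(f (x + h n) + g (x + h n)) - (f x + g x)\<bar> \<partial>lborel) \<longlonglongrightarrow> 0" if "h \<longlonglongrightarrow> 0" for h
  proof (rule Lim_null_comparison)
    show "(\<lambda>n. (\<integral>x. \<bar>f (x + h n) - f x\<bar> \<partial>lborel) + (\<integral>x. \<bar>g (x + h n) - g x\<bar> \<partial>lborel)) \<longlonglongrightarrow> 0"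
      using f g that by (auto intro!: tendsto_add_zero simp: L1_translation_continuous_def)
    have "(\<integral>x. \<bar>(f (x + h) + g (x + h)) - (f x + g x)\<bar> \<partial>lborel)
        \<le> (\<integral>x. \<bar>f (x + h) - f x\<bar> + \<bar>g (x + h) - g x\<bar> \<partial>lborel)" for h
      by (intro integral_mono Bochner_Integration.integrable_add integrable_abs Bochner_Integration.integrable_diff i ih)
         linarith
    then show "\<forall>\<^sub>F n in sequentially. norm (\<integral>x. \<bar>(f (x + h n) + g (x + h n)) - (f x + g x)\<bar> \<partial>lborel)
        \<le> (\<integral>x. \<bar>f (x + h n) - f x\<bar> \<partial>lborel) + (\<integral>x. \<bar>g (x + h n) - g x\<bar> \<partial>lborel)"
      by (simp add: i ih)
  qed
  then show ?thesis using i by (simp add: L1_translation_continuous_def)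
qed

lemma L1_translation_continuous_scale:
  assumes "L1_translation_continuous f"
  shows "L1_translation_continuous (\<lambda>x. c * f x)"
proof -
  have "(\<integral>x. \<bar>c * f (x + h) - c * f x\<bar> \<partial>lborel) = \<bar>c\<bar> * (\<integral>x. \<bar>f (x + h) - f x\<bar> \<partial>lborel)" for h
    by (simp add: right_diff_distrib[symmetric] abs_mult)
  then show ?thesis
    using assms by (auto simp: L1_translation_continuous_def intro!: tendsto_mult_right_zero)
qed

text \<open>Off the frontier, which is a null set, the indicator is locally constant.\<close>

lemma indicator_box_translate_tendsto:
  fixes a b :: "'a::euclidean_space"
  assumes h: "h \<longlonglongrightarrow> 0" and x: "x \<notin> cbox a b - box a b"
  shows "(\<lambda>n. \<bar>indicat_real (box a b) (x + h n) - indicat_real (box a b) x\<bar>) \<longlonglongrightarrow> 0"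
proof (rule tendsto_eventually)
  have lim: "(\<lambda>n. x + h n) \<longlonglongrightarrow> x" using tendsto_add[OF tendsto_const h, of x] by simp
  show "\<forall>\<^sub>F n in sequentially. \<bar>indicat_real (box a b) (x + h n) - indicat_real (box a b) x\<bar> = 0"
  proof (cases "x \<in> box a b")
    case True
    show ?thesis
    proof (rule eventually_mono[OF topological_tendstoD[OF lim open_box True]])
      fix n assume "x + h n \<in> box a b"
      then show "\<bar>indicat_real (box a b) (x + h n) - indicat_real (box a b) x\<bar> = 0"
        using True by (simp only: indicator_simps diff_self abs_zero)
    qed
  next
    case False
    then have "x \<in> - cbox a b" using x by blast
    show ?thesis
    proof (rule eventually_mono[OF topological_tendstoD[OF lim open_Compl[OF closed_cbox] \<open>x \<in> - cbox a b\<close>]])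
      fix n assume "x + h n \<in> - cbox a b"
      then have "x + h n \<notin> box a b" using box_subset_cbox[of a b] by blast
      then have "indicat_real (box a b) (x + h n) = 0" by (rule indicator_simps)
      moreover have "indicat_real (box a b) x = 0" using False by (rule indicator_simps)
      ultimately show "\<bar>indicat_real (box a b) (x + h n) - indicat_real (box a b) x\<bar> = 0"
        by (simp only: diff_self abs_zero)
    qed
  qed
qed

lemma L1_translation_continuous_box:
  fixes a b :: "'a::euclidean_space"
  shows "L1_translation_continuous (indicat_real (box a b))"
  unfolding L1_translation_continuous_def
proof (intro conjI allI impI)
  show "integrable lborel (indicat_real (box a b))"
    by (rule integrable_real_indicator) (simp_all add: emeasure_lborel_box_finite[simplified])
  fix h :: "nat \<Rightarrow> 'a" assume h: "h \<longlonglongrightarrow> 0"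
  obtain R where R: "\<And>x. x \<in> box a b \<Longrightarrow> norm x \<le> R"
    using bounded_box[of a b] by (auto simp: bounded_pos)
  obtain B where B: "\<And>n. norm (h n) \<le> B"
    using convergent_imp_Bseq[of h] h by (auto simp: convergent_def Bseq_def)
  have "(\<lambda>n. \<integral>x. \<bar>indicat_real (box a b) (x + h n) - indicat_real (box a b) x\<bar> \<partial>lborel)
      \<longlonglongrightarrow> (\<integral>x. 0 \<partial>(lborel :: 'a measure))"
  proof (rule integral_dominated_convergence)
    show "integrable lborel (indicat_real (cball (0::'a) (R + B)))"
      by (rule integrable_real_indicator) (simp_all add: emeasure_lborel_cball_finite[simplified])
    show "AE x in lborel. norm \<bar>indicat_real (box a b) (x + h n) - indicat_real (box a b) x\<bar>
        \<le> indicat_real (cball 0 (R + B)) x" for n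
    proof (rule AE_I2)
      fix x
      show "norm \<bar>indicat_real (box a b) (x + h n) - indicat_real (box a b) x\<bar>
        \<le> indicat_real (cball 0 (R + B)) x"
      proof (cases "x \<in> box a b \<or> x + h n \<in> box a b")
        case True
        then have "norm x \<le> R + B"
          using R[of x] R[of "x + h n"] B[of n] norm_triangle_ineq4[of "x + h n" "h n"] norm_ge_zero[of "h n"]
          unfolding add_diff_cancel_right' by linarith
        then have "indicat_real (cball 0 (R + B)) x = 1" by simp
        moreover have "0 \<le> indicat_real A y \<and> indicat_real A y \<le> 1" for A and y :: 'a by simp
        ultimately show ?thesis
          unfolding real_norm_def abs_idempotent by (smt (verit))
      qed simp
    qed
    have "cbox a b - box a b \<in> null_sets lborel"
      using negligible_frontier_interval[of a b] by (simp add: negligible_iff_null_sets null_sets_completion_iff)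
    then have "AE x in lborel. x \<notin> cbox a b - box a b" by (rule AE_not_in)
    then show "AE x in lborel. (\<lambda>n. \<bar>indicat_real (box a b) (x + h n) - indicat_real (box a b) x\<bar>) \<longlonglongrightarrow> 0"
      by (rule eventually_mono) (rule indicator_box_translate_tendsto[OF h])
  qed measurable
  then show "(\<lambda>n. \<integral>x. \<bar>indicat_real (box a b) (x + h n) - indicat_real (box a b) x\<bar> \<partial>lborel) \<longlonglongrightarrow> 0"
    by (simp only: integral_zero)
qed

text \<open>A Dynkin system argument from boxes to Borel sets. The fixed box keeps all measures
  finite, so that complements are differences of integrable indicators and partial unions converge
  in L1.\<close>

lemma L1_translation_continuous_indicator_bounded:
  fixes A :: "'a::euclidean_space set"
  assumes "A \<in> sets borel"
  shows "L1_translation_continuous (indicat_real (box a b \<inter> A))"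
proof -
  have int: "integrable lborel (indicat_real (box a b \<inter> A))" if [measurable]: "A \<in> sets borel" for A
  proof (rule integrable_real_indicator)
    have "emeasure lborel (box a b \<inter> A) \<le> emeasure lborel (box a b)" by (intro emeasure_mono) auto
    then show "emeasure lborel (box a b \<inter> A) < \<infinity>"
      using emeasure_lborel_box_finite[of a b] by (rule order.strict_trans1)
  qed measurable
  let ?G = "range (\<lambda>(a, b). box a b :: 'a set)"
  have "Int_stable ?G"
    unfolding Int_stable_def by (clarsimp simp: box_Int_box) blast
  moreover have "?G \<subseteq> Pow UNIV" by auto
  moreover have "A \<in> sigma_sets UNIV ?G"
    using assms unfolding borel_eq_box by simp
  ultimately show ?thesis
  proof (induction rule: sigma_sets_induct_disjoint)
    case (basic A)
    then obtain c d where "A = box c d" by auto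
    then show ?case by (simp only: box_Int_box L1_translation_continuous_box)
  next
    case empty
    then show ?case by (simp add: L1_translation_continuous_def)
  next
    case (compl A)
    have "indicat_real (box a b \<inter> (UNIV - A)) = (\<lambda>x. indicat_real (box a b) x + (-1) * indicat_real (box a b \<inter> A) x)"
      by (auto split: split_indicator)
    then show ?case
      by (simp only: L1_translation_continuous_add[OF L1_translation_continuous_box
            L1_translation_continuous_scale[OF compl(2)]])
  next
    case (union A)
    have [measurable]: "A i \<in> sets borel" for i unfolding borel_eq_box using union(2) by auto
    have TC: "L1_translation_continuous (indicat_real (box a b \<inter> (\<Union>i<n. A i)))" for n
    proof (induction n)
      case (Suc n)
      have "indicat_real (box a b \<inter> (\<Union>i<Suc n. A i))
          = (\<lambda>x. indicat_real (box a b \<inter> (\<Union>i<n. A i)) x + indicat_real (box a b \<inter> A n) x)"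
      proof
        fix x
        have "A i \<inter> A n = {}" if "i < n" for i
          using disjoint_family_onD[OF union(1), of i n] that by simp
        then have "(box a b \<inter> (\<Union>i<n. A i)) \<inter> (box a b \<inter> A n) = {}" by blast
        moreover have "box a b \<inter> (\<Union>i<Suc n. A i) = (box a b \<inter> (\<Union>i<n. A i)) \<union> (box a b \<inter> A n)"
          unfolding lessThan_Suc by blast
        ultimately show "indicat_real (box a b \<inter> (\<Union>i<Suc n. A i)) x
          = indicat_real (box a b \<inter> (\<Union>i<n. A i)) x + indicat_real (box a b \<inter> A n) x"
          by (simp only: indicator_disj_union)
      qed
      then show ?case by (simp only: L1_translation_continuous_add[OF Suc union(3)])
    qed (simp add: L1_translation_continuous_def)
    show ?case
    proof (rule L1_translation_continuous_limit[OF int TC])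
      have "(\<lambda>n. \<integral>x. \<bar>indicat_real (box a b \<inter> (\<Union>i. A i)) x - indicat_real (box a b \<inter> (\<Union>i<n. A i)) x\<bar> \<partial>lborel)
        \<longlonglongrightarrow> (\<integral>x. 0 \<partial>(lborel :: 'a measure))"
      proof (rule integral_dominated_convergence)
        show "integrable lborel (indicat_real (box a b \<inter> UNIV))" by (rule int) simp
        show "AE x in lborel. (\<lambda>n. \<bar>indicat_real (box a b \<inter> (\<Union>i. A i)) x
            - indicat_real (box a b \<inter> (\<Union>i<n. A i)) x\<bar>) \<longlonglongrightarrow> 0"
        proof (rule AE_I2, rule tendsto_rabs_zero)
          fix x
          have "(\<lambda>n. indicat_real (box a b \<inter> (\<Union>i<n. A i)) x) \<longlonglongrightarrow> indicat_real (box a b \<inter> (\<Union>i. A i)) x"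
            unfolding Int_UN_distrib by (rule LIMSEQ_indicator_UN)
          from tendsto_diff[OF tendsto_const this, of "indicat_real (box a b \<inter> (\<Union>i. A i)) x"]
          show "(\<lambda>n. indicat_real (box a b \<inter> (\<Union>i. A i)) x - indicat_real (box a b \<inter> (\<Union>i<n. A i)) x) \<longlonglongrightarrow> 0"
            by (simp only: diff_self)
        qed
      qed (measurable, simp split: split_indicator)
      then show "(\<lambda>n. \<integral>x. \<bar>indicat_real (box a b \<inter> (\<Union>i. A i)) x - indicat_real (box a b \<inter> (\<Union>i<n. A i)) x\<bar> \<partial>lborel)
        \<longlonglongrightarrow> 0" by simp
    qed measurable
  qed
qed

text \<open>The bound \<open>2 * \<bar>f x\<bar>\<close> is the one supplied by the limit case of
  \<open>integrable_induct\<close>.\<close>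

lemma tendsto_L1_dominated:
  fixes f :: "'a::euclidean_space \<Rightarrow> real"
  assumes [measurable]: "\<And>i. s i \<in> borel_measurable borel" and f: "integrable lborel f"
    and lim: "\<And>x. (\<lambda>i. s i x) \<longlonglongrightarrow> f x" and dom: "\<And>i x. \<bar>s i x\<bar> \<le> 2 * \<bar>f x\<bar>"
  shows "(\<lambda>i. \<integral>x. \<bar>f x - s i x\<bar> \<partial>lborel) \<longlonglongrightarrow> 0"
proof -
  have [measurable]: "f \<in> borel_measurable borel" using f by (auto dest: borel_measurable_integrable)
  have "(\<lambda>i. \<integral>x. \<bar>f x - s i x\<bar> \<partial>lborel) \<longlonglongrightarrow> (\<integral>x. 0 \<partial>(lborel :: 'a measure))"
  proof (rule integral_dominated_convergence)
    show "integrable lborel (\<lambda>x. 3 * \<bar>f x\<bar>)" using f by simp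
    show "AE x in lborel. (\<lambda>i. \<bar>f x - s i x\<bar>) \<longlonglongrightarrow> 0"
    proof (rule AE_I2, rule tendsto_rabs_zero)
      fix x
      from tendsto_diff[OF tendsto_const lim, of "f x" x]
      show "(\<lambda>i. f x - s i x) \<longlonglongrightarrow> 0" by (simp only: diff_self)
    qed
    show "AE x in lborel. norm \<bar>f x - s i x\<bar> \<le> 3 * \<bar>f x\<bar>" for i
    proof (rule AE_I2)
      fix x show "norm \<bar>f x - s i x\<bar> \<le> 3 * \<bar>f x\<bar>" using dom[of i x] by simp
    qed
  qed measurable
  then show ?thesis by simp
qed

text \<open>The property passes from indicators of bounded Borel sets to those of finite measure,
  then to sums and L1 limits.\<close>

lemma L1_translation_continuous:
  fixes f :: "'a::euclidean_space \<Rightarrow> real"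
  assumes "integrable lborel f"
  shows "L1_translation_continuous f"
  using assms
proof (induction rule: integrable_induct)
  case (base A c)
  then have [measurable]: "A \<in> sets borel" by simp
  define Q :: "nat \<Rightarrow> 'a set" where "Q N = box (- (real N *\<^sub>R One)) (real N *\<^sub>R One)" for N
  have "incseq Q"
    unfolding incseq_def Q_def by (intro allI impI subset_box_imp(4)) simp
  have "L1_translation_continuous (indicat_real A)"
  proof (rule L1_translation_continuous_limit)
    show "L1_translation_continuous (indicat_real (Q N \<inter> A))" for N
      unfolding Q_def by (rule L1_translation_continuous_indicator_bounded) simp
    show "(\<lambda>N. \<integral>x. \<bar>indicat_real A x - indicat_real (Q N \<inter> A) x\<bar> \<partial>lborel) \<longlonglongrightarrow> 0"
    proof (rule tendsto_L1_dominated)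
      fix x :: 'a
      have "(\<Union>N. Q N) = UNIV"
        unfolding Q_def by (rule UN_box_eq_UNIV)
      then have "(\<lambda>N. indicat_real (Q N) x) \<longlonglongrightarrow> 1"
        using LIMSEQ_indicator_incseq[OF \<open>incseq Q\<close>, of x] by simp
      from tendsto_mult_right[OF this, of "indicat_real A x"]
      show "(\<lambda>N. indicat_real (Q N \<inter> A) x) \<longlonglongrightarrow> indicat_real A x"
        by (simp only: indicator_inter_arith mult_1_left)
    next
      show "integrable lborel (indicat_real A)" using base by (simp add: integrable_indicator_iff)
      show "indicat_real (Q N \<inter> A) \<in> borel_measurable borel" for N unfolding Q_def by measurable
    qed (auto split: split_indicator)
  qed (use base in \<open>simp add: integrable_indicator_iff\<close>)
  from L1_translation_continuous_scale[OF this, of c] show ?case by (simp add: mult.commute)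
next
  case (add f g)
  then show ?case by (simp add: L1_translation_continuous_add)
next
  case (lim f s)
  show ?case
  proof (rule L1_translation_continuous_limit[OF lim.hyps(4) lim.IH])
    show "(\<lambda>i. \<integral>x. \<bar>f x - s i x\<bar> \<partial>lborel) \<longlonglongrightarrow> 0"
    proof (rule tendsto_L1_dominated[OF _ lim.hyps(4)])
      show "s i \<in> borel_measurable borel" for i
        using borel_measurable_integrable[OF lim.hyps(1)[of i]] by simp
    qed (use lim.hyps(2,3) in simp_all)
  qed
qed

subsection \<open>Convex functions of absolutely continuous functions\<close>

text \<open>The interval is divided into equal steps shorter than \<delta>.\<close>

lemma decreasing_of_locally_decreasing:
  fixes H :: "real \<Rightarrow> real"
  assumes "0 \<le> T" "0 < \<delta>"
    and step: "\<And>a b. 0 \<le> a \<Longrightarrow> a \<le> b \<Longrightarrow> b \<le> T \<Longrightarrow> b - a < \<delta> \<Longrightarrow> H b \<le> H a"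
  shows "H T \<le> H 0"
proof -
  obtain n :: nat where n: "T / \<delta> < real n" using reals_Archimedean2 by blast
  moreover have "0 \<le> T / \<delta>" using assms by simp
  ultimately have "n > 0" by (cases n) auto
  define d where "d = T / real n"
  have d: "0 \<le> d" "real n * d = T" using \<open>n > 0\<close> assms(1) by (simp_all add: d_def)
  have "d < \<delta>"
    using n \<open>n > 0\<close> \<open>0 < \<delta>\<close> unfolding d_def by (simp add: divide_less_eq mult.commute)
  have "H (real i * d) \<le> H 0" if "i \<le> n" for i
    using that
  proof (induction i)
    case (Suc i)
    have "real (Suc i) * d \<le> real n * d"
      using Suc.prems d(1) by (intro mult_right_mono) simp_all
    moreover have "real (Suc i) * d = real i * d + d" by (simp add: distrib_right)
    moreover have "0 \<le> real i * d" using d(1) by simp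
    ultimately have "H (real (Suc i) * d) \<le> H (real i * d)"
      using d \<open>d < \<delta>\<close> by (intro step) linarith+
    with Suc show ?case by simp
  qed simp
  from this[of n] show ?thesis using d by simp
qed

lemma convex_chain_rule:
  fixes g \<beta> \<beta>' :: "real \<Rightarrow> real"
  assumes "0 \<le> T" and g: "set_integrable lborel {0..T} g"
    and convex: "\<And>a b. \<beta> a - \<beta> b \<le> \<beta>' a * (a - b)"
    and \<beta>': "continuous_on UNIV \<beta>'"
    and w: "\<And>t. w t = w0 + (LBINT s:{0..t}. g s)"
  shows "\<beta> (w T) \<le> \<beta> w0 + (LBINT s:{0..T}. \<beta>' (w s) * g s)"
    and "set_integrable lborel {0..T} (\<lambda>s. \<beta>' (w s) * g s)"
    and "continuous_on {0..T} w"
proof -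
  have gsub: "set_integrable lborel {a..b} g" if "0 \<le> a" "b \<le> T" for a b
    by (rule set_integrable_subset[OF g]) (use that in auto)
  have w_eq: "w t = w0 + integral {0..t} g" if "0 \<le> t" "t \<le> T" for t
    using set_borel_integral_eq_integral(2)[OF gsub[of 0 t]] that w by simp
  have g_int: "g integrable_on {0..T}" by (rule set_borel_integral_eq_integral(1)[OF g])
  have "continuous_on {0..T} (\<lambda>t. w0 + integral {0..t} g)"
    by (intro continuous_intros indefinite_integral_continuous_1 g_int)
  then show cw: "continuous_on {0..T} w"
    by (rule continuous_on_eq) (simp add: w_eq)
  have cb: "continuous_on {0..T} (\<lambda>t. \<beta>' (w t))"
    by (rule continuous_on_compose2[OF \<beta>' cw]) simp
  obtain B where B: "\<forall>t\<in>{0..T}. \<bar>\<beta>' (w t)\<bar> \<le> B"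
    using compact_imp_bounded[OF compact_continuous_image[OF cb compact_Icc]] by (auto simp: bounded_iff)
  have k: "set_integrable lborel {0..T} (\<lambda>s. \<beta>' (w s) * g s)"
    unfolding set_integrable_def
  proof (rule Bochner_Integration.integrable_bound)
    show "integrable lborel (\<lambda>s. B * (indicator {0..T} s *\<^sub>R g s))"
      using g unfolding set_integrable_def by simp
    have "(\<lambda>s. indicator {0..T} s *\<^sub>R \<beta>' (w s)) \<in> borel_measurable borel"
      using borel_measurable_continuous_on_indicator[OF _ cb] by simp
    moreover have "(\<lambda>s. indicator {0..T} s *\<^sub>R g s) \<in> borel_measurable lborel"
      using borel_measurable_integrable[OF g[unfolded set_integrable_def]] .
    \<comment> \<open>Only the restrictions of g and of \<open>\<beta>' (w s)\<close> to [0,T] are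
      known to be measurable; a product of two indicators keeps both restricted.\<close>
    ultimately have "(\<lambda>s. (indicator {0..T} s *\<^sub>R \<beta>' (w s)) * (indicator {0..T} s *\<^sub>R g s)) \<in> borel_measurable lborel"
      by measurable
    also have "(\<lambda>s. (indicator {0..T} s *\<^sub>R \<beta>' (w s)) * (indicator {0..T} s *\<^sub>R g s))
        = (\<lambda>s. indicator {0..T} s *\<^sub>R (\<beta>' (w s) * g s))"
      by (rule ext) (simp split: split_indicator)
    finally show "(\<lambda>s. indicator {0..T} s *\<^sub>R (\<beta>' (w s) * g s)) \<in> borel_measurable lborel" .
    show "AE s in lborel. norm (indicator {0..T} s *\<^sub>R (\<beta>' (w s) * g s)) \<le> norm (B * (indicator {0..T} s *\<^sub>R g s))"
    proof (rule AE_I2)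
      fix s
      have "\<bar>\<beta>' (w s)\<bar> \<le> \<bar>B\<bar>" if "s \<in> {0..T}" using bspec[OF B that] by linarith
      then show "norm (indicator {0..T} s *\<^sub>R (\<beta>' (w s) * g s)) \<le> norm (B * (indicator {0..T} s *\<^sub>R g s))"
        by (auto split: split_indicator simp: abs_mult intro: mult_right_mono)
    qed
  qed
  then show "set_integrable lborel {0..T} (\<lambda>s. \<beta>' (w s) * g s)" .
  have ksub: "set_integrable lborel {a..b} (\<lambda>s. \<beta>' (w s) * g s)" if "0 \<le> a" "b \<le> T" for a b
    by (rule set_integrable_subset[OF k]) (use that in auto)
  have asub: "set_integrable lborel {a..b} (\<lambda>s. \<bar>g s\<bar>)" if "0 \<le> a" "b \<le> T" for a b
    using gsub[OF that] by (rule set_integrable_abs)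
  note HK = set_borel_integral_eq_integral(1)
  let ?I = "\<lambda>t. integral {0..t} (\<lambda>s. \<beta>' (w s) * g s)" and ?A = "\<lambda>t. integral {0..t} (\<lambda>s. \<bar>g s\<bar>)"
  have eps: "\<beta> (w T) - \<beta> w0 - ?I T \<le> e * ?A T" if "e > 0" for e
  proof -
    have "uniformly_continuous_on {0..T} (\<lambda>t. \<beta>' (w t))"
      by (rule compact_uniformly_continuous[OF cb]) simp
    then obtain \<delta> where \<delta>: "\<delta> > 0"
      "\<forall>s\<in>{0..T}. \<forall>t\<in>{0..T}. \<bar>t - s\<bar> < \<delta> \<longrightarrow> \<bar>\<beta>' (w t) - \<beta>' (w s)\<bar> < e"
      using \<open>e > 0\<close> unfolding uniformly_continuous_on_def dist_real_def by blast
    \<comment> \<open>The last term of H pays for freezing the slope at the right end point, so that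
      H decreases over every interval shorter than \<delta>.\<close>
    define H where "H t = \<beta> (w t) - ?I t - e * ?A t" for t
    have "H T \<le> H 0"
    proof (rule decreasing_of_locally_decreasing[OF assms(1) \<delta>(1)])
      fix a b assume ab: "0 \<le> a" "a \<le> b" "b \<le> T" "b - a < \<delta>"
      have split: "integral {0..b} f = integral {0..a} f + integral {a..b} f"
        if "f integrable_on {0..b}" for f :: "real \<Rightarrow> real"
        using Henstock_Kurzweil_Integration.integral_combine[OF ab(1,2) that] by simp
      have "\<beta> (w b) - \<beta> (w a) \<le> \<beta>' (w b) * (w b - w a)" by (rule convex)
      also have "w b - w a = integral {a..b} g"
        using ab split[OF HK[OF gsub[of 0 b]]] by (simp add: w_eq)
      also have "\<beta>' (w b) * integral {a..b} g = integral {a..b} (\<lambda>s. \<beta>' (w b) * g s)" by simp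
      also have "\<dots> \<le> integral {a..b} (\<lambda>s. \<beta>' (w s) * g s + e * \<bar>g s\<bar>)"
      proof (rule integral_le)
        show "(\<lambda>s. \<beta>' (w b) * g s) integrable_on {a..b}"
          using HK[OF gsub] ab by (intro integrable_on_mult_right) auto
        show "(\<lambda>s. \<beta>' (w s) * g s + e * \<bar>g s\<bar>) integrable_on {a..b}"
          using HK[OF ksub] HK[OF asub] ab by (intro integrable_add integrable_on_mult_right) auto
        fix s assume "s \<in> {a..b}"
        then have "\<bar>\<beta>' (w b) - \<beta>' (w s)\<bar> < e"
          using ab by (intro \<delta>(2)[rule_format]) auto
        then have "\<bar>\<beta>' (w b) - \<beta>' (w s)\<bar> \<le> e" by simp
        then have "\<bar>(\<beta>' (w b) - \<beta>' (w s)) * g s\<bar> \<le> e * \<bar>g s\<bar>" by (simp add: abs_mult mult_right_mono)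
        then show "\<beta>' (w b) * g s \<le> \<beta>' (w s) * g s + e * \<bar>g s\<bar>" by (simp add: left_diff_distrib)
      qed
      also have "\<dots> = integral {a..b} (\<lambda>s. \<beta>' (w s) * g s) + e * integral {a..b} (\<lambda>s. \<bar>g s\<bar>)"
        using HK[OF ksub] HK[OF asub] ab
        by (subst Henstock_Kurzweil_Integration.integral_add) (auto intro!: integrable_on_mult_right)
      finally have "\<beta> (w b) - \<beta> (w a) \<le> integral {a..b} (\<lambda>s. \<beta>' (w s) * g s) + e * integral {a..b} (\<lambda>s. \<bar>g s\<bar>)" .
      moreover have "?I b = ?I a + integral {a..b} (\<lambda>s. \<beta>' (w s) * g s)"
        using ab by (intro split HK ksub) auto
      moreover have "?A b = ?A a + integral {a..b} (\<lambda>s. \<bar>g s\<bar>)"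
        using ab by (intro split HK asub) auto
      then have "e * ?A b = e * ?A a + e * integral {a..b} (\<lambda>s. \<bar>g s\<bar>)"
        by (simp only: distrib_left)
      ultimately show "H b \<le> H a"
        unfolding H_def by linarith
    qed
    moreover have "w 0 = w0" using w_eq[of 0] assms(1) by simp
    ultimately show ?thesis unfolding H_def by simp
  qed
  have "\<beta> (w T) - \<beta> w0 - ?I T \<le> 0"
  proof (rule field_le_epsilon)
    fix e :: real assume "e > 0"
    have A0: "0 \<le> ?A T" by (rule Henstock_Kurzweil_Integration.integral_nonneg[OF HK[OF asub]]) auto
    \<comment> \<open>The 1 in the denominator covers the case that g vanishes almost
      everywhere.\<close>
    have "\<beta> (w T) - \<beta> w0 - ?I T \<le> e / (?A T + 1) * ?A T"
      by (rule eps) (use A0 \<open>e > 0\<close> in simp)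
    also have "\<dots> = e * (?A T / (?A T + 1))" by simp
    also have "\<dots> \<le> e * 1"
      using A0 \<open>e > 0\<close> by (intro mult_left_mono) auto
    finally show "\<beta> (w T) - \<beta> w0 - ?I T \<le> 0 + e" by simp
  qed
  then show "\<beta> (w T) \<le> \<beta> w0 + (LBINT s:{0..T}. \<beta>' (w s) * g s)"
    unfolding set_borel_integral_eq_integral(2)[OF k] by linarith
qed

subsection \<open>Scaling, slices and integration by parts\<close>

lemma nn_integral_lborel_scale:
  fixes f :: "'a::euclidean_space \<Rightarrow> ennreal"
  assumes [measurable]: "f \<in> borel_measurable borel" and "c > 0"
  shows "(\<integral>\<^sup>+x. f x \<partial>lborel) = ennreal (c ^ DIM('a)) * (\<integral>\<^sup>+z. f (a + c *\<^sub>R z) \<partial>lborel)"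
proof -
  have "(\<integral>\<^sup>+x. f x \<partial>lborel) = (\<integral>\<^sup>+x. f x \<partial>density (distr lborel borel (\<lambda>x. a + c *\<^sub>R x)) (\<lambda>_. ennreal (\<bar>c\<bar> ^ DIM('a))))"
    using lborel_affine[of c a] \<open>c > 0\<close> by simp
  also have "\<dots> = ennreal (c ^ DIM('a)) * (\<integral>\<^sup>+z. f (a + c *\<^sub>R z) \<partial>lborel)"
    using \<open>c > 0\<close> by (subst nn_integral_density) (auto simp: nn_integral_cmult nn_integral_distr)
  finally show ?thesis .
qed

lemma lborel_scale:
  fixes f :: "'a::euclidean_space \<Rightarrow> 'b::{banach, second_countable_topology}"
  assumes [measurable]: "f \<in> borel_measurable borel" and "c > 0"
  shows integrable_lborel_scale_iff: "integrable lborel (\<lambda>z. f (a + c *\<^sub>R z)) \<longleftrightarrow> integrable lborel f"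
    and integral_lborel_scale: "(\<integral>x. f x \<partial>lborel) = c ^ DIM('a) *\<^sub>R (\<integral>z. f (a + c *\<^sub>R z) \<partial>lborel)"
proof -
  let ?D = "distr lborel borel (\<lambda>x. a + c *\<^sub>R x)"
  have eq: "lborel = density ?D (\<lambda>_. ennreal (c ^ DIM('a)))"
    using lborel_affine[of c a] \<open>c > 0\<close> by simp
  have "integrable lborel f \<longleftrightarrow> integrable (density ?D (\<lambda>_. ennreal (c ^ DIM('a)))) f"
    by (subst eq) (rule refl)
  also have "\<dots> \<longleftrightarrow> integrable ?D (\<lambda>x. c ^ DIM('a) *\<^sub>R f x)"
    using \<open>c > 0\<close> by (subst integrable_density) auto
  also have "\<dots> \<longleftrightarrow> integrable ?D f"
  proof
    assume "integrable ?D (\<lambda>x. c ^ DIM('a) *\<^sub>R f x)"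
    then have "integrable ?D (\<lambda>x. inverse (c ^ DIM('a)) *\<^sub>R (c ^ DIM('a) *\<^sub>R f x))"
      by (rule integrable_scaleR_right)
    then show "integrable ?D f" using \<open>c > 0\<close> by simp
  qed (rule integrable_scaleR_right)
  also have "\<dots> \<longleftrightarrow> integrable lborel (\<lambda>z. f (a + c *\<^sub>R z))"
    by (simp add: integrable_distr_eq)
  finally show "integrable lborel (\<lambda>z. f (a + c *\<^sub>R z)) \<longleftrightarrow> integrable lborel f" by simp
  have "(\<integral>x. f x \<partial>lborel) = (\<integral>x. f x \<partial>density ?D (\<lambda>_. ennreal (c ^ DIM('a))))"
    by (subst eq) (rule refl)
  also have "\<dots> = c ^ DIM('a) *\<^sub>R (\<integral>z. f (a + c *\<^sub>R z) \<partial>lborel)"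
    using \<open>c > 0\<close> by (subst integral_density) (auto simp: integral_distr)
  finally show "(\<integral>x. f x \<partial>lborel) = c ^ DIM('a) *\<^sub>R (\<integral>z. f (a + c *\<^sub>R z) \<partial>lborel)" .
qed

section \<open>Slices and tensor products\<close>

lemma borel_measurable_slice:
  assumes "f \<in> borel_measurable borel"
  shows "(\<lambda>x. f (t, x)) \<in> borel_measurable borel"
  by (rule measurable_compose[OF borel_measurable_continuous_onI assms]) (intro continuous_intros)

text \<open>Fubini is applied on balls of integer radius only, so that one null set of times serves
  all balls.\<close>

lemma L1_loc_slices:
  fixes u :: "real \<times> 'a::euclidean_space \<Rightarrow> 'b::euclidean_space"
  assumes u: "L1_loc u"
  shows "AE t in lborel. L1_loc (\<lambda>x. u (t, x))"
proof -
  note meas[measurable] = L1_loc_measurable[OF u]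
  have "AE t in lborel. \<forall>n. integrable lborel (\<lambda>x. indicat_real (cball 0 (real n)) (t, x) *\<^sub>R u (t, x))"
    unfolding AE_all_countable
  proof
    fix n
    have "integrable (lborel \<Otimes>\<^sub>M lborel) (\<lambda>p. indicat_real (cball 0 (real n)) p *\<^sub>R u p)"
      using L1_loc_integrable[OF u] by (simp add: lborel_prod)
    from lborel_pair.AE_integrable_fst'[OF this]
    show "AE t in lborel. integrable lborel (\<lambda>x. indicat_real (cball 0 (real n)) (t, x) *\<^sub>R u (t, x))" .
  qed
  then show ?thesis
  proof eventually_elim
    case (elim t)
    have [measurable]: "(\<lambda>x. u (t, x)) \<in> borel_measurable borel" by (rule borel_measurable_slice[OF meas])
    show ?case
      unfolding L1_loc_def
    proof safe
      fix R
      obtain n where n: "\<bar>t\<bar> + R \<le> real n" using real_arch_simple by blast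
      show "integrable lborel (\<lambda>x. indicat_real (cball 0 R) x *\<^sub>R u (t, x))"
      proof (rule Bochner_Integration.integrable_bound[OF elim[rule_format, of n]])
        have in_ball: "norm (t, x) \<le> real n" if "norm x \<le> R" for x
          using norm_Pair_le[of t x] n that by simp
        have "norm (indicat_real (cball 0 R) x *\<^sub>R u (t, x))
            \<le> norm (indicat_real (cball 0 (real n)) (t, x) *\<^sub>R u (t, x))" for x
          using in_ball[of x] by (cases "norm x \<le> R") simp_all
        then show "AE x in lborel. norm (indicat_real (cball 0 R) x *\<^sub>R u (t, x))
            \<le> norm (indicat_real (cball 0 (real n)) (t, x) *\<^sub>R u (t, x))"
          by (rule AE_I2)
      qed measurable
    qed measurable
  qed
qed

lemma Cc_infinity_tensor:
  fixes \<theta> :: "real \<Rightarrow> real" and \<psi> :: "'a::euclidean_space \<Rightarrow> real"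
  assumes \<theta>: "Cc_infinity \<theta>" and \<psi>: "Cc_infinity \<psi>"
  shows "Cc_infinity (\<lambda>p. \<theta> (fst p) * \<psi> (snd p))"
proof (rule Cc_infinityI)
  show "smooth (\<lambda>p::real \<times> 'a. \<theta> (fst p) * \<psi> (snd p))"
    using smooth_affine[OF Cc_infinity_smooth[OF \<theta>] bounded_linear_fst, of 0]
      smooth_affine[OF Cc_infinity_smooth[OF \<psi>] bounded_linear_snd, of 0]
    by (intro smooth_mult) simp_all
  show "bounded ({t. \<theta> t \<noteq> 0} \<times> {x. \<psi> x \<noteq> 0})"
    using \<theta> \<psi> by (intro bounded_Times) (auto simp: Cc_infinity_iff)
qed auto

lemma frechet_derivative_tensor:
  fixes \<theta> :: "real \<Rightarrow> real" and \<psi> :: "'a::euclidean_space \<Rightarrow> real"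
  assumes \<theta>: "smooth \<theta>" and \<psi>: "smooth \<psi>"
  shows "frechet_derivative (\<lambda>p. \<theta> (fst p) * \<psi> (snd p)) (at p) v
    = \<theta> (fst p) * frechet_derivative \<psi> (at (snd p)) (snd v) + frechet_derivative \<theta> (at (fst p)) (fst v) * \<psi> (snd p)"
proof -
  have f: "((\<lambda>p. \<theta> (fst p)) has_derivative (\<lambda>v. frechet_derivative \<theta> (at (fst p)) (fst v))) (at p)"
    by (rule has_derivative_compose[OF bounded_linear_imp_has_derivative[OF bounded_linear_fst] smooth_has_derivative[OF \<theta>]])
  have s: "((\<lambda>p. \<psi> (snd p)) has_derivative (\<lambda>v. frechet_derivative \<psi> (at (snd p)) (snd v))) (at p)"
    by (rule has_derivative_compose[OF bounded_linear_imp_has_derivative[OF bounded_linear_snd] smooth_has_derivative[OF \<psi>]])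
  from frechet_derivative_at[OF has_derivative_mult[OF f s]] show ?thesis
    by (simp add: fun_eq_iff)
qed

text \<open>The integral of \<phi>(x - v) - \<phi>(x) vanishes by translation invariance. Along the
  segment this difference is an average of shifted derivatives, all with the same integral.\<close>

lemma integral_frechet_derivative_eq_0:
  fixes \<phi> :: "'a::euclidean_space \<Rightarrow> real"
  assumes \<phi>: "Cc_infinity \<phi>"
  shows "(\<integral>x. frechet_derivative \<phi> (at x) v \<partial>lborel) = 0"
proof -
  note sm = Cc_infinity_smooth[OF \<phi>]
  note [measurable] = smooth_measurable[OF sm] smooth_measurable_derivative[OF sm]
  obtain R where R: "R > 0" "\<And>x. R < norm x \<Longrightarrow> \<phi> x = 0"
    "\<And>x v. R < norm x \<Longrightarrow> frechet_derivative \<phi> (at x) v = 0"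
    using Cc_infinity_support[OF \<phi>] by blast
  obtain M where M: "M > 0" "\<And>x. norm (\<phi> x) \<le> M" "\<And>x v. norm (frechet_derivative \<phi> (at x) v) \<le> M * norm v"
    using Cc_infinity_bounded[OF \<phi>] by blast
  have one: "L1_loc (\<lambda>x::'a. 1::real)"
    by (simp add: L1_loc_def integrable_indicator_iff emeasure_lborel_cball_finite[simplified])
  have i\<phi>: "integrable lborel \<phi>"
    using L1_loc_mult_real[OF one, of \<phi> M R] M R by simp
  have shift_out: "R < norm (x - \<theta> *\<^sub>R v)" if "R + norm v < norm x" "\<theta> \<in> {0..1}" for x \<theta>
  proof -
    have "norm (\<theta> *\<^sub>R v) \<le> norm v" using that by (simp add: mult_left_le_one_le)
    then show ?thesis using that norm_triangle_ineq2[of x "\<theta> *\<^sub>R v"] by linarith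
  qed
  have i1: "integrable (lborel \<Otimes>\<^sub>M unit_meas) (\<lambda>(x, \<theta>). frechet_derivative \<phi> (at (x - \<theta> *\<^sub>R v)) v *\<^sub>R (1::real))"
    by (rule integrable_unit_bounded[OF one, of _ "M * norm v" "R + norm v"])
       (use M(3)[of _ v] R(3) shift_out in auto)
  have "0 = (\<integral>x. \<phi> (x - v) \<partial>lborel) - (\<integral>x. \<phi> x \<partial>lborel)"
    using integral_lborel_translate[of \<phi> "- v"] by simp
  also have "\<dots> = (\<integral>x. \<phi> (x - v) - \<phi> x \<partial>lborel)"
    using i\<phi> integrable_lborel_translate_iff[of \<phi> "- v"] by simp
  also have "\<dots> = (\<integral>x. \<integral>\<theta>. - frechet_derivative \<phi> (at (x - \<theta> *\<^sub>R v)) v \<partial>unit_meas \<partial>lborel)"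
    by (simp only: smooth_diff_eq_integral[OF sm])
  also have "\<dots> = (\<integral>\<theta>. \<integral>x. - frechet_derivative \<phi> (at (x - \<theta> *\<^sub>R v)) v \<partial>lborel \<partial>unit_meas)"
    by (rule lborel_unit.Fubini_integral[symmetric])
       (use integrable_minus[OF i1] in \<open>simp add: split_beta'\<close>)
  also have "\<dots> = (\<integral>\<theta>. \<integral>x. - frechet_derivative \<phi> (at x) v \<partial>lborel \<partial>unit_meas)"
    using integral_lborel_translate[of "\<lambda>x. - frechet_derivative \<phi> (at x) v" "- (_ *\<^sub>R v)"] by simp
  also have "\<dots> = - (\<integral>x. frechet_derivative \<phi> (at x) v \<partial>lborel)"
  proof -
    have "measure unit_meas UNIV = 1" using emeasure_unit_meas by (simp add: measure_def)
    then show ?thesis by simp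
  qed
  finally show ?thesis by simp
qed

text \<open>Enlarges the class of test functions: \<Psi> has to be differentiable along e only and
  may jump in other directions, as the time weight used later does. Difference quotients of \<Psi>
  are shifted onto w, where the increment is an average of g, and then the step length tends to
  0.\<close>

lemma weak_derivative_by_parts:
  fixes w g \<Psi> d\<Psi> :: "'a::euclidean_space \<Rightarrow> real"
  assumes w: "L1_loc w" and g: "L1_loc g"
    and weak: "\<And>\<phi>. Cc_infinity \<phi> \<Longrightarrow>
      (\<integral>x. w x * frechet_derivative \<phi> (at x) e \<partial>lborel) = - (\<integral>x. g x * \<phi> x \<partial>lborel)"
    and [measurable]: "\<Psi> \<in> borel_measurable borel" "d\<Psi> \<in> borel_measurable borel"
    and der: "\<And>x. ((\<lambda>s. \<Psi> (x + s *\<^sub>R e)) has_real_derivative d\<Psi> x) (at 0)"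
    and M: "\<And>x. \<bar>d\<Psi> x\<bar> \<le> M" "\<And>x. \<bar>\<Psi> x\<bar> \<le> M" and supp: "\<And>x. R < norm x \<Longrightarrow> \<Psi> x = 0"
  shows "(\<integral>x. w x * d\<Psi> x \<partial>lborel) = - (\<integral>x. g x * \<Psi> x \<partial>lborel)"
proof -
  note [measurable] = L1_loc_measurable[OF w] L1_loc_measurable[OF g]
  define h where "h n = 1 / real (Suc n)" for n
  have h: "0 < h n" "h n \<le> 1" for n by (auto simp: h_def)
  have h0: "h \<longlonglongrightarrow> 0" unfolding h_def using LIMSEQ_inverse_real_of_nat by (simp add: inverse_eq_divide)
  have der_at: "((\<lambda>s. \<Psi> (x + s *\<^sub>R e)) has_real_derivative d\<Psi> (x + s *\<^sub>R e)) (at s)" for x s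
  proof -
    have "((\<lambda>s'. \<Psi> ((x + s *\<^sub>R e) + s' *\<^sub>R e)) has_real_derivative d\<Psi> (x + s *\<^sub>R e)) (at (s - s))"
      using der[of "x + s *\<^sub>R e"] by simp
    then have "((\<lambda>s'. \<Psi> ((x + s *\<^sub>R e) + (s' - s) *\<^sub>R e)) has_real_derivative d\<Psi> (x + s *\<^sub>R e) * 1) (at s)"
      by (rule DERIV_chain2) (auto intro!: derivative_eq_intros)
    then show ?thesis by (simp add: algebra_simps)
  qed
  have lip: "\<bar>\<Psi> (x + s *\<^sub>R e) - \<Psi> x\<bar> \<le> M * s" if "s > 0" for x s
  proof -
    have "\<exists>z>0. z < s \<and> \<Psi> (x + s *\<^sub>R e) - \<Psi> (x + 0 *\<^sub>R e) = (s - 0) * d\<Psi> (x + z *\<^sub>R e)"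
      by (rule MVT2[OF that der_at])
    then obtain z where "\<Psi> (x + s *\<^sub>R e) - \<Psi> (x + 0 *\<^sub>R e) = (s - 0) * d\<Psi> (x + z *\<^sub>R e)" by blast
    then have "\<bar>\<Psi> (x + s *\<^sub>R e) - \<Psi> x\<bar> = s * \<bar>d\<Psi> (x + z *\<^sub>R e)\<bar>" using that by (simp add: abs_mult)
    also have "\<dots> \<le> s * M" using that by (intro mult_left_mono M) simp
    finally show ?thesis by (simp add: mult.commute)
  qed
  define R' where "R' = R + norm e"
  have out: "\<Psi> (x + s *\<^sub>R e) = 0" if "R' < norm x" "0 \<le> s" "s \<le> 1" for x s
  proof (rule supp)
    have "norm (s *\<^sub>R e) \<le> norm e" using that by (simp add: mult_left_le_one_le)
    then show "R < norm (x + s *\<^sub>R e)"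
      using norm_diff_ineq[of x "s *\<^sub>R e"] that by (simp add: R'_def)
  qed
  let ?I = "\<lambda>f. integral\<^sup>L lborel (f :: 'a \<Rightarrow> real)"
  let ?q = "\<lambda>n x. (\<Psi> (x + h n *\<^sub>R e) - \<Psi> x) / h n"
  \<comment> \<open>Discrete integration by parts: the forward quotient of \<Psi> becomes a backward
    quotient of w, and the average of g that results is shifted back onto \<Psi>.\<close>
  have q_eq: "?I (\<lambda>x. w x * ?q n x) = - ?I (\<lambda>x. g x * (\<integral>\<theta>. \<Psi> (x + (\<theta> * h n) *\<^sub>R e) \<partial>unit_meas))" for n
  proof -
    have hg: "L1_loc (\<lambda>x. - h n * g x)"
      using L1_loc_scaleR[OF g, of "- h n"] by simp
    have "AE x in lborel. w (x + (- h n) *\<^sub>R e) - w x = (\<integral>\<theta>. - h n * g (x + \<theta> *\<^sub>R ((- h n) *\<^sub>R e)) \<partial>unit_meas)"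
    proof (rule weak_derivative_difference_real[OF w hg])
      fix \<phi> :: "'a \<Rightarrow> real" assume \<phi>: "Cc_infinity \<phi>"
      have "frechet_derivative \<phi> (at x) ((- h n) *\<^sub>R e) = - h n * frechet_derivative \<phi> (at x) e" for x
        using linear_scale[OF has_derivative_linear[OF smooth_has_derivative[OF Cc_infinity_smooth[OF \<phi>]]], of x "- h n" e]
        by simp
      then have "?I (\<lambda>x. w x * frechet_derivative \<phi> (at x) ((- h n) *\<^sub>R e)) = - h n * ?I (\<lambda>x. w x * frechet_derivative \<phi> (at x) e)"
        by (simp add: mult.left_commute)
      then show "?I (\<lambda>x. w x * frechet_derivative \<phi> (at x) ((- h n) *\<^sub>R e)) = - ?I (\<lambda>x. - h n * g x * \<phi> x)"
        by (simp add: weak[OF \<phi>] mult.assoc)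
    qed
    then have AE: "AE x in lborel. (w (x - h n *\<^sub>R e) - w x) / h n = - (\<integral>\<theta>. g (x - (\<theta> * h n) *\<^sub>R e) \<partial>unit_meas)"
      by eventually_elim (use h(1)[of n] in \<open>simp add: field_simps\<close>)
    have iw: "integrable lborel (\<lambda>x. w x * \<Psi> x)"
      by (rule L1_loc_mult_real[OF w, of _ M R]) (use M supp in simp_all)
    have iwh: "integrable lborel (\<lambda>x. w x * \<Psi> (x + h n *\<^sub>R e))"
      by (rule L1_loc_mult_real[OF w, of _ M R']) (use M out[of _ "h n"] h[of n] in simp_all)
    have iwh': "integrable lborel (\<lambda>x. w (x - h n *\<^sub>R e) * \<Psi> x)"
      using iwh integrable_lborel_translate_iff[of "\<lambda>x. w (x - h n *\<^sub>R e) * \<Psi> x" "h n *\<^sub>R e"] by simp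
    have "?I (\<lambda>x. w x * ?q n x) = (?I (\<lambda>x. w x * \<Psi> (x + h n *\<^sub>R e)) - ?I (\<lambda>x. w x * \<Psi> x)) / h n"
      using iw iwh by (simp add: right_diff_distrib)
    also have "?I (\<lambda>x. w x * \<Psi> (x + h n *\<^sub>R e)) = ?I (\<lambda>x. w (x - h n *\<^sub>R e) * \<Psi> x)"
      using integral_lborel_translate[of "\<lambda>x. w (x - h n *\<^sub>R e) * \<Psi> x" "h n *\<^sub>R e"] by simp
    also have "(\<dots> - ?I (\<lambda>x. w x * \<Psi> x)) / h n = ?I (\<lambda>x. (w (x - h n *\<^sub>R e) - w x) / h n * \<Psi> x)"
      using iw iwh' by (simp add: left_diff_distrib)
    also have "\<dots> = ?I (\<lambda>x. - (\<integral>\<theta>. g (x - (\<theta> * h n) *\<^sub>R e) \<partial>unit_meas) * \<Psi> x)"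
      by (rule integral_cong_AE) (use AE in \<open>measurable, eventually_elim, simp\<close>)
    also have "\<dots> = - ?I (\<lambda>x. \<integral>\<theta>. \<Psi> x * g (x + \<theta> *\<^sub>R ((- h n) *\<^sub>R e)) \<partial>unit_meas)"
      by (simp add: mult.commute)
    also have "?I (\<lambda>x. \<integral>\<theta>. \<Psi> x * g (x + \<theta> *\<^sub>R ((- h n) *\<^sub>R e)) \<partial>unit_meas)
        = (\<integral>\<theta>. \<integral>x. \<Psi> x * g (x + \<theta> *\<^sub>R ((- h n) *\<^sub>R e)) \<partial>lborel \<partial>unit_meas)"
      using integrable_unit_shift[OF g, of \<Psi> M R "(- h n) *\<^sub>R e"] M supp
      by (intro lborel_unit.Fubini_integral[symmetric]) simp
    also have "\<dots> = (\<integral>\<theta>. \<integral>x. g x * \<Psi> (x + (\<theta> * h n) *\<^sub>R e) \<partial>lborel \<partial>unit_meas)"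
    proof (rule Bochner_Integration.integral_cong[OF refl])
      fix \<theta> :: real
      show "?I (\<lambda>x. \<Psi> x * g (x + \<theta> *\<^sub>R ((- h n) *\<^sub>R e))) = ?I (\<lambda>x. g x * \<Psi> (x + (\<theta> * h n) *\<^sub>R e))"
        by (subst integral_lborel_translate[symmetric, where a = "(\<theta> * h n) *\<^sub>R e"]) (auto simp: mult.commute)
    qed
    also have "\<dots> = ?I (\<lambda>x. \<integral>\<theta>. g x * \<Psi> (x + (\<theta> * h n) *\<^sub>R e) \<partial>unit_meas)"
    proof (rule lborel_unit.Fubini_integral)
      have "integrable (lborel \<Otimes>\<^sub>M unit_meas) (\<lambda>(x, \<theta>). \<Psi> (x + (\<theta> * h n) *\<^sub>R e) *\<^sub>R g x)"
      proof (rule integrable_unit_bounded[OF g _ M(2), of _ R'])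
        fix x :: 'a and \<theta> :: real assume "\<theta> \<in> {0..1}" "R' < norm x"
        then show "\<Psi> (x + (\<theta> * h n) *\<^sub>R e) = 0" using h[of n] by (intro out) (auto simp: mult_le_one)
      qed measurable
      then show "integrable (lborel \<Otimes>\<^sub>M unit_meas) (\<lambda>(x, \<theta>). g x * \<Psi> (x + (\<theta> * h n) *\<^sub>R e))"
        by (simp add: mult.commute)
    qed
    finally show ?thesis by simp
  qed
  have ind: "integrable lborel (\<lambda>x. M * \<bar>indicat_real (cball 0 R') x *\<^sub>R w x\<bar>)"
    "integrable lborel (\<lambda>x. M * \<bar>indicat_real (cball 0 R') x *\<^sub>R g x\<bar>)"
    by (intro integrable_mult_right integrable_abs L1_loc_integrable w g)+
  have "(\<lambda>n. ?I (\<lambda>x. w x * ?q n x)) \<longlonglongrightarrow> ?I (\<lambda>x. w x * d\<Psi> x)"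
  proof (rule integral_dominated_convergence[OF _ _ ind(1)])
    show "AE x in lborel. (\<lambda>n. w x * ?q n x) \<longlonglongrightarrow> w x * d\<Psi> x"
    proof (intro AE_I2 tendsto_mult_left)
      fix x
      have "((\<lambda>s. (\<Psi> (x + (0 + s) *\<^sub>R e) - \<Psi> (x + 0 *\<^sub>R e)) / s) \<longlongrightarrow> d\<Psi> x) (at 0)"
        using der[of x] unfolding DERIV_def .
      then have "((\<lambda>s. (\<Psi> (x + s *\<^sub>R e) - \<Psi> x) / s) \<longlongrightarrow> d\<Psi> x) (at 0)" by simp
      moreover have "filterlim h (at 0) sequentially"
        using h0 h(1) by (intro filterlim_atI) (auto intro!: always_eventually simp: less_imp_neq[symmetric] dest: less_imp_neq)
      ultimately show "(\<lambda>n. ?q n x) \<longlonglongrightarrow> d\<Psi> x" by (rule filterlim_compose)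
    qed
    show "AE x in lborel. norm (w x * ?q n x) \<le> M * \<bar>indicat_real (cball 0 R') x *\<^sub>R w x\<bar>" for n
    proof (rule AE_I2)
      fix x
      have "\<bar>?q n x\<bar> \<le> M" using lip[OF h(1), of x n] h(1)[of n] by (simp add: abs_divide divide_le_eq)
      then have "\<bar>w x\<bar> * \<bar>?q n x\<bar> \<le> \<bar>w x\<bar> * M" by (rule mult_left_mono) simp
      moreover have "?q n x = 0" if "R' < norm x"
        using out[OF that, of "h n"] out[OF that, of 0] h[of n] by simp
      ultimately show "norm (w x * ?q n x) \<le> M * \<bar>indicat_real (cball 0 R') x *\<^sub>R w x\<bar>"
        unfolding real_norm_def abs_mult[of "w x"]
        by (cases "R' < norm x") (simp_all only: abs_zero mult_zero_right, simp_all add: mult.commute)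
    qed
  qed measurable
  moreover have "(\<lambda>n. ?I (\<lambda>x. g x * (\<integral>\<theta>. \<Psi> (x + (\<theta> * h n) *\<^sub>R e) \<partial>unit_meas))) \<longlonglongrightarrow> ?I (\<lambda>x. g x * \<Psi> x)"
  proof (rule integral_dominated_convergence[OF _ _ ind(2)])
    have unit1: "measure unit_meas UNIV = 1" using emeasure_unit_meas by (simp add: measure_def)
    show "AE x in lborel. (\<lambda>n. g x * (\<integral>\<theta>. \<Psi> (x + (\<theta> * h n) *\<^sub>R e) \<partial>unit_meas)) \<longlonglongrightarrow> g x * \<Psi> x"
    proof (intro AE_I2 tendsto_mult_left)
      fix x
      have "(\<lambda>n. \<integral>\<theta>. \<Psi> (x + (\<theta> * h n) *\<^sub>R e) \<partial>unit_meas) \<longlonglongrightarrow> (\<integral>\<theta>. \<Psi> x \<partial>unit_meas)"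
      proof (rule integral_dominated_convergence)
        show "AE \<theta> in unit_meas. (\<lambda>n. \<Psi> (x + (\<theta> * h n) *\<^sub>R e)) \<longlonglongrightarrow> \<Psi> x"
        proof (rule AE_I2)
          fix \<theta> :: real
          have "(\<lambda>n. \<theta> * h n) \<longlonglongrightarrow> 0" using tendsto_mult_right_zero[OF h0] .
          from isCont_tendsto_compose[OF DERIV_isCont[OF der] this]
          show "(\<lambda>n. \<Psi> (x + (\<theta> * h n) *\<^sub>R e)) \<longlonglongrightarrow> \<Psi> x" by simp
        qed
        show "integrable unit_meas (\<lambda>_. M)" by simp
      qed (use M in auto)
      then show "(\<lambda>n. \<integral>\<theta>. \<Psi> (x + (\<theta> * h n) *\<^sub>R e) \<partial>unit_meas) \<longlonglongrightarrow> \<Psi> x"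
        by (simp add: unit1)
    qed
    show "AE x in lborel. norm (g x * (\<integral>\<theta>. \<Psi> (x + (\<theta> * h n) *\<^sub>R e) \<partial>unit_meas))
        \<le> M * \<bar>indicat_real (cball 0 R') x *\<^sub>R g x\<bar>" for n
    proof (rule AE_I2)
      fix x
      have "norm (\<integral>\<theta>. \<Psi> (x + (\<theta> * h n) *\<^sub>R e) \<partial>unit_meas) \<le> (\<integral>\<theta>. norm (\<Psi> (x + (\<theta> * h n) *\<^sub>R e)) \<partial>unit_meas)"
        by (rule integral_norm_bound)
      also have "\<dots> \<le> (\<integral>\<theta>. M \<partial>unit_meas)"
        by (rule integral_mono_AE')  (use M order_trans[OF abs_ge_zero M(2)] in auto)
      finally have "\<bar>g x\<bar> * \<bar>\<integral>\<theta>. \<Psi> (x + (\<theta> * h n) *\<^sub>R e) \<partial>unit_meas\<bar> \<le> \<bar>g x\<bar> * M"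
        by (intro mult_left_mono) (simp_all add: unit1)
      moreover have "(\<integral>\<theta>. \<Psi> (x + (\<theta> * h n) *\<^sub>R e) \<partial>unit_meas) = 0" if "R' < norm x"
      proof (rule integral_eq_zero_AE)
        show "AE \<theta> in unit_meas. \<Psi> (x + (\<theta> * h n) *\<^sub>R e) = 0"
          using AE_unit_meas
        proof eventually_elim
          case (elim \<theta>)
          then show ?case using that h[of n] by (intro out) (auto simp: mult_le_one)
        qed
      qed
      ultimately show "norm (g x * (\<integral>\<theta>. \<Psi> (x + (\<theta> * h n) *\<^sub>R e) \<partial>unit_meas))
          \<le> M * \<bar>indicat_real (cball 0 R') x *\<^sub>R g x\<bar>"
        by (cases "R' < norm x") (simp_all add: abs_mult mult.commute)
    qed
  qed measurable
  ultimately show ?thesis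
    unfolding q_eq by (auto dest: tendsto_minus LIMSEQ_unique)
qed

subsection \<open>Mollification of the transport equation\<close>

text \<open>Functions on space-time are measured by \<open>borel\<close> on the product type and not
  by a product of two sigma-algebras, so the projections are given rules of this shape.\<close>

lemma borel_measurable_fst_borel [measurable (raw)]:
  fixes f :: "'c \<Rightarrow> 'a::second_countable_topology \<times> 'b::second_countable_topology"
  assumes "f \<in> M \<rightarrow>\<^sub>M borel"
  shows "(\<lambda>x. fst (f x)) \<in> M \<rightarrow>\<^sub>M borel"
  using measurable_compose[OF assms borel_measurable_continuous_onI[OF continuous_on_fst[OF continuous_on_id]]] .

lemma borel_measurable_snd_borel [measurable (raw)]:
  fixes f :: "'c \<Rightarrow> 'a::second_countable_topology \<times> 'b::second_countable_topology"
  assumes "f \<in> M \<rightarrow>\<^sub>M borel"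
  shows "(\<lambda>x. snd (f x)) \<in> M \<rightarrow>\<^sub>M borel"
  using measurable_compose[OF assms borel_measurable_continuous_onI[OF continuous_on_snd[OF continuous_on_id]]] .

lemma norm_rescale_le:
  fixes x y :: "'a::real_normed_vector"
  assumes "c > 0"
  shows "norm ((1 / c) *\<^sub>R (x - y)) \<le> R \<longleftrightarrow> norm (x - y) \<le> c * R"
  unfolding norm_scaleR using assms by (simp add: divide_le_eq mult.commute)

lemma L1_loc_scale:
  fixes f :: "'a::euclidean_space \<Rightarrow> 'b::euclidean_space"
  assumes f: "L1_loc f" and "c > 0"
  shows "L1_loc (\<lambda>z. f (a + c *\<^sub>R z))"
proof -
  note [measurable] = L1_loc_measurable[OF f]
  have "integrable lborel (\<lambda>z. indicat_real (cball 0 R) z *\<^sub>R f (a + c *\<^sub>R z))" for R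
  proof -
    have "integrable lborel (\<lambda>x. indicat_real (cball 0 R) ((1 / c) *\<^sub>R (x - a)) *\<^sub>R f x)"
    proof (rule L1_loc_mult[OF f, of _ 1 "norm a + c * R"])
      fix x :: 'a assume x: "norm a + c * R < norm x"
      have "c * R < norm (x - a)" using x norm_triangle_ineq2[of x a] by linarith
      then have "\<not> norm ((1 / c) *\<^sub>R (x - a)) \<le> R" unfolding norm_rescale_le[OF \<open>c > 0\<close>] by simp
      then show "indicat_real (cball 0 R) ((1 / c) *\<^sub>R (x - a)) = 0" by simp
    qed (auto split: split_indicator)
    then show ?thesis
      using \<open>c > 0\<close> by (subst (asm) integrable_lborel_scale_iff[symmetric, where a = a and c = c]) auto
  qed
  then show ?thesis by (simp add: L1_loc_def)
qed

lemma L1_loc_inner_mult: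
  fixes f \<gamma> :: "'a::euclidean_space \<Rightarrow> 'b::euclidean_space"
  assumes f: "L1_loc f" and [measurable]: "\<gamma> \<in> borel_measurable borel"
    and M: "\<And>x. norm (\<gamma> x) \<le> M" and supp: "\<And>x. R < norm x \<Longrightarrow> \<gamma> x = 0"
  shows "integrable lborel (\<lambda>x. \<gamma> x \<bullet> f x)"
proof (rule Bochner_Integration.integrable_bound)
  note [measurable] = L1_loc_measurable[OF f]
  show "integrable lborel (\<lambda>x. M *\<^sub>R (indicator (cball 0 R) x *\<^sub>R f x))"
    by (intro integrable_scaleR_right L1_loc_integrable f)
  show "(\<lambda>x. \<gamma> x \<bullet> f x) \<in> borel_measurable lborel" by measurable
  show "AE x in lborel. norm (\<gamma> x \<bullet> f x) \<le> norm (M *\<^sub>R (indicator (cball 0 R) x *\<^sub>R f x))"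
  proof (rule AE_I2)
    fix x
    have "\<bar>\<gamma> x \<bullet> f x\<bar> \<le> norm (\<gamma> x) * norm (f x)" by (rule Cauchy_Schwarz_ineq2)
    also have "\<dots> \<le> \<bar>M\<bar> * norm (f x)" using M[of x] by (intro mult_right_mono) auto
    finally show "norm (\<gamma> x \<bullet> f x) \<le> norm (M *\<^sub>R (indicator (cball 0 R) x *\<^sub>R f x))"
      using supp[of x] by (cases "R < norm x") simp_all
  qed
qed

text \<open>\<gamma> is the gradient of \<eta> as a vector field. M and R bound the size and the
  support of both at once.\<close>

locale mollifier =
  fixes \<eta> :: "'a::euclidean_space \<Rightarrow> real" and \<gamma> :: "'a \<Rightarrow> 'a" and M R :: real
  assumes Cc: "Cc_infinity \<eta>" and \<eta>_nonneg: "\<And>z. 0 \<le> \<eta> z" and \<eta>_integral: "(\<integral>z. \<eta> z \<partial>lborel) = 1"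
    and \<gamma>: "\<And>z v. frechet_derivative \<eta> (at z) v = \<gamma> z \<bullet> v"
    and \<eta>_le: "\<And>z. \<eta> z \<le> M" and \<gamma>_le: "\<And>z. norm (\<gamma> z) \<le> M"
    and \<eta>_supp: "\<And>z. R < norm z \<Longrightarrow> \<eta> z = 0" and \<gamma>_supp: "\<And>z. R < norm z \<Longrightarrow> \<gamma> z = 0"
    and M_pos: "0 < M" and R_pos: "0 < R"
begin

lemma \<eta>_measurable [measurable]: "\<eta> \<in> borel_measurable borel"
  by (rule smooth_measurable[OF Cc_infinity_smooth[OF Cc]])

lemma \<gamma>_measurable [measurable]: "\<gamma> \<in> borel_measurable borel"
  by (rule borel_measurable_euclidean_space[THEN iffD2])
     (simp flip: \<gamma> add: smooth_measurable_derivative[OF Cc_infinity_smooth[OF Cc]])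

lemma \<eta>_abs_le: "\<bar>\<eta> z\<bar> \<le> M"
  using \<eta>_nonneg \<eta>_le by simp

lemma L1_loc_const: "L1_loc (\<lambda>x::'b::euclidean_space. c::'c::euclidean_space)"
  by (auto simp: L1_loc_def integrable_indicator_iff emeasure_lborel_cball_finite[simplified]
      intro!: integrable_scaleR_left)

lemma \<eta>_mult_integrable:
  assumes [measurable]: "b \<in> borel_measurable borel" and "\<And>z. \<bar>b z\<bar> \<le> C"
  shows "integrable lborel (\<lambda>z. b z * \<eta> z)"
proof (rule L1_loc_mult_real[OF _ \<eta>_measurable \<eta>_abs_le \<eta>_supp])
  have "\<bar>b z\<bar> \<le> \<bar>C\<bar>" for z using assms(2)[of z] by linarith
  then show "L1_loc b" by (intro L1_loc_bound[OF L1_loc_const[of C]]) simp_all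
qed

lemma \<eta>_integrable: "integrable lborel \<eta>"
  using \<eta>_mult_integrable[of "\<lambda>_. 1" 1] by simp

lemma \<gamma>_inner_integrable: "integrable lborel (\<lambda>z. \<gamma> z \<bullet> v)"
  by (rule L1_loc_inner_mult[OF L1_loc_const \<gamma>_measurable \<gamma>_le \<gamma>_supp])

text \<open>One of the two cancellations behind the commutator form of the flux: a velocity that is
  constant in z contributes nothing when the density factor is constant as well.\<close>

lemma \<gamma>_integral: "(\<integral>z. \<gamma> z \<bullet> v \<partial>lborel) = 0"
  using integral_frechet_derivative_eq_0[OF Cc, of v] by (simp add: \<gamma>)

lemma Cc_infinity_rescaled:
  assumes "\<epsilon> > 0"
  shows "Cc_infinity (\<lambda>y. \<eta> ((1 / \<epsilon>) *\<^sub>R (y - x)))"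
    and "frechet_derivative (\<lambda>y. \<eta> ((1 / \<epsilon>) *\<^sub>R (y - x))) (at y) v = (1 / \<epsilon>) * (\<gamma> ((1 / \<epsilon>) *\<^sub>R (y - x)) \<bullet> v)"
proof -
  have eq: "(1 / \<epsilon>) *\<^sub>R (y - x) = - ((1 / \<epsilon>) *\<^sub>R x) + (1 / \<epsilon>) *\<^sub>R y" for y
    by (simp add: scaleR_diff_right)
  show "Cc_infinity (\<lambda>y. \<eta> ((1 / \<epsilon>) *\<^sub>R (y - x)))"
  proof (rule Cc_infinityI)
    show "smooth (\<lambda>y. \<eta> ((1 / \<epsilon>) *\<^sub>R (y - x)))"
      unfolding eq by (rule smooth_affine[OF Cc_infinity_smooth[OF Cc] bounded_linear_scaleR_right])
    fix y assume "y \<notin> cball x (\<epsilon> * R)"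
    then have "\<not> norm ((1 / \<epsilon>) *\<^sub>R (y - x)) \<le> R"
      unfolding norm_rescale_le[OF assms] by (simp add: dist_norm norm_minus_commute)
    then have "R < norm ((1 / \<epsilon>) *\<^sub>R (y - x))" by (simp only: not_le)
    then show "\<eta> ((1 / \<epsilon>) *\<^sub>R (y - x)) = 0" by (rule \<eta>_supp)
  qed simp
  have "((\<lambda>y. (1 / \<epsilon>) *\<^sub>R (y - x)) has_derivative (\<lambda>v. (1 / \<epsilon>) *\<^sub>R v)) (at y)"
    by (auto intro!: derivative_eq_intros)
  from frechet_derivative_at[OF has_derivative_compose[OF this smooth_has_derivative[OF Cc_infinity_smooth[OF Cc]]]]
  show "frechet_derivative (\<lambda>y. \<eta> ((1 / \<epsilon>) *\<^sub>R (y - x))) (at y) v = (1 / \<epsilon>) * (\<gamma> ((1 / \<epsilon>) *\<^sub>R (y - x)) \<bullet> v)"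
    by (simp add: fun_eq_iff \<gamma>)
qed

end

lemma mollifier_exists: "\<exists>(\<eta> :: 'a::euclidean_space \<Rightarrow> real) \<gamma> M R. mollifier \<eta> \<gamma> M R"
proof -
  \<comment> \<open>With steepness 4 on the unit cube the plateau covers the middle cube with
    coordinates between 1/4 and 3/4, which makes the integral positive.\<close>
  define b where "b = box_bump (0::'a) One 4"
  have Cc: "Cc_infinity b" unfolding b_def by (rule Cc_infinity_box_bump) simp
  note sm = Cc_infinity_smooth[OF Cc]
  note [measurable] = smooth_measurable[OF sm]
  obtain R where R: "R > 0" "\<And>x. R < norm x \<Longrightarrow> b x = 0"
    "\<And>x v. R < norm x \<Longrightarrow> frechet_derivative b (at x) v = 0"
    using Cc_infinity_support[OF Cc] by blast
  obtain M where M: "M > 0" "\<And>x. norm (b x) \<le> M" "\<And>x v. norm (frechet_derivative b (at x) v) \<le> M * norm v"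
    using Cc_infinity_bounded[OF Cc] by blast
  have int: "integrable lborel b"
  proof -
    have "L1_loc (\<lambda>x::'a. 1::real)"
      by (simp add: L1_loc_def integrable_indicator_iff emeasure_lborel_cball_finite[simplified])
    from L1_loc_mult_real[OF this, of b M R] show ?thesis using M R by simp
  qed
  define I where "I = (\<integral>x. b x \<partial>lborel)"
  define Q where "Q = box ((1/4) *\<^sub>R One) ((3/4) *\<^sub>R One :: 'a)"
  have "0 < measure lborel Q"
    unfolding Q_def by (subst measure_lborel_box_eq) (auto simp: inner_diff_left intro!: prod_pos)
  also have "measure lborel Q = (\<integral>x. indicator Q x \<partial>lborel)" by simp
  also have "\<dots> \<le> I"
    unfolding I_def
  proof (rule integral_mono[OF _ int])
    show "integrable lborel (indicat_real Q)"
      by (rule integrable_real_indicator) (simp_all add: Q_def emeasure_lborel_box_finite[simplified])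
    fix x
    have "b x = 1" if "x \<in> Q"
      unfolding b_def
    proof (rule box_bump_eq_1)
      fix i :: 'a assume "i \<in> Basis"
      then have "1/4 < x \<bullet> i" "x \<bullet> i < 3/4" using that by (auto simp: Q_def mem_box)
      then show "1 \<le> 4 * (x \<bullet> i - 0 \<bullet> i) \<and> 1 \<le> 4 * (One \<bullet> i - x \<bullet> i)" using \<open>i \<in> Basis\<close> by simp
    qed
    then show "indicat_real Q x \<le> b x"
      using box_bump_bounds(1)[of 0 One 4 x] by (simp add: b_def split: split_indicator)
  qed
  finally have I: "0 < I" .
  define \<eta> where "\<eta> x = inverse I * b x" for x
  define \<gamma> where "\<gamma> x = (\<Sum>i\<in>Basis. frechet_derivative \<eta> (at x) i *\<^sub>R i)" for x
  have sm\<eta>: "smooth \<eta>" unfolding \<eta>_def[abs_def] by (intro smooth_mult smooth_const sm)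
  have Cc\<eta>: "Cc_infinity \<eta>"
    by (rule Cc_infinityI[OF sm\<eta>, of "cball 0 R"]) (auto simp: \<eta>_def R(2))
  have \<gamma>_eq: "frechet_derivative \<eta> (at z) v = \<gamma> z \<bullet> v" for z v
  proof -
    have lin: "linear (frechet_derivative \<eta> (at z))"
      by (rule has_derivative_linear[OF smooth_has_derivative[OF sm\<eta>]])
    have "frechet_derivative \<eta> (at z) (\<Sum>i\<in>Basis. (v \<bullet> i) *\<^sub>R i) = (\<Sum>i\<in>Basis. (v \<bullet> i) * frechet_derivative \<eta> (at z) i)"
      by (simp add: linear_sum[OF lin] linear_scale[OF lin])
    also have "\<dots> = \<gamma> z \<bullet> v"
      unfolding \<gamma>_def inner_sum_left by (intro sum.cong refl) (simp add: inner_commute mult.commute)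
    finally show ?thesis by (simp only: euclidean_representation)
  qed
  obtain R' where R': "R' > 0" "\<And>x. R' < norm x \<Longrightarrow> \<eta> x = 0"
    "\<And>x v. R' < norm x \<Longrightarrow> frechet_derivative \<eta> (at x) v = 0"
    using Cc_infinity_support[OF Cc\<eta>] by blast
  obtain M' where M': "M' > 0" "\<And>x. norm (\<eta> x) \<le> M'" "\<And>x v. norm (frechet_derivative \<eta> (at x) v) \<le> M' * norm v"
    using Cc_infinity_bounded[OF Cc\<eta>] by blast
  have "mollifier \<eta> \<gamma> M' R'"
  proof
    show "0 \<le> \<eta> z" for z using I box_bump_bounds(1)[of 0 One 4 z] by (simp add: \<eta>_def b_def)
    show "(\<integral>z. \<eta> z \<partial>lborel) = 1" using I by (simp add: \<eta>_def I_def)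
    show "\<eta> z \<le> M'" for z using M'(2)[of z] by simp
    show "norm (\<gamma> z) \<le> M'" for z
    proof (cases "\<gamma> z = 0")
      case False
      \<comment> \<open>The derivative in the direction of the gradient itself is the square of its
        norm.\<close>
      have "norm (\<gamma> z) * norm (\<gamma> z) \<le> M' * norm (\<gamma> z)"
        using M'(3)[of z "\<gamma> z"] by (simp add: \<gamma>_eq dot_square_norm power2_eq_square)
      then show ?thesis using False by simp
    qed (use M'(1) in simp)
    show "\<gamma> z = 0" if "R' < norm z" for z using R'(3)[OF that] by (simp add: \<gamma>_def)
  qed (use Cc\<eta> \<gamma>_eq R' M' in auto)
  then show ?thesis by blast
qed

text \<open>Testing with products suffices: the mollified equation only sees such test functions.\<close>

definition transported :: "(real \<times> 'a::euclidean_space \<Rightarrow> 'a) \<Rightarrow> (real \<times> 'a \<Rightarrow> real) \<Rightarrow> bool" where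
  "transported u a \<longleftrightarrow> (\<forall>\<theta> \<psi>. Cc_infinity \<theta> \<longrightarrow> Cc_infinity \<psi> \<longrightarrow>
     (\<integral>p. a p * (frechet_derivative \<theta> (at (fst p)) 1 * \<psi> (snd p)
        + \<theta> (fst p) * frechet_derivative \<psi> (at (snd p)) (u p)) \<partial>lborel) = 0)"

locale mollified_flow = mollifier \<eta> \<gamma> M R
  for \<eta> :: "'a::euclidean_space \<Rightarrow> real" and \<gamma> M R +
  fixes u :: "real \<times> 'a \<Rightarrow> 'a"
  assumes u: "L1_loc u" and u0: "\<And>t x. t \<le> 0 \<Longrightarrow> u (t, x) = 0"
begin

text \<open>Mollification at scale \<epsilon> in the variable z = (y - x)/\<epsilon>, that is,
  convolution with the reflected kernel. The scale enters only through the argument of a.\<close>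

definition sm :: "(real \<times> 'a \<Rightarrow> real) \<Rightarrow> real \<Rightarrow> real \<Rightarrow> 'a \<Rightarrow> real" where
  "sm a \<epsilon> t x = (\<integral>z. a (t, x + \<epsilon> *\<^sub>R z) * \<eta> z \<partial>lborel)"

text \<open>The mollified -div(a u), the derivative being placed on the kernel. It is the time
  derivative of \<open>sm a \<epsilon>\<close> when a is transported by u.\<close>

definition fl :: "(real \<times> 'a \<Rightarrow> real) \<Rightarrow> real \<Rightarrow> real \<Rightarrow> 'a \<Rightarrow> real" where
  "fl a \<epsilon> t x = (1 / \<epsilon>) * (\<integral>z. a (t, x + \<epsilon> *\<^sub>R z) * (\<gamma> z \<bullet> u (t, x + \<epsilon> *\<^sub>R z)) \<partial>lborel)"

lemma u_measurable [measurable]: "u \<in> borel_measurable borel"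
  by (rule L1_loc_measurable[OF u])

context
  fixes a :: "real \<times> 'a \<Rightarrow> real" and C :: real
  assumes a_meas [measurable]: "a \<in> borel_measurable borel" and a_le: "\<And>p. \<bar>a p\<bar> \<le> C"
begin

lemma C_nonneg: "0 \<le> C"
  using a_le[of undefined] abs_ge_zero[of "a undefined"] by linarith

lemma sm_measurable [measurable]:
  "(\<lambda>p. sm a \<epsilon> (fst p) (snd p)) \<in> borel_measurable borel"
  unfolding sm_def by (intro lborel.borel_measurable_lebesgue_integral) measurable

lemma sm_measurable_time [measurable]: "(\<lambda>t. sm a \<epsilon> t x) \<in> borel_measurable borel"
  unfolding sm_def by (intro lborel.borel_measurable_lebesgue_integral) measurable

lemma fl_measurable [measurable]:
  "(\<lambda>p. fl a \<epsilon> (fst p) (snd p)) \<in> borel_measurable borel"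
  unfolding fl_def
  by (intro borel_measurable_times borel_measurable_const lborel.borel_measurable_lebesgue_integral) measurable

lemma fl_measurable_time [measurable]: "(\<lambda>t. fl a \<epsilon> t x) \<in> borel_measurable borel"
  unfolding fl_def
  by (intro borel_measurable_times borel_measurable_const lborel.borel_measurable_lebesgue_integral) measurable

lemma sm_integrand_integrable: "integrable lborel (\<lambda>z. a (t, x + \<epsilon> *\<^sub>R z) * \<eta> z)"
  by (rule \<eta>_mult_integrable[of _ C]) (auto intro: a_le)

lemma sm_between:
  assumes "\<And>y. lo \<le> a (t, y)" "\<And>y. a (t, y) \<le> hi"
  shows "lo \<le> sm a \<epsilon> t x" "sm a \<epsilon> t x \<le> hi"
proof -
  have "(\<integral>z. lo * \<eta> z \<partial>lborel) \<le> sm a \<epsilon> t x"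
    unfolding sm_def
    by (intro integral_mono sm_integrand_integrable integrable_mult_right \<eta>_integrable mult_right_mono assms \<eta>_nonneg)
  then show "lo \<le> sm a \<epsilon> t x" by (simp add: \<eta>_integral)
  have "sm a \<epsilon> t x \<le> (\<integral>z. hi * \<eta> z \<partial>lborel)"
    unfolding sm_def
    by (intro integral_mono sm_integrand_integrable integrable_mult_right \<eta>_integrable mult_right_mono assms \<eta>_nonneg)
  then show "sm a \<epsilon> t x \<le> hi" by (simp add: \<eta>_integral)
qed

lemma sm_abs_le: "\<bar>sm a \<epsilon> t x\<bar> \<le> C"
proof -
  have "- C \<le> a p \<and> a p \<le> C" for p using a_le[of p] by linarith
  then show ?thesis using sm_between[of "- C" t C \<epsilon> x] by auto
qed

lemma fl_zero: "t \<le> 0 \<Longrightarrow> fl a \<epsilon> t x = 0"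
  by (simp add: fl_def u0)

lemma fl_integrand_integrable:
  assumes "L1_loc (\<lambda>y. u (t, y))" "\<epsilon> > 0"
  shows "integrable lborel (\<lambda>z. a (t, x + \<epsilon> *\<^sub>R z) * (\<gamma> z \<bullet> u (t, x + \<epsilon> *\<^sub>R z)))"
proof -
  have "integrable lborel (\<lambda>z. (a (t, x + \<epsilon> *\<^sub>R z) *\<^sub>R \<gamma> z) \<bullet> u (t, x + \<epsilon> *\<^sub>R z))"
    by (rule L1_loc_inner_mult[OF L1_loc_scale[OF assms], of _ "C * M" R])
       (auto simp: \<gamma>_supp intro!: mult_mono a_le \<gamma>_le C_nonneg)
  then show ?thesis by simp
qed

text \<open>In extended nonnegative reals the bound holds for every t and x, including slices on
  which the flux integral has its default value 0.\<close>

lemma nn_integral_fl_bound: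
  assumes "\<epsilon> > 0"
  shows "ennreal \<bar>fl a \<epsilon> t x\<bar> \<le> ennreal (C * M / \<epsilon>) * (\<integral>\<^sup>+z. indicator (cball 0 R) z * ennreal (norm (u (t, x + \<epsilon> *\<^sub>R z))) \<partial>lborel)"
proof -
  let ?J = "\<integral>z. a (t, x + \<epsilon> *\<^sub>R z) * (\<gamma> z \<bullet> u (t, x + \<epsilon> *\<^sub>R z)) \<partial>lborel"
  have "ennreal \<bar>fl a \<epsilon> t x\<bar> = ennreal (1 / \<epsilon>) * ennreal (norm ?J)"
    using assms by (simp add: fl_def abs_mult ennreal_mult[symmetric] del: divide_ennreal_def)
  also have "ennreal (norm ?J) \<le> (\<integral>\<^sup>+z. ennreal (norm (a (t, x + \<epsilon> *\<^sub>R z) * (\<gamma> z \<bullet> u (t, x + \<epsilon> *\<^sub>R z)))) \<partial>lborel)"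
    by (rule norm_integral_le_nn_integral)
  also have "\<dots> \<le> (\<integral>\<^sup>+z. ennreal (C * M) * (indicator (cball 0 R) z * ennreal (norm (u (t, x + \<epsilon> *\<^sub>R z)))) \<partial>lborel)"
  proof (rule nn_integral_mono)
    fix z
    show "ennreal (norm (a (t, x + \<epsilon> *\<^sub>R z) * (\<gamma> z \<bullet> u (t, x + \<epsilon> *\<^sub>R z))))
      \<le> ennreal (C * M) * (indicator (cball 0 R) z * ennreal (norm (u (t, x + \<epsilon> *\<^sub>R z))))"
    proof (cases "R < norm z")
      case False
      have "\<bar>\<gamma> z \<bullet> u (t, x + \<epsilon> *\<^sub>R z)\<bar> \<le> M * norm (u (t, x + \<epsilon> *\<^sub>R z))"
        by (rule order_trans[OF Cauchy_Schwarz_ineq2]) (intro mult_right_mono \<gamma>_le norm_ge_zero)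
      then have "\<bar>a (t, x + \<epsilon> *\<^sub>R z)\<bar> * \<bar>\<gamma> z \<bullet> u (t, x + \<epsilon> *\<^sub>R z)\<bar> \<le> C * (M * norm (u (t, x + \<epsilon> *\<^sub>R z)))"
        by (intro mult_mono a_le C_nonneg) auto
      then show ?thesis
        using False C_nonneg M_pos by (simp add: abs_mult ennreal_mult[symmetric] mult.assoc ennreal_leI)
    qed (simp add: \<gamma>_supp)
  qed
  also have "\<dots> = ennreal (C * M) * (\<integral>\<^sup>+z. indicator (cball 0 R) z * ennreal (norm (u (t, x + \<epsilon> *\<^sub>R z))) \<partial>lborel)"
    by (rule nn_integral_cmult) measurable
  finally have "ennreal \<bar>fl a \<epsilon> t x\<bar> \<le> ennreal (1 / \<epsilon>) * (ennreal (C * M) * (\<integral>\<^sup>+z. indicator (cball 0 R) z * ennreal (norm (u (t, x + \<epsilon> *\<^sub>R z))) \<partial>lborel))"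
    by (simp add: mult_left_mono)
  also have "\<dots> = ennreal (C * M / \<epsilon>) * (\<integral>\<^sup>+z. indicator (cball 0 R) z * ennreal (norm (u (t, x + \<epsilon> *\<^sub>R z))) \<partial>lborel)"
    using assms C_nonneg M_pos by (simp add: mult.assoc[symmetric] ennreal_mult[symmetric] mult.commute)
  finally show ?thesis .
qed

text \<open>Holds for every single x: the average over z turns the integral over a time interval
  into an integral of the norm of u over a bounded region of space-time.\<close>

lemma L1_loc_fl_time:
  assumes "\<epsilon> > 0"
  shows "L1_loc (\<lambda>t. fl a \<epsilon> t x)"
  unfolding L1_loc_def
proof safe
  fix S :: real
  let ?N = "\<lambda>t. \<integral>\<^sup>+z. indicator (cball 0 R) z * ennreal (norm (u (t, x + \<epsilon> *\<^sub>R z))) \<partial>lborel"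
  \<comment> \<open>A ball containing (t, x + \<epsilon> z) for all times in question and all z in
    the ball of radius R.\<close>
  define B where "B = \<bar>S\<bar> + norm x + \<epsilon> * R"
  have "(\<integral>\<^sup>+t. ennreal (norm (indicat_real (cball 0 S) t *\<^sub>R fl a \<epsilon> t x)) \<partial>lborel)
      \<le> (\<integral>\<^sup>+t. ennreal (C * M / \<epsilon>) * (indicator (cball 0 S) t * ?N t) \<partial>lborel)"
    using nn_integral_fl_bound[OF assms] by (intro nn_integral_mono) (simp split: split_indicator)
  also have "\<dots> = ennreal (C * M / \<epsilon>) * (\<integral>\<^sup>+t. \<integral>\<^sup>+z. indicator (cball 0 S) t * (indicator (cball 0 R) z * ennreal (norm (u (t, x + \<epsilon> *\<^sub>R z)))) \<partial>lborel \<partial>lborel)"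
    by (simp add: nn_integral_cmult)
  also have "(\<integral>\<^sup>+t. \<integral>\<^sup>+z. indicator (cball 0 S) t * (indicator (cball 0 R) z * ennreal (norm (u (t, x + \<epsilon> *\<^sub>R z)))) \<partial>lborel \<partial>lborel)
      \<le> (\<integral>\<^sup>+t. \<integral>\<^sup>+z. ennreal (norm (indicat_real (cball 0 B) (t, x + \<epsilon> *\<^sub>R z) *\<^sub>R u (t, x + \<epsilon> *\<^sub>R z))) \<partial>lborel \<partial>lborel)"
  proof (intro nn_integral_mono)
    fix t :: real and z
    have "norm (t, x + \<epsilon> *\<^sub>R z) \<le> B" if "norm t \<le> S" "norm z \<le> R"
    proof -
      have "norm (\<epsilon> *\<^sub>R z) \<le> \<epsilon> * R" using that assms by simp
      then show ?thesis
        using norm_Pair_le[of t "x + \<epsilon> *\<^sub>R z"] norm_triangle_ineq[of x "\<epsilon> *\<^sub>R z"] that unfolding B_def by simp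
    qed
    then show "indicator (cball 0 S) t * (indicator (cball 0 R) z * ennreal (norm (u (t, x + \<epsilon> *\<^sub>R z))))
       \<le> ennreal (norm (indicat_real (cball 0 B) (t, x + \<epsilon> *\<^sub>R z) *\<^sub>R u (t, x + \<epsilon> *\<^sub>R z)))"
      by (cases "norm t \<le> S \<and> norm z \<le> R") auto
  qed
  also have "\<dots> = (\<integral>\<^sup>+t. ennreal (inverse (\<epsilon> ^ DIM('a))) * (\<integral>\<^sup>+y. ennreal (norm (indicat_real (cball 0 B) (t, y) *\<^sub>R u (t, y))) \<partial>lborel) \<partial>lborel)"
  proof (rule nn_integral_cong)
    fix t :: real
    show "(\<integral>\<^sup>+z. ennreal (norm (indicat_real (cball 0 B) (t, x + \<epsilon> *\<^sub>R z) *\<^sub>R u (t, x + \<epsilon> *\<^sub>R z))) \<partial>lborel)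
       = ennreal (inverse (\<epsilon> ^ DIM('a))) * (\<integral>\<^sup>+y. ennreal (norm (indicat_real (cball 0 B) (t, y) *\<^sub>R u (t, y))) \<partial>lborel)"
      using assms
      by (subst (2) nn_integral_lborel_scale[where a = x and c = \<epsilon>])
         (simp_all add: mult.assoc[symmetric] ennreal_mult[symmetric])
  qed
  also have "\<dots> = ennreal (inverse (\<epsilon> ^ DIM('a))) * (\<integral>\<^sup>+p. ennreal (norm (indicat_real (cball 0 B) p *\<^sub>R u p)) \<partial>(lborel \<Otimes>\<^sub>M lborel))"
  proof -
    have "(\<lambda>p. ennreal (norm (indicat_real (cball 0 B) p *\<^sub>R u p))) \<in> borel_measurable (lborel \<Otimes>\<^sub>M lborel)"
      unfolding lborel_prod by measurable
    from lborel.nn_integral_fst[OF this] show ?thesis by (subst nn_integral_cmult) auto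
  qed
  also have "ennreal (C * M / \<epsilon>) * \<dots> < \<infinity>"
    using L1_loc_integrable[OF u, of B]
    by (auto simp: integrable_iff_bounded lborel_prod ennreal_mult_less_top)
  finally show "integrable lborel (\<lambda>t. indicat_real (cball 0 S) t *\<^sub>R fl a \<epsilon> t x)"
    by (auto simp: integrable_iff_bounded mult_left_mono)
qed measurable

lemma L1_loc_sm_time: "L1_loc (\<lambda>t. sm a \<epsilon> t x)"
  by (rule L1_loc_bound[OF L1_loc_const[of C]]) (use sm_abs_le C_nonneg in auto)

text \<open>The equation is tested with \<theta>(t) times the kernel centred at x. Rescaling to z
  produces the factor \<epsilon>^d in both terms, and it cancels.\<close>

lemma transported_weak:
  assumes tr: "transported u a" and "\<epsilon> > 0" and \<theta>: "Cc_infinity \<theta>"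
  shows "(\<integral>t. sm a \<epsilon> t x * frechet_derivative \<theta> (at t) 1 \<partial>lborel) = - (\<integral>t. fl a \<epsilon> t x * \<theta> t \<partial>lborel)"
proof -
  let ?s = "\<lambda>y. (1 / \<epsilon>) *\<^sub>R (y - x)"
  let ?\<theta>' = "\<lambda>t. frechet_derivative \<theta> (at t) 1"
  note sm\<theta> = Cc_infinity_smooth[OF \<theta>]
  note [measurable] = smooth_measurable[OF sm\<theta>] smooth_measurable_derivative[OF sm\<theta>]
  obtain S where S: "S > 0" "\<And>x. S < norm x \<Longrightarrow> \<theta> x = 0"
    "\<And>x v. S < norm x \<Longrightarrow> frechet_derivative \<theta> (at x) v = 0"
    using Cc_infinity_support[OF \<theta>] by blast
  obtain K where K: "K > 0" "\<And>x. norm (\<theta> x) \<le> K" "\<And>x v. norm (frechet_derivative \<theta> (at x) v) \<le> K * norm v"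
    using Cc_infinity_bounded[OF \<theta>] by blast
  have K': "\<bar>?\<theta>' t\<bar> \<le> K" for t using K(3)[of t 1] by simp
  define B where "B = S + norm x + \<epsilon> * R"
  have out: "S < norm (fst p) \<or> R < norm (?s (snd p))" if "B < norm p" for p
  proof (rule ccontr)
    assume "\<not> ?thesis"
    then have *: "norm (fst p) \<le> S" "norm (?s (snd p)) \<le> R" by auto
    then have "norm (snd p - x) \<le> \<epsilon> * R" unfolding norm_rescale_le[OF \<open>\<epsilon> > 0\<close>] by simp
    then have "norm (snd p) \<le> norm x + \<epsilon> * R" using norm_triangle_ineq2[of "snd p" x] by linarith
    then show False using that * norm_Pair_le[of "fst p" "snd p"] by (simp add: B_def)
  qed
  have i1: "integrable (lborel \<Otimes>\<^sub>M lborel) (\<lambda>p. a p * (?\<theta>' (fst p) * \<eta> (?s (snd p))))"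
    unfolding lborel_prod
  proof (rule L1_loc_mult_real[of a _ "K * M" B])
    show "L1_loc a" by (rule L1_loc_bound[OF L1_loc_const[of C]]) (use a_le C_nonneg in auto)
    show "\<bar>?\<theta>' (fst p) * \<eta> (?s (snd p))\<bar> \<le> K * M" for p
      unfolding abs_mult using K(1) by (intro mult_mono K' \<eta>_abs_le) auto
    show "?\<theta>' (fst p) * \<eta> (?s (snd p)) = 0" if "B < norm p" for p
      using out[OF that] S(3) \<eta>_supp by auto
  qed measurable
  have i2: "integrable (lborel \<Otimes>\<^sub>M lborel) (\<lambda>p. a p * (\<theta> (fst p) * ((1 / \<epsilon>) * (\<gamma> (?s (snd p)) \<bullet> u p))))"
  proof -
    have "integrable lborel (\<lambda>p. ((a p * \<theta> (fst p) * (1 / \<epsilon>)) *\<^sub>R \<gamma> (?s (snd p))) \<bullet> u p)"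
    proof (rule L1_loc_inner_mult[OF u, of _ "C * K * (1 / \<epsilon>) * M" B])
      show "norm ((a p * \<theta> (fst p) * (1 / \<epsilon>)) *\<^sub>R \<gamma> (?s (snd p))) \<le> C * K * (1 / \<epsilon>) * M" for p
        unfolding norm_scaleR abs_mult using K(1) K(2)[of "fst p"] \<open>\<epsilon> > 0\<close> C_nonneg
        by (intro mult_mono \<gamma>_le a_le) auto
      show "(a p * \<theta> (fst p) * (1 / \<epsilon>)) *\<^sub>R \<gamma> (?s (snd p)) = 0" if "B < norm p" for p
        using out[OF that] S(2) \<gamma>_supp by auto
    qed measurable
    then show ?thesis by (simp add: lborel_prod mult.assoc)
  qed
  have sc1: "(\<integral>y. a (t, y) * (?\<theta>' t * \<eta> (?s y)) \<partial>lborel) = \<epsilon> ^ DIM('a) * (sm a \<epsilon> t x * ?\<theta>' t)" for t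
  proof -
    have "(\<integral>y. a (t, y) * (?\<theta>' t * \<eta> (?s y)) \<partial>lborel) = \<epsilon> ^ DIM('a) *\<^sub>R (\<integral>z. a (t, x + \<epsilon> *\<^sub>R z) * (?\<theta>' t * \<eta> (?s (x + \<epsilon> *\<^sub>R z))) \<partial>lborel)"
      by (rule integral_lborel_scale[OF _ \<open>\<epsilon> > 0\<close>]) measurable
    also have "(\<integral>z. a (t, x + \<epsilon> *\<^sub>R z) * (?\<theta>' t * \<eta> (?s (x + \<epsilon> *\<^sub>R z))) \<partial>lborel)
        = (\<integral>z. (a (t, x + \<epsilon> *\<^sub>R z) * \<eta> z) * ?\<theta>' t \<partial>lborel)"
      using \<open>\<epsilon> > 0\<close> by (intro Bochner_Integration.integral_cong) auto
    also have "\<dots> = sm a \<epsilon> t x * ?\<theta>' t" by (simp add: sm_def)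
    finally show ?thesis by simp
  qed
  have sc2: "(\<integral>y. a (t, y) * (\<theta> t * ((1 / \<epsilon>) * (\<gamma> (?s y) \<bullet> u (t, y)))) \<partial>lborel) = \<epsilon> ^ DIM('a) * (fl a \<epsilon> t x * \<theta> t)" for t
  proof -
    have "(\<integral>y. a (t, y) * (\<theta> t * ((1 / \<epsilon>) * (\<gamma> (?s y) \<bullet> u (t, y)))) \<partial>lborel)
        = \<epsilon> ^ DIM('a) *\<^sub>R (\<integral>z. a (t, x + \<epsilon> *\<^sub>R z) * (\<theta> t * ((1 / \<epsilon>) * (\<gamma> (?s (x + \<epsilon> *\<^sub>R z)) \<bullet> u (t, x + \<epsilon> *\<^sub>R z)))) \<partial>lborel)"
      by (rule integral_lborel_scale[OF _ \<open>\<epsilon> > 0\<close>]) measurable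
    also have "(\<integral>z. a (t, x + \<epsilon> *\<^sub>R z) * (\<theta> t * ((1 / \<epsilon>) * (\<gamma> (?s (x + \<epsilon> *\<^sub>R z)) \<bullet> u (t, x + \<epsilon> *\<^sub>R z)))) \<partial>lborel)
        = (\<integral>z. (\<theta> t * (1 / \<epsilon>)) * (a (t, x + \<epsilon> *\<^sub>R z) * (\<gamma> z \<bullet> u (t, x + \<epsilon> *\<^sub>R z))) \<partial>lborel)"
      using \<open>\<epsilon> > 0\<close> by (intro Bochner_Integration.integral_cong) auto
    also have "\<dots> = fl a \<epsilon> t x * \<theta> t" by (simp add: fl_def)
    finally show ?thesis by simp
  qed
  have "0 = (\<integral>p. a p * (?\<theta>' (fst p) * \<eta> (?s (snd p)) + \<theta> (fst p) * ((1 / \<epsilon>) * (\<gamma> (?s (snd p)) \<bullet> u p))) \<partial>(lborel \<Otimes>\<^sub>M lborel))"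
    using tr[unfolded transported_def, rule_format, OF \<theta> Cc_infinity_rescaled(1)[OF \<open>\<epsilon> > 0\<close>, of x]]
    by (simp only: Cc_infinity_rescaled(2)[OF \<open>\<epsilon> > 0\<close>] lborel_prod)
  also have "\<dots> = (\<integral>p. a p * (?\<theta>' (fst p) * \<eta> (?s (snd p))) \<partial>(lborel \<Otimes>\<^sub>M lborel))
      + (\<integral>p. a p * (\<theta> (fst p) * ((1 / \<epsilon>) * (\<gamma> (?s (snd p)) \<bullet> u p))) \<partial>(lborel \<Otimes>\<^sub>M lborel))"
    unfolding distrib_left by (rule Bochner_Integration.integral_add[OF i1 i2])
  also have "\<dots> = \<epsilon> ^ DIM('a) * (\<integral>t. sm a \<epsilon> t x * ?\<theta>' t \<partial>lborel) + \<epsilon> ^ DIM('a) * (\<integral>t. fl a \<epsilon> t x * \<theta> t \<partial>lborel)"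
    by (simp only: lborel_pair.integral_fst'[OF i1, symmetric] lborel_pair.integral_fst'[OF i2, symmetric] fst_conv snd_conv sc1 sc2 integral_mult_right_zero)
  finally have "\<epsilon> ^ DIM('a) * ((\<integral>t. sm a \<epsilon> t x * ?\<theta>' t \<partial>lborel) + (\<integral>t. fl a \<epsilon> t x * \<theta> t \<partial>lborel)) = 0"
    by (simp only: distrib_left)
  then show ?thesis using \<open>\<epsilon> > 0\<close> by simp
qed

text \<open>The increment formula is used with a step of the full length T, starting at t - T. That
  time is negative, so the mollified density still has its initial value there, and the flux is zero
  until time 0. The initial condition is thereby attained without any discussion of traces.\<close>

lemma transported_ode:
  assumes tr: "transported u a" and "\<epsilon> > 0" "T > 0" and past: "\<And>t x. t \<le> 0 \<Longrightarrow> a (t, x) = a (0, x)"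
  shows "AE t in lborel. 0 < t \<and> t < T \<longrightarrow> sm a \<epsilon> t x = sm a \<epsilon> 0 x + (LBINT s:{0..t}. fl a \<epsilon> s x)"
proof -
  have Tfl: "L1_loc (\<lambda>t. T * fl a \<epsilon> t x)"
    using L1_loc_scaleR[OF L1_loc_fl_time[OF \<open>\<epsilon> > 0\<close>], of T] by simp
  have "AE t in lborel. sm a \<epsilon> (t + T) x - sm a \<epsilon> t x = (\<integral>\<theta>. T * fl a \<epsilon> (t + \<theta> *\<^sub>R T) x \<partial>unit_meas)"
  proof (rule weak_derivative_difference_real[OF L1_loc_sm_time Tfl])
    fix \<theta> :: "real \<Rightarrow> real" assume \<theta>: "Cc_infinity \<theta>"
    have "frechet_derivative \<theta> (at t) T = T * frechet_derivative \<theta> (at t) 1" for t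
      using linear_scale[OF has_derivative_linear[OF smooth_has_derivative[OF Cc_infinity_smooth[OF \<theta>]]], of t T 1]
      by simp
    then show "(\<integral>t. sm a \<epsilon> t x * frechet_derivative \<theta> (at t) T \<partial>lborel) = - (\<integral>t. T * fl a \<epsilon> t x * \<theta> t \<partial>lborel)"
      using transported_weak[OF tr \<open>\<epsilon> > 0\<close> \<theta>, of x] by (simp add: mult.left_commute[of _ T] mult.assoc)
  qed
  from AE_lborel_translate[OF this, of "- T"]
  show ?thesis
  proof eventually_elim
    case (elim t)
    show ?case
    proof
      assume t: "0 < t \<and> t < T"
      have "sm a \<epsilon> (t - T) x = sm a \<epsilon> 0 x"
        using past[of "t - T"] t unfolding sm_def by (intro Bochner_Integration.integral_cong) auto
      moreover have "(\<integral>\<theta>. T * fl a \<epsilon> (t + - T + \<theta> *\<^sub>R T) x \<partial>unit_meas) = (LBINT s:{0..t}. fl a \<epsilon> s x)"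
      proof -
        have "(\<integral>\<theta>. T * fl a \<epsilon> (t + - T + \<theta> *\<^sub>R T) x \<partial>unit_meas) = (LBINT \<theta>:{0..1}. T * fl a \<epsilon> (t + - T + \<theta> *\<^sub>R T) x)"
          by (rule integral_unit_meas) measurable
        \<comment> \<open>Substitution s = t - T + T \<theta>; the part with s \<le> 0 drops out
          because the flux vanishes there.\<close>
        also have "\<dots> = \<bar>T\<bar> *\<^sub>R (\<integral>\<theta>. indicator {0..t} ((t - T) + T * \<theta>) *\<^sub>R fl a \<epsilon> ((t - T) + T * \<theta>) x \<partial>lborel)"
          unfolding set_lebesgue_integral_def integral_scaleR_right[symmetric]
        proof (rule Bochner_Integration.integral_cong[OF refl])
          fix \<theta> :: real
          have "T * \<theta> \<le> T \<longleftrightarrow> \<theta> \<le> 1" using \<open>T > 0\<close> by simp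
          moreover have "fl a \<epsilon> ((t - T) + T * \<theta>) x = 0" if "(t - T) + T * \<theta> \<le> 0" using that by (rule fl_zero)
          moreover have "(t - T) + T * \<theta> \<le> 0" if "\<theta> < 0"
            using mult_pos_neg[OF \<open>T > 0\<close> that] t by linarith
          ultimately show "indicat_real {0..1} \<theta> *\<^sub>R (T * fl a \<epsilon> (t + - T + \<theta> *\<^sub>R T) x)
              = \<bar>T\<bar> *\<^sub>R (indicat_real {0..t} ((t - T) + T * \<theta>) *\<^sub>R fl a \<epsilon> ((t - T) + T * \<theta>) x)"
            using \<open>T > 0\<close> t by (auto split: split_indicator simp: mult.commute)
        qed
        also have "\<dots> = (LBINT s:{0..t}. fl a \<epsilon> s x)"
          unfolding set_lebesgue_integral_def
          using lborel_integral_real_affine[of T "\<lambda>s. indicator {0..t} s *\<^sub>R fl a \<epsilon> s x" "t - T"] \<open>T > 0\<close> by simp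
        finally show ?thesis .
      qed
      ultimately show "sm a \<epsilon> t x = sm a \<epsilon> 0 x + (LBINT s:{0..t}. fl a \<epsilon> s x)"
        using elim by simp
    qed
  qed
qed

end

end

text \<open>The equation in time comes with a null set of times for each x; measurability of P in
  both variables combines these into a null set of space-time.\<close>

lemma AE_lborel_prodI:
  fixes P :: "'a::euclidean_space \<times> 'b::euclidean_space \<Rightarrow> bool"
  assumes [measurable]: "Measurable.pred borel P" and AE: "\<And>y. AE x in lborel. P (x, y)"
  shows "AE p in lborel. P p"
proof -
  have sets: "{p \<in> space (lborel \<Otimes>\<^sub>M lborel). P p} \<in> sets (lborel \<Otimes>\<^sub>M lborel)"
    unfolding lborel_prod by simp
  have "AE x in lborel. AE y in lborel. P (x, y)"
    using AE by (subst lborel_pair.AE_commute) (use sets in auto)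
  then have "AE p in (lborel \<Otimes>\<^sub>M lborel). P p"
    by (rule lborel_pair.AE_pair_measure[OF sets])
  then show ?thesis by (simp only: lborel_prod)
qed

lemma nn_integral_lborel_fst:
  fixes f :: "'a::euclidean_space \<times> 'b::euclidean_space \<Rightarrow> ennreal"
  assumes "f \<in> borel_measurable borel"
  shows "(\<integral>\<^sup>+p. f p \<partial>lborel) = (\<integral>\<^sup>+x. \<integral>\<^sup>+y. f (x, y) \<partial>lborel \<partial>lborel)"
  using lborel.nn_integral_fst[of f lborel] assms unfolding lborel_prod by simp

lemma norm_power2_le_twice:
  fixes x y :: "'a::real_normed_vector"
  shows "(norm x)\<^sup>2 \<le> 2 * (norm (y - x))\<^sup>2 + 2 * (norm y)\<^sup>2"
proof -
  have "norm x \<le> norm (y - x) + norm y" using norm_triangle_ineq4[of y "y - x"] by simp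
  then have "(norm x)\<^sup>2 \<le> (norm (y - x) + norm y)\<^sup>2" by (rule power_mono) simp
  also have "\<dots> \<le> 2 * (norm (y - x))\<^sup>2 + 2 * (norm y)\<^sup>2"
    using zero_le_power2[of "norm (y - x) - norm y"] unfolding power2_diff power2_sum by linarith
  finally show ?thesis .
qed

section \<open>The transport setting on the whole of space-time\<close>

definition slab :: "real \<Rightarrow> (real \<times> 'a::euclidean_space) set" where
  "slab T = {0<..<T} \<times> UNIV"

lemma slab_measurable [measurable]: "slab T \<in> sets borel"
  unfolding slab_def by (intro borel_open open_Times) auto

lemma indicator_slab [simp]: "indicator (slab T) (t, x) = indicator {0<..<T} t"
  by (simp add: slab_def indicator_def)

text \<open>\<open>g i\<close> is the weak derivative of u in the spatial direction i. The numbers c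
  and \<open>C\<^sub>0\<close> bound the initial density only, C bounds the density at all times,
  and B bounds the energy at almost every time. All test functions range over the whole of
  space-time, so no boundary term at t = 0 occurs.\<close>

locale transport = mollified_flow \<eta> \<gamma> M R u
  for \<eta> :: "'a::euclidean_space \<Rightarrow> real" and \<gamma> M R and u :: "real \<times> 'a \<Rightarrow> 'a" +
  fixes r :: "real \<times> 'a \<Rightarrow> real" and g :: "'a \<Rightarrow> real \<times> 'a \<Rightarrow> 'a" and c C\<^sub>0 C B :: real
  assumes r_measurable [measurable]: "r \<in> borel_measurable borel"
    and r_nonneg: "\<And>p. 0 \<le> r p" and r_le: "\<And>p. r p \<le> C"
    and r_past: "\<And>t x. t \<le> 0 \<Longrightarrow> r (t, x) = r (0, x)"
    and r_initial: "\<And>x. c \<le> r (0, x)" "\<And>x. r (0, x) \<le> C\<^sub>0" and c_pos: "0 < c"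
    and r_transported: "transported u r"
    and g_measurable [measurable]: "\<And>i. i \<in> Basis \<Longrightarrow> g i \<in> borel_measurable borel"
    and g_L2: "\<And>i. i \<in> Basis \<Longrightarrow> integrable lborel (\<lambda>p. (norm (g i p))\<^sup>2)"
    and weak_gradient: "\<And>\<phi> i j. Cc_infinity \<phi> \<Longrightarrow> i \<in> Basis \<Longrightarrow> j \<in> Basis \<Longrightarrow>
      (\<integral>p. (u p \<bullet> j) * frechet_derivative \<phi> (at p) (0, i) \<partial>lborel) = - (\<integral>p. (g i p \<bullet> j) * \<phi> p \<partial>lborel)"
    and incompressible: "\<And>\<phi> :: real \<times> 'a \<Rightarrow> real. Cc_infinity \<phi> \<Longrightarrow> (\<integral>p. frechet_derivative \<phi> (at p) (0::real, u p) \<partial>lborel) = 0"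
    and energy: "AE t in lborel. (\<integral>\<^sup>+x. ennreal (r (t, x) * (norm (u (t, x)))\<^sup>2) \<partial>lborel) \<le> ennreal B"
    and B_nonneg: "0 \<le> B"
begin

lemma r_abs_le: "\<bar>r p\<bar> \<le> C"
  using r_nonneg[of p] r_le[of p] by simp

lemma C_pos: "0 < C"
  using r_initial(1)[of 0] r_le[of "(0, 0)"] c_pos by linarith

lemmas r_sm_measurable [measurable] = sm_measurable[OF r_measurable r_abs_le]
lemmas r_sm_measurable_time [measurable] = sm_measurable_time[OF r_measurable r_abs_le]
lemmas r_fl_measurable [measurable] = fl_measurable[OF r_measurable r_abs_le]
lemmas r_fl_measurable_time [measurable] = fl_measurable_time[OF r_measurable r_abs_le]

lemma g_L1_loc: "i \<in> Basis \<Longrightarrow> L1_loc (g i)"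
  by (rule L1_locI_L2[OF g_measurable g_L2])

lemma frechet_derivative_space:
  fixes \<phi> :: "real \<times> 'a \<Rightarrow> real"
  assumes "smooth \<phi>"
  shows "frechet_derivative \<phi> (at p) (0, v) = (\<Sum>i\<in>Basis. (v \<bullet> i) *\<^sub>R frechet_derivative \<phi> (at p) (0, i))"
proof -
  have lin: "linear (frechet_derivative \<phi> (at p))"
    by (rule has_derivative_linear[OF smooth_has_derivative[OF assms]])
  have "(0::real, v) = (\<Sum>i\<in>Basis. (v \<bullet> i) *\<^sub>R (0, i))"
    by (simp add: prod_eq_iff fst_sum snd_sum euclidean_representation)
  then have "frechet_derivative \<phi> (at p) (0, v) = frechet_derivative \<phi> (at p) (\<Sum>i\<in>Basis. (v \<bullet> i) *\<^sub>R (0, i))"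
    by (simp only:)
  then show ?thesis by (simp only: linear_sum[OF lin] linear_scale[OF lin])
qed

text \<open>Passes from the distributional form of incompressibility to a pointwise one, through the
  weak gradient and the fundamental lemma.\<close>

lemma divergence_free: "AE p in lborel. (\<Sum>i\<in>Basis. g i p \<bullet> i) = 0"
proof (rule fundamental_lemma)
  show "L1_loc (\<lambda>p. \<Sum>i\<in>Basis. g i p \<bullet> i)"
    by (intro L1_loc_sum L1_loc_inner g_L1_loc) simp_all
  fix \<phi> :: "real \<times> 'a \<Rightarrow> real" assume \<phi>: "Cc_infinity \<phi>"
  note sm = Cc_infinity_smooth[OF \<phi>]
  note [measurable] = smooth_measurable[OF sm] smooth_measurable_derivative[OF sm]
  obtain S where S: "S > 0" "\<And>x. S < norm x \<Longrightarrow> \<phi> x = 0"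
    "\<And>x v. S < norm x \<Longrightarrow> frechet_derivative \<phi> (at x) v = 0"
    using Cc_infinity_support[OF \<phi>] by blast
  obtain K where K: "K > 0" "\<And>x. norm (\<phi> x) \<le> K" "\<And>x v. norm (frechet_derivative \<phi> (at x) v) \<le> K * norm v"
    using Cc_infinity_bounded[OF \<phi>] by blast
  have ig: "integrable lborel (\<lambda>p. (g i p \<bullet> i) * \<phi> p)" if "i \<in> Basis" for i
    by (rule L1_loc_mult_real[OF L1_loc_inner[OF g_L1_loc[OF that]], of _ K S]) (use S K in auto)
  have iu: "integrable lborel (\<lambda>p. (u p \<bullet> i) * frechet_derivative \<phi> (at p) (0, i))" if "i \<in> Basis" for i
    by (rule L1_loc_mult_real[OF L1_loc_inner[OF u], of _ "K * norm (0::real, i)" S]) (use S K(3)[of _ "(0, i)"] in auto)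
  have "(\<integral>p. (\<Sum>i\<in>Basis. g i p \<bullet> i) * \<phi> p \<partial>lborel) = (\<Sum>i\<in>Basis. \<integral>p. (g i p \<bullet> i) * \<phi> p \<partial>lborel)"
    unfolding sum_distrib_right by (rule Bochner_Integration.integral_sum) (rule ig)
  also have "\<dots> = (\<Sum>i\<in>Basis. - (\<integral>p. (u p \<bullet> i) * frechet_derivative \<phi> (at p) (0, i) \<partial>lborel))"
    by (intro sum.cong refl) (simp add: weak_gradient[OF \<phi>])
  also have "\<dots> = - (\<integral>p. (\<Sum>i\<in>Basis. (u p \<bullet> i) * frechet_derivative \<phi> (at p) (0, i)) \<partial>lborel)"
    by (subst Bochner_Integration.integral_sum) (simp_all add: iu sum_negf)
  also have "(\<integral>p. (\<Sum>i\<in>Basis. (u p \<bullet> i) * frechet_derivative \<phi> (at p) (0, i)) \<partial>lborel)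
      = (\<integral>p. frechet_derivative \<phi> (at p) (0, u p) \<partial>lborel)"
    by (simp add: frechet_derivative_space[OF sm, of _ "u _"])
  also have "\<dots> = 0" by (rule incompressible[OF \<phi>])
  finally show "(\<integral>p. (\<Sum>i\<in>Basis. g i p \<bullet> i) * \<phi> p \<partial>lborel) = 0" by simp
qed

text \<open>The dimension is the price of Cauchy-Schwarz for the sum over the basis directions; with
  it A bounds the squared L2 norm of increments per squared length of the shift.\<close>

definition A :: real where
  "A = real DIM('a) * (\<Sum>i\<in>Basis. \<integral>p. (norm (g i p))\<^sup>2 \<partial>lborel)"

lemma A_nonneg: "0 \<le> A"
  unfolding A_def by (intro mult_nonneg_nonneg sum_nonneg) auto

text \<open>The weak derivative along (0, h) is the combination of the \<open>g i\<close> with the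
  coefficients of h. The gained power of the length of h is what cancels 1/\<epsilon> in the
  commutator.\<close>

lemma u_translate_diff:
  "(\<integral>\<^sup>+p. ennreal ((norm (u (p + (0, h)) - u p))\<^sup>2) \<partial>lborel) \<le> ennreal ((norm h)\<^sup>2 * A)"
proof -
  define G where "G p = (\<Sum>i\<in>Basis. (h \<bullet> i) *\<^sub>R g i p)" for p
  have G: "L1_loc G" unfolding G_def[abs_def] by (intro L1_loc_sum L1_loc_scaleR g_L1_loc) simp_all
  have "(\<integral>\<^sup>+p. ennreal ((norm (u (p + (0, h)) - u p))\<^sup>2) \<partial>lborel) \<le> (\<integral>\<^sup>+p. ennreal ((norm (G p))\<^sup>2) \<partial>lborel)"
  proof (rule nn_integral_translate_diff_le[OF u G])
    fix \<phi> :: "real \<times> 'a \<Rightarrow> real" and j :: 'a assume \<phi>: "Cc_infinity \<phi>" and j: "j \<in> Basis"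
    note sm = Cc_infinity_smooth[OF \<phi>]
    note [measurable] = smooth_measurable[OF sm] smooth_measurable_derivative[OF sm]
    obtain S where S: "S > 0" "\<And>x. S < norm x \<Longrightarrow> \<phi> x = 0"
      "\<And>x v. S < norm x \<Longrightarrow> frechet_derivative \<phi> (at x) v = 0"
      using Cc_infinity_support[OF \<phi>] by blast
    obtain K where K: "K > 0" "\<And>x. norm (\<phi> x) \<le> K" "\<And>x v. norm (frechet_derivative \<phi> (at x) v) \<le> K * norm v"
      using Cc_infinity_bounded[OF \<phi>] by blast
    have ig: "integrable lborel (\<lambda>p. (h \<bullet> i) * ((g i p \<bullet> j) * \<phi> p))" if "i \<in> Basis" for i
      by (rule integrable_mult_right, rule L1_loc_mult_real[OF L1_loc_inner[OF g_L1_loc[OF that]], of _ K S]) (use S K in auto)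
    have iu: "integrable lborel (\<lambda>p. (h \<bullet> i) * ((u p \<bullet> j) * frechet_derivative \<phi> (at p) (0, i)))" if "i \<in> Basis" for i
      by (rule integrable_mult_right, rule L1_loc_mult_real[OF L1_loc_inner[OF u], of _ "K * norm (0::real, i)" S])
         (use S K(3)[of _ "(0, i)"] in auto)
    have "(\<integral>p. (u p \<bullet> j) * frechet_derivative \<phi> (at p) (0, h) \<partial>lborel)
        = (\<integral>p. (\<Sum>i\<in>Basis. (h \<bullet> i) * ((u p \<bullet> j) * frechet_derivative \<phi> (at p) (0, i))) \<partial>lborel)"
      by (simp add: frechet_derivative_space[OF sm, of _ h] sum_distrib_left mult.left_commute)
    also have "\<dots> = (\<Sum>i\<in>Basis. (h \<bullet> i) * (\<integral>p. (u p \<bullet> j) * frechet_derivative \<phi> (at p) (0, i) \<partial>lborel))"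
      by (subst Bochner_Integration.integral_sum[OF iu]) simp_all
    also have "\<dots> = - (\<Sum>i\<in>Basis. (h \<bullet> i) * (\<integral>p. (g i p \<bullet> j) * \<phi> p \<partial>lborel))"
      by (simp add: weak_gradient[OF \<phi> _ j] sum_negf)
    also have "(\<Sum>i\<in>Basis. (h \<bullet> i) * (\<integral>p. (g i p \<bullet> j) * \<phi> p \<partial>lborel))
        = (\<integral>p. (\<Sum>i\<in>Basis. (h \<bullet> i) * ((g i p \<bullet> j) * \<phi> p)) \<partial>lborel)"
      by (subst Bochner_Integration.integral_sum[OF ig]) simp_all
    also have "\<dots> = (\<integral>p. (G p \<bullet> j) * \<phi> p \<partial>lborel)"
      by (simp add: G_def inner_sum_left sum_distrib_right mult.assoc)
    finally show "(\<integral>p. (u p \<bullet> j) * frechet_derivative \<phi> (at p) (0, h) \<partial>lborel) = - (\<integral>p. (G p \<bullet> j) * \<phi> p \<partial>lborel)" .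
  qed
  also have "\<dots> \<le> (\<integral>\<^sup>+p. ennreal ((norm h)\<^sup>2 * (real DIM('a) * (\<Sum>i\<in>Basis. (norm (g i p))\<^sup>2))) \<partial>lborel)"
  proof (intro nn_integral_mono ennreal_leI)
    fix p
    have "norm (G p) \<le> (\<Sum>i\<in>Basis. norm h * norm (g i p))"
      unfolding G_def by (rule sum_norm_le) (auto intro!: mult_right_mono Basis_le_norm)
    also have "\<dots> = norm h * (\<Sum>i\<in>Basis. norm (g i p))" by (simp add: sum_distrib_left)
    finally have "(norm (G p))\<^sup>2 \<le> (norm h * (\<Sum>i\<in>Basis. norm (g i p)))\<^sup>2" by (rule power_mono) simp
    also have "\<dots> = (norm h)\<^sup>2 * (\<Sum>i\<in>Basis. norm (g i p))\<^sup>2" by (simp add: power_mult_distrib)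
    also have "(\<Sum>i\<in>Basis. norm (g i p))\<^sup>2 \<le> real DIM('a) * (\<Sum>i\<in>Basis. (norm (g i p))\<^sup>2)"
      using sum_squared_le_sum_of_squares[of "\<lambda>i. norm (g i p)" Basis] by (simp add: mult.commute)
    finally show "(norm (G p))\<^sup>2 \<le> (norm h)\<^sup>2 * (real DIM('a) * (\<Sum>i\<in>Basis. (norm (g i p))\<^sup>2))"
      by (simp add: mult_left_mono)
  qed
  also have "\<dots> = ennreal (\<integral>p. (norm h)\<^sup>2 * (real DIM('a) * (\<Sum>i\<in>Basis. (norm (g i p))\<^sup>2)) \<partial>lborel)"
    by (intro nn_integral_eq_integral integrable_mult_right Bochner_Integration.integrable_sum g_L2)
       (auto intro!: AE_I2 mult_nonneg_nonneg sum_nonneg)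
  also have "(\<integral>p. (norm h)\<^sup>2 * (real DIM('a) * (\<Sum>i\<in>Basis. (norm (g i p))\<^sup>2)) \<partial>lborel) = (norm h)\<^sup>2 * A"
    by (simp add: A_def Bochner_Integration.integral_sum g_L2)
  finally show ?thesis .
qed

text \<open>Incompressibility as a transport equation, so that the mollified equation can be used
  for the constant density 1.\<close>

lemma const_transported: "transported u (\<lambda>_. 1)"
  unfolding transported_def
proof (intro allI impI)
  fix \<theta> :: "real \<Rightarrow> real" and \<psi> :: "'a \<Rightarrow> real" assume \<theta>: "Cc_infinity \<theta>" and \<psi>: "Cc_infinity \<psi>"
  note s\<theta> = Cc_infinity_smooth[OF \<theta>] and s\<psi> = Cc_infinity_smooth[OF \<psi>]
  note tensor = Cc_infinity_tensor[OF \<theta> \<psi>]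
  let ?\<phi> = "\<lambda>p::real \<times> 'a. \<theta> (fst p) * \<psi> (snd p)"
  have time: "frechet_derivative ?\<phi> (at p) (1, 0) = frechet_derivative \<theta> (at (fst p)) 1 * \<psi> (snd p)" for p
    unfolding frechet_derivative_tensor[OF s\<theta> s\<psi>] fst_conv snd_conv
      linear_0[OF has_derivative_linear[OF smooth_has_derivative[OF s\<psi>]]] by simp
  have space: "frechet_derivative ?\<phi> (at p) (0, v) = \<theta> (fst p) * frechet_derivative \<psi> (at (snd p)) v" for p v
    unfolding frechet_derivative_tensor[OF s\<theta> s\<psi>] fst_conv snd_conv
      linear_0[OF has_derivative_linear[OF smooth_has_derivative[OF s\<theta>]]] by simp
  note st = Cc_infinity_smooth[OF tensor]
  note [measurable] = smooth_measurable_derivative[OF st]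
  obtain S where S: "S > 0" "\<And>x. S < norm x \<Longrightarrow> ?\<phi> x = 0"
    "\<And>x v. S < norm x \<Longrightarrow> frechet_derivative ?\<phi> (at x) v = 0"
    using Cc_infinity_support[OF tensor] by blast
  obtain K where K: "K > 0" "\<And>x. norm (?\<phi> x) \<le> K" "\<And>x v. norm (frechet_derivative ?\<phi> (at x) v) \<le> K * norm v"
    using Cc_infinity_bounded[OF tensor] by blast
  have "integrable lborel (\<lambda>p. (1::real) * frechet_derivative ?\<phi> (at p) (1, 0))"
  proof (rule L1_loc_mult_real[OF L1_loc_const, where R = S])
    show "\<bar>frechet_derivative ?\<phi> (at p) (1, 0)\<bar> \<le> K * norm (1::real, 0::'a)" for p
      using K(3)[of p "(1, 0)"] by (simp only: real_norm_def)
  next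
    show "frechet_derivative ?\<phi> (at p) v = 0" if "S < norm p" for p v using that by (rule S(3))
  qed measurable
  then have i1: "integrable lborel (\<lambda>p. frechet_derivative ?\<phi> (at p) (1, 0))" by (simp only: mult_1_left)
  have i2: "integrable lborel (\<lambda>p. frechet_derivative ?\<phi> (at p) (0, u p))"
    unfolding frechet_derivative_space[OF st, of _ "u _"]
  proof (rule Bochner_Integration.integrable_sum)
    fix i :: 'a
    have "integrable lborel (\<lambda>p. (u p \<bullet> i) * frechet_derivative ?\<phi> (at p) (0, i))"
    proof (rule L1_loc_mult_real[OF L1_loc_inner[OF u], where R = S])
      show "\<bar>frechet_derivative ?\<phi> (at p) (0, i)\<bar> \<le> K * norm (0::real, i)" for p
        using K(3)[of p "(0, i)"] by (simp only: real_norm_def)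
    next
    show "frechet_derivative ?\<phi> (at p) v = 0" if "S < norm p" for p v using that by (rule S(3))
  qed measurable
    then show "integrable lborel (\<lambda>p. (u p \<bullet> i) *\<^sub>R frechet_derivative ?\<phi> (at p) (0, i))"
      by (simp only: real_scaleR_def)
  qed
  have "(\<integral>p. frechet_derivative ?\<phi> (at p) (1, 0) + frechet_derivative ?\<phi> (at p) (0, u p) \<partial>lborel) = 0"
    by (simp only: Bochner_Integration.integral_add[OF i1 i2] integral_frechet_derivative_eq_0[OF tensor] incompressible[OF tensor] add_0)
  then show "(\<integral>p. 1 * (frechet_derivative \<theta> (at (fst p)) 1 * \<psi> (snd p)
      + \<theta> (fst p) * frechet_derivative \<psi> (at (snd p)) (u p)) \<partial>lborel) = 0"
    by (simp only: time space mult_1_left)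
qed

text \<open>The mollified constant does not change in time, hence its flux, the mollified divergence
  of u up to sign, vanishes. This is the second cancellation behind the commutator form.\<close>

lemma fl_const_eq_0:
  assumes "\<epsilon> > 0"
  shows "AE p in lborel. fl (\<lambda>_. 1) \<epsilon> (fst p) (snd p) = 0"
proof (rule AE_lborel_prodI)
  have m1: "(\<lambda>_. 1) \<in> borel_measurable borel" and b1: "\<bar>1::real\<bar> \<le> 1" by simp_all
  note [measurable] = fl_measurable[OF m1 b1]
  show "Measurable.pred borel (\<lambda>p. fl (\<lambda>_. 1) \<epsilon> (fst p) (snd p) = 0)" by measurable
  fix x
  have "AE t in lborel. fl (\<lambda>_. 1) \<epsilon> t x = 0"
  proof (rule fundamental_lemma[OF L1_loc_fl_time[OF m1 b1 assms]])
    fix \<theta> :: "real \<Rightarrow> real" assume \<theta>: "Cc_infinity \<theta>"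
    show "(\<integral>t. fl (\<lambda>_. 1) \<epsilon> t x * \<theta> t \<partial>lborel) = 0"
      using transported_weak[OF m1 b1 const_transported assms \<theta>, of x] integral_frechet_derivative_eq_0[OF \<theta>, of 1]
      by (simp add: sm_def \<eta>_integral)
  qed
  then show "AE t in lborel. fl (\<lambda>_. 1) \<epsilon> (fst (t, x)) (snd (t, x)) = 0" by simp
qed

subsection \<open>Square integrability of the velocity\<close>

lemma energy_slab:
  assumes "0 \<le> T"
  shows "(\<integral>\<^sup>+p. indicator (slab T) p * ennreal (r p * (norm (u p))\<^sup>2) \<partial>lborel) \<le> ennreal (T * B)"
proof -
  have "(\<integral>\<^sup>+p. indicator (slab T) p * ennreal (r p * (norm (u p))\<^sup>2) \<partial>lborel)
      = (\<integral>\<^sup>+t. indicator {0<..<T} t * (\<integral>\<^sup>+x. ennreal (r (t, x) * (norm (u (t, x)))\<^sup>2) \<partial>lborel) \<partial>lborel)"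
    by (subst nn_integral_lborel_fst) (simp_all add: nn_integral_cmult)
  also have "\<dots> \<le> (\<integral>\<^sup>+t. indicator {0<..<T} t * ennreal B \<partial>lborel)"
    by (rule nn_integral_mono_AE) (use energy in \<open>eventually_elim, simp add: mult_left_mono\<close>)
  also have "\<dots> = ennreal (T * B)"
    using assms B_nonneg by (simp add: nn_integral_multc ennreal_mult)
  finally show ?thesis .
qed

text \<open>From Cauchy-Schwarz on the flux integral weighted by the density: the gradient of the
  kernel contributes M^2 times C times the volume of its ball, the velocity contributes the energy
  bound B.\<close>

definition K :: real where
  "K = sqrt (M\<^sup>2 * (C * measure lborel (cball (0::'a) R)) * B)"

lemma K_nonneg: "0 \<le> K"
  using C_pos B_nonneg by (simp add: K_def)

text \<open>Half of the density, as a square root, goes to each factor of Cauchy-Schwarz, so that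
  only the energy and the upper bound of the density enter. One null set of times serves all scales
  and all points, because it is the one on which the energy bound fails.\<close>

lemma fl_small: "AE t in lborel. \<forall>\<epsilon>\<ge>1. \<forall>x. \<bar>fl r \<epsilon> t x\<bar> \<le> K / \<epsilon>"
  using energy
proof eventually_elim
  case (elim t)
  show ?case
  proof (intro allI impI)
    fix \<epsilon> :: real and x assume \<epsilon>: "1 \<le> \<epsilon>"
    let ?r = "\<lambda>z. r (t, x + \<epsilon> *\<^sub>R z)" and ?u = "\<lambda>z. u (t, x + \<epsilon> *\<^sub>R z)"
    let ?J = "\<integral>z. ?r z * (\<gamma> z \<bullet> ?u z) \<partial>lborel"
    let ?f = "\<lambda>z. ennreal (M * (indicator (cball 0 R) z * sqrt (?r z)))" and ?g = "\<lambda>z. ennreal (sqrt (?r z) * norm (?u z))"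
    have "ennreal (norm ?J) \<le> (\<integral>\<^sup>+z. ennreal (norm (?r z * (\<gamma> z \<bullet> ?u z))) \<partial>lborel)"
      by (rule norm_integral_le_nn_integral)
    also have "\<dots> \<le> (\<integral>\<^sup>+z. ?f z * ?g z \<partial>lborel)"
    proof (rule nn_integral_mono)
      fix z
      have "norm (?r z * (\<gamma> z \<bullet> ?u z)) \<le> (M * (indicator (cball 0 R) z * sqrt (?r z))) * (sqrt (?r z) * norm (?u z))"
      proof (cases "R < norm z")
        case False
        have "\<bar>\<gamma> z \<bullet> ?u z\<bar> \<le> M * norm (?u z)"
          by (rule order_trans[OF Cauchy_Schwarz_ineq2]) (intro mult_right_mono \<gamma>_le norm_ge_zero)
        then have "?r z * \<bar>\<gamma> z \<bullet> ?u z\<bar> \<le> ?r z * (M * norm (?u z))" by (rule mult_left_mono) (rule r_nonneg)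
        also have "\<dots> = (M * (indicator (cball 0 R) z * sqrt (?r z))) * (sqrt (?r z) * norm (?u z))"
          using False real_sqrt_mult_self[of "?r z"] r_nonneg[of "(t, x + \<epsilon> *\<^sub>R z)"] by simp
        finally show ?thesis using r_nonneg by (simp add: abs_mult)
      qed (simp add: \<gamma>_supp)
      then show "ennreal (norm (?r z * (\<gamma> z \<bullet> ?u z))) \<le> ?f z * ?g z"
        using M_pos r_nonneg by (subst ennreal_mult[symmetric]) (auto intro!: ennreal_leI)
    qed
    finally have "(ennreal (norm ?J))\<^sup>2 \<le> (\<integral>\<^sup>+z. ?f z * ?g z \<partial>lborel)\<^sup>2" by (rule power_mono) simp
    also have "\<dots> \<le> (\<integral>\<^sup>+z. (?f z)\<^sup>2 \<partial>lborel) * (\<integral>\<^sup>+z. (?g z)\<^sup>2 \<partial>lborel)"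
      by (rule Cauchy_Schwarz_nn_integral) measurable
    also have "\<dots> \<le> ennreal (M\<^sup>2 * (C * measure lborel (cball (0::'a) R))) * ennreal B"
    proof (rule mult_mono)
      have "(\<integral>\<^sup>+z. (?f z)\<^sup>2 \<partial>lborel) \<le> (\<integral>\<^sup>+z. ennreal (M\<^sup>2 * C) * indicator (cball (0::'a) R) z \<partial>lborel)"
      proof (rule nn_integral_mono)
        fix z
        have "(M * (1 * sqrt (?r z)))\<^sup>2 \<le> M\<^sup>2 * C"
          using r_nonneg[of "(t, x + \<epsilon> *\<^sub>R z)"] r_le[of "(t, x + \<epsilon> *\<^sub>R z)"] by (simp add: power_mult_distrib mult_left_mono)
        then show "(?f z)\<^sup>2 \<le> ennreal (M\<^sup>2 * C) * indicator (cball 0 R) z"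
          using M_pos r_nonneg by (cases "norm z \<le> R") (simp_all add: ennreal_power ennreal_leI)
      qed
      also have "\<dots> = ennreal (M\<^sup>2 * C) * emeasure lborel (cball (0::'a) R)"
        by (simp add: nn_integral_cmult)
      also have "emeasure lborel (cball (0::'a) R) = ennreal (measure lborel (cball (0::'a) R))"
        using emeasure_lborel_cball_finite[of "0::'a" R] by (intro emeasure_eq_ennreal_measure) auto
      finally show "(\<integral>\<^sup>+z. (?f z)\<^sup>2 \<partial>lborel) \<le> ennreal (M\<^sup>2 * (C * measure lborel (cball (0::'a) R)))"
        using C_pos by (simp add: ennreal_mult[symmetric] mult.assoc)
      have "(\<integral>\<^sup>+z. (?g z)\<^sup>2 \<partial>lborel) = (\<integral>\<^sup>+z. ennreal (?r z * (norm (?u z))\<^sup>2) \<partial>lborel)"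
        using r_nonneg by (intro nn_integral_cong) (simp add: ennreal_power power_mult_distrib)
      \<comment> \<open>Rescaling to y would even give a gain \<epsilon>^(-d); since 1 \<le>
        \<epsilon> it is estimated by 1.\<close>
      also have "\<dots> \<le> ennreal (\<epsilon> ^ DIM('a)) * (\<integral>\<^sup>+z. ennreal (?r z * (norm (?u z))\<^sup>2) \<partial>lborel)"
      proof -
        have "1 * (\<integral>\<^sup>+z. ennreal (?r z * (norm (?u z))\<^sup>2) \<partial>lborel) \<le> ennreal (\<epsilon> ^ DIM('a)) * (\<integral>\<^sup>+z. ennreal (?r z * (norm (?u z))\<^sup>2) \<partial>lborel)"
          by (rule mult_right_mono) (use ennreal_leI[OF one_le_power[OF \<epsilon>, of "DIM('a)"]] in simp_all)
        then show ?thesis by simp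
      qed
      also have "\<dots> = (\<integral>\<^sup>+y. ennreal (r (t, y) * (norm (u (t, y)))\<^sup>2) \<partial>lborel)"
        using \<epsilon> by (intro nn_integral_lborel_scale[symmetric]) simp_all
      also have "\<dots> \<le> ennreal B" by (rule elim)
      finally show "(\<integral>\<^sup>+z. (?g z)\<^sup>2 \<partial>lborel) \<le> ennreal B" .
    qed simp_all
    also have "\<dots> = ennreal (M\<^sup>2 * (C * measure lborel (cball (0::'a) R)) * B)"
      using C_pos B_nonneg by (intro ennreal_mult[symmetric]) auto
    finally have "(norm ?J)\<^sup>2 \<le> M\<^sup>2 * (C * measure lborel (cball (0::'a) R)) * B"
      using C_pos B_nonneg by (simp add: ennreal_power ennreal_le_iff)
    then have "norm ?J \<le> K" unfolding K_def by (rule real_le_rsqrt)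
    then have "(1 / \<epsilon>) * norm ?J \<le> (1 / \<epsilon>) * K" using \<epsilon> by (intro mult_left_mono) auto
    then show "\<bar>fl r \<epsilon> t x\<bar> \<le> K / \<epsilon>" using \<epsilon> by (simp add: fl_def abs_mult)
  qed
qed

text \<open>At a large scale the mollified density moves slowly, so it stays above \<open>c / 2\<close>.\<close>

lemma sm_lower_bound:
  assumes "0 < T" "1 \<le> \<epsilon>" "2 * T * K \<le> c * \<epsilon>"
  shows "AE p in lborel. 0 < fst p \<and> fst p < T \<longrightarrow> c / 2 \<le> sm r \<epsilon> (fst p) (snd p)"
proof (rule AE_lborel_prodI)
  show "Measurable.pred borel (\<lambda>p. 0 < fst p \<and> fst p < T \<longrightarrow> c / 2 \<le> sm r \<epsilon> (fst p) (snd p))" by measurable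
  fix x
  have \<epsilon>: "0 < \<epsilon>" using assms by simp
  have "AE t in lborel. 0 < t \<and> t < T \<longrightarrow> sm r \<epsilon> t x = sm r \<epsilon> 0 x + (LBINT s:{0..t}. fl r \<epsilon> s x)"
    by (rule transported_ode[OF r_measurable r_abs_le r_transported \<epsilon> \<open>0 < T\<close> r_past])
  then have "AE t in lborel. 0 < t \<and> t < T \<longrightarrow> c / 2 \<le> sm r \<epsilon> t x"
  proof eventually_elim
    case (elim t)
    show ?case
    proof
      assume t: "0 < t \<and> t < T"
      have "\<bar>LBINT s:{0..t}. fl r \<epsilon> s x\<bar> \<le> (\<integral>s. norm (indicator {0..t} s *\<^sub>R fl r \<epsilon> s x) \<partial>lborel)"
        unfolding set_lebesgue_integral_def real_norm_def[symmetric] by (rule integral_norm_bound)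
      also have "\<dots> \<le> (\<integral>s. indicator {0..t} s * (K / \<epsilon>) \<partial>lborel)"
      proof (rule integral_mono_AE')
        show "integrable lborel (\<lambda>s. indicat_real {0..t} s * (K / \<epsilon>))"
          by (intro integrable_mult_left integrable_real_indicator) (use t in auto)
        show "AE s in lborel. norm (indicator {0..t} s *\<^sub>R fl r \<epsilon> s x) \<le> indicator {0..t} s * (K / \<epsilon>)"
          using fl_small
        proof eventually_elim
          case (elim s)
          then have "\<bar>fl r \<epsilon> s x\<bar> \<le> K / \<epsilon>" using assms(2) by blast
          then show ?case by (simp split: split_indicator)
        qed
      qed (use K_nonneg \<epsilon> in simp)
      also have "\<dots> = t * (K / \<epsilon>)" using t by simp
      also have "\<dots> \<le> T * (K / \<epsilon>)" using t K_nonneg \<epsilon> by (intro mult_right_mono) auto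
      also have "\<dots> \<le> c / 2" using assms(3) \<epsilon> by (simp add: field_simps)
      finally have "- (c / 2) \<le> (LBINT s:{0..t}. fl r \<epsilon> s x)" by linarith
      moreover have "c \<le> sm r \<epsilon> 0 x"
        by (rule sm_between(1)[OF r_measurable r_abs_le r_initial])
      moreover have "sm r \<epsilon> t x = sm r \<epsilon> 0 x + (LBINT s:{0..t}. fl r \<epsilon> s x)" using elim t by blast
      ultimately show "c / 2 \<le> sm r \<epsilon> t x" by linarith
    qed
  qed
  then show "AE t in lborel. 0 < fst (t, x) \<and> fst (t, x) < T \<longrightarrow> c / 2 \<le> sm r \<epsilon> (fst (t, x)) (snd (t, x))" by simp
qed

text \<open>The lower bound c/2 on the mollified density bounds the square of u(p) by an average
  over q = p + (0, \<epsilon> z) of r(q) times that square. Splitting u(p) into u(p) - u(q) and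
  u(q), the first part is paid by the gradient and the upper bound C, the second by the energy at
  q.\<close>

lemma u_L2_slab:
  assumes "0 < T"
  shows "(\<integral>\<^sup>+p. indicator (slab T) p * ennreal ((norm (u p))\<^sup>2) \<partial>lborel) < \<infinity>"
proof -
  \<comment> \<open>Chosen to satisfy both requirements of \<open>sm_lower_bound\<close>: \<epsilon>
    is at least 1, and the drift over time T is at most c/2.\<close>
  define \<epsilon> where "\<epsilon> = 1 + 2 * T * K / c"
  have "0 \<le> 2 * T * K / c" using assms K_nonneg c_pos by simp
  then have \<epsilon>: "1 \<le> \<epsilon>" "0 < \<epsilon>" by (simp_all add: \<epsilon>_def)
  have \<epsilon>2: "2 * T * K \<le> c * \<epsilon>" using c_pos by (simp add: \<epsilon>_def distrib_left)
  let ?I = "\<lambda>p. indicator (slab T) p :: ennreal"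
  let ?p = "\<lambda>p z. p + (0, \<epsilon> *\<^sub>R z)"
  let ?D = "\<lambda>p z. ennreal ((norm (u (?p p z) - u p))\<^sup>2)" and ?E = "\<lambda>p z. ennreal (r (?p p z) * (norm (u (?p p z)))\<^sup>2)"
  have "(\<integral>\<^sup>+p. ?I p * ennreal (c / 2 * (norm (u p))\<^sup>2) \<partial>lborel)
      \<le> (\<integral>\<^sup>+p. \<integral>\<^sup>+z. ennreal (\<eta> z) * (ennreal (2 * C) * ?D p z + 2 * (?I (?p p z) * ?E p z)) \<partial>lborel \<partial>lborel)"
  proof (rule nn_integral_mono_AE)
    show "AE p in lborel. ?I p * ennreal (c / 2 * (norm (u p))\<^sup>2)
      \<le> (\<integral>\<^sup>+z. ennreal (\<eta> z) * (ennreal (2 * C) * ?D p z + 2 * (?I (?p p z) * ?E p z)) \<partial>lborel)"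
      using sm_lower_bound[OF assms \<epsilon>(1) \<epsilon>2]
    proof eventually_elim
      case (elim p)
      obtain t x where p: "p = (t, x)" by (cases p)
      show ?case
      proof (cases "0 < t \<and> t < T")
        case True
        then have "c / 2 * (norm (u p))\<^sup>2 \<le> sm r \<epsilon> t x * (norm (u p))\<^sup>2"
          using elim by (intro mult_right_mono) (simp_all add: p)
        also have "\<dots> = (\<integral>z. (r (?p p z) * \<eta> z) * (norm (u p))\<^sup>2 \<partial>lborel)" by (simp add: sm_def p)
        finally have "ennreal (c / 2 * (norm (u p))\<^sup>2) \<le> ennreal (\<integral>z. (r (?p p z) * \<eta> z) * (norm (u p))\<^sup>2 \<partial>lborel)"
          by (rule ennreal_leI)
        also have "\<dots> = (\<integral>\<^sup>+z. ennreal ((r (?p p z) * \<eta> z) * (norm (u p))\<^sup>2) \<partial>lborel)"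
          using sm_integrand_integrable[OF r_measurable r_abs_le, of t x \<epsilon>] r_nonneg \<eta>_nonneg
          by (intro nn_integral_eq_integral[symmetric] integrable_mult_left) (simp_all add: p)
        also have "\<dots> \<le> (\<integral>\<^sup>+z. ennreal (\<eta> z) * (ennreal (2 * C) * ?D p z + 2 * (?I (?p p z) * ?E p z)) \<partial>lborel)"
        proof (rule nn_integral_mono)
          fix z
          let ?q = "?p p z"
          have "r ?q * (norm (u p))\<^sup>2 \<le> r ?q * (2 * (norm (u ?q - u p))\<^sup>2 + 2 * (norm (u ?q))\<^sup>2)"
            by (intro mult_left_mono norm_power2_le_twice r_nonneg)
          also have "\<dots> = r ?q * (2 * (norm (u ?q - u p))\<^sup>2) + 2 * (r ?q * (norm (u ?q))\<^sup>2)" by (simp add: distrib_left)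
          also have "\<dots> \<le> C * (2 * (norm (u ?q - u p))\<^sup>2) + 2 * (r ?q * (norm (u ?q))\<^sup>2)"
            by (intro add_right_mono mult_right_mono r_le) simp
          finally have "\<eta> z * (r ?q * (norm (u p))\<^sup>2) \<le> \<eta> z * (2 * C * (norm (u ?q - u p))\<^sup>2 + 2 * (r ?q * (norm (u ?q))\<^sup>2))"
            by (intro mult_left_mono \<eta>_nonneg) (simp add: mult.commute mult.left_commute)
          then have "ennreal ((r ?q * \<eta> z) * (norm (u p))\<^sup>2) \<le> ennreal (\<eta> z * (2 * C * (norm (u ?q - u p))\<^sup>2 + 2 * (r ?q * (norm (u ?q))\<^sup>2)))"
            by (intro ennreal_leI) (simp add: mult.commute mult.left_commute)
          also have "\<dots> = ennreal (\<eta> z) * (ennreal (2 * C) * ?D p z + 2 * ?E p z)"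
            using \<eta>_nonneg r_nonneg C_pos by (simp add: ennreal_mult ennreal_plus)
          \<comment> \<open>The shift is purely spatial, so q lies in the slab with p; the indicator
            is needed at q, where the energy integral is taken.\<close>
          also have "?E p z = ?I ?q * ?E p z" using True by (simp add: p)
          finally show "ennreal ((r ?q * \<eta> z) * (norm (u p))\<^sup>2) \<le> ennreal (\<eta> z) * (ennreal (2 * C) * ?D p z + 2 * (?I ?q * ?E p z))" .
        qed
        finally show ?thesis using True by (simp add: p)
      qed (auto simp: p)
    qed
  qed
  also have "\<dots> = (\<integral>\<^sup>+z. \<integral>\<^sup>+p. ennreal (\<eta> z) * (ennreal (2 * C) * ?D p z + 2 * (?I (?p p z) * ?E p z)) \<partial>lborel \<partial>lborel)"
    by (rule lborel_pair.Fubini'[symmetric]) measurable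
  also have "\<dots> \<le> (\<integral>\<^sup>+z. ennreal (\<eta> z) * (ennreal (2 * C) * ennreal ((\<epsilon> * R)\<^sup>2 * A) + 2 * ennreal (T * B)) \<partial>lborel)"
  proof (rule nn_integral_mono)
    fix z
    show "(\<integral>\<^sup>+p. ennreal (\<eta> z) * (ennreal (2 * C) * ?D p z + 2 * (?I (?p p z) * ?E p z)) \<partial>lborel)
      \<le> ennreal (\<eta> z) * (ennreal (2 * C) * ennreal ((\<epsilon> * R)\<^sup>2 * A) + 2 * ennreal (T * B))"
    proof (cases "R < norm z")
      case False
      have "(\<integral>\<^sup>+p. ?D p z \<partial>lborel) \<le> ennreal ((norm (\<epsilon> *\<^sub>R z))\<^sup>2 * A)" by (rule u_translate_diff)
      also have "\<dots> \<le> ennreal ((\<epsilon> * R)\<^sup>2 * A)"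
        using False \<epsilon>(2) A_nonneg by (intro ennreal_leI mult_right_mono power_mono) auto
      finally have D: "(\<integral>\<^sup>+p. ?D p z \<partial>lborel) \<le> ennreal ((\<epsilon> * R)\<^sup>2 * A)" .
      have "(\<integral>\<^sup>+p. ?I (?p p z) * ?E p z \<partial>lborel) = (\<integral>\<^sup>+p. ?I p * ennreal (r p * (norm (u p))\<^sup>2) \<partial>lborel)"
        by (rule nn_integral_lborel_translate) measurable
      also have "\<dots> \<le> ennreal (T * B)" using assms by (intro energy_slab) simp
      finally have E: "(\<integral>\<^sup>+p. ?I (?p p z) * ?E p z \<partial>lborel) \<le> ennreal (T * B)" .
      have "(\<integral>\<^sup>+p. ennreal (\<eta> z) * (ennreal (2 * C) * ?D p z + 2 * (?I (?p p z) * ?E p z)) \<partial>lborel)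
        = ennreal (\<eta> z) * (ennreal (2 * C) * (\<integral>\<^sup>+p. ?D p z \<partial>lborel) + 2 * (\<integral>\<^sup>+p. ?I (?p p z) * ?E p z \<partial>lborel))"
        by (subst nn_integral_cmult, measurable, subst nn_integral_add, measurable, subst (1 2) nn_integral_cmult) auto
      also have "\<dots> \<le> ennreal (\<eta> z) * (ennreal (2 * C) * ennreal ((\<epsilon> * R)\<^sup>2 * A) + 2 * ennreal (T * B))"
        by (intro mult_left_mono add_mono D E) simp_all
      finally show ?thesis .
    qed (simp add: \<eta>_supp)
  qed
  also have "\<dots> = (\<integral>\<^sup>+z. ennreal (\<eta> z) \<partial>lborel) * (ennreal (2 * C) * ennreal ((\<epsilon> * R)\<^sup>2 * A) + 2 * ennreal (T * B))"
    by (rule nn_integral_multc) measurable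
  also have "\<dots> < \<infinity>"
    using nn_integral_eq_integral[OF \<eta>_integrable] \<eta>_nonneg \<eta>_integral
    by (auto simp: ennreal_mult_less_top ennreal_mult[symmetric])
  finally have fin: "(\<integral>\<^sup>+p. ?I p * ennreal (c / 2 * (norm (u p))\<^sup>2) \<partial>lborel) < \<infinity>" .
  have "(\<integral>\<^sup>+p. ?I p * ennreal ((norm (u p))\<^sup>2) \<partial>lborel) = (\<integral>\<^sup>+p. ennreal (2 / c) * (?I p * ennreal (c / 2 * (norm (u p))\<^sup>2)) \<partial>lborel)"
  proof (rule nn_integral_cong)
    fix p
    have "ennreal (2 / c) * ennreal (c / 2 * (norm (u p))\<^sup>2) = ennreal ((norm (u p))\<^sup>2)"
      using c_pos by (subst ennreal_mult[symmetric]) auto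
    then show "?I p * ennreal ((norm (u p))\<^sup>2) = ennreal (2 / c) * (?I p * ennreal (c / 2 * (norm (u p))\<^sup>2))"
      by (simp add: mult.left_commute)
  qed
  also have "\<dots> = ennreal (2 / c) * (\<integral>\<^sup>+p. ?I p * ennreal (c / 2 * (norm (u p))\<^sup>2) \<partial>lborel)"
    by (rule nn_integral_cmult) measurable
  also have "\<dots> < \<infinity>" using fin by (auto simp: ennreal_mult_less_top)
  finally show ?thesis .
qed

end

subsection \<open>A convex function vanishing on an interval\<close>

text \<open>Serves functions built from squared positive parts, whose remainder is quadratic with no
  case distinction at the kink.\<close>

lemma has_real_derivative_quadratic_remainder:
  fixes f :: "real \<Rightarrow> real"
  assumes "\<And>y. \<bar>f y - f x - D * (y - x)\<bar> \<le> L * (y - x)\<^sup>2"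
  shows "(f has_real_derivative D) (at x)"
  unfolding DERIV_def
proof (rule LIM_zero_cancel, rule Lim_null_comparison)
  have "norm ((f (x + h) - f x) / h - D) \<le> \<bar>L\<bar> * \<bar>h\<bar>" if "h \<noteq> 0" for h
  proof -
    have "\<bar>(f (x + h) - f x) / h - D\<bar> * \<bar>h\<bar> = \<bar>f (x + h) - f x - D * h\<bar>"
    proof -
      have q: "(f (x + h) - f x) / h * h = f (x + h) - f x" using that by simp
      have "f (x + h) - f x - D * h = ((f (x + h) - f x) / h - D) * h" by (subst left_diff_distrib) (simp only: q)
      then show ?thesis by (simp only: abs_mult)
    qed
    also have "\<dots> \<le> L * h\<^sup>2" using assms[of "x + h"] by simp
    also have "\<dots> \<le> \<bar>L\<bar> * (\<bar>h\<bar> * \<bar>h\<bar>)"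
      by (simp add: power2_eq_square[symmetric] mult_right_mono)
    finally have "\<bar>(f (x + h) - f x) / h - D\<bar> * \<bar>h\<bar> \<le> (\<bar>L\<bar> * \<bar>h\<bar>) * \<bar>h\<bar>" by (simp only: mult.assoc)
    then show ?thesis unfolding real_norm_def by (rule mult_right_le_imp_le) (use that in simp)
  qed
  then show "\<forall>\<^sub>F h in at 0. norm ((f (x + h) - f x) / h - D) \<le> \<bar>L\<bar> * \<bar>h\<bar>"
    by (simp add: eventually_at_filter)
  have "((\<lambda>h. \<bar>L\<bar> * \<bar>h\<bar>) \<longlongrightarrow> \<bar>L\<bar> * \<bar>0\<bar>) (at (0::real))" by (intro tendsto_intros)
  then show "((\<lambda>h. \<bar>L\<bar> * \<bar>h\<bar>) \<longlongrightarrow> 0) (at (0::real))" by simp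
qed

definition dist_sq :: "real \<Rightarrow> real \<Rightarrow> real \<Rightarrow> real" where
  "dist_sq lo hi s = (max 0 (lo - s))\<^sup>2 + (max 0 (s - hi))\<^sup>2"

definition dist_sq' :: "real \<Rightarrow> real \<Rightarrow> real \<Rightarrow> real" where
  "dist_sq' lo hi s = 2 * max 0 (s - hi) - 2 * max 0 (lo - s)"

lemma max_0_square_convex:
  fixes a b :: real
  shows "(max 0 a)\<^sup>2 - (max 0 b)\<^sup>2 \<le> 2 * max 0 a * (a - b)"
proof -
  have "0 \<le> (max 0 a - max 0 b)\<^sup>2" by simp
  then have "(max 0 a)\<^sup>2 - (max 0 b)\<^sup>2 \<le> 2 * (max 0 a * max 0 a) - 2 * (max 0 a * max 0 b)"
    unfolding power2_diff by (simp add: power2_eq_square)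
  moreover have "max 0 a * max 0 a = max 0 a * a" by (simp add: max_def)
  moreover have "max 0 a * b \<le> max 0 a * max 0 b" by (intro mult_left_mono) auto
  ultimately have "(max 0 a)\<^sup>2 - (max 0 b)\<^sup>2 \<le> 2 * (max 0 a * a) - 2 * (max 0 a * b)" by linarith
  then show ?thesis by (simp add: right_diff_distrib)
qed

lemma dist_sq_convex: "dist_sq lo hi a - dist_sq lo hi b \<le> dist_sq' lo hi a * (a - b)"
  using max_0_square_convex[of "lo - a" "lo - b"] max_0_square_convex[of "a - hi" "b - hi"]
  by (simp add: dist_sq_def dist_sq'_def algebra_simps)

lemma continuous_on_dist_sq': "continuous_on A (dist_sq' lo hi)"
  unfolding dist_sq'_def[abs_def] by (intro continuous_intros)

text \<open>The subgradient inequalities at s and at y place the remainder between 0 and the product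
  of y - s with the increment of \<open>dist_sq'\<close>, which is Lipschitz with constant
  4.\<close>

lemma dist_sq_deriv: "(dist_sq lo hi has_real_derivative dist_sq' lo hi s) (at s)"
proof (rule has_real_derivative_quadratic_remainder)
  fix y
  have "\<bar>dist_sq' lo hi y - dist_sq' lo hi s\<bar> \<le> 4 * \<bar>y - s\<bar>"
    unfolding dist_sq'_def by (simp add: max_def abs_if)
  then have "\<bar>dist_sq' lo hi y - dist_sq' lo hi s\<bar> * \<bar>y - s\<bar> \<le> 4 * \<bar>y - s\<bar> * \<bar>y - s\<bar>"
    by (rule mult_right_mono) simp
  then have "(dist_sq' lo hi y - dist_sq' lo hi s) * (y - s) \<le> 4 * (y - s)\<^sup>2"
    unfolding abs_mult[symmetric] by (simp add: power2_eq_square abs_mult[symmetric] mult.assoc)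
  then show "\<bar>dist_sq lo hi y - dist_sq lo hi s - dist_sq' lo hi s * (y - s)\<bar> \<le> 4 * (y - s)\<^sup>2"
    using dist_sq_convex[of lo hi y s] dist_sq_convex[of lo hi s y] by (simp add: algebra_simps)
qed

lemma continuous_on_dist_sq: "continuous_on A (dist_sq lo hi)"
  unfolding dist_sq_def[abs_def] by (intro continuous_intros)

lemma dist_sq_measurable [measurable]: "dist_sq lo hi \<in> borel_measurable borel"
  by (intro borel_measurable_continuous_onI continuous_on_dist_sq)

lemma dist_sq'_measurable [measurable]: "dist_sq' lo hi \<in> borel_measurable borel"
  by (intro borel_measurable_continuous_onI continuous_on_dist_sq')

lemma dist_sq_nonneg: "0 \<le> dist_sq lo hi s"
  by (simp add: dist_sq_def)

lemma dist_sq_eq_0_iff: "dist_sq lo hi s = 0 \<longleftrightarrow> lo \<le> s \<and> s \<le> hi"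
  by (auto simp: dist_sq_def add_nonneg_eq_0_iff max_def split: if_splits)

subsection \<open>The renormalised inequality for the mollified density\<close>

text \<open>The weight that remains on the source when an inequality at almost every t is integrated
  over (0,T): the source at time s is counted for all later times.\<close>

definition wt :: "real \<Rightarrow> real \<Rightarrow> real" where
  "wt T s = (if 0 \<le> s \<and> s \<le> T then T - s else 0)"

lemma wt_measurable [measurable]: "wt T \<in> borel_measurable borel"
  unfolding wt_def[abs_def] by measurable

lemma integral_of_primitive:
  fixes k :: "real \<Rightarrow> real"
  assumes [measurable]: "k \<in> borel_measurable borel" and k: "set_integrable lborel {0..T} k" and "0 \<le> T"
  shows "integrable lborel (\<lambda>t. indicator {0<..<T} t * (LBINT s:{0..t}. k s))"
    and "(\<integral>t. indicator {0<..<T} t * (LBINT s:{0..t}. k s) \<partial>lborel) = (\<integral>s. wt T s * k s \<partial>lborel)"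
proof -
  let ?f = "\<lambda>t s. indicat_real {0<..<T} t * (indicat_real {0..t} s * k s)"
  have eq: "?f t s = indicat_real {0<..<T} t * ((if 0 \<le> s \<and> s \<le> t then 1 else 0) * k s)" for t s
    by (simp add: indicator_def)
  have kT: "integrable lborel (\<lambda>s. indicat_real {0..T} s * k s)"
    using k by (simp add: set_integrable_def)
  have int: "integrable (lborel \<Otimes>\<^sub>M lborel) (\<lambda>(t, s). ?f t s)"
  proof (rule Bochner_Integration.integrable_bound)
    show "integrable (lborel \<Otimes>\<^sub>M lborel) (\<lambda>(t, s). indicat_real {0<..<T} t * (indicat_real {0..T} s * k s))"
      by (rule lborel_pair.Fubini_integrable)
         (use kT \<open>0 \<le> T\<close> in \<open>auto simp: abs_mult intro!: integrable_mult_left integrable_real_indicator\<close>)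
    show "(\<lambda>(t, s). ?f t s) \<in> borel_measurable (lborel \<Otimes>\<^sub>M lborel)" unfolding eq by measurable
    show "AE p in lborel \<Otimes>\<^sub>M lborel. norm (case p of (t, s) \<Rightarrow> ?f t s)
        \<le> norm (case p of (t, s) \<Rightarrow> indicat_real {0<..<T} t * (indicat_real {0..T} s * k s))"
      by (rule AE_I2) (auto simp: indicator_def)
  qed
  from lborel_pair.integrable_fst[OF int]
  show "integrable lborel (\<lambda>t. indicator {0<..<T} t * (LBINT s:{0..t}. k s))"
    by (simp add: set_lebesgue_integral_def)
  have "(\<integral>t. indicator {0<..<T} t * (LBINT s:{0..t}. k s) \<partial>lborel) = (\<integral>t. \<integral>s. ?f t s \<partial>lborel \<partial>lborel)"
    by (simp add: set_lebesgue_integral_def)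
  also have "\<dots> = (\<integral>s. \<integral>t. ?f t s \<partial>lborel \<partial>lborel)"
    by (rule lborel_pair.Fubini_integral[symmetric]) (use int in simp)
  also have "\<dots> = (\<integral>s. wt T s * k s \<partial>lborel)"
  proof (rule Bochner_Integration.integral_cong[OF refl])
    fix s
    have "(\<integral>t. ?f t s \<partial>lborel) = (\<integral>t. indicat_real {0<..<T} t * indicat_real {0..t} s \<partial>lborel) * k s"
      by (simp flip: integral_mult_left_zero add: mult.assoc)
    also have "(\<integral>t. indicat_real {0<..<T} t * indicat_real {0..t} s \<partial>lborel) = wt T s"
    proof (cases "0 \<le> s \<and> s \<le> T")
      case True
      have "(\<integral>t. indicat_real {0<..<T} t * indicat_real {0..t} s \<partial>lborel) = (\<integral>t. indicat_real {s..T} t \<partial>lborel)"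
      proof (rule integral_cong_AE)
        have "AE t in lborel. t \<noteq> 0 \<and> t \<noteq> T" by (intro AE_conjI AE_lborel_singleton)
        then show "AE t in lborel. indicat_real {0<..<T} t * indicat_real {0..t} s = indicat_real {s..T} t"
          by eventually_elim (use True in \<open>auto simp: indicator_def\<close>)
        have "indicat_real {0..t} s = (if s \<le> t then 1 else 0)" for t using True by (simp add: indicator_def)
        then show "(\<lambda>t. indicat_real {0<..<T} t * indicat_real {0..t} s) \<in> borel_measurable lborel" by simp
      qed measurable
      then show ?thesis using True by (simp add: wt_def)
    next
      case False
      then have "(\<lambda>t. indicat_real {0<..<T} t * indicat_real {0..t} s) = (\<lambda>_. 0)" by (auto simp: indicator_def)
      then show ?thesis using False unfolding wt_def by (simp only: if_False Bochner_Integration.integral_zero)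
    qed
    finally show "(\<integral>t. ?f t s \<partial>lborel) = wt T s * k s" .
  qed
  finally show "(\<integral>t. indicator {0<..<T} t * (LBINT s:{0..t}. k s) \<partial>lborel) = (\<integral>s. wt T s * k s \<partial>lborel)" .
qed

context transport
begin

abbreviation \<beta> :: "real \<Rightarrow> real" where "\<beta> \<equiv> dist_sq c C\<^sub>0"
abbreviation \<beta>' :: "real \<Rightarrow> real" where "\<beta>' \<equiv> dist_sq' c C\<^sub>0"

text \<open>One constant for three purposes: on [0,C] it bounds \<open>\<beta>\<close>, the modulus
  of \<open>\<beta>'\<close> and the Lipschitz constant of \<open>\<beta>\<close>.\<close>

definition L :: real where "L = (c + C)\<^sup>2 + 2 * (c + C)"

lemma L_pos: "0 < L"
  unfolding L_def using c_pos C_pos by (intro add_nonneg_pos) auto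

lemma C0_pos: "0 < C\<^sub>0"
  using r_initial[of 0] c_pos by linarith

lemma \<beta>_le:
  assumes "0 \<le> s" "s \<le> C"
  shows "\<beta> s \<le> L"
proof -
  have *: "(max 0 (c - s))\<^sup>2 + (max 0 (s - C\<^sub>0))\<^sup>2 \<le> (max 0 (c - s) + max 0 (s - C\<^sub>0))\<^sup>2"
    by (simp add: power2_sum)
  also have "max 0 (c - s) + max 0 (s - C\<^sub>0) \<le> c + C" using assms c_pos C_pos C0_pos by auto
  then have "(max 0 (c - s) + max 0 (s - C\<^sub>0))\<^sup>2 \<le> (c + C)\<^sup>2" by (rule power_mono) auto
  finally show ?thesis unfolding dist_sq_def L_def using c_pos C_pos by simp
qed

lemma \<beta>'_le:
  assumes "0 \<le> s" "s \<le> C"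
  shows "\<bar>\<beta>' s\<bar> \<le> L"
proof -
  have "\<bar>\<beta>' s\<bar> \<le> 2 * (c + C)" unfolding dist_sq'_def using assms c_pos C_pos C0_pos by (simp add: max_def abs_if)
  then show ?thesis unfolding L_def using zero_le_power2[of "c + C"] by linarith
qed

lemma \<beta>_lipschitz:
  assumes "0 \<le> a" "a \<le> C" "0 \<le> b" "b \<le> C"
  shows "\<bar>\<beta> a - \<beta> b\<bar> \<le> L * \<bar>a - b\<bar>"
proof -
  have *: "\<beta>' s * (s - s') \<le> L * \<bar>s - s'\<bar>" if "0 \<le> s" "s \<le> C" for s s'
  proof -
    have "\<beta>' s * (s - s') \<le> \<bar>\<beta>' s\<bar> * \<bar>s - s'\<bar>" unfolding abs_mult[symmetric] by (rule abs_ge_self)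
    also have "\<dots> \<le> L * \<bar>s - s'\<bar>" by (intro mult_right_mono \<beta>'_le that) simp
    finally show ?thesis .
  qed
  show ?thesis
    using *[OF assms(1,2), of b] *[OF assms(3,4), of a] dist_sq_convex[of c C\<^sub>0 a b] dist_sq_convex[of c C\<^sub>0 b a]
    unfolding abs_minus_commute[of b a] by linarith
qed

lemma sm_range: "0 \<le> sm r \<epsilon> t x" "sm r \<epsilon> t x \<le> C"
  by (rule sm_between[OF r_measurable r_abs_le r_nonneg r_le])+

text \<open>For fixed x the mollified density agrees at almost every time with an absolutely
  continuous function. Averaging keeps its initial value in [c, \<open>C\<^sub>0\<close>], where
  \<open>\<beta>\<close> vanishes, so integrating the chain rule inequality over t leaves the source
  term alone.\<close>

lemma convex_time_inequality:
  assumes "0 < \<epsilon>" "0 < T"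
  shows "(\<integral>t. indicator {0<..<T} t * \<beta> (sm r \<epsilon> t x) \<partial>lborel)
    \<le> (\<integral>s. wt T s * (\<beta>' (sm r \<epsilon> s x) * fl r \<epsilon> s x) \<partial>lborel)"
proof -
  define w where "w t = sm r \<epsilon> 0 x + (LBINT s:{0..t}. fl r \<epsilon> s x)" for t
  have fl_int: "set_integrable lborel {0..t} (\<lambda>s. fl r \<epsilon> s x)" for t
  proof (rule set_integrable_subset)
    show "set_integrable lborel (cball 0 (max \<bar>t\<bar> 0)) (\<lambda>s. fl r \<epsilon> s x)"
      using L1_loc_integrable[OF L1_loc_fl_time[OF r_measurable r_abs_le assms(1)], of "max \<bar>t\<bar> 0" x]
      by (simp add: set_integrable_def)
  qed auto
  have ode: "AE t in lborel. 0 < t \<and> t < T \<longrightarrow> sm r \<epsilon> t x = w t"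
    unfolding w_def by (rule transported_ode[OF r_measurable r_abs_le r_transported assms r_past])
  let ?k = "\<lambda>s. \<beta>' (sm r \<epsilon> s x) * fl r \<epsilon> s x"
  have k_int: "set_integrable lborel {0..T} ?k"
    unfolding set_integrable_def
  proof (rule Bochner_Integration.integrable_bound)
    show "integrable lborel (\<lambda>s. L * (indicator {0..T} s *\<^sub>R fl r \<epsilon> s x))"
      using fl_int[of T] by (simp add: set_integrable_def)
    show "AE s in lborel. norm (indicator {0..T} s *\<^sub>R ?k s) \<le> norm (L * (indicator {0..T} s *\<^sub>R fl r \<epsilon> s x))"
    proof (rule AE_I2)
      fix s
      have "\<bar>\<beta>' (sm r \<epsilon> s x)\<bar> * \<bar>fl r \<epsilon> s x\<bar> \<le> \<bar>L\<bar> * \<bar>fl r \<epsilon> s x\<bar>"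
        using \<beta>'_le[OF sm_range] L_pos by (intro mult_right_mono) auto
      then show "norm (indicator {0..T} s *\<^sub>R ?k s) \<le> norm (L * (indicator {0..T} s *\<^sub>R fl r \<epsilon> s x))"
        by (simp add: indicator_def abs_mult)
    qed
  qed measurable
  have AE_le: "AE t in lborel. indicator {0<..<T} t * \<beta> (sm r \<epsilon> t x) \<le> indicator {0<..<T} t * (LBINT s:{0..t}. ?k s)"
    using ode
  proof eventually_elim
    case (elim t)
    show ?case
    proof (cases "0 < t \<and> t < T")
      case True
      have "\<beta> (w t) \<le> \<beta> (sm r \<epsilon> 0 x) + (LBINT s:{0..t}. \<beta>' (w s) * fl r \<epsilon> s x)"
        using True by (intro convex_chain_rule(1)[OF _ fl_int dist_sq_convex continuous_on_dist_sq' w_def]) simp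
      moreover have "\<beta> (sm r \<epsilon> 0 x) = 0"
        using sm_between[OF r_measurable r_abs_le, of c 0 C\<^sub>0] r_initial by (simp add: dist_sq_eq_0_iff)
      moreover have "(LBINT s:{0..t}. \<beta>' (w s) * fl r \<epsilon> s x) = (LBINT s:{0..t}. ?k s)"
        unfolding set_lebesgue_integral_def
      proof (rule integral_cong_AE)
        \<comment> \<open>The equation for the mollified density is available for positive times
          only, while the interval of integration contains 0.\<close>
        have "AE s in lborel. s \<noteq> 0" by (rule AE_lborel_singleton)
        with ode show "AE s in lborel. indicator {0..t} s *\<^sub>R (\<beta>' (w s) * fl r \<epsilon> s x) = indicator {0..t} s *\<^sub>R ?k s"
          by eventually_elim (use True in \<open>auto simp: indicator_def\<close>)
        show "(\<lambda>s. indicator {0..t} s *\<^sub>R (\<beta>' (w s) * fl r \<epsilon> s x)) \<in> borel_measurable lborel"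
          using convex_chain_rule(2)[OF _ fl_int dist_sq_convex continuous_on_dist_sq' w_def, of t c C\<^sub>0] True
          unfolding set_integrable_def by (intro borel_measurable_integrable) simp
      qed measurable
      ultimately show ?thesis using True elim by simp
    qed auto
  qed
  have k_meas: "?k \<in> borel_measurable borel" by measurable
  note prim = integral_of_primitive[OF k_meas k_int less_imp_le[OF assms(2)]]
  have "(\<integral>t. indicator {0<..<T} t * \<beta> (sm r \<epsilon> t x) \<partial>lborel) \<le> (\<integral>t. indicator {0<..<T} t * (LBINT s:{0..t}. ?k s) \<partial>lborel)"
  proof (rule integral_mono_AE[OF _ prim(1) AE_le])
    show "integrable lborel (\<lambda>t. indicat_real {0<..<T} t * \<beta> (sm r \<epsilon> t x))"
    proof (rule Bochner_Integration.integrable_bound)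
      show "integrable lborel (\<lambda>t. indicat_real {0<..<T} t * L)"
        by (intro integrable_mult_left integrable_real_indicator) (use assms in auto)
      show "AE t in lborel. norm (indicat_real {0<..<T} t * \<beta> (sm r \<epsilon> t x)) \<le> norm (indicat_real {0<..<T} t * L)"
        using \<beta>_le[OF sm_range] L_pos dist_sq_nonneg by (intro AE_I2) (auto simp: indicator_def)
    qed measurable
  qed
  then show ?thesis unfolding prim(2) .
qed

lemma L1_loc_fl:
  assumes "0 < \<epsilon>"
  shows "L1_loc (\<lambda>p. fl r \<epsilon> (fst p) (snd p))"
  unfolding L1_loc_def
proof safe
  fix S :: real
  let ?p = "\<lambda>p z. p + (0, \<epsilon> *\<^sub>R z)"
  define D where "D = \<bar>S\<bar> + \<epsilon> * R"
  have "(\<integral>\<^sup>+p. ennreal (norm (indicat_real (cball 0 S) p *\<^sub>R fl r \<epsilon> (fst p) (snd p))) \<partial>lborel)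
      \<le> (\<integral>\<^sup>+p. ennreal (C * M / \<epsilon>) * (\<integral>\<^sup>+z. indicator (cball 0 S) p * (indicator (cball (0::'a) R) z * ennreal (norm (u (?p p z)))) \<partial>lborel) \<partial>lborel)"
  proof (rule nn_integral_mono)
    fix p :: "real \<times> 'a"
    obtain t x where p: "p = (t, x)" by (cases p)
    show "ennreal (norm (indicat_real (cball 0 S) p *\<^sub>R fl r \<epsilon> (fst p) (snd p)))
      \<le> ennreal (C * M / \<epsilon>) * (\<integral>\<^sup>+z. indicator (cball 0 S) p * (indicator (cball (0::'a) R) z * ennreal (norm (u (?p p z)))) \<partial>lborel)"
      using nn_integral_fl_bound[OF r_measurable r_abs_le assms, of t x]
      by (cases "norm (t, x) \<le> S") (simp_all add: p)
  qed
  also have "\<dots> = ennreal (C * M / \<epsilon>) * (\<integral>\<^sup>+p. \<integral>\<^sup>+z. indicator (cball 0 S) p * (indicator (cball (0::'a) R) z * ennreal (norm (u (?p p z)))) \<partial>lborel \<partial>lborel)"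
    by (rule nn_integral_cmult) measurable
  also have "(\<integral>\<^sup>+p. \<integral>\<^sup>+z. indicator (cball 0 S) p * (indicator (cball (0::'a) R) z * ennreal (norm (u (?p p z)))) \<partial>lborel \<partial>lborel)
     = (\<integral>\<^sup>+z. \<integral>\<^sup>+p. indicator (cball 0 S) p * (indicator (cball (0::'a) R) z * ennreal (norm (u (?p p z)))) \<partial>lborel \<partial>lborel)"
    by (rule lborel_pair.Fubini'[symmetric]) measurable
  also have "\<dots> \<le> (\<integral>\<^sup>+z. indicator (cball (0::'a) R) z * (\<integral>\<^sup>+p. ennreal (norm (indicat_real (cball 0 D) p *\<^sub>R u p)) \<partial>lborel) \<partial>lborel)"
  proof (rule nn_integral_mono)
    fix z :: 'a
    show "(\<integral>\<^sup>+p. indicator (cball 0 S) p * (indicator (cball (0::'a) R) z * ennreal (norm (u (?p p z)))) \<partial>lborel)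
      \<le> indicator (cball (0::'a) R) z * (\<integral>\<^sup>+p. ennreal (norm (indicat_real (cball 0 D) p *\<^sub>R u p)) \<partial>lborel)"
    proof (cases "norm z \<le> R")
      case True
      have "norm (?p p z) \<le> D" if "norm p \<le> S" for p :: "real \<times> 'a"
      proof -
        have "norm (0::real, \<epsilon> *\<^sub>R z) \<le> \<epsilon> * R" using True assms by (simp add: norm_Pair)
        then show ?thesis using that norm_triangle_ineq[of p "(0, \<epsilon> *\<^sub>R z)"] by (simp add: D_def)
      qed
      then have "(\<integral>\<^sup>+p. indicator (cball 0 S) p * (indicator (cball (0::'a) R) z * ennreal (norm (u (?p p z)))) \<partial>lborel)
        \<le> (\<integral>\<^sup>+p. ennreal (norm (indicat_real (cball 0 D) (?p p z) *\<^sub>R u (?p p z))) \<partial>lborel)"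
      proof (intro nn_integral_mono)
        fix p
        assume D: "\<And>p :: real \<times> 'a. norm p \<le> S \<Longrightarrow> norm (?p p z) \<le> D"
        show "indicator (cball 0 S) p * (indicator (cball (0::'a) R) z * ennreal (norm (u (?p p z))))
          \<le> ennreal (norm (indicat_real (cball 0 D) (?p p z) *\<^sub>R u (?p p z)))"
          using D[of p] True by (cases "norm p \<le> S") simp_all
      qed
      also have "\<dots> = (\<integral>\<^sup>+p. ennreal (norm (indicat_real (cball 0 D) p *\<^sub>R u p)) \<partial>lborel)"
        by (rule nn_integral_lborel_translate[of "\<lambda>p. ennreal (norm (indicat_real (cball 0 D) p *\<^sub>R u p))"]) measurable
      finally show ?thesis using True by simp
    qed simp
  qed
  also have "\<dots> = emeasure lborel (cball (0::'a) R) * (\<integral>\<^sup>+p. ennreal (norm (indicat_real (cball 0 D) p *\<^sub>R u p)) \<partial>lborel)"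
    by (subst nn_integral_multc) simp_all
  also have "ennreal (C * M / \<epsilon>) * \<dots> < \<infinity>"
    using L1_loc_integrable[OF u, of D] emeasure_lborel_cball_finite[of "0::'a" R]
    by (auto simp: integrable_iff_bounded ennreal_mult_less_top)
  finally show "integrable lborel (\<lambda>p. indicat_real (cball 0 S) p *\<^sub>R fl r \<epsilon> (fst p) (snd p))"
    by (auto simp: integrable_iff_bounded mult_left_mono)
qed measurable

text \<open>The spatial gradient of \<open>sm r \<epsilon> t\<close> at x. The derivative falls on
  the kernel centred at x, whence the minus sign.\<close>

definition sg :: "real \<Rightarrow> real \<Rightarrow> 'a \<Rightarrow> 'a" where
  "sg \<epsilon> t x = - (1 / \<epsilon>) *\<^sub>R (\<integral>z. r (t, x + \<epsilon> *\<^sub>R z) *\<^sub>R \<gamma> z \<partial>lborel)"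

text \<open>The commutator of mollification and transport: u \<bullet> grad of the mollified density
  minus the mollified divergence of r u. As a product of increments it is small without any
  derivative of r.\<close>

definition cm :: "real \<Rightarrow> real \<Rightarrow> 'a \<Rightarrow> real" where
  "cm \<epsilon> t x = (1 / \<epsilon>) * (\<integral>z. (r (t, x + \<epsilon> *\<^sub>R z) - r (t, x)) * (\<gamma> z \<bullet> (u (t, x + \<epsilon> *\<^sub>R z) - u (t, x))) \<partial>lborel)"

lemma sg_measurable [measurable]: "(\<lambda>p. sg \<epsilon> (fst p) (snd p)) \<in> borel_measurable borel"
  unfolding sg_def
  by (intro borel_measurable_scaleR borel_measurable_const lborel.borel_measurable_lebesgue_integral) measurable

lemma cm_measurable [measurable]: "(\<lambda>p. cm \<epsilon> (fst p) (snd p)) \<in> borel_measurable borel"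
  unfolding cm_def
  by (intro borel_measurable_times borel_measurable_const lborel.borel_measurable_lebesgue_integral) measurable

lemma r_\<gamma>_integrable: "integrable lborel (\<lambda>z. r (t, x + \<epsilon> *\<^sub>R z) *\<^sub>R \<gamma> z)"
proof (rule Bochner_Integration.integrable_bound)
  show "integrable lborel (\<lambda>z. (C * M) * indicat_real (cball (0::'a) R) z)"
    by (intro integrable_mult_right integrable_real_indicator) (simp_all add: emeasure_lborel_cball_finite[simplified])
  show "AE z in lborel. norm (r (t, x + \<epsilon> *\<^sub>R z) *\<^sub>R \<gamma> z) \<le> norm ((C * M) * indicat_real (cball (0::'a) R) z)"
  proof (rule AE_I2)
    fix z
    have "norm (r (t, x + \<epsilon> *\<^sub>R z) *\<^sub>R \<gamma> z) \<le> C * M"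
      unfolding norm_scaleR using C_pos by (intro mult_mono r_abs_le \<gamma>_le) auto
    then show "norm (r (t, x + \<epsilon> *\<^sub>R z) *\<^sub>R \<gamma> z) \<le> norm ((C * M) * indicat_real (cball (0::'a) R) z)"
      using C_pos M_pos by (cases "R < norm z") (simp_all add: \<gamma>_supp)
  qed
qed measurable

text \<open>The product of increments has four terms. The one with both values at the shifted point
  is the flux; r shifted with u at x gives the gradient of the mollified density. The term with r at
  x and u shifted vanishes by incompressibility, and the one with both values at x because \<gamma>
  has mean zero.\<close>

lemma commutator_identity:
  assumes "0 < \<epsilon>"
  shows "AE p in lborel. fl r \<epsilon> (fst p) (snd p) = cm \<epsilon> (fst p) (snd p) - sg \<epsilon> (fst p) (snd p) \<bullet> u p"
proof -
  have "AE t in lborel. AE x::'a in lborel. L1_loc (\<lambda>y. u (t, y))"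
    using L1_loc_slices[OF u] by eventually_elim simp
  moreover have "AE t in lborel. AE x in lborel. fl (\<lambda>_. 1) \<epsilon> t x = 0"
  proof -
    have "AE p in lborel \<Otimes>\<^sub>M lborel. fl (\<lambda>_. 1) \<epsilon> (fst p) (snd p) = 0"
      using fl_const_eq_0[OF assms] by (simp only: lborel_prod)
    from lborel_pair.AE_pair[OF this] show ?thesis by simp
  qed
  ultimately have "AE t in lborel. AE x in lborel. fl r \<epsilon> t x = cm \<epsilon> t x - sg \<epsilon> t x \<bullet> u (t, x)"
  proof eventually_elim
    case (elim t)
    from elim show ?case
    proof eventually_elim
      case (elim x)
      let ?r = "\<lambda>z. r (t, x + \<epsilon> *\<^sub>R z)" and ?u = "\<lambda>z. u (t, x + \<epsilon> *\<^sub>R z)"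
      have i1: "integrable lborel (\<lambda>z. ?r z * (\<gamma> z \<bullet> ?u z))"
        by (rule fl_integrand_integrable[OF r_measurable r_abs_le elim(1) assms])
      have i2: "integrable lborel (\<lambda>z. ?r z * (\<gamma> z \<bullet> u (t, x)))"
        using integrable_inner_left[OF r_\<gamma>_integrable[of t x \<epsilon>], of "u (t, x)"] by simp
      have "integrable lborel (\<lambda>z. 1 * (\<gamma> z \<bullet> ?u z))"
        by (rule fl_integrand_integrable[where a = "\<lambda>_. 1" and C = 1, OF _ _ elim(1) assms]) simp_all
      then have i3: "integrable lborel (\<lambda>z. r (t, x) * (\<gamma> z \<bullet> ?u z))" by simp
      have i4: "integrable lborel (\<lambda>z. r (t, x) * (\<gamma> z \<bullet> u (t, x)))"
        by (intro integrable_mult_right \<gamma>_inner_integrable)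
      have I1: "(\<integral>z. ?r z * (\<gamma> z \<bullet> ?u z) \<partial>lborel) = \<epsilon> * fl r \<epsilon> t x"
        using assms by (simp add: fl_def)
      have I2: "(\<integral>z. ?r z * (\<gamma> z \<bullet> u (t, x)) \<partial>lborel) = - \<epsilon> * (sg \<epsilon> t x \<bullet> u (t, x))"
        using assms integral_inner_left[OF r_\<gamma>_integrable[of t x \<epsilon>], of "u (t, x)"] by (simp add: sg_def)
      have I3: "(\<integral>z. r (t, x) * (\<gamma> z \<bullet> ?u z) \<partial>lborel) = 0"
        using elim(2) assms by (simp add: fl_def)
      have I4: "(\<integral>z. r (t, x) * (\<gamma> z \<bullet> u (t, x)) \<partial>lborel) = 0"
        by (simp add: \<gamma>_integral)
      have "(\<integral>z. (?r z - r (t, x)) * (\<gamma> z \<bullet> (?u z - u (t, x))) \<partial>lborel)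
          = (\<integral>z. (?r z * (\<gamma> z \<bullet> ?u z) - ?r z * (\<gamma> z \<bullet> u (t, x))) - (r (t, x) * (\<gamma> z \<bullet> ?u z) - r (t, x) * (\<gamma> z \<bullet> u (t, x))) \<partial>lborel)"
        by (intro Bochner_Integration.integral_cong refl) (simp add: algebra_simps)
      also have "\<dots> = \<epsilon> * fl r \<epsilon> t x + \<epsilon> * (sg \<epsilon> t x \<bullet> u (t, x))"
        using i1 i2 i3 i4 by (simp add: Bochner_Integration.integral_diff Bochner_Integration.integrable_diff I1 I2 I3 I4 del: integral_mult_right_zero)
      finally have "cm \<epsilon> t x = (1 / \<epsilon>) * (\<epsilon> * fl r \<epsilon> t x + \<epsilon> * (sg \<epsilon> t x \<bullet> u (t, x)))"
        unfolding cm_def by (simp only:)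
      also have "\<dots> = fl r \<epsilon> t x + sg \<epsilon> t x \<bullet> u (t, x)" using assms by (simp add: distrib_left)
      finally show ?case by simp
    qed
  qed
  then have AE2: "AE t in lborel. AE x in lborel. fl r \<epsilon> (fst (t, x)) (snd (t, x)) = cm \<epsilon> (fst (t, x)) (snd (t, x)) - sg \<epsilon> (fst (t, x)) (snd (t, x)) \<bullet> u (t, x)"
    by simp
  have "{p \<in> space (lborel \<Otimes>\<^sub>M lborel). fl r \<epsilon> (fst p) (snd p) = cm \<epsilon> (fst p) (snd p) - sg \<epsilon> (fst p) (snd p) \<bullet> u p} \<in> sets (lborel \<Otimes>\<^sub>M lborel)"
    unfolding lborel_prod by measurable
  from lborel_pair.AE_pair_measure[OF this AE2] show ?thesis by (simp only: lborel_prod)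
qed

text \<open>Puts the shift of x on the smooth kernel, since r itself is merely bounded and
  measurable.\<close>

lemma sm_shift: "sm r \<epsilon> t (x + s *\<^sub>R v) = (\<integral>z. r (t, x + \<epsilon> *\<^sub>R z) * \<eta> (z - (s / \<epsilon>) *\<^sub>R v) \<partial>lborel)" if "0 < \<epsilon>"
proof -
  have "(\<integral>z. r (t, x + \<epsilon> *\<^sub>R z) * \<eta> (z - (s / \<epsilon>) *\<^sub>R v) \<partial>lborel)
      = (\<integral>z. r (t, x + \<epsilon> *\<^sub>R (z + (s / \<epsilon>) *\<^sub>R v)) * \<eta> ((z + (s / \<epsilon>) *\<^sub>R v) - (s / \<epsilon>) *\<^sub>R v) \<partial>lborel)"
    by (rule integral_lborel_translate[symmetric]) measurable
  also have "\<dots> = sm r \<epsilon> t (x + s *\<^sub>R v)"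
    using that by (simp add: sm_def scaleR_add_right add.assoc add.commute[of "s *\<^sub>R v"])
  finally show ?thesis by simp
qed

lemma \<eta>_diff_le: "\<bar>\<eta> (z - e) - \<eta> z\<bar> \<le> M * norm e"
proof -
  have "\<bar>\<eta> (z - e) - \<eta> z\<bar> = norm (\<integral>\<theta>. - (\<gamma> (z - \<theta> *\<^sub>R e) \<bullet> e) \<partial>unit_meas)"
    using smooth_diff_eq_integral[OF Cc_infinity_smooth[OF Cc], of z e] by (simp add: \<gamma>)
  also have "\<dots> \<le> (\<integral>\<theta>. norm (- (\<gamma> (z - \<theta> *\<^sub>R e) \<bullet> e)) \<partial>unit_meas)" by (rule integral_norm_bound)
  also have "\<dots> \<le> (\<integral>\<theta>. M * norm e \<partial>unit_meas)"
  proof (rule integral_mono_AE')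
    have "norm (- (\<gamma> (z - \<theta> *\<^sub>R e) \<bullet> e)) \<le> M * norm e" for \<theta>
      unfolding norm_minus_cancel
      by (rule order_trans[OF Cauchy_Schwarz_ineq2[folded real_norm_def]]) (intro mult_right_mono \<gamma>_le norm_ge_zero)
    then show "AE \<theta> in unit_meas. norm (- (\<gamma> (z - \<theta> *\<^sub>R e) \<bullet> e)) \<le> M * norm e" by (rule AE_I2)
  qed (use M_pos in simp_all)
  also have "\<dots> = M * norm e"
  proof -
    have "measure unit_meas UNIV = 1" using emeasure_unit_meas by (simp add: measure_def)
    then show ?thesis by simp
  qed
  finally show ?thesis .
qed

lemma sm_derivative:
  assumes "0 < \<epsilon>"
  shows "((\<lambda>s. sm r \<epsilon> t (x + s *\<^sub>R v)) has_real_derivative sg \<epsilon> t x \<bullet> v) (at 0)"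
  unfolding DERIV_def tendsto_at_iff_sequentially
proof (intro allI impI)
  fix h :: "nat \<Rightarrow> real" assume nz: "\<forall>n. h n \<in> UNIV - {0}" and h: "h \<longlonglongrightarrow> 0"
  obtain H where H: "\<And>n. \<bar>h n\<bar> \<le> H"
    using convergent_imp_Bseq[of h] h by (auto simp: convergent_def Bseq_def)
  \<comment> \<open>A convergent sequence h is bounded by some H, so all shifted kernels vanish
    outside one ball, which provides the integrable majorant.\<close>
  define S where "S = R + H / \<epsilon> * norm v"
  let ?r = "\<lambda>z. r (t, x + \<epsilon> *\<^sub>R z)"
  let ?q = "\<lambda>n z. (\<eta> (z - (h n / \<epsilon>) *\<^sub>R v) - \<eta> z) / h n"
  have i\<eta>: "integrable lborel (\<lambda>z. ?r z * \<eta> (z - e))" for e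
  proof -
    have "integrable lborel (\<lambda>z. r (t, x + \<epsilon> *\<^sub>R (z + e)) * \<eta> z)"
      by (rule \<eta>_mult_integrable[of _ C]) (measurable, rule r_abs_le)
    then show ?thesis
      using integrable_lborel_translate_iff[of "\<lambda>z. ?r z * \<eta> (z - e)" e] by simp
  qed
  have "(\<lambda>n. \<integral>z. ?r z * ?q n z \<partial>lborel) \<longlonglongrightarrow> (\<integral>z. ?r z * (- (1 / \<epsilon>) * (\<gamma> z \<bullet> v)) \<partial>lborel)"
  proof (rule integral_dominated_convergence)
    show "integrable lborel (\<lambda>z. (C * (M * (1 / \<epsilon> * norm v))) * indicat_real (cball (0::'a) S) z)"
      by (intro integrable_mult_right integrable_real_indicator) (simp_all add: emeasure_lborel_cball_finite[simplified])
    show "AE z in lborel. norm (?r z * ?q n z) \<le> (C * (M * (1 / \<epsilon> * norm v))) * indicat_real (cball (0::'a) S) z" for n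
    proof (rule AE_I2)
      fix z
      have hn: "0 < \<bar>h n\<bar>" using nz by auto
      have "\<bar>?q n z\<bar> \<le> M * (1 / \<epsilon> * norm v)"
        using \<eta>_diff_le[of z "(h n / \<epsilon>) *\<^sub>R v"] hn assms by (simp add: abs_divide divide_le_eq mult_ac)
      then have "norm (?r z * ?q n z) \<le> C * (M * (1 / \<epsilon> * norm v))"
        unfolding real_norm_def abs_mult using C_pos by (intro mult_mono r_abs_le) auto
      moreover have "?q n z = 0" if "S < norm z"
      proof -
        have "\<bar>h n\<bar> / \<epsilon> * norm v \<le> H / \<epsilon> * norm v"
          using H[of n] assms by (intro mult_right_mono divide_right_mono) auto
        then have "norm ((h n / \<epsilon>) *\<^sub>R v) \<le> H / \<epsilon> * norm v" using assms by (simp add: abs_divide)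
        then have 1: "R < norm (z - (h n / \<epsilon>) *\<^sub>R v)"
          using that norm_triangle_ineq2[of z "(h n / \<epsilon>) *\<^sub>R v"] unfolding S_def by linarith
        have "0 \<le> H / \<epsilon> * norm v" using \<open>norm ((h n / \<epsilon>) *\<^sub>R v) \<le> H / \<epsilon> * norm v\<close> norm_ge_zero order_trans by blast
        then have 2: "R < norm z" using that unfolding S_def by linarith
        show ?thesis using \<eta>_supp[OF 1] \<eta>_supp[OF 2] by simp
      qed
      ultimately show "norm (?r z * ?q n z) \<le> (C * (M * (1 / \<epsilon> * norm v))) * indicat_real (cball (0::'a) S) z"
      proof (cases "S < norm z")
        case False
        then have "indicat_real (cball (0::'a) S) z = 1" by simp
        then show ?thesis using \<open>norm (?r z * ?q n z) \<le> C * (M * (1 / \<epsilon> * norm v))\<close> by (simp only: mult_1_right)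
      next
        case True
        then have "indicat_real (cball (0::'a) S) z = 0" by simp
        then show ?thesis using \<open>S < norm z \<Longrightarrow> ?q n z = 0\<close>[OF True] by (simp only: mult_zero_right norm_zero order_refl)
      qed
    qed
    show "AE z in lborel. (\<lambda>n. ?r z * ?q n z) \<longlonglongrightarrow> ?r z * (- (1 / \<epsilon>) * (\<gamma> z \<bullet> v))"
    proof (intro AE_I2 tendsto_mult_left)
      fix z
      have lin: "((\<lambda>s. z - (s / \<epsilon>) *\<^sub>R v) has_derivative (\<lambda>s. - ((s / \<epsilon>) *\<^sub>R v))) (at 0)"
        using assms by (auto intro!: derivative_eq_intros)
      have "(\<eta> has_derivative frechet_derivative \<eta> (at (z - (0 / \<epsilon>) *\<^sub>R v))) (at (z - (0 / \<epsilon>) *\<^sub>R v))"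
        by (rule smooth_has_derivative[OF Cc_infinity_smooth[OF Cc]])
      from has_derivative_compose[OF lin this]
      have "((\<lambda>s. \<eta> (z - (s / \<epsilon>) *\<^sub>R v)) has_real_derivative - (1 / \<epsilon>) * (\<gamma> z \<bullet> v)) (at 0)"
        by (rule has_derivative_imp_has_field_derivative) (simp add: \<gamma>)
      then have "((\<lambda>s. (\<eta> (z - (s / \<epsilon>) *\<^sub>R v) - \<eta> z) / s) \<longlongrightarrow> - (1 / \<epsilon>) * (\<gamma> z \<bullet> v)) (at 0)"
        by (simp add: DERIV_def)
      moreover have "filterlim h (at 0) sequentially"
        using h nz by (intro filterlim_atI) auto
      ultimately show "(\<lambda>n. ?q n z) \<longlonglongrightarrow> - (1 / \<epsilon>) * (\<gamma> z \<bullet> v)" by (rule filterlim_compose)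
    qed
  qed measurable
  moreover have "(\<integral>z. ?r z * (- (1 / \<epsilon>) * (\<gamma> z \<bullet> v)) \<partial>lborel) = sg \<epsilon> t x \<bullet> v"
  proof -
    have "(\<integral>z. ?r z * (- (1 / \<epsilon>) * (\<gamma> z \<bullet> v)) \<partial>lborel) = (\<integral>z. (- (1 / \<epsilon>)) * ((?r z *\<^sub>R \<gamma> z) \<bullet> v) \<partial>lborel)"
      by (simp add: mult.left_commute)
    also have "\<dots> = (- (1 / \<epsilon>)) * ((\<integral>z. ?r z *\<^sub>R \<gamma> z \<partial>lborel) \<bullet> v)"
      by (simp only: integral_mult_right_zero integral_inner_left[OF r_\<gamma>_integrable])
    finally show ?thesis by (simp add: sg_def)
  qed
  moreover have "(\<integral>z. ?r z * ?q n z \<partial>lborel) = (sm r \<epsilon> t (x + (0 + h n) *\<^sub>R v) - sm r \<epsilon> t (x + 0 *\<^sub>R v)) / h n" for n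
  proof -
    have "(\<integral>z. ?r z * ?q n z \<partial>lborel) = (\<integral>z. (?r z * \<eta> (z - (h n / \<epsilon>) *\<^sub>R v) - ?r z * \<eta> (z - 0)) / h n \<partial>lborel)"
      by (simp add: right_diff_distrib diff_divide_distrib)
    also have "\<dots> = ((\<integral>z. ?r z * \<eta> (z - (h n / \<epsilon>) *\<^sub>R v) \<partial>lborel) - (\<integral>z. ?r z * \<eta> (z - 0) \<partial>lborel)) / h n"
      by (simp only: integral_divide_zero Bochner_Integration.integral_diff[OF i\<eta> i\<eta>])
    finally show ?thesis using sm_shift[OF assms, of t x "h n" v] sm_shift[OF assms, of t x 0 v] by simp
  qed
  ultimately show "((\<lambda>s. (sm r \<epsilon> t (x + (0 + s) *\<^sub>R v) - sm r \<epsilon> t (x + 0 *\<^sub>R v)) / s) \<circ> h) \<longlonglongrightarrow> sg \<epsilon> t x \<bullet> v"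
    by (simp only: comp_def)
qed

lemma sg_bounded:
  assumes "0 < \<epsilon>"
  shows "norm (sg \<epsilon> t x) \<le> 1 / \<epsilon> * (C * M * measure lborel (cball (0::'a) R))"
proof -
  have "norm (\<integral>z. r (t, x + \<epsilon> *\<^sub>R z) *\<^sub>R \<gamma> z \<partial>lborel) \<le> (\<integral>z. norm (r (t, x + \<epsilon> *\<^sub>R z) *\<^sub>R \<gamma> z) \<partial>lborel)"
    by (rule integral_norm_bound)
  also have "\<dots> \<le> (\<integral>z. (C * M) * indicat_real (cball (0::'a) R) z \<partial>lborel)"
  proof (rule integral_mono[OF integrable_norm[OF r_\<gamma>_integrable]])
    show "integrable lborel (\<lambda>z. (C * M) * indicat_real (cball (0::'a) R) z)"
      by (intro integrable_mult_right integrable_real_indicator) (simp_all add: emeasure_lborel_cball_finite[simplified])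
    fix z
    have "norm (r (t, x + \<epsilon> *\<^sub>R z) *\<^sub>R \<gamma> z) \<le> C * M"
      unfolding norm_scaleR using C_pos by (intro mult_mono r_abs_le \<gamma>_le) auto
    then show "norm (r (t, x + \<epsilon> *\<^sub>R z) *\<^sub>R \<gamma> z) \<le> (C * M) * indicat_real (cball (0::'a) R) z"
      by (cases "R < norm z") (simp_all add: \<gamma>_supp)
  qed
  also have "\<dots> = C * M * measure lborel (cball (0::'a) R)" by simp
  finally have "1 / \<epsilon> * norm (\<integral>z. r (t, x + \<epsilon> *\<^sub>R z) *\<^sub>R \<gamma> z \<partial>lborel) \<le> 1 / \<epsilon> * (C * M * measure lborel (cball (0::'a) R))"
    using assms by (intro mult_left_mono) auto
  then show ?thesis using assms by (simp add: sg_def)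
qed

end

subsection \<open>Passage to the limit\<close>

lemma lborel_fubini_snd:
  fixes f :: "'a::euclidean_space \<times> 'b::euclidean_space \<Rightarrow> real"
  assumes "integrable lborel f"
  shows "(\<integral>p. f p \<partial>lborel) = (\<integral>y. \<integral>x. f (x, y) \<partial>lborel \<partial>lborel)"
    and "integrable lborel (\<lambda>y. \<integral>x. f (x, y) \<partial>lborel)"
proof -
  have i: "integrable (lborel \<Otimes>\<^sub>M lborel) (\<lambda>(x, y). f (x, y))"
    using assms by (simp add: lborel_prod)
  show "(\<integral>p. f p \<partial>lborel) = (\<integral>y. \<integral>x. f (x, y) \<partial>lborel \<partial>lborel)"
    using lborel_pair.integral_snd[OF i] by (simp add: lborel_prod)
  show "integrable lborel (\<lambda>y. \<integral>x. f (x, y) \<partial>lborel)"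
    by (rule lborel_pair.integrable_snd[OF i])
qed

text \<open>The cut-off is required to be differentiable with bounded derivative rather than smooth,
  which admits a squared positive part. N bounds its gradient, S the radius of its support, and T is
  the final time.\<close>

locale cutoff = transport \<eta> \<gamma> M R u r g c C\<^sub>0 C B
  for \<eta> :: "'a::euclidean_space \<Rightarrow> real" and \<gamma> M R and u :: "real \<times> 'a \<Rightarrow> 'a"
    and r g c C\<^sub>0 C B +
  fixes \<phi> :: "'a \<Rightarrow> real" and \<phi>' :: "'a \<Rightarrow> 'a" and N S T :: real
  assumes \<phi>_deriv: "\<And>x. (\<phi> has_derivative (\<lambda>v. \<phi>' x \<bullet> v)) (at x)"
    and \<phi>'_measurable [measurable]: "\<phi>' \<in> borel_measurable borel"
    and \<phi>_bounds: "\<And>x. 0 \<le> \<phi> x" "\<And>x. \<phi> x \<le> 1" and \<phi>'_le: "\<And>x. norm (\<phi>' x) \<le> N"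
    and \<phi>_supp: "\<And>x. S < norm x \<Longrightarrow> \<phi> x = 0" "\<And>x. S < norm x \<Longrightarrow> \<phi>' x = 0"
    and T_pos: "0 < T" and S_pos: "0 < S"
begin

lemma \<phi>_measurable [measurable]: "\<phi> \<in> borel_measurable borel"
  by (intro borel_measurable_continuous_onI continuous_at_imp_continuous_on ballI has_derivative_continuous[OF \<phi>_deriv])

lemma N_nonneg: "0 \<le> N"
  using norm_ge_zero \<phi>'_le order_trans by blast

text \<open>A bounded region outside which the time weight or the cut-off vanishes.\<close>

abbreviation Q :: "(real \<times> 'a) set" where "Q \<equiv> cball 0 (T + S)"

lemma outside_Q: "p \<notin> Q \<Longrightarrow> wt T (fst p) = 0 \<or> S < norm (snd p)"
proof (rule ccontr)
  assume "p \<notin> Q" "\<not> (wt T (fst p) = 0 \<or> S < norm (snd p))"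
  then have "norm (fst p) \<le> T" "norm (snd p) \<le> S" "T + S < norm p" by (auto simp: wt_def split: if_splits)
  then show False using norm_Pair_le[of "fst p" "snd p"] by simp
qed

lemma slab_outside_Q: "p \<notin> Q \<Longrightarrow> p \<in> slab T \<Longrightarrow> S < norm (snd p)"
proof (rule ccontr)
  assume "p \<notin> Q" "p \<in> slab T" "\<not> S < norm (snd p)"
  then have "norm (fst p) \<le> T" "norm (snd p) \<le> S" "T + S < norm p" by (auto simp: slab_def)
  then show False using norm_Pair_le[of "fst p" "snd p"] by simp
qed

text \<open>At t = 0 the weight still has the value T while the slab is open, so the identity holds
  only off a null set.\<close>

lemma wt_slab: "AE p :: real \<times> 'a in lborel. wt T (fst p) = indicator (slab T) p * wt T (fst p)"
proof (rule AE_lborel_prodI)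
  show "AE t in lborel. wt T (fst (t, x)) = indicator (slab T) (t, x) * wt T (fst (t, x))" for x :: 'a
  proof -
    have "AE t in lborel. t \<noteq> 0" by (rule AE_lborel_singleton)
    then show ?thesis
      unfolding fst_conv indicator_slab by eventually_elim (auto simp: wt_def indicator_def)
  qed
qed measurable

lemma wt_le: "0 \<le> wt T s" "wt T s \<le> T" "\<bar>wt T s\<bar> \<le> T"
  using T_pos by (auto simp: wt_def)

text \<open>The vector multiplied with u is the spatial gradient of the time weight times
  \<open>\<beta>\<close> of the mollified density times \<phi>, and u has divergence zero. The jump
  of the time weight does no harm because only spatial derivatives are taken.\<close>

lemma by_parts:
  assumes "0 < \<epsilon>"
  shows "(\<integral>p. u p \<bullet> (wt T (fst p) *\<^sub>R ((\<beta>' (sm r \<epsilon> (fst p) (snd p)) * \<phi> (snd p)) *\<^sub>R sg \<epsilon> (fst p) (snd p)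
      + \<beta> (sm r \<epsilon> (fst p) (snd p)) *\<^sub>R \<phi>' (snd p))) \<partial>lborel) = 0"
proof -
  let ?s = "\<lambda>p. sm r \<epsilon> (fst p) (snd p)"
  let ?\<Psi> = "\<lambda>p. wt T (fst p) * (\<beta> (?s p) * \<phi> (snd p))"
  let ?d = "\<lambda>p. wt T (fst p) *\<^sub>R ((\<beta>' (?s p) * \<phi> (snd p)) *\<^sub>R sg \<epsilon> (fst p) (snd p) + \<beta> (?s p) *\<^sub>R \<phi>' (snd p))"
  define G where "G = 1 / \<epsilon> * (C * M * measure lborel (cball (0::'a) R))"
  \<comment> \<open>\<open>weak_derivative_by_parts\<close> takes one bound for the test function
    and its derivative; the sum dominates both.\<close>
  define D where "D = T * (L * G + L * N) + T * L"
  have G0: "0 \<le> G" using sg_bounded[OF assms, of 0 0] norm_ge_zero order_trans unfolding G_def by blast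
  have d_le: "norm (?d p) \<le> T * (L * G + L * N)" for p
  proof -
    have "norm (?d p) \<le> T * (L * 1 * G + L * N)"
      unfolding norm_scaleR
    proof (intro mult_mono norm_triangle_le add_mono)
      show "norm ((\<beta>' (?s p) * \<phi> (snd p)) *\<^sub>R sg \<epsilon> (fst p) (snd p)) \<le> L * 1 * G"
        unfolding norm_scaleR abs_mult using L_pos \<phi>_bounds sg_bounded[OF assms] G0
        by (intro mult_mono \<beta>'_le sm_range) (auto simp: G_def)
      show "norm (\<beta> (?s p) *\<^sub>R \<phi>' (snd p)) \<le> L * N"
        unfolding norm_scaleR using L_pos \<beta>_le[OF sm_range] dist_sq_nonneg by (intro mult_mono \<phi>'_le) auto
    qed (use wt_le T_pos in auto)
    then show ?thesis by simp
  qed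
  have \<Psi>_le: "\<bar>?\<Psi> p\<bar> \<le> T * L" for p
  proof -
    have "\<bar>wt T (fst p)\<bar> * (\<bar>\<beta> (?s p)\<bar> * \<bar>\<phi> (snd p)\<bar>) \<le> T * (L * 1)"
      using wt_le T_pos L_pos \<beta>_le[OF sm_range] dist_sq_nonneg \<phi>_bounds by (intro mult_mono) auto
    then show ?thesis by (simp add: abs_mult)
  qed
  have nonneg: "0 \<le> T * (L * G + L * N)" "0 \<le> T * L" using T_pos L_pos G0 N_nonneg by auto
  have parts: "(\<integral>p. (u p \<bullet> i) * (?d p \<bullet> i) \<partial>lborel) = - (\<integral>p. (g i p \<bullet> i) * ?\<Psi> p \<partial>lborel)" if i: "i \<in> Basis" for i
  proof (rule weak_derivative_by_parts[OF L1_loc_inner[OF u] L1_loc_inner[OF g_L1_loc[OF i]] weak_gradient[OF _ i i]])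
    show "((\<lambda>s. ?\<Psi> (p + s *\<^sub>R (0, i))) has_real_derivative ?d p \<bullet> i) (at 0)" for p
    proof -
      obtain t x where p: "p = (t, x)" by (cases p)
      have s: "((\<lambda>s. sm r \<epsilon> t (x + s *\<^sub>R i)) has_real_derivative sg \<epsilon> t x \<bullet> i) (at 0)"
        by (rule sm_derivative[OF assms])
      have "((\<lambda>s. \<beta> (sm r \<epsilon> t (x + s *\<^sub>R i))) has_real_derivative \<beta>' (sm r \<epsilon> t (x + 0 *\<^sub>R i)) * (sg \<epsilon> t x \<bullet> i)) (at 0)"
        by (rule DERIV_chain2[OF dist_sq_deriv s])
      moreover have "((\<lambda>s. \<phi> (x + s *\<^sub>R i)) has_real_derivative \<phi>' x \<bullet> i) (at 0)"
      proof -
        have "((\<lambda>s. x + s *\<^sub>R i) has_derivative (\<lambda>s. s *\<^sub>R i)) (at 0)" by (auto intro!: derivative_eq_intros)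
        moreover have "(\<phi> has_derivative (\<lambda>v. \<phi>' x \<bullet> v)) (at (x + 0 *\<^sub>R i))" using \<phi>_deriv[of x] by simp
        ultimately have "((\<lambda>s. \<phi> (x + s *\<^sub>R i)) has_derivative (\<lambda>s. \<phi>' x \<bullet> (s *\<^sub>R i))) (at 0)"
          by (rule has_derivative_compose)
        then show ?thesis by (rule has_derivative_imp_has_field_derivative) simp
      qed
      ultimately show ?thesis
        unfolding p by (auto intro!: derivative_eq_intros simp: inner_add_left algebra_simps)
    qed
    show "\<bar>?d p \<bullet> i\<bar> \<le> D" for p
      using Basis_le_norm[OF i, of "?d p"] d_le[of p] nonneg(2) unfolding D_def by linarith
    show "\<bar>?\<Psi> p\<bar> \<le> D" for p
      using \<Psi>_le[of p] nonneg(1) unfolding D_def by linarith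
    show "?\<Psi> p = 0" if "T + S < norm p" for p
      using outside_Q[of p] that \<phi>_supp(1)[of "snd p"] by auto
  qed measurable
  have out: "?d p = 0" if "T + S < norm p" for p
    using outside_Q[of p] that \<phi>_supp[of "snd p"] by auto
  have iu: "integrable lborel (\<lambda>p. (u p \<bullet> i) * (?d p \<bullet> i))" if i: "i \<in> Basis" for i
  proof (rule L1_loc_mult_real[OF L1_loc_inner[OF u], where M = D and R = "T + S"])
    show "\<bar>?d p \<bullet> i\<bar> \<le> D" for p
      using Basis_le_norm[OF i, of "?d p"] d_le[of p] nonneg(2) unfolding D_def by linarith
    show "?d p \<bullet> i = 0" if "T + S < norm p" for p by (simp only: out[OF that] inner_zero_left)
  qed measurable
  have ig: "integrable lborel (\<lambda>p. (g i p \<bullet> i) * ?\<Psi> p)" if i: "i \<in> Basis" for i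
  proof (rule L1_loc_mult_real[OF L1_loc_inner[OF g_L1_loc[OF i]], where M = "T * L" and R = "T + S"])
    show "?\<Psi> p = 0" if "T + S < norm p" for p
      using outside_Q[of p] that \<phi>_supp(1)[of "snd p"] by auto
  qed (use \<Psi>_le in auto)
  have "(\<integral>p. u p \<bullet> ?d p \<partial>lborel) = (\<integral>p. (\<Sum>i\<in>Basis. (u p \<bullet> i) * (?d p \<bullet> i)) \<partial>lborel)"
    by (subst euclidean_inner) (rule refl)
  also have "\<dots> = (\<Sum>i\<in>Basis. - (\<integral>p. (g i p \<bullet> i) * ?\<Psi> p \<partial>lborel))"
    by (subst Bochner_Integration.integral_sum[OF iu]) (simp_all only: parts cong: sum.cong)
  also have "\<dots> = - (\<integral>p. (\<Sum>i\<in>Basis. (g i p \<bullet> i) * ?\<Psi> p) \<partial>lborel)"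
    by (subst Bochner_Integration.integral_sum[OF ig]) (simp_all only: sum_negf)
  also have "(\<integral>p. (\<Sum>i\<in>Basis. (g i p \<bullet> i) * ?\<Psi> p) \<partial>lborel) = (\<integral>p. 0 \<partial>(lborel :: (real \<times> 'a) measure))"
  proof (rule integral_cong_AE)
    show "AE p in lborel. (\<Sum>i\<in>Basis. (g i p \<bullet> i) * ?\<Psi> p) = 0"
      using divergence_free by eventually_elim (simp only: sum_distrib_right[symmetric] mult_zero_left)
    show "(\<lambda>p. \<Sum>i\<in>Basis. (g i p \<bullet> i) * ?\<Psi> p) \<in> borel_measurable lborel"
      by (rule borel_measurable_sum) measurable
  qed simp
  finally show ?thesis by simp
qed

text \<open>The inequality in time is multiplied by \<phi>(x) and integrated over x. The flux is
  then split into the commutator and the transport term, and the latter is moved onto the cut-off by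
  parts.\<close>

lemma mollified_inequality:
  assumes "0 < \<epsilon>"
  shows "(\<integral>p. indicator (slab T) p * \<beta> (sm r \<epsilon> (fst p) (snd p)) * \<phi> (snd p) \<partial>lborel)
    \<le> (\<integral>p. wt T (fst p) * \<beta>' (sm r \<epsilon> (fst p) (snd p)) * \<phi> (snd p) * cm \<epsilon> (fst p) (snd p) \<partial>lborel)
      + (\<integral>p. wt T (fst p) * \<beta> (sm r \<epsilon> (fst p) (snd p)) * (\<phi>' (snd p) \<bullet> u p) \<partial>lborel)"
proof -
  let ?s = "\<lambda>p. sm r \<epsilon> (fst p) (snd p)" and ?f = "\<lambda>p. fl r \<epsilon> (fst p) (snd p)"
  let ?sg = "\<lambda>p. sg \<epsilon> (fst p) (snd p)"
  let ?a = "\<lambda>p. indicator (slab T) p * \<beta> (?s p) * \<phi> (snd p)"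
  let ?k = "\<lambda>p. wt T (fst p) * \<beta>' (?s p) * \<phi> (snd p)"
  have k_le: "\<bar>?k p\<bar> \<le> T * L * 1" for p
    unfolding abs_mult using T_pos L_pos wt_le \<phi>_bounds by (intro mult_mono \<beta>'_le sm_range) auto
  have k_out: "?k p = 0" if "T + S < norm p" for p
    using outside_Q[of p] that \<phi>_supp(1)[of "snd p"] by auto
  have ia: "integrable lborel ?a"
  proof (rule Bochner_Integration.integrable_bound)
    show "integrable lborel (\<lambda>p. L * indicat_real Q p)"
      by (intro integrable_mult_right integrable_real_indicator) (simp_all add: emeasure_lborel_cball_finite[simplified])
    show "AE p in lborel. norm (?a p) \<le> norm (L * indicat_real Q p)"
    proof (rule AE_I2)
      fix p
      have "\<bar>?a p\<bar> \<le> 1 * L * 1"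
        unfolding abs_mult using L_pos \<beta>_le[OF sm_range] dist_sq_nonneg \<phi>_bounds
        by (intro mult_mono) (auto simp: indicator_def)
      moreover have "?a p = 0" if "p \<notin> Q"
        using slab_outside_Q[OF that] \<phi>_supp(1)[of "snd p"] by (cases "p \<in> slab T") auto
      ultimately show "norm (?a p) \<le> norm (L * indicat_real Q p)"
        using L_pos by (cases "p \<in> Q") auto
    qed
  qed measurable
  have ikf: "integrable lborel (\<lambda>p. ?f p * ?k p)"
    by (rule L1_loc_mult_real[OF L1_loc_fl[OF assms], where M = "T * L * 1" and R = "T + S"])
       (measurable, rule k_le, rule k_out)
  have iksg: "integrable lborel (\<lambda>p. (?k p *\<^sub>R ?sg p) \<bullet> u p)"
  proof (rule L1_loc_inner_mult[OF u, where M = "T * L * 1 * (1 / \<epsilon> * (C * M * measure lborel (cball (0::'a) R)))" and R = "T + S"])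
    show "norm (?k p *\<^sub>R ?sg p) \<le> T * L * 1 * (1 / \<epsilon> * (C * M * measure lborel (cball (0::'a) R)))" for p
      unfolding norm_scaleR using T_pos L_pos by (intro mult_mono k_le sg_bounded assms) auto
    show "?k p *\<^sub>R ?sg p = 0" if "T + S < norm p" for p by (simp only: k_out[OF that] scaleR_zero_left)
  qed measurable
  have ip: "integrable lborel (\<lambda>p. wt T (fst p) * \<beta> (?s p) * (\<phi>' (snd p) \<bullet> u p))"
  proof -
    have "integrable lborel (\<lambda>p. ((wt T (fst p) * \<beta> (?s p)) *\<^sub>R \<phi>' (snd p)) \<bullet> u p)"
    proof (rule L1_loc_inner_mult[OF u, where M = "T * L * N" and R = "T + S"])
      show "norm ((wt T (fst p) * \<beta> (?s p)) *\<^sub>R \<phi>' (snd p)) \<le> T * L * N" for p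
        unfolding norm_scaleR abs_mult using T_pos L_pos wt_le \<beta>_le[OF sm_range] dist_sq_nonneg
        by (intro mult_mono \<phi>'_le) auto
      show "(wt T (fst p) * \<beta> (?s p)) *\<^sub>R \<phi>' (snd p) = 0" if "T + S < norm p" for p
        using outside_Q[of p] that \<phi>_supp(2)[of "snd p"] by auto
    qed measurable
    then show ?thesis by simp
  qed
  have AEk: "AE p in lborel. ?f p * ?k p = ?k p * cm \<epsilon> (fst p) (snd p) - (?k p *\<^sub>R ?sg p) \<bullet> u p"
    using commutator_identity[OF assms]
  proof eventually_elim
    case (elim p)
    have "(a - b) * k = k * a - k * b" for a b k :: real by (simp add: algebra_simps)
    then show ?case unfolding elim inner_scaleR_left .
  qed
  \<comment> \<open>Integrability of the commutator term follows from that of the flux and of the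
    transport term by the identity, ahead of any estimate of the commutator.\<close>
  have ikc: "integrable lborel (\<lambda>p. ?k p * cm \<epsilon> (fst p) (snd p))"
  proof (rule integrable_cong_AE[THEN iffD1, OF _ _ _ Bochner_Integration.integrable_add[OF ikf iksg]])
    show "AE p in lborel. ?f p * ?k p + (?k p *\<^sub>R ?sg p) \<bullet> u p = ?k p * cm \<epsilon> (fst p) (snd p)"
      using AEk by eventually_elim linarith
  qed measurable
  have "(\<integral>p. ?a p \<partial>lborel) = (\<integral>x. \<integral>t. ?a (t, x) \<partial>lborel \<partial>lborel)"
    by (rule lborel_fubini_snd(1)[OF ia])
  \<comment> \<open>Time is the inner variable because the inequality is available after integration
    in time, for every x.\<close>
  also have "\<dots> \<le> (\<integral>x. \<integral>t. ?f (t, x) * ?k (t, x) \<partial>lborel \<partial>lborel)"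
  proof (rule integral_mono)
    show "integrable lborel (\<lambda>x. \<integral>t. ?a (t, x) \<partial>lborel)"
      by (rule lborel_fubini_snd(2)[OF ia])
    show "integrable lborel (\<lambda>x. \<integral>t. ?f (t, x) * ?k (t, x) \<partial>lborel)"
      by (rule lborel_fubini_snd(2)[OF ikf])
    fix x
    have "(\<integral>t. ?a (t, x) \<partial>lborel) = (\<integral>t. indicator {0<..<T} t * \<beta> (sm r \<epsilon> t x) \<partial>lborel) * \<phi> x"
      by simp
    also have "\<dots> \<le> (\<integral>s. wt T s * (\<beta>' (sm r \<epsilon> s x) * fl r \<epsilon> s x) \<partial>lborel) * \<phi> x"
      by (rule mult_right_mono[OF convex_time_inequality[OF assms T_pos] \<phi>_bounds(1)])
    also have "\<dots> = (\<integral>t. ?f (t, x) * ?k (t, x) \<partial>lborel)"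
      by (subst integral_mult_left_zero[symmetric]) (simp add: mult_ac)
    finally show "(\<integral>t. ?a (t, x) \<partial>lborel) \<le> (\<integral>t. ?f (t, x) * ?k (t, x) \<partial>lborel)" .
  qed
  also have "\<dots> = (\<integral>p. ?f p * ?k p \<partial>lborel)"
    by (rule lborel_fubini_snd(1)[OF ikf, symmetric])
  also have "\<dots> = (\<integral>p. ?k p * cm \<epsilon> (fst p) (snd p) - (?k p *\<^sub>R ?sg p) \<bullet> u p \<partial>lborel)"
    by (rule integral_cong_AE) (measurable, rule AEk)
  also have "\<dots> = (\<integral>p. ?k p * cm \<epsilon> (fst p) (snd p) \<partial>lborel) - (\<integral>p. (?k p *\<^sub>R ?sg p) \<bullet> u p \<partial>lborel)"
    by (rule Bochner_Integration.integral_diff[OF ikc iksg])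
  also have "(\<integral>p. (?k p *\<^sub>R ?sg p) \<bullet> u p \<partial>lborel) = - (\<integral>p. wt T (fst p) * \<beta> (?s p) * (\<phi>' (snd p) \<bullet> u p) \<partial>lborel)"
  proof -
    have "(\<integral>p. (?k p *\<^sub>R ?sg p) \<bullet> u p \<partial>lborel) + (\<integral>p. wt T (fst p) * \<beta> (?s p) * (\<phi>' (snd p) \<bullet> u p) \<partial>lborel)
      = (\<integral>p. (?k p *\<^sub>R ?sg p) \<bullet> u p + wt T (fst p) * \<beta> (?s p) * (\<phi>' (snd p) \<bullet> u p) \<partial>lborel)"
      by (rule Bochner_Integration.integral_add[OF iksg ip, symmetric])
    also have "\<dots> = (\<integral>p. u p \<bullet> (wt T (fst p) *\<^sub>R ((\<beta>' (?s p) * \<phi> (snd p)) *\<^sub>R ?sg p + \<beta> (?s p) *\<^sub>R \<phi>' (snd p))) \<partial>lborel)"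
      by (intro Bochner_Integration.integral_cong refl) (simp add: inner_add_right inner_commute[of "u _"] algebra_simps)
    also have "\<dots> = 0" by (rule by_parts[OF assms])
    finally show ?thesis by simp
  qed
  finally show ?thesis by simp
qed

end

section \<open>Moduli of continuity and convergence of the three terms\<close>

lemma ennreal_power2_le_imp_le:
  fixes X :: ennreal
  assumes "X\<^sup>2 \<le> ennreal (y\<^sup>2)" "0 \<le> y"
  shows "X \<le> ennreal y"
proof (cases X)
  case (real x)
  then have "x\<^sup>2 \<le> y\<^sup>2" using assms by (simp add: ennreal_power ennreal_le_iff)
  then have "x \<le> y" by (rule power2_le_imp_le) (rule assms)
  then show ?thesis using real by (simp add: ennreal_leI)
next
  case top
  then have "(top :: ennreal) \<le> ennreal (y\<^sup>2)" using assms(1) by (simp add: power2_eq_square ennreal_top_mult)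
  then show ?thesis by (simp add: top_unique)
qed

lemma abs_diff_product:
  fixes a x x' y :: real
  shows "\<bar>a * x * y - a * x' * y\<bar> = \<bar>a\<bar> * (\<bar>x - x'\<bar> * \<bar>y\<bar>)"
proof -
  have "a * x * y - a * x' * y = a * ((x - x') * y)" by (simp add: algebra_simps)
  then show ?thesis by (simp only: abs_mult)
qed

lemma ennreal_square_le:
  assumes "a \<le> C"
  shows "(ennreal a)\<^sup>2 \<le> ennreal C * ennreal a"
  unfolding power2_eq_square by (intro mult_right_mono ennreal_leI assms) simp

lemma abs_integral_le_of_nn_integral:
  fixes f :: "'a \<Rightarrow> real"
  assumes "(\<integral>\<^sup>+x. ennreal \<bar>f x\<bar> \<partial>M) \<le> ennreal y" "0 \<le> y"
  shows "\<bar>\<integral>x. f x \<partial>M\<bar> \<le> y"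
proof -
  have "ennreal (norm (\<integral>x. f x \<partial>M)) \<le> (\<integral>\<^sup>+x. ennreal (norm (f x)) \<partial>M)" by (rule norm_integral_le_nn_integral)
  also have "\<dots> \<le> ennreal y" using assms(1) by simp
  finally show ?thesis using assms(2) by (simp add: ennreal_le_iff)
qed

context cutoff
begin

definition e :: "nat \<Rightarrow> real" where "e n = 1 / real (Suc n)"

lemma e_bounds: "0 < e n" "e n \<le> 1"
  by (auto simp: e_def)

lemma e_tendsto: "e \<longlonglongrightarrow> 0"
  unfolding e_def[abs_def] using LIMSEQ_inverse_real_of_nat by (simp add: inverse_eq_divide)

text \<open>The L1 modulus of continuity in space of the density on Q, at the shift
  \<open>e n *\<^sub>R z\<close>.\<close>

definition \<tau> :: "nat \<Rightarrow> 'a \<Rightarrow> real" where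
  "\<tau> n z = (\<integral>p. indicator Q p * \<bar>r (p + (0, e n *\<^sub>R z)) - r p\<bar> \<partial>lborel)"

lemma Q_finite: "emeasure lborel Q < \<infinity>"
  by (rule emeasure_lborel_cball_finite)

lemma r_diff_le: "\<bar>r p - r q\<bar> \<le> C"
  using r_nonneg[of p] r_le[of p] r_nonneg[of q] r_le[of q] by linarith

lemma \<tau>_integrable: "integrable lborel (\<lambda>p. indicator Q p * \<bar>r (p + (0, e n *\<^sub>R z)) - r p\<bar>)"
proof (rule Bochner_Integration.integrable_bound)
  show "integrable lborel (\<lambda>p. C * indicat_real Q p)"
    using Q_finite by (intro integrable_mult_right integrable_real_indicator) auto
  show "AE p in lborel. norm (indicat_real Q p * \<bar>r (p + (0, e n *\<^sub>R z)) - r p\<bar>) \<le> norm (C * indicat_real Q p)"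
    using r_diff_le C_pos by (intro AE_I2) (simp add: indicator_def)
qed measurable

lemma \<tau>_nonneg: "0 \<le> \<tau> n z"
  unfolding \<tau>_def by (rule integral_nonneg_AE) simp

lemma \<tau>_le: "\<tau> n z \<le> C * measure lborel Q"
proof -
  have "\<tau> n z \<le> (\<integral>p. C * indicat_real Q p \<partial>lborel)"
    unfolding \<tau>_def
  proof (rule integral_mono[OF \<tau>_integrable])
    show "integrable lborel (\<lambda>p. C * indicat_real Q p)"
      using Q_finite by (intro integrable_mult_right integrable_real_indicator) auto
    show "indicat_real Q p * \<bar>r (p + (0, e n *\<^sub>R z)) - r p\<bar> \<le> C * indicat_real Q p" for p
      using r_diff_le C_pos by (simp add: indicator_def)
  qed
  then show ?thesis by simp
qed

lemma \<tau>_measurable [measurable]: "\<tau> n \<in> borel_measurable borel"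
  unfolding \<tau>_def[abs_def] by (intro lborel.borel_measurable_lebesgue_integral) measurable

lemma \<tau>_tendsto: "(\<lambda>n. \<tau> n z) \<longlonglongrightarrow> 0"
proof (rule Lim_null_comparison)
  \<comment> \<open>The ball contains every point of Q and each of its shifts, as \<open>e n\<close>
    is at most 1. On Q the increments of f are therefore those of r, and f is integrable.\<close>
  define f where "f p = indicat_real (cball 0 (T + S + norm z)) p * r p" for p
  have [measurable]: "f \<in> borel_measurable borel" unfolding f_def[abs_def] by measurable
  have f: "integrable lborel f"
  proof (rule Bochner_Integration.integrable_bound)
    show "integrable lborel (\<lambda>p. C * indicat_real (cball (0::real \<times> 'a) (T + S + norm z)) p)"
      by (intro integrable_mult_right integrable_real_indicator) (simp_all add: emeasure_lborel_cball_finite[simplified])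
    show "AE p in lborel. norm (f p) \<le> norm (C * indicat_real (cball (0::real \<times> 'a) (T + S + norm z)) p)"
      using r_abs_le C_pos by (intro AE_I2) (simp add: indicator_def f_def)
  qed measurable
  have "(\<lambda>n. (0::real, e n *\<^sub>R z)) \<longlonglongrightarrow> (0, 0 *\<^sub>R z)"
    by (intro tendsto_intros e_tendsto)
  then have h: "(\<lambda>n. (0::real, e n *\<^sub>R z)) \<longlonglongrightarrow> 0" by (simp add: zero_prod_def)
  show "(\<lambda>n. \<integral>p. \<bar>f (p + (0, e n *\<^sub>R z)) - f p\<bar> \<partial>lborel) \<longlonglongrightarrow> 0"
    using L1_translation_continuous[OF f] h unfolding L1_translation_continuous_def by blast
  have "\<tau> n z \<le> (\<integral>p. \<bar>f (p + (0, e n *\<^sub>R z)) - f p\<bar> \<partial>lborel)" for n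
    unfolding \<tau>_def
  proof (rule integral_mono[OF \<tau>_integrable])
    show "integrable lborel (\<lambda>p. \<bar>f (p + (0, e n *\<^sub>R z)) - f p\<bar>)"
      using f integrable_lborel_translate_iff[of f "(0, e n *\<^sub>R z)"]
      by (intro integrable_abs Bochner_Integration.integrable_diff) simp_all
    fix p
    have "norm (e n *\<^sub>R z) \<le> norm z" using e_bounds[of n] by (simp add: mult_left_le_one_le)
    then have "norm (p + (0, e n *\<^sub>R z)) \<le> T + S + norm z" if "p \<in> Q"
      using norm_triangle_ineq[of p "(0, e n *\<^sub>R z)"] that by (simp add: norm_Pair)
    moreover have "norm p \<le> T + S + norm z" if "p \<in> Q"
      using that norm_ge_zero[of z] unfolding mem_cball_0 by linarith
    ultimately show "indicat_real Q p * \<bar>r (p + (0, e n *\<^sub>R z)) - r p\<bar> \<le> \<bar>f (p + (0, e n *\<^sub>R z)) - f p\<bar>"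
      by (cases "p \<in> Q") (simp_all add: f_def)
  qed
  then show "\<forall>\<^sub>F n in sequentially. norm (\<tau> n z) \<le> (\<integral>p. \<bar>f (p + (0, e n *\<^sub>R z)) - f p\<bar> \<partial>lborel)"
    using \<tau>_nonneg by simp
qed

text \<open>The square root is produced by Cauchy-Schwarz in the commutator estimate, in which the
  density increment enters through its L2 norm.\<close>

definition \<omega> :: "nat \<Rightarrow> real" where
  "\<omega> n = (\<integral>z. indicator (cball 0 R) z * sqrt (\<tau> n z) \<partial>lborel)"

lemma \<omega>_integrable: "integrable lborel (\<lambda>z. indicat_real (cball 0 R) z * sqrt (\<tau> n z))"
proof (rule Bochner_Integration.integrable_bound)
  show "integrable lborel (\<lambda>z. sqrt (C * measure lborel Q) * indicat_real (cball (0::'a) R) z)"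
    by (intro integrable_mult_right integrable_real_indicator) (simp_all add: emeasure_lborel_cball_finite[simplified])
  show "AE z in lborel. norm (indicat_real (cball 0 R) z * sqrt (\<tau> n z))
      \<le> norm (sqrt (C * measure lborel Q) * indicat_real (cball (0::'a) R) z)"
    using \<tau>_le \<tau>_nonneg C_pos by (intro AE_I2) (simp add: indicator_def)
qed measurable

lemma \<omega>_nonneg: "0 \<le> \<omega> n"
  unfolding \<omega>_def using \<tau>_nonneg by (intro integral_nonneg_AE) simp

lemma \<omega>_tendsto: "\<omega> \<longlonglongrightarrow> 0"
proof -
  have "(\<lambda>n. \<integral>z. indicat_real (cball 0 R) z * sqrt (\<tau> n z) \<partial>lborel) \<longlonglongrightarrow> (\<integral>z. 0 \<partial>(lborel :: 'a measure))"
  proof (rule integral_dominated_convergence)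
    show "integrable lborel (\<lambda>z. sqrt (C * measure lborel Q) * indicat_real (cball (0::'a) R) z)"
      by (intro integrable_mult_right integrable_real_indicator) (simp_all add: emeasure_lborel_cball_finite[simplified])
    show "AE z in lborel. norm (indicat_real (cball 0 R) z * sqrt (\<tau> n z))
      \<le> sqrt (C * measure lborel Q) * indicat_real (cball (0::'a) R) z" for n
      using \<tau>_le \<tau>_nonneg C_pos by (intro AE_I2) (simp add: indicator_def)
    show "AE z in lborel. (\<lambda>n. indicat_real (cball 0 R) z * sqrt (\<tau> n z)) \<longlonglongrightarrow> 0"
      using tendsto_real_sqrt[OF \<tau>_tendsto] by (intro AE_I2 tendsto_mult_right_zero) simp
  qed measurable
  then show ?thesis unfolding \<omega>_def[abs_def] by simp
qed

text \<open>The modulus averaged with the kernel; it bounds the L1 distance on Q between the density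
  and its mollification.\<close>

definition \<delta> :: "nat \<Rightarrow> real" where
  "\<delta> n = (\<integral>z. \<eta> z * \<tau> n z \<partial>lborel)"

lemma \<delta>_integrable: "integrable lborel (\<lambda>z. \<eta> z * \<tau> n z)"
  using \<eta>_mult_integrable[of "\<tau> n" "C * measure lborel Q"] \<tau>_le \<tau>_nonneg by (simp add: mult.commute)

lemma \<delta>_nonneg: "0 \<le> \<delta> n"
  unfolding \<delta>_def using \<tau>_nonneg \<eta>_nonneg by (intro integral_nonneg_AE) simp

lemma \<delta>_tendsto: "\<delta> \<longlonglongrightarrow> 0"
proof -
  have "(\<lambda>n. \<integral>z. \<eta> z * \<tau> n z \<partial>lborel) \<longlonglongrightarrow> (\<integral>z. 0 \<partial>(lborel :: 'a measure))"
  proof (rule integral_dominated_convergence)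
    show "integrable lborel (\<lambda>z. \<eta> z * (C * measure lborel Q))"
      by (rule integrable_mult_left) (rule \<eta>_integrable)
    show "AE z in lborel. norm (\<eta> z * \<tau> n z) \<le> \<eta> z * (C * measure lborel Q)" for n
      using \<tau>_le \<tau>_nonneg \<eta>_nonneg by (intro AE_I2) (simp add: mult_left_mono)
    show "AE z in lborel. (\<lambda>n. \<eta> z * \<tau> n z) \<longlonglongrightarrow> 0"
      by (intro AE_I2 tendsto_mult_right_zero \<tau>_tendsto)
  qed measurable
  then show ?thesis unfolding \<delta>_def[abs_def] by simp
qed

lemma sm_diff_nn_integral:
  "(\<integral>\<^sup>+p. ennreal (indicator Q p * \<bar>sm r (e n) (fst p) (snd p) - r p\<bar>) \<partial>lborel) \<le> ennreal (\<delta> n)"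
proof -
  let ?p = "\<lambda>p z. p + (0, e n *\<^sub>R z)"
  have "(\<integral>\<^sup>+p. ennreal (indicator Q p * \<bar>sm r (e n) (fst p) (snd p) - r p\<bar>) \<partial>lborel)
      \<le> (\<integral>\<^sup>+p. \<integral>\<^sup>+z. ennreal (\<eta> z) * ennreal (indicator Q p * \<bar>r (?p p z) - r p\<bar>) \<partial>lborel \<partial>lborel)"
  proof (rule nn_integral_mono)
    fix p :: "real \<times> 'a"
    obtain t x where p: "p = (t, x)" by (cases p)
    have i: "integrable lborel (\<lambda>z. r (?p p z) * \<eta> z)"
      using sm_integrand_integrable[OF r_measurable r_abs_le, of t x "e n"] by (simp add: p)
    have "sm r (e n) (fst p) (snd p) - r p = (\<integral>z. r (?p p z) * \<eta> z - r p * \<eta> z \<partial>lborel)"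
      by (subst Bochner_Integration.integral_diff[OF i integrable_mult_right[OF \<eta>_integrable]]) (simp add: sm_def \<eta>_integral p)
    then have "ennreal \<bar>sm r (e n) (fst p) (snd p) - r p\<bar> = ennreal (norm (\<integral>z. r (?p p z) * \<eta> z - r p * \<eta> z \<partial>lborel))"
      by simp
    also have "\<dots> \<le> (\<integral>\<^sup>+z. ennreal (norm (r (?p p z) * \<eta> z - r p * \<eta> z)) \<partial>lborel)"
      by (rule norm_integral_le_nn_integral)
    also have "\<dots> = (\<integral>\<^sup>+z. ennreal (\<eta> z) * ennreal \<bar>r (?p p z) - r p\<bar> \<partial>lborel)"
    proof (rule nn_integral_cong)
      fix z
      have "norm (r (?p p z) * \<eta> z - r p * \<eta> z) = \<eta> z * \<bar>r (?p p z) - r p\<bar>"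
        using \<eta>_nonneg[of z] by (simp add: left_diff_distrib[symmetric] abs_mult)
      then show "ennreal (norm (r (?p p z) * \<eta> z - r p * \<eta> z)) = ennreal (\<eta> z) * ennreal \<bar>r (?p p z) - r p\<bar>"
        using \<eta>_nonneg[of z] by (simp add: ennreal_mult)
    qed
    finally show "ennreal (indicator Q p * \<bar>sm r (e n) (fst p) (snd p) - r p\<bar>)
      \<le> (\<integral>\<^sup>+z. ennreal (\<eta> z) * ennreal (indicator Q p * \<bar>r (?p p z) - r p\<bar>) \<partial>lborel)"
      by (cases "p \<in> Q") simp_all
  qed
  also have "\<dots> = (\<integral>\<^sup>+z. \<integral>\<^sup>+p. ennreal (\<eta> z) * ennreal (indicator Q p * \<bar>r (?p p z) - r p\<bar>) \<partial>lborel \<partial>lborel)"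
    by (rule lborel_pair.Fubini'[symmetric]) measurable
  also have "\<dots> = (\<integral>\<^sup>+z. ennreal (\<eta> z * \<tau> n z) \<partial>lborel)"
  proof (rule nn_integral_cong)
    fix z
    have "(\<integral>\<^sup>+p. ennreal (indicator Q p * \<bar>r (?p p z) - r p\<bar>) \<partial>lborel) = ennreal (\<tau> n z)"
      unfolding \<tau>_def by (rule nn_integral_eq_integral[OF \<tau>_integrable]) simp
    then show "(\<integral>\<^sup>+p. ennreal (\<eta> z) * ennreal (indicator Q p * \<bar>r (?p p z) - r p\<bar>) \<partial>lborel) = ennreal (\<eta> z * \<tau> n z)"
      using \<eta>_nonneg \<tau>_nonneg by (subst nn_integral_cmult) (auto simp: ennreal_mult)
  qed
  also have "\<dots> = ennreal (\<delta> n)"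
    unfolding \<delta>_def using \<tau>_nonneg \<eta>_nonneg by (intro nn_integral_eq_integral \<delta>_integrable) simp
  finally show ?thesis .
qed

text \<open>For each z, Cauchy-Schwarz in space-time separates the increments. The squared density
  increment is at most C times the increment, which leaves \<tau>; the L2 norm of the velocity
  increment is at most \<open>e n * R * sqrt A\<close>, and its factor \<open>e n\<close> removes
  the singular factor.\<close>

lemma cm_nn_integral:
  "(\<integral>\<^sup>+p. ennreal (indicator Q p * \<bar>cm (e n) (fst p) (snd p)\<bar>) \<partial>lborel) \<le> ennreal (M * sqrt (C * A) * R * \<omega> n)"
proof -
  let ?p = "\<lambda>p z. p + (0, e n *\<^sub>R z)"
  let ?\<Delta>r = "\<lambda>p z. \<bar>r (?p p z) - r p\<bar>" and ?\<Delta>u = "\<lambda>p z. norm (u (?p p z) - u p)"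
  have "(\<integral>\<^sup>+p. ennreal (indicator Q p * \<bar>cm (e n) (fst p) (snd p)\<bar>) \<partial>lborel)
      \<le> (\<integral>\<^sup>+p. \<integral>\<^sup>+z. ennreal (M / e n * indicator (cball 0 R) z) * (ennreal (indicator Q p * ?\<Delta>r p z) * ennreal (?\<Delta>u p z)) \<partial>lborel \<partial>lborel)"
  proof (rule nn_integral_mono)
    fix p :: "real \<times> 'a"
    obtain t x where p: "p = (t, x)" by (cases p)
    let ?J = "\<integral>z. (r (?p p z) - r p) * (\<gamma> z \<bullet> (u (?p p z) - u p)) \<partial>lborel"
    have "ennreal \<bar>cm (e n) (fst p) (snd p)\<bar> = ennreal (1 / e n) * ennreal (norm ?J)"
      using e_bounds(1)[of n] by (simp add: cm_def p abs_mult ennreal_mult[symmetric])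
    also have "\<dots> \<le> ennreal (1 / e n) * (\<integral>\<^sup>+z. ennreal (norm ((r (?p p z) - r p) * (\<gamma> z \<bullet> (u (?p p z) - u p)))) \<partial>lborel)"
      by (intro mult_left_mono norm_integral_le_nn_integral) simp
    also have "\<dots> = (\<integral>\<^sup>+z. ennreal (1 / e n) * ennreal (norm ((r (?p p z) - r p) * (\<gamma> z \<bullet> (u (?p p z) - u p)))) \<partial>lborel)"
      by (rule nn_integral_cmult[symmetric]) measurable
    also have "\<dots> \<le> (\<integral>\<^sup>+z. ennreal (M / e n * indicator (cball 0 R) z) * (ennreal (?\<Delta>r p z) * ennreal (?\<Delta>u p z)) \<partial>lborel)"
    proof (rule nn_integral_mono)
      fix z
      have "1 / e n * norm ((r (?p p z) - r p) * (\<gamma> z \<bullet> (u (?p p z) - u p))) \<le> M / e n * indicator (cball 0 R) z * (?\<Delta>r p z * ?\<Delta>u p z)"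
      proof (cases "R < norm z")
        case False
        have "\<bar>\<gamma> z \<bullet> (u (?p p z) - u p)\<bar> \<le> M * ?\<Delta>u p z"
          by (rule order_trans[OF Cauchy_Schwarz_ineq2]) (intro mult_right_mono \<gamma>_le norm_ge_zero)
        then have "?\<Delta>r p z * \<bar>\<gamma> z \<bullet> (u (?p p z) - u p)\<bar> \<le> ?\<Delta>r p z * (M * ?\<Delta>u p z)" by (rule mult_left_mono) simp
        then have "1 / e n * norm ((r (?p p z) - r p) * (\<gamma> z \<bullet> (u (?p p z) - u p))) \<le> 1 / e n * (?\<Delta>r p z * (M * ?\<Delta>u p z))"
          unfolding real_norm_def abs_mult by (rule mult_left_mono) (use e_bounds(1)[of n] in simp)
        also have "\<dots> = M / e n * 1 * (?\<Delta>r p z * ?\<Delta>u p z)" by simp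
        finally show ?thesis using False by (simp only: indicator_simps mem_cball_0 not_less)
      qed (simp add: \<gamma>_supp)
      then show "ennreal (1 / e n) * ennreal (norm ((r (?p p z) - r p) * (\<gamma> z \<bullet> (u (?p p z) - u p))))
        \<le> ennreal (M / e n * indicator (cball 0 R) z) * (ennreal (?\<Delta>r p z) * ennreal (?\<Delta>u p z))"
      proof -
        assume le: "1 / e n * norm ((r (?p p z) - r p) * (\<gamma> z \<bullet> (u (?p p z) - u p)))
          \<le> M / e n * indicator (cball 0 R) z * (?\<Delta>r p z * ?\<Delta>u p z)"
        have "ennreal (1 / e n) * ennreal (norm ((r (?p p z) - r p) * (\<gamma> z \<bullet> (u (?p p z) - u p))))
          = ennreal (1 / e n * norm ((r (?p p z) - r p) * (\<gamma> z \<bullet> (u (?p p z) - u p))))"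
          by (rule ennreal_mult[symmetric]) (use e_bounds(1)[of n] in simp_all)
        also have "\<dots> \<le> ennreal (M / e n * indicator (cball 0 R) z * (?\<Delta>r p z * ?\<Delta>u p z))"
          by (rule ennreal_leI[OF le])
        also have "\<dots> = ennreal (M / e n * indicator (cball 0 R) z) * ennreal (?\<Delta>r p z * ?\<Delta>u p z)"
          by (rule ennreal_mult) (use e_bounds(1)[of n] M_pos in simp_all)
        also have "ennreal (?\<Delta>r p z * ?\<Delta>u p z) = ennreal (?\<Delta>r p z) * ennreal (?\<Delta>u p z)"
          by (rule ennreal_mult) simp_all
        finally show ?thesis .
      qed
    qed
    finally show "ennreal (indicator Q p * \<bar>cm (e n) (fst p) (snd p)\<bar>)
      \<le> (\<integral>\<^sup>+z. ennreal (M / e n * indicator (cball 0 R) z) * (ennreal (indicator Q p * ?\<Delta>r p z) * ennreal (?\<Delta>u p z)) \<partial>lborel)"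
      by (cases "p \<in> Q") simp_all
  qed
  also have "\<dots> = (\<integral>\<^sup>+z. \<integral>\<^sup>+p. ennreal (M / e n * indicator (cball (0::'a) R) z) * (ennreal (indicator Q p * ?\<Delta>r p z) * ennreal (?\<Delta>u p z)) \<partial>lborel \<partial>lborel)"
    by (rule lborel_pair.Fubini'[symmetric]) measurable
  also have "\<dots> \<le> (\<integral>\<^sup>+z. ennreal (M * sqrt (C * A) * R * (indicator (cball (0::'a) R) z * sqrt (\<tau> n z))) \<partial>lborel)"
  proof (rule nn_integral_mono)
    fix z :: 'a
    let ?X = "\<integral>\<^sup>+p. ennreal (indicator Q p * ?\<Delta>r p z) * ennreal (?\<Delta>u p z) \<partial>lborel"
    show "(\<integral>\<^sup>+p. ennreal (M / e n * indicator (cball (0::'a) R) z) * (ennreal (indicator Q p * ?\<Delta>r p z) * ennreal (?\<Delta>u p z)) \<partial>lborel)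
      \<le> ennreal (M * sqrt (C * A) * R * (indicator (cball (0::'a) R) z * sqrt (\<tau> n z)))"
    proof (cases "R < norm z")
      case False
      have "?X\<^sup>2 \<le> (\<integral>\<^sup>+p. (ennreal (indicator Q p * ?\<Delta>r p z))\<^sup>2 \<partial>lborel) * (\<integral>\<^sup>+p. (ennreal (?\<Delta>u p z))\<^sup>2 \<partial>lborel)"
        by (rule Cauchy_Schwarz_nn_integral) measurable
      also have "\<dots> \<le> ennreal (C * \<tau> n z) * ennreal ((e n * R)\<^sup>2 * A)"
      proof (rule mult_mono)
        have "(\<integral>\<^sup>+p. (ennreal (indicator Q p * ?\<Delta>r p z))\<^sup>2 \<partial>lborel) \<le> (\<integral>\<^sup>+p. ennreal C * ennreal (indicator Q p * ?\<Delta>r p z) \<partial>lborel)"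
        proof (rule nn_integral_mono)
          fix p
          have "indicator Q p * ?\<Delta>r p z \<le> C"
            using r_diff_le C_pos by (cases "p \<in> Q") simp_all
          then show "(ennreal (indicator Q p * ?\<Delta>r p z))\<^sup>2 \<le> ennreal C * ennreal (indicator Q p * ?\<Delta>r p z)"
            by (rule ennreal_square_le)
        qed
        also have "\<dots> = ennreal C * (\<integral>\<^sup>+p. ennreal (indicator Q p * ?\<Delta>r p z) \<partial>lborel)"
          by (rule nn_integral_cmult) measurable
        also have "(\<integral>\<^sup>+p. ennreal (indicator Q p * ?\<Delta>r p z) \<partial>lborel) = ennreal (\<tau> n z)"
          unfolding \<tau>_def by (rule nn_integral_eq_integral[OF \<tau>_integrable]) simp
        also have "ennreal C * ennreal (\<tau> n z) = ennreal (C * \<tau> n z)"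
          by (rule ennreal_mult[symmetric]) (use C_pos \<tau>_nonneg in simp_all)
        finally show "(\<integral>\<^sup>+p. (ennreal (indicator Q p * ?\<Delta>r p z))\<^sup>2 \<partial>lborel) \<le> ennreal (C * \<tau> n z)" .
        have "(\<integral>\<^sup>+p. (ennreal (?\<Delta>u p z))\<^sup>2 \<partial>lborel) = (\<integral>\<^sup>+p. ennreal ((?\<Delta>u p z)\<^sup>2) \<partial>lborel)"
          by (simp only: ennreal_power norm_ge_zero)
        also have "\<dots> \<le> ennreal ((norm (e n *\<^sub>R z))\<^sup>2 * A)" by (rule u_translate_diff)
        also have "\<dots> \<le> ennreal ((e n * R)\<^sup>2 * A)"
          using False e_bounds(1)[of n] A_nonneg by (intro ennreal_leI mult_right_mono power_mono) auto
        finally show "(\<integral>\<^sup>+p. (ennreal (?\<Delta>u p z))\<^sup>2 \<partial>lborel) \<le> ennreal ((e n * R)\<^sup>2 * A)" .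
      qed simp_all
      also have "\<dots> = ennreal (C * \<tau> n z * ((e n * R)\<^sup>2 * A))"
        by (rule ennreal_mult[symmetric]) (use C_pos A_nonneg \<tau>_nonneg in simp_all)
      \<comment> \<open>Arranged as a square so that the root can be taken; the factor
        \<open>e n\<close> in it cancels the one in \<open>M / e n\<close>.\<close>
      also have "C * \<tau> n z * ((e n * R)\<^sup>2 * A) = (e n * (sqrt (C * A) * R * sqrt (\<tau> n z)))\<^sup>2"
      proof -
        have s: "(sqrt (C * A))\<^sup>2 = C * A" "(sqrt (\<tau> n z))\<^sup>2 = \<tau> n z"
          using C_pos A_nonneg \<tau>_nonneg by simp_all
        show ?thesis unfolding power_mult_distrib s by (simp only: mult_ac)
      qed
      finally have X: "?X \<le> ennreal (e n * (sqrt (C * A) * R * sqrt (\<tau> n z)))"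
      proof (rule ennreal_power2_le_imp_le)
        show "0 \<le> e n * (sqrt (C * A) * R * sqrt (\<tau> n z))"
          using e_bounds(1)[of n] C_pos A_nonneg R_pos \<tau>_nonneg[of n z] by simp
      qed
      have "(\<integral>\<^sup>+p. ennreal (M / e n * indicator (cball (0::'a) R) z) * (ennreal (indicator Q p * ?\<Delta>r p z) * ennreal (?\<Delta>u p z)) \<partial>lborel)
        = ennreal (M / e n * indicator (cball (0::'a) R) z) * ?X"
        by (rule nn_integral_cmult) measurable
      also have "\<dots> \<le> ennreal (M / e n * indicator (cball (0::'a) R) z) * ennreal (e n * (sqrt (C * A) * R * sqrt (\<tau> n z)))"
        by (rule mult_left_mono[OF X]) simp
      also have "\<dots> = ennreal (M / e n * indicator (cball (0::'a) R) z * (e n * (sqrt (C * A) * R * sqrt (\<tau> n z))))"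
        by (rule ennreal_mult[symmetric])
           (use e_bounds(1)[of n] C_pos M_pos A_nonneg R_pos \<tau>_nonneg[of n z] in simp_all)
      also have "M / e n * indicator (cball (0::'a) R) z * (e n * (sqrt (C * A) * R * sqrt (\<tau> n z)))
        = M * sqrt (C * A) * R * (indicator (cball (0::'a) R) z * sqrt (\<tau> n z))"
        using e_bounds(1)[of n] by simp
      finally show ?thesis .
    qed simp
  qed
  also have "\<dots> = ennreal (\<integral>z. M * sqrt (C * A) * R * (indicator (cball (0::'a) R) z * sqrt (\<tau> n z)) \<partial>lborel)"
    using M_pos C_pos A_nonneg R_pos \<tau>_nonneg
    by (intro nn_integral_eq_integral integrable_mult_right \<omega>_integrable) (auto intro!: AE_I2 mult_nonneg_nonneg)
  also have "(\<integral>z. M * sqrt (C * A) * R * (indicator (cball (0::'a) R) z * sqrt (\<tau> n z)) \<partial>lborel) = M * sqrt (C * A) * R * \<omega> n"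
    by (simp add: \<omega>_def)
  finally show ?thesis .
qed

text \<open>The squared L2 norm of the velocity on the slab. It is finite by
  \<open>u_L2_slab\<close>, so the conversion to a real number loses nothing.\<close>

definition U :: real where
  "U = enn2real (\<integral>\<^sup>+p. indicator (slab T) p * ennreal ((norm (u p))\<^sup>2) \<partial>lborel)"

lemma U_eq: "(\<integral>\<^sup>+p. indicator (slab T) p * ennreal ((norm (u p))\<^sup>2) \<partial>lborel) = ennreal U"
  unfolding U_def using u_L2_slab[OF T_pos] by (simp add: ennreal_enn2real)

lemma U_nonneg: "0 \<le> U"
  by (simp add: U_def)

lemma flux_integrable:
  assumes [measurable]: "b \<in> borel_measurable borel" and "\<And>p. \<bar>b p\<bar> \<le> L"
  shows "integrable lborel (\<lambda>p. wt T (fst p) * b p * (\<phi>' (snd p) \<bullet> u p))"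
proof -
  have "integrable lborel (\<lambda>p. ((wt T (fst p) * b p) *\<^sub>R \<phi>' (snd p)) \<bullet> u p)"
  proof (rule L1_loc_inner_mult[OF u, where M = "T * L * N" and R = "T + S"])
    show "norm ((wt T (fst p) * b p) *\<^sub>R \<phi>' (snd p)) \<le> T * L * N" for p
      unfolding norm_scaleR abs_mult using T_pos L_pos wt_le assms(2)
      by (intro mult_mono \<phi>'_le) auto
    show "(wt T (fst p) * b p) *\<^sub>R \<phi>' (snd p) = 0" if "T + S < norm p" for p
      using outside_Q[of p] that \<phi>_supp(2)[of "snd p"] by auto
  qed measurable
  then show ?thesis by simp
qed

lemma density_integrable:
  assumes [measurable]: "b \<in> borel_measurable borel" and "\<And>p. \<bar>b p\<bar> \<le> L"
  shows "integrable lborel (\<lambda>p. indicator (slab T) p * b p * \<phi> (snd p))"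
proof (rule Bochner_Integration.integrable_bound)
  show "integrable lborel (\<lambda>p. L * indicat_real Q p)"
    using Q_finite by (intro integrable_mult_right integrable_real_indicator) auto
  show "AE p in lborel. norm (indicator (slab T) p * b p * \<phi> (snd p)) \<le> norm (L * indicat_real Q p)"
  proof (rule AE_I2)
    fix p
    have "\<bar>indicator (slab T) p * b p * \<phi> (snd p)\<bar> \<le> 1 * L * 1"
      unfolding abs_mult using L_pos assms(2) \<phi>_bounds by (intro mult_mono) (auto simp: indicator_def)
    moreover have "indicator (slab T) p * b p * \<phi> (snd p) = 0" if "p \<notin> Q"
      using slab_outside_Q[OF that] \<phi>_supp(1)[of "snd p"] by (cases "p \<in> slab T") auto
    ultimately show "norm (indicator (slab T) p * b p * \<phi> (snd p)) \<le> norm (L * indicat_real Q p)"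
      using L_pos by (cases "p \<in> Q") auto
  qed
qed measurable

lemma \<beta>_sm_abs: "\<bar>\<beta> (sm r \<epsilon> t x)\<bar> \<le> L"
  using \<beta>_le[OF sm_range] dist_sq_nonneg by simp

lemma \<beta>_r_abs: "\<bar>\<beta> (r p)\<bar> \<le> L"
  using \<beta>_le[OF r_nonneg r_le] dist_sq_nonneg by simp

lemma density_tendsto:
  "(\<lambda>n. \<integral>p. indicator (slab T) p * \<beta> (sm r (e n) (fst p) (snd p)) * \<phi> (snd p) \<partial>lborel)
    \<longlonglongrightarrow> (\<integral>p. indicator (slab T) p * \<beta> (r p) * \<phi> (snd p) \<partial>lborel)"
proof (rule LIM_zero_cancel, rule Lim_null_comparison)
  show "(\<lambda>n. L * \<delta> n) \<longlonglongrightarrow> 0" by (rule tendsto_mult_right_zero[OF \<delta>_tendsto])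
  have "\<bar>(\<integral>p. indicator (slab T) p * \<beta> (sm r (e n) (fst p) (snd p)) * \<phi> (snd p) \<partial>lborel)
      - (\<integral>p. indicator (slab T) p * \<beta> (r p) * \<phi> (snd p) \<partial>lborel)\<bar> \<le> L * \<delta> n" for n
  proof -
    let ?s = "\<lambda>p. sm r (e n) (fst p) (snd p)"
    have "(\<integral>p. indicator (slab T) p * \<beta> (?s p) * \<phi> (snd p) \<partial>lborel) - (\<integral>p. indicator (slab T) p * \<beta> (r p) * \<phi> (snd p) \<partial>lborel)
      = (\<integral>p. indicator (slab T) p * \<beta> (?s p) * \<phi> (snd p) - indicator (slab T) p * \<beta> (r p) * \<phi> (snd p) \<partial>lborel)"
      by (rule Bochner_Integration.integral_diff[symmetric]; rule density_integrable)
         (measurable, rule \<beta>_sm_abs, measurable, rule \<beta>_r_abs)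
    also have "\<bar>\<dots>\<bar> \<le> L * \<delta> n"
    proof (rule abs_integral_le_of_nn_integral)
      have "(\<integral>\<^sup>+p. ennreal \<bar>indicator (slab T) p * \<beta> (?s p) * \<phi> (snd p) - indicator (slab T) p * \<beta> (r p) * \<phi> (snd p)\<bar> \<partial>lborel)
        \<le> (\<integral>\<^sup>+p. ennreal L * ennreal (indicator Q p * \<bar>?s p - r p\<bar>) \<partial>lborel)"
      proof (rule nn_integral_mono)
        fix p
        have "\<bar>indicator (slab T) p * \<beta> (?s p) * \<phi> (snd p) - indicator (slab T) p * \<beta> (r p) * \<phi> (snd p)\<bar>
          = \<bar>indicat_real (slab T) p\<bar> * (\<bar>\<phi> (snd p)\<bar> * \<bar>\<beta> (?s p) - \<beta> (r p)\<bar>)"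
          unfolding abs_diff_product by (simp only: mult.commute)
        also have "\<dots> \<le> L * (indicator Q p * \<bar>?s p - r p\<bar>)"
        proof (cases "p \<in> Q")
          case True
          have "\<bar>indicat_real (slab T) p\<bar> * (\<bar>\<phi> (snd p)\<bar> * \<bar>\<beta> (?s p) - \<beta> (r p)\<bar>) \<le> 1 * (1 * (L * \<bar>?s p - r p\<bar>))"
            using \<phi>_bounds by (intro mult_mono \<beta>_lipschitz sm_range r_nonneg r_le) (auto simp: indicator_def)
          then show ?thesis using True by simp
        next
          case False
          then show ?thesis using slab_outside_Q[OF False] \<phi>_supp(1)[of "snd p"] by (cases "p \<in> slab T") auto
        qed
        finally show "ennreal \<bar>indicator (slab T) p * \<beta> (?s p) * \<phi> (snd p) - indicator (slab T) p * \<beta> (r p) * \<phi> (snd p)\<bar>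
          \<le> ennreal L * ennreal (indicator Q p * \<bar>?s p - r p\<bar>)"
          using L_pos by (simp add: ennreal_mult[symmetric] ennreal_leI)
      qed
      also have "\<dots> = ennreal L * (\<integral>\<^sup>+p. ennreal (indicator Q p * \<bar>?s p - r p\<bar>) \<partial>lborel)"
        by (rule nn_integral_cmult) measurable
      also have "\<dots> \<le> ennreal L * ennreal (\<delta> n)"
        by (rule mult_left_mono[OF sm_diff_nn_integral]) simp
      finally show "(\<integral>\<^sup>+p. ennreal \<bar>indicator (slab T) p * \<beta> (?s p) * \<phi> (snd p) - indicator (slab T) p * \<beta> (r p) * \<phi> (snd p)\<bar> \<partial>lborel)
        \<le> ennreal (L * \<delta> n)" using L_pos \<delta>_nonneg by (simp add: ennreal_mult)
    qed (use L_pos \<delta>_nonneg in simp)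
    finally show ?thesis .
  qed
  then show "\<forall>\<^sub>F n in sequentially. norm ((\<integral>p. indicator (slab T) p * \<beta> (sm r (e n) (fst p) (snd p)) * \<phi> (snd p) \<partial>lborel)
      - (\<integral>p. indicator (slab T) p * \<beta> (r p) * \<phi> (snd p) \<partial>lborel)) \<le> L * \<delta> n" by simp
qed

text \<open>The velocity is only square integrable, so the mollified density has to converge in L2
  on Q. Boundedness gives this from L1 convergence: the squared difference is at most C times the
  difference.\<close>

lemma flux_tendsto:
  "(\<lambda>n. \<integral>p. wt T (fst p) * \<beta> (sm r (e n) (fst p) (snd p)) * (\<phi>' (snd p) \<bullet> u p) \<partial>lborel)
    \<longlonglongrightarrow> (\<integral>p. wt T (fst p) * \<beta> (r p) * (\<phi>' (snd p) \<bullet> u p) \<partial>lborel)"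
proof (rule LIM_zero_cancel, rule Lim_null_comparison)
  have "(\<lambda>n. T * L * N * sqrt (C * \<delta> n * U)) \<longlonglongrightarrow> T * L * N * sqrt (C * 0 * U)"
    by (intro tendsto_intros \<delta>_tendsto)
  then show "(\<lambda>n. T * L * N * sqrt (C * \<delta> n * U)) \<longlonglongrightarrow> 0" by simp
  have "\<bar>(\<integral>p. wt T (fst p) * \<beta> (sm r (e n) (fst p) (snd p)) * (\<phi>' (snd p) \<bullet> u p) \<partial>lborel)
      - (\<integral>p. wt T (fst p) * \<beta> (r p) * (\<phi>' (snd p) \<bullet> u p) \<partial>lborel)\<bar> \<le> T * L * N * sqrt (C * \<delta> n * U)" for n
  proof -
    let ?s = "\<lambda>p. sm r (e n) (fst p) (snd p)"
    let ?X = "\<integral>\<^sup>+p. ennreal (indicator Q p * \<bar>?s p - r p\<bar>) * ennreal (indicator (slab T) p * norm (u p)) \<partial>lborel"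
    have sr_le: "\<bar>?s p - r p\<bar> \<le> C" for p
      using sm_range[of "e n" "fst p" "snd p"] r_nonneg[of p] r_le[of p] by linarith
    have "?X\<^sup>2 \<le> (\<integral>\<^sup>+p. (ennreal (indicator Q p * \<bar>?s p - r p\<bar>))\<^sup>2 \<partial>lborel) * (\<integral>\<^sup>+p. (ennreal (indicator (slab T) p * norm (u p)))\<^sup>2 \<partial>lborel)"
      by (rule Cauchy_Schwarz_nn_integral) measurable
    also have "\<dots> \<le> ennreal (C * \<delta> n) * ennreal U"
    proof (rule mult_mono)
      have "(\<integral>\<^sup>+p. (ennreal (indicator Q p * \<bar>?s p - r p\<bar>))\<^sup>2 \<partial>lborel) \<le> (\<integral>\<^sup>+p. ennreal C * ennreal (indicator Q p * \<bar>?s p - r p\<bar>) \<partial>lborel)"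
      proof (rule nn_integral_mono)
        fix p
        have "indicator Q p * \<bar>?s p - r p\<bar> \<le> C"
          using sr_le[of p] C_pos by (cases "p \<in> Q") simp_all
        then show "(ennreal (indicator Q p * \<bar>?s p - r p\<bar>))\<^sup>2 \<le> ennreal C * ennreal (indicator Q p * \<bar>?s p - r p\<bar>)"
          by (rule ennreal_square_le)
      qed
      also have "\<dots> = ennreal C * (\<integral>\<^sup>+p. ennreal (indicator Q p * \<bar>?s p - r p\<bar>) \<partial>lborel)"
        by (rule nn_integral_cmult) measurable
      also have "\<dots> \<le> ennreal C * ennreal (\<delta> n)"
        by (rule mult_left_mono[OF sm_diff_nn_integral]) simp
      finally show "(\<integral>\<^sup>+p. (ennreal (indicator Q p * \<bar>?s p - r p\<bar>))\<^sup>2 \<partial>lborel) \<le> ennreal (C * \<delta> n)"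
        using C_pos \<delta>_nonneg by (simp add: ennreal_mult)
      have "(\<integral>\<^sup>+p. (ennreal (indicator (slab T) p * norm (u p)))\<^sup>2 \<partial>lborel) = (\<integral>\<^sup>+p. indicator (slab T) p * ennreal ((norm (u p))\<^sup>2) \<partial>lborel)"
        by (intro nn_integral_cong) (simp add: ennreal_power indicator_def)
      then show "(\<integral>\<^sup>+p. (ennreal (indicator (slab T) p * norm (u p)))\<^sup>2 \<partial>lborel) \<le> ennreal U" by (simp add: U_eq)
    qed simp_all
    also have "\<dots> = ennreal (C * \<delta> n * U)"
      by (rule ennreal_mult[symmetric]) (use C_pos \<delta>_nonneg U_nonneg in simp_all)
    also have "C * \<delta> n * U = (sqrt (C * \<delta> n * U))\<^sup>2"
      using C_pos \<delta>_nonneg U_nonneg by simp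
    finally have X: "?X \<le> ennreal (sqrt (C * \<delta> n * U))"
      by (rule ennreal_power2_le_imp_le) (use C_pos \<delta>_nonneg U_nonneg in simp)
    have "(\<integral>p. wt T (fst p) * \<beta> (?s p) * (\<phi>' (snd p) \<bullet> u p) \<partial>lborel) - (\<integral>p. wt T (fst p) * \<beta> (r p) * (\<phi>' (snd p) \<bullet> u p) \<partial>lborel)
      = (\<integral>p. wt T (fst p) * \<beta> (?s p) * (\<phi>' (snd p) \<bullet> u p) - wt T (fst p) * \<beta> (r p) * (\<phi>' (snd p) \<bullet> u p) \<partial>lborel)"
      by (rule Bochner_Integration.integral_diff[symmetric]; rule flux_integrable)
         (measurable, rule \<beta>_sm_abs, measurable, rule \<beta>_r_abs)
    also have "\<bar>\<dots>\<bar> \<le> T * L * N * sqrt (C * \<delta> n * U)"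
    proof (rule abs_integral_le_of_nn_integral)
      have "(\<integral>\<^sup>+p. ennreal \<bar>wt T (fst p) * \<beta> (?s p) * (\<phi>' (snd p) \<bullet> u p) - wt T (fst p) * \<beta> (r p) * (\<phi>' (snd p) \<bullet> u p)\<bar> \<partial>lborel)
        \<le> (\<integral>\<^sup>+p. ennreal (T * L * N) * (ennreal (indicator Q p * \<bar>?s p - r p\<bar>) * ennreal (indicator (slab T) p * norm (u p))) \<partial>lborel)"
      proof (rule nn_integral_mono_AE)
        show "AE p in lborel. ennreal \<bar>wt T (fst p) * \<beta> (?s p) * (\<phi>' (snd p) \<bullet> u p) - wt T (fst p) * \<beta> (r p) * (\<phi>' (snd p) \<bullet> u p)\<bar>
          \<le> ennreal (T * L * N) * (ennreal (indicator Q p * \<bar>?s p - r p\<bar>) * ennreal (indicator (slab T) p * norm (u p)))"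
          using wt_slab
        proof eventually_elim
          case (elim p)
          have "\<bar>wt T (fst p) * \<beta> (?s p) * (\<phi>' (snd p) \<bullet> u p) - wt T (fst p) * \<beta> (r p) * (\<phi>' (snd p) \<bullet> u p)\<bar>
            = \<bar>wt T (fst p)\<bar> * (\<bar>\<beta> (?s p) - \<beta> (r p)\<bar> * \<bar>\<phi>' (snd p) \<bullet> u p\<bar>)"
            by (rule abs_diff_product)
          also have "\<dots> \<le> T * L * N * ((indicator Q p * \<bar>?s p - r p\<bar>) * (indicator (slab T) p * norm (u p)))"
          proof (cases "p \<in> Q \<and> p \<in> slab T")
            case True
            have "\<bar>\<phi>' (snd p) \<bullet> u p\<bar> \<le> N * norm (u p)"
              by (rule order_trans[OF Cauchy_Schwarz_ineq2]) (intro mult_right_mono \<phi>'_le norm_ge_zero)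
            then have "\<bar>wt T (fst p)\<bar> * (\<bar>\<beta> (?s p) - \<beta> (r p)\<bar> * \<bar>\<phi>' (snd p) \<bullet> u p\<bar>) \<le> T * ((L * \<bar>?s p - r p\<bar>) * (N * norm (u p)))"
              using T_pos L_pos by (intro mult_mono wt_le \<beta>_lipschitz sm_range r_nonneg r_le) auto
            then show ?thesis using True by (simp add: mult_ac)
          next
            case False
            show ?thesis
            proof (cases "p \<in> slab T")
              case True
              then have "S < norm (snd p)" using False slab_outside_Q by blast
              then show ?thesis using \<phi>_supp(2)[of "snd p"] True T_pos L_pos N_nonneg by simp
            next
              case False
              then have "wt T (fst p) = 0" using elim by simp
              then show ?thesis using False by simp
            qed
          qed
          finally show ?case
            using T_pos L_pos N_nonneg by (simp add: ennreal_mult[symmetric] ennreal_leI)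
        qed
      qed
      also have "\<dots> = ennreal (T * L * N) * ?X"
        by (rule nn_integral_cmult) measurable
      also have "\<dots> \<le> ennreal (T * L * N) * ennreal (sqrt (C * \<delta> n * U))"
        by (rule mult_left_mono[OF X]) simp
      finally show "(\<integral>\<^sup>+p. ennreal \<bar>wt T (fst p) * \<beta> (?s p) * (\<phi>' (snd p) \<bullet> u p) - wt T (fst p) * \<beta> (r p) * (\<phi>' (snd p) \<bullet> u p)\<bar> \<partial>lborel)
        \<le> ennreal (T * L * N * sqrt (C * \<delta> n * U))"
        using T_pos L_pos N_nonneg C_pos \<delta>_nonneg U_nonneg by (simp add: ennreal_mult[symmetric])
    qed (use T_pos L_pos N_nonneg C_pos \<delta>_nonneg U_nonneg in simp)
    finally show ?thesis .
  qed
  then show "\<forall>\<^sub>F n in sequentially. norm ((\<integral>p. wt T (fst p) * \<beta> (sm r (e n) (fst p) (snd p)) * (\<phi>' (snd p) \<bullet> u p) \<partial>lborel)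
      - (\<integral>p. wt T (fst p) * \<beta> (r p) * (\<phi>' (snd p) \<bullet> u p) \<partial>lborel)) \<le> T * L * N * sqrt (C * \<delta> n * U)" by simp
qed

lemma commutator_tendsto:
  "(\<lambda>n. \<integral>p. wt T (fst p) * \<beta>' (sm r (e n) (fst p) (snd p)) * \<phi> (snd p) * cm (e n) (fst p) (snd p) \<partial>lborel) \<longlonglongrightarrow> 0"
proof (rule Lim_null_comparison)
  show "(\<lambda>n. T * L * (M * sqrt (C * A) * R * \<omega> n)) \<longlonglongrightarrow> 0"
    by (intro tendsto_mult_right_zero \<omega>_tendsto)
  have "\<bar>\<integral>p. wt T (fst p) * \<beta>' (sm r (e n) (fst p) (snd p)) * \<phi> (snd p) * cm (e n) (fst p) (snd p) \<partial>lborel\<bar>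
      \<le> T * L * (M * sqrt (C * A) * R * \<omega> n)" for n
  proof (rule abs_integral_le_of_nn_integral)
    let ?s = "\<lambda>p. sm r (e n) (fst p) (snd p)" and ?c = "\<lambda>p. cm (e n) (fst p) (snd p)"
    have "(\<integral>\<^sup>+p. ennreal \<bar>wt T (fst p) * \<beta>' (?s p) * \<phi> (snd p) * ?c p\<bar> \<partial>lborel)
      \<le> (\<integral>\<^sup>+p. ennreal (T * L) * ennreal (indicator Q p * \<bar>?c p\<bar>) \<partial>lborel)"
    proof (rule nn_integral_mono)
      fix p
      have "\<bar>wt T (fst p) * \<beta>' (?s p) * \<phi> (snd p) * ?c p\<bar> \<le> T * L * (indicator Q p * \<bar>?c p\<bar>)"
      proof (cases "p \<in> Q")
        case True
        have "\<bar>wt T (fst p) * \<beta>' (?s p) * \<phi> (snd p) * ?c p\<bar> \<le> T * L * 1 * \<bar>?c p\<bar>"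
          unfolding abs_mult using T_pos L_pos \<phi>_bounds
          by (intro mult_mono wt_le \<beta>'_le sm_range) auto
        then show ?thesis using True by simp
      next
        case False
        then show ?thesis using outside_Q[OF False] \<phi>_supp(1)[of "snd p"] by auto
      qed
      then show "ennreal \<bar>wt T (fst p) * \<beta>' (?s p) * \<phi> (snd p) * ?c p\<bar> \<le> ennreal (T * L) * ennreal (indicator Q p * \<bar>?c p\<bar>)"
        using T_pos L_pos by (simp add: ennreal_mult[symmetric] ennreal_leI)
    qed
    also have "\<dots> = ennreal (T * L) * (\<integral>\<^sup>+p. ennreal (indicator Q p * \<bar>?c p\<bar>) \<partial>lborel)"
      by (rule nn_integral_cmult) measurable
    also have "\<dots> \<le> ennreal (T * L) * ennreal (M * sqrt (C * A) * R * \<omega> n)"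
      by (rule mult_left_mono[OF cm_nn_integral]) simp
    finally show "(\<integral>\<^sup>+p. ennreal \<bar>wt T (fst p) * \<beta>' (?s p) * \<phi> (snd p) * ?c p\<bar> \<partial>lborel)
      \<le> ennreal (T * L * (M * sqrt (C * A) * R * \<omega> n))"
      using T_pos L_pos M_pos C_pos A_nonneg R_pos \<omega>_nonneg by (simp add: ennreal_mult[symmetric])
  qed (use T_pos L_pos M_pos C_pos A_nonneg R_pos \<omega>_nonneg in simp)
  then show "\<forall>\<^sub>F n in sequentially. norm (\<integral>p. wt T (fst p) * \<beta>' (sm r (e n) (fst p) (snd p)) * \<phi> (snd p) * cm (e n) (fst p) (snd p) \<partial>lborel)
      \<le> T * L * (M * sqrt (C * A) * R * \<omega> n)" by simp
qed

lemma renormalised_inequality: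
  "(\<integral>p. indicator (slab T) p * \<beta> (r p) * \<phi> (snd p) \<partial>lborel)
    \<le> (\<integral>p. wt T (fst p) * \<beta> (r p) * (\<phi>' (snd p) \<bullet> u p) \<partial>lborel)"
proof -
  have "(\<integral>p. indicator (slab T) p * \<beta> (r p) * \<phi> (snd p) \<partial>lborel)
      \<le> 0 + (\<integral>p. wt T (fst p) * \<beta> (r p) * (\<phi>' (snd p) \<bullet> u p) \<partial>lborel)"
    by (rule LIMSEQ_le[OF density_tendsto tendsto_add[OF commutator_tendsto flux_tendsto]])
       (use mollified_inequality[OF e_bounds(1)] in blast)
  then show ?thesis by simp
qed

end

subsection \<open>Letting the cutoff radius tend to infinity\<close>

lemma (in cutoff) renormalised_bound:
  assumes k: "\<And>x. (norm (\<phi>' x))\<^sup>2 \<le> k\<^sup>2 * \<phi> x" and "0 \<le> k"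
  shows "(\<integral>p. indicator (slab T) p * \<beta> (r p) * \<phi> (snd p) \<partial>lborel) \<le> (T * k)\<^sup>2 * L * U"
proof -
  define N' where "N' = (\<integral>p. indicator (slab T) p * \<beta> (r p) * \<phi> (snd p) \<partial>lborel)"
  have int: "integrable lborel (\<lambda>p. indicator (slab T) p * \<beta> (r p) * \<phi> (snd p))"
    by (rule density_integrable) (measurable, rule \<beta>_r_abs)
  have N'_nonneg: "0 \<le> N'"
    unfolding N'_def using dist_sq_nonneg \<phi>_bounds(1) by (intro integral_nonneg_AE) simp
  let ?f = "\<lambda>p. ennreal (indicator (slab T) p * \<beta> (r p) * norm (\<phi>' (snd p)))"
    and ?g = "\<lambda>p. ennreal (indicator (slab T) p * norm (u p))"
  let ?X = "\<integral>\<^sup>+p. ?f p * ?g p \<partial>lborel"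
  have "?X\<^sup>2 \<le> (\<integral>\<^sup>+p. (?f p)\<^sup>2 \<partial>lborel) * (\<integral>\<^sup>+p. (?g p)\<^sup>2 \<partial>lborel)"
    by (rule Cauchy_Schwarz_nn_integral) measurable
  also have "\<dots> \<le> ennreal (k\<^sup>2 * L * N') * ennreal U"
  proof (rule mult_mono)
    have "(\<integral>\<^sup>+p. (?f p)\<^sup>2 \<partial>lborel) \<le> (\<integral>\<^sup>+p. ennreal (k\<^sup>2 * L * (indicator (slab T) p * \<beta> (r p) * \<phi> (snd p))) \<partial>lborel)"
    proof (rule nn_integral_mono)
      fix p
      have "(\<beta> (r p) * norm (\<phi>' (snd p)))\<^sup>2 = \<beta> (r p) * \<beta> (r p) * (norm (\<phi>' (snd p)))\<^sup>2"
        by (simp only: power_mult_distrib power2_eq_square[of "\<beta> (r p)"])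
      also have "\<dots> \<le> L * \<beta> (r p) * (k\<^sup>2 * \<phi> (snd p))"
        using L_pos \<beta>_le[OF r_nonneg r_le] dist_sq_nonneg[of c C\<^sub>0 "r p"] by (intro mult_mono k) auto
      also have "\<dots> = k\<^sup>2 * L * (1 * \<beta> (r p) * \<phi> (snd p))" by simp
      finally have le: "(\<beta> (r p) * norm (\<phi>' (snd p)))\<^sup>2 \<le> k\<^sup>2 * L * (1 * \<beta> (r p) * \<phi> (snd p))" .
      show "(?f p)\<^sup>2 \<le> ennreal (k\<^sup>2 * L * (indicator (slab T) p * \<beta> (r p) * \<phi> (snd p)))"
      proof (cases "p \<in> slab T")
        case True
        then have "(?f p)\<^sup>2 = ennreal ((\<beta> (r p) * norm (\<phi>' (snd p)))\<^sup>2)"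
          using dist_sq_nonneg[of c C\<^sub>0 "r p"] by (simp add: ennreal_power)
        then show ?thesis using True ennreal_leI[OF le] by simp
      qed simp
    qed
    also have "\<dots> = ennreal (\<integral>p. k\<^sup>2 * L * (indicator (slab T) p * \<beta> (r p) * \<phi> (snd p)) \<partial>lborel)"
      using L_pos dist_sq_nonneg \<phi>_bounds(1)
      by (intro nn_integral_eq_integral integrable_mult_right int AE_I2) simp
    also have "(\<integral>p. k\<^sup>2 * L * (indicator (slab T) p * \<beta> (r p) * \<phi> (snd p)) \<partial>lborel) = k\<^sup>2 * L * N'"
      unfolding N'_def by (rule integral_mult_right_zero)
    finally show "(\<integral>\<^sup>+p. (?f p)\<^sup>2 \<partial>lborel) \<le> ennreal (k\<^sup>2 * L * N')" .
    have "(\<integral>\<^sup>+p. (?g p)\<^sup>2 \<partial>lborel) = (\<integral>\<^sup>+p. indicator (slab T) p * ennreal ((norm (u p))\<^sup>2) \<partial>lborel)"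
      by (intro nn_integral_cong) (simp add: ennreal_power indicator_def)
    then show "(\<integral>\<^sup>+p. (?g p)\<^sup>2 \<partial>lborel) \<le> ennreal U" by (simp add: U_eq)
  qed simp_all
  also have "\<dots> = ennreal (k\<^sup>2 * L * N' * U)"
    by (rule ennreal_mult[symmetric]) (use L_pos N'_nonneg U_nonneg in simp_all)
  also have "k\<^sup>2 * L * N' * U = (sqrt (k\<^sup>2 * L * N' * U))\<^sup>2"
    using L_pos N'_nonneg U_nonneg by simp
  finally have X: "?X \<le> ennreal (sqrt (k\<^sup>2 * L * N' * U))"
    by (rule ennreal_power2_le_imp_le) (use L_pos N'_nonneg U_nonneg in simp)
  have "\<bar>\<integral>p. wt T (fst p) * \<beta> (r p) * (\<phi>' (snd p) \<bullet> u p) \<partial>lborel\<bar> \<le> T * sqrt (k\<^sup>2 * L * N' * U)"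
  proof (rule abs_integral_le_of_nn_integral)
    have "(\<integral>\<^sup>+p. ennreal \<bar>wt T (fst p) * \<beta> (r p) * (\<phi>' (snd p) \<bullet> u p)\<bar> \<partial>lborel) \<le> (\<integral>\<^sup>+p. ennreal T * (?f p * ?g p) \<partial>lborel)"
    proof (rule nn_integral_mono_AE)
      show "AE p in lborel. ennreal \<bar>wt T (fst p) * \<beta> (r p) * (\<phi>' (snd p) \<bullet> u p)\<bar> \<le> ennreal T * (?f p * ?g p)"
        using wt_slab
      proof eventually_elim
        case (elim p)
        show ?case
        proof (cases "p \<in> slab T")
          case True
          have "\<bar>wt T (fst p) * \<beta> (r p) * (\<phi>' (snd p) \<bullet> u p)\<bar> \<le> T * \<beta> (r p) * (norm (\<phi>' (snd p)) * norm (u p))"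
            unfolding abs_mult using T_pos dist_sq_nonneg
            by (intro mult_mono wt_le Cauchy_Schwarz_ineq2) auto
          also have "\<dots> = T * ((\<beta> (r p) * norm (\<phi>' (snd p))) * norm (u p))" by simp
          finally have "ennreal \<bar>wt T (fst p) * \<beta> (r p) * (\<phi>' (snd p) \<bullet> u p)\<bar> \<le> ennreal (T * ((\<beta> (r p) * norm (\<phi>' (snd p))) * norm (u p)))"
            by (rule ennreal_leI)
          also have "\<dots> = ennreal T * ennreal ((\<beta> (r p) * norm (\<phi>' (snd p))) * norm (u p))"
            by (rule ennreal_mult) (use T_pos dist_sq_nonneg in simp_all)
          also have "ennreal ((\<beta> (r p) * norm (\<phi>' (snd p))) * norm (u p)) = ennreal (\<beta> (r p) * norm (\<phi>' (snd p))) * ennreal (norm (u p))"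
            by (rule ennreal_mult) (use dist_sq_nonneg in simp_all)
          finally show ?thesis using True by simp
        next
          case False
          then have "wt T (fst p) = 0" using elim by simp
          then show ?thesis by simp
        qed
      qed
    qed
    also have "\<dots> = ennreal T * ?X" by (rule nn_integral_cmult) measurable
    also have "\<dots> \<le> ennreal T * ennreal (sqrt (k\<^sup>2 * L * N' * U))" by (rule mult_left_mono[OF X]) simp
    also have "\<dots> = ennreal (T * sqrt (k\<^sup>2 * L * N' * U))"
      by (rule ennreal_mult[symmetric]) (use T_pos L_pos N'_nonneg U_nonneg in simp_all)
    finally show "(\<integral>\<^sup>+p. ennreal \<bar>wt T (fst p) * \<beta> (r p) * (\<phi>' (snd p) \<bullet> u p)\<bar> \<partial>lborel) \<le> ennreal (T * sqrt (k\<^sup>2 * L * N' * U))" .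
  qed (use T_pos L_pos N'_nonneg U_nonneg in simp)
  then have "N' \<le> T * sqrt (k\<^sup>2 * L * N' * U)"
    using renormalised_inequality unfolding N'_def by linarith
  then have "N'\<^sup>2 \<le> (T * sqrt (k\<^sup>2 * L * N' * U))\<^sup>2" using N'_nonneg by (rule power_mono)
  also have "\<dots> = T\<^sup>2 * (k\<^sup>2 * L * N' * U)"
    using L_pos N'_nonneg U_nonneg by (simp only: power_mult_distrib) simp
  finally have "N' * N' \<le> ((T * k)\<^sup>2 * L * U) * N'" by (simp only: power2_eq_square mult_ac)
  \<comment> \<open>One factor N' may be divided out because the bounded support of the cut-off
    makes N' finite.\<close>
  then have "N' \<le> (T * k)\<^sup>2 * L * U"
  proof (cases "N' = 0")
    case False
    with N'_nonneg have "0 < N'" by simp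
    with \<open>N' * N' \<le> ((T * k)\<^sup>2 * L * U) * N'\<close> show ?thesis by (simp only: mult_le_cancel_right_pos)
  qed (use L_pos U_nonneg in simp)
  then show ?thesis by (simp only: N'_def)
qed

section \<open>The quadratic cut-off\<close>

definition bump :: "real \<Rightarrow> 'a::euclidean_space \<Rightarrow> real" where
  "bump \<rho> x = (max 0 (1 - (norm x)\<^sup>2 / \<rho>\<^sup>2))\<^sup>2"

text \<open>The gradient of \<open>bump\<close>; the 4 is 2 from the outer square times 2 from the
  squared norm of x.\<close>

definition bump' :: "real \<Rightarrow> 'a::euclidean_space \<Rightarrow> 'a" where
  "bump' \<rho> x = (- 4 / \<rho>\<^sup>2 * max 0 (1 - (norm x)\<^sup>2 / \<rho>\<^sup>2)) *\<^sub>R x"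

lemma max_0_square_deriv: "((\<lambda>s::real. (max 0 s)\<^sup>2) has_real_derivative 2 * max 0 s) (at s)"
proof (rule has_real_derivative_quadratic_remainder)
  fix y
  have "\<bar>2 * max 0 y - 2 * max 0 s\<bar> \<le> 2 * \<bar>y - s\<bar>" by (simp add: max_def abs_if)
  then have "\<bar>2 * max 0 y - 2 * max 0 s\<bar> * \<bar>y - s\<bar> \<le> 2 * \<bar>y - s\<bar> * \<bar>y - s\<bar>" by (rule mult_right_mono) simp
  then have "(2 * max 0 y - 2 * max 0 s) * (y - s) \<le> 2 * (y - s)\<^sup>2"
    unfolding abs_mult[symmetric] by (simp add: power2_eq_square abs_mult[symmetric] mult.assoc)
  then show "\<bar>(max 0 y)\<^sup>2 - (max 0 s)\<^sup>2 - 2 * max 0 s * (y - s)\<bar> \<le> 2 * (y - s)\<^sup>2"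
    using max_0_square_convex[of y s] max_0_square_convex[of s y] by (simp add: algebra_simps)
qed

lemma bump_deriv: "(bump \<rho> has_derivative (\<lambda>v. bump' \<rho> x \<bullet> v)) (at x)"
proof -
  have "((\<lambda>x. 1 - inverse (\<rho>\<^sup>2) * (x \<bullet> x)) has_derivative (\<lambda>v. - (inverse (\<rho>\<^sup>2) * (2 * (x \<bullet> v))))) (at x)"
    by (auto intro!: derivative_eq_intros simp: inner_commute)
  then have "((\<lambda>x. 1 - (norm x)\<^sup>2 / \<rho>\<^sup>2) has_derivative (\<lambda>v. - (2 * (x \<bullet> v) / \<rho>\<^sup>2))) (at x)"
    unfolding power2_norm_eq_inner divide_inverse by (simp only: mult.commute[of "inverse _"])
  from has_derivative_compose[OF this has_field_derivative_imp_has_derivative[OF max_0_square_deriv]]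
  show ?thesis unfolding bump_def[abs_def] bump'_def
    by (rule has_derivative_eq_rhs) (simp add: fun_eq_iff)
qed

lemma bump_outside:
  assumes "0 < \<rho>" "\<rho> < norm x"
  shows "max 0 (1 - (norm x)\<^sup>2 / \<rho>\<^sup>2) = 0"
proof -
  have "\<rho>\<^sup>2 \<le> (norm x)\<^sup>2" using assms by (intro power_mono) auto
  then show ?thesis using assms by (simp add: le_divide_eq max_def)
qed

text \<open>On the support the norm of x is at most \<rho>, which removes one power of \<rho>. The
  right side is 4/\<rho> times the square root of \<open>bump \<rho> x\<close>.\<close>

lemma bump'_le:
  assumes "0 < \<rho>"
  shows "norm (bump' \<rho> x) \<le> 4 / \<rho> * max 0 (1 - (norm x)\<^sup>2 / \<rho>\<^sup>2)"
proof (cases "\<rho> < norm x")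
  case True
  then show ?thesis unfolding bump'_def bump_outside[OF assms True] by simp
next
  case False
  have "norm (bump' \<rho> x) = (4 / \<rho>\<^sup>2 * max 0 (1 - (norm x)\<^sup>2 / \<rho>\<^sup>2)) * norm x"
    unfolding bump'_def norm_scaleR by (simp add: abs_mult)
  also have "\<dots> \<le> (4 / \<rho>\<^sup>2 * max 0 (1 - (norm x)\<^sup>2 / \<rho>\<^sup>2)) * \<rho>"
    using False by (intro mult_left_mono) auto
  also have "\<dots> = 4 / \<rho> * max 0 (1 - (norm x)\<^sup>2 / \<rho>\<^sup>2)" using assms by (simp add: power2_eq_square)
  finally show ?thesis .
qed

lemma bump'_measurable: "bump' \<rho> \<in> borel_measurable borel"
  unfolding bump'_def[abs_def] by measurable

context transport
begin

lemma cutoff_bump: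
  assumes "0 < \<rho>" "0 < T"
  shows "cutoff \<eta> \<gamma> M R u r g c C\<^sub>0 C B (bump \<rho>) (bump' \<rho>) (4 / \<rho>) \<rho> T"
proof
  show "(bump \<rho> has_derivative (\<lambda>v. bump' \<rho> x \<bullet> v)) (at x)" for x :: 'a by (rule bump_deriv)
  show "(bump' \<rho> :: 'a \<Rightarrow> 'a) \<in> borel_measurable borel" by (rule bump'_measurable)
  show "0 \<le> bump \<rho> x" for x :: 'a by (simp add: bump_def)
  show "bump \<rho> x \<le> 1" for x :: 'a unfolding bump_def by (rule power_le_one) auto
  show "norm (bump' \<rho> x) \<le> 4 / \<rho>" for x :: 'a
  proof -
    have "4 / \<rho> * max 0 (1 - (norm x)\<^sup>2 / \<rho>\<^sup>2) \<le> 4 / \<rho> * 1" using assms by (intro mult_left_mono) auto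
    then show ?thesis using bump'_le[OF assms(1), of x] by simp
  qed
  show "bump \<rho> x = 0" "bump' \<rho> x = 0" if "\<rho> < norm x" for x :: 'a
    unfolding bump_def bump'_def bump_outside[OF assms(1) that] by simp_all
qed (use assms in auto)

text \<open>The integral over the fixed ball is dominated by the weighted integrals for all large
  radii, and these are of order 1/\<rho>^2 with a constant independent of \<rho>.\<close>

lemma local_integral_eq_0:
  assumes "0 < T" "0 < m"
  shows "AE p in lborel. p \<in> slab T \<longrightarrow> norm (snd p) \<le> m \<longrightarrow> \<beta> (r p) = 0"
proof -
  let ?h = "\<lambda>p. indicator (slab T) p * \<beta> (r p) * indicator (cball 0 m) (snd p)"
  define I where "I = (\<integral>p. ?h p \<partial>lborel)"
  \<comment> \<open>The same quantity as \<open>U\<close>, named outside \<open>cutoff\<close> so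
    that one value visibly serves all radii.\<close>
  define V where "V = enn2real (\<integral>\<^sup>+p. indicator (slab T) p * ennreal ((norm (u p))\<^sup>2) \<partial>lborel)"
  have V: "0 \<le> V" by (simp add: V_def)
  have h_int: "integrable lborel ?h"
  proof (rule Bochner_Integration.integrable_bound)
    show "integrable lborel (\<lambda>p. L * indicat_real (cball (0::real \<times> 'a) (T + m)) p)"
      by (intro integrable_mult_right integrable_real_indicator) (simp_all add: emeasure_lborel_cball_finite[simplified])
    show "AE p in lborel. norm (?h p) \<le> norm (L * indicat_real (cball (0::real \<times> 'a) (T + m)) p)"
    proof (rule AE_I2)
      fix p :: "real \<times> 'a"
      show "norm (?h p) \<le> norm (L * indicat_real (cball (0::real \<times> 'a) (T + m)) p)"
      proof (cases "p \<in> slab T \<and> snd p \<in> cball 0 m")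
        case True
        then have "norm p \<le> T + m"
          using norm_Pair_le[of "fst p" "snd p"] by (auto simp: slab_def)
        then show ?thesis using True \<beta>_le[OF r_nonneg r_le] dist_sq_nonneg L_pos by simp
      qed auto
    qed
  qed measurable
  have h_nonneg: "0 \<le> ?h p" for p using dist_sq_nonneg by simp
  have bound: "I \<le> 2 * ((T * (4 / \<rho>))\<^sup>2 * L * V)" if \<rho>: "2 * m \<le> \<rho>" for \<rho>
  proof -
    have "0 < \<rho>" using \<rho> assms(2) by simp
    interpret cutoff \<eta> \<gamma> M R u r g c C\<^sub>0 C B "bump \<rho>" "bump' \<rho>" "4 / \<rho>" \<rho> T
      by (rule cutoff_bump[OF \<open>0 < \<rho>\<close> assms(1)])
    have "U = V" unfolding U_def V_def ..
    have k: "(norm (bump' \<rho> x))\<^sup>2 \<le> (4 / \<rho>)\<^sup>2 * bump \<rho> x" for x :: 'a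
      using power_mono[OF bump'_le[OF \<open>0 < \<rho>\<close>, of x] norm_ge_zero, of 2]
      unfolding bump_def power_mult_distrib .
    have "(\<integral>p. indicator (slab T) p * \<beta> (r p) * bump \<rho> (snd p) \<partial>lborel) \<le> (T * (4 / \<rho>))\<^sup>2 * L * V"
      using renormalised_bound[OF k] \<open>0 < \<rho>\<close> by (simp only: \<open>U = V\<close>) simp
    moreover have "I \<le> (\<integral>p. 2 * (indicator (slab T) p * \<beta> (r p) * bump \<rho> (snd p)) \<partial>lborel)"
      unfolding I_def
    proof (rule integral_mono[OF h_int])
      show "integrable lborel (\<lambda>p. 2 * (indicator (slab T) p * \<beta> (r p) * bump \<rho> (snd p)))"
        by (intro integrable_mult_right density_integrable) (measurable, rule \<beta>_r_abs)
      fix p :: "real \<times> 'a"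
      \<comment> \<open>For \<rho> at least 2 m the cut-off is at least (3/4)^2 = 9/16 on the ball
        of radius m, which explains the factor 2.\<close>
      have "1 \<le> 2 * bump \<rho> (snd p)" if "norm (snd p) \<le> m"
      proof -
        have "norm (snd p) / \<rho> \<le> 1 / 2" using that \<rho> \<open>0 < \<rho>\<close> by (simp add: divide_le_eq)
        then have "(norm (snd p) / \<rho>)\<^sup>2 \<le> (1 / 2)\<^sup>2" using \<open>0 < \<rho>\<close> by (intro power_mono) auto
        moreover have "(norm (snd p))\<^sup>2 / \<rho>\<^sup>2 = (norm (snd p) / \<rho>)\<^sup>2" by (rule power_divide[symmetric])
        moreover have "(1 / 2 :: real)\<^sup>2 = 1 / 4" by (simp add: power2_eq_square)
        ultimately have "3 / 4 \<le> 1 - (norm (snd p))\<^sup>2 / \<rho>\<^sup>2" by linarith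
        then have "3 / 4 \<le> max 0 (1 - (norm (snd p))\<^sup>2 / \<rho>\<^sup>2)" by (rule max.coboundedI2)
        then have "(3 / 4)\<^sup>2 \<le> bump \<rho> (snd p)" unfolding bump_def by (rule power_mono) simp
        then show ?thesis by (simp add: power2_eq_square)
      qed
      then have "indicat_real (cball 0 m) (snd p) \<le> 2 * bump \<rho> (snd p)"
        using \<phi>_bounds(1)[of "snd p"] by (cases "norm (snd p) \<le> m") simp_all
      then have "indicator (slab T) p * \<beta> (r p) * indicator (cball 0 m) (snd p)
        \<le> indicator (slab T) p * \<beta> (r p) * (2 * bump \<rho> (snd p))"
        using dist_sq_nonneg by (intro mult_left_mono) simp_all
      then show "?h p \<le> 2 * (indicator (slab T) p * \<beta> (r p) * bump \<rho> (snd p))" by simp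
    qed
    ultimately show ?thesis by simp
  qed
  have "I \<le> 0"
  proof (rule tendsto_lowerbound[OF _ _ trivial_limit_at_top_linorder])
    have "((\<lambda>\<rho>. 2 * ((T * (4 * inverse \<rho>))\<^sup>2 * L * V)) \<longlongrightarrow> 2 * ((T * (4 * 0))\<^sup>2 * L * V)) at_top"
      by (intro tendsto_intros tendsto_inverse_0_at_top filterlim_ident)
    then show "((\<lambda>\<rho>. 2 * ((T * (4 / \<rho>))\<^sup>2 * L * V)) \<longlongrightarrow> 0) at_top" by (simp add: divide_inverse)
    show "\<forall>\<^sub>F \<rho> in at_top. I \<le> 2 * ((T * (4 / \<rho>))\<^sup>2 * L * V)"
      using eventually_ge_at_top[of "2 * m"] by (rule eventually_mono) (rule bound)
  qed
  moreover have "0 \<le> I" unfolding I_def using h_nonneg by (intro integral_nonneg_AE AE_I2)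
  ultimately have "I = 0" by simp
  then have "AE p in lborel. ?h p = 0"
    using integral_nonneg_eq_0_iff_AE[OF h_int] h_nonneg unfolding I_def by simp
  then show ?thesis
    by eventually_elim (auto simp: indicator_def split: if_splits)
qed

theorem density_bounds: "AE p in lborel. c \<le> r p \<and> r p \<le> C\<^sub>0"
proof -
  have "AE p in lborel. \<forall>n. p \<in> slab (real (Suc n)) \<longrightarrow> norm (snd p) \<le> real (Suc n) \<longrightarrow> \<beta> (r p) = 0"
    unfolding AE_all_countable by (intro allI local_integral_eq_0) simp_all
  then show ?thesis
  proof eventually_elim
    case (elim p)
    obtain t x where p: "p = (t, x)" by (cases p)
    show ?case
    proof (cases "t \<le> 0")
      case True
      then show ?thesis using r_past[OF True, of x] r_initial[of x] by (simp add: p)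
    next
      case False
      obtain n where n: "max t (norm x) < real n" using reals_Archimedean2 by blast
      then have "\<beta> (r p) = 0"
        using elim[rule_format, of n] False by (simp add: p slab_def)
      then show ?thesis by (simp add: dist_sq_eq_0_iff)
    qed
  qed
qed

end

subsection \<open>Borel representatives\<close>

abbreviation half :: "(real \<times> 'a::euclidean_space) set" where
  "half \<equiv> {0<..} \<times> UNIV"

lemma half_measurable [measurable]: "(half :: (real \<times> 'a::euclidean_space) set) \<in> sets borel"
  by (intro borel_open open_Times) auto

lemma half_lebesgue [simp]: "(half :: (real \<times> 'a::euclidean_space) set) \<in> sets lebesgue"
  by (rule sets_completionI_sets) (simp add: half_measurable)

text \<open>Reduces to real functions by components; finitely many null sets are united.\<close>

lemma lebesgue_ex_borel:
  fixes f :: "'a::euclidean_space \<Rightarrow> 'b::euclidean_space"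
  assumes "f \<in> borel_measurable lebesgue"
  shows "\<exists>f'\<in>borel_measurable borel. AE x in lborel. f x = f' x"
proof -
  have "\<exists>h\<in>borel_measurable lborel. AE x in lborel. f x \<bullet> j = h x" for j
    by (rule completion_ex_borel_measurable_real) (use assms in measurable)
  then have "\<forall>j. \<exists>h. h \<in> borel_measurable lborel \<and> (AE x in lborel. f x \<bullet> j = h x)" by (simp add: Bex_def)
  from choice[OF this] obtain h where "\<forall>j. h j \<in> borel_measurable lborel \<and> (AE x in lborel. f x \<bullet> j = h j x)" ..
  then have h: "h j \<in> borel_measurable lborel" "AE x in lborel. f x \<bullet> j = h j x" for j by simp_all
  have [measurable]: "h j \<in> borel_measurable borel" for j using h(1)[of j] by simp
  have "AE x in lborel. \<forall>j\<in>Basis. f x \<bullet> j = h j x"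
    by (rule AE_finite_allI) (auto intro: h(2))
  then have "AE x in lborel. f x = (\<Sum>j\<in>Basis. h j x *\<^sub>R j)"
  proof eventually_elim
    case (elim x)
    have "f x = (\<Sum>j\<in>Basis. (f x \<bullet> j) *\<^sub>R j)" by (simp add: euclidean_representation)
    also have "\<dots> = (\<Sum>j\<in>Basis. h j x *\<^sub>R j)" by (intro sum.cong refl) (simp add: elim)
    finally show ?case .
  qed
  moreover have "(\<lambda>x. \<Sum>j\<in>Basis. h j x *\<^sub>R j) \<in> borel_measurable borel" by measurable
  ultimately show ?thesis by (rule bexI)
qed

lemma AE_spacetime_iff:
  "(AE p in lebesgue_on half. P p) \<longleftrightarrow> (AE p in lborel. p \<in> half \<longrightarrow> P p)"
  by (subst AE_restrict_space_iff) (simp_all add: AE_completion_iff)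

lemma spacetime_ex_borel:
  fixes f :: "real \<times> 'a::euclidean_space \<Rightarrow> 'b::euclidean_space"
  assumes "f \<in> borel_measurable (lebesgue_on half)"
  shows "\<exists>f'\<in>borel_measurable borel. AE p in lborel. p \<in> half \<longrightarrow> f p = f' p"
proof -
  obtain f' where f': "f' \<in> borel_measurable borel" "AE p in lborel. (if p \<in> half then f p else 0) = f' p"
    using lebesgue_ex_borel[OF borel_measurable_if_I[OF assms half_lebesgue]] by (rule bexE)
  from f'(2) have "AE p in lborel. p \<in> half \<longrightarrow> f p = f' p"
    by eventually_elim (simp split: if_splits)
  then show ?thesis using f'(1) by (rule bexI)
qed

text \<open>Translates integrals of the weak formulation into Borel integrals of zero extensions.
  Measurability of f is inherited from F by completeness of Lebesgue measure.\<close>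

lemma spacetime_integral:
  fixes f F :: "real \<times> 'a::euclidean_space \<Rightarrow> 'b::euclidean_space"
  assumes F [measurable]: "F \<in> borel_measurable borel"
    and AE: "AE p in lborel. p \<in> half \<longrightarrow> f p = F p"
  shows spacetime_integrable_iff: "integrable (lebesgue_on half) f \<longleftrightarrow> integrable lborel (\<lambda>p. indicator half p *\<^sub>R F p)"
    and spacetime_integral_eq: "integral\<^sup>L (lebesgue_on half) f = (\<integral>p. indicator half p *\<^sub>R F p \<partial>lborel)"
proof -
  have mF: "(\<lambda>p. indicator half p *\<^sub>R F p) \<in> borel_measurable lborel" by measurable
  have AE': "AE p in lebesgue. indicator half p *\<^sub>R F p = indicator half p *\<^sub>R f p"
    unfolding AE_completion_iff using AE by eventually_elim (simp split: split_indicator)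
  have mf: "(\<lambda>p. indicator half p *\<^sub>R f p) \<in> borel_measurable lebesgue"
    by (rule borel_measurable_AE[OF measurable_completion[OF mF] AE'])
  have half: "half \<inter> space lebesgue \<in> sets lebesgue" by simp
  show "integrable (lebesgue_on half) f \<longleftrightarrow> integrable lborel (\<lambda>p. indicator half p *\<^sub>R F p)"
    unfolding integrable_restrict_space[OF half]
    using integrable_cong_AE[OF measurable_completion[OF mF] mf AE'] integrable_completion[OF mF] by (simp only:)
  show "integral\<^sup>L (lebesgue_on half) f = (\<integral>p. indicator half p *\<^sub>R F p \<partial>lborel)"
    unfolding integral_restrict_space[OF half]
    using integral_cong_AE[OF measurable_completion[OF mF] mf AE'] integral_completion[OF mF] by (simp only:)
qed

lemma frechet_derivative_slice:
  fixes \<Phi> :: "real \<times> 'a::euclidean_space \<Rightarrow> real"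
  assumes "smooth \<Phi>"
  shows "frechet_derivative (\<lambda>x. \<Phi> (t, x)) (at x) v = frechet_derivative \<Phi> (at (t, x)) (0, v)"
proof -
  have "((\<lambda>x. (t, x)) has_derivative (\<lambda>v. (0, v))) (at x)" by (auto intro!: derivative_eq_intros)
  from frechet_derivative_at[OF has_derivative_compose[OF this smooth_has_derivative[OF assms]]]
  show ?thesis by (simp add: fun_eq_iff)
qed

lemma grad_slice:
  fixes \<Phi> :: "real \<times> (real^'n) \<Rightarrow> real"
  assumes "smooth \<Phi>"
  shows "grad (\<lambda>x. \<Phi> (t, x)) x $ k = frechet_derivative \<Phi> (at (t, x)) (0, axis k 1)"
    and "v \<bullet> grad (\<lambda>x. \<Phi> (t, x)) x = frechet_derivative \<Phi> (at (t, x)) (0, v)"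
proof -
  show *: "grad (\<lambda>x. \<Phi> (t, x)) x $ k = frechet_derivative \<Phi> (at (t, x)) (0, axis k 1)" for k
    by (simp add: grad_def frechet_derivative_slice[OF assms])
  have lin: "linear (\<lambda>v. frechet_derivative \<Phi> (at (t, x)) (0, v))"
    using linear_compose[of "\<lambda>v. (0, v)" "frechet_derivative \<Phi> (at (t, x))"]
      has_derivative_linear[OF smooth_has_derivative[OF assms]]
    by (auto simp: comp_def linear_iff)
  have "frechet_derivative \<Phi> (at (t, x)) (0, v) = frechet_derivative \<Phi> (at (t, x)) (0, \<Sum>k\<in>UNIV. v $ k *\<^sub>R axis k 1)"
    using basis_expansion[of v] by (simp add: scalar_mult_eq_scaleR)
  also have "\<dots> = (\<Sum>k\<in>UNIV. v $ k * frechet_derivative \<Phi> (at (t, x)) (0, axis k 1))"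
    by (simp add: linear_sum[OF lin] linear_scale[OF lin])
  also have "\<dots> = v \<bullet> grad (\<lambda>x. \<Phi> (t, x)) x"
    by (simp add: inner_vec_def *)
  finally show "v \<bullet> grad (\<lambda>x. \<Phi> (t, x)) x = frechet_derivative \<Phi> (at (t, x)) (0, v)" by simp
qed

subsection \<open>The velocity is locally integrable up to the initial time\<close>

text \<open>The spatial gradient of a coordinate function is constant, so on a large ball testing
  incompressibility with its cut-off exhibits one component of the velocity.\<close>

lemma coordinate_test_function:
  fixes k :: "'n::finite" and n :: nat
  defines "\<Phi> \<equiv> \<lambda>p::real \<times> (real^'n). (snd p $ k) * box_bump (- (real (Suc n) *\<^sub>R One)) (real (Suc n) *\<^sub>R One) 1 p"
  shows "Cc_infinity \<Phi>"
    and "norm p < real n \<Longrightarrow> frechet_derivative \<Phi> (at p) (0, v) = v $ k"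
proof -
  let ?b = "box_bump (- (real (Suc n) *\<^sub>R One)) (real (Suc n) *\<^sub>R One) 1 :: real \<times> (real^'n) \<Rightarrow> real"
  have bl: "bounded_linear (\<lambda>p::real \<times> (real^'n). snd p $ k)"
    by (intro bounded_linear_compose[OF bounded_linear_vec_nth bounded_linear_snd])
  have Cc: "Cc_infinity ?b" by (rule Cc_infinity_box_bump) simp
  show "Cc_infinity \<Phi>"
  proof (rule Cc_infinityI)
    show "smooth \<Phi>" unfolding \<Phi>_def
      by (intro smooth_mult smooth_bounded_linear bl Cc_infinity_smooth[OF Cc])
    show "bounded {p. ?b p \<noteq> 0}" using Cc by (simp add: Cc_infinity_iff)
  qed (simp add: \<Phi>_def)
  assume p: "norm p < real n"
  have "(\<Phi> has_derivative (\<lambda>v. snd v $ k)) (at p)"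
  proof (rule has_derivative_transform_within_open[OF bounded_linear_imp_has_derivative[OF bl]])
    show "open (ball (0::real \<times> (real^'n)) (real n))" by simp
    fix q :: "real \<times> (real^'n)" assume "q \<in> ball 0 (real n)"
    then have q: "norm q < real n" by simp
    \<comment> \<open>The box has half-width n + 1 and its transition layer has width 1, so the
      plateau covers the ball of radius n.\<close>
    have "?b q = 1"
    proof (rule box_bump_eq_1)
      fix i :: "real \<times> (real^'n)" assume i: "i \<in> Basis"
      have "\<bar>q \<bullet> i\<bar> < real n" using Basis_le_norm[OF i, of q] q by linarith
      then show "1 \<le> 1 * (q \<bullet> i - - (real (Suc n) *\<^sub>R One) \<bullet> i) \<and> 1 \<le> 1 * (real (Suc n) *\<^sub>R One \<bullet> i - q \<bullet> i)"
        using i by (simp add: abs_less_iff)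
    qed
    then show "snd q $ k = \<Phi> q" by (simp add: \<Phi>_def)
  qed (use p in simp)
  from fun_cong[OF frechet_derivative_at[OF this], of "(0, v)"] show "frechet_derivative \<Phi> (at p) (0, v) = v $ k"
    by simp
qed

section \<open>From a weak solution to Borel data on the whole of space-time\<close>

locale weak_density =
  fixes \<rho>\<^sub>0 :: "real^'n \<Rightarrow> real" and \<rho> :: "real \<Rightarrow> real^'n \<Rightarrow> real" and u :: "real \<Rightarrow> real^'n \<Rightarrow> real^'n"
    and G :: "real \<Rightarrow> real^'n \<Rightarrow> real^'n^'n" and c\<^sub>0 C\<^sub>0 :: real
  assumes \<rho>_bounded: "L_infinity spacetime (\<lambda>(t, x). \<rho> t x)"
    and \<rho>_nonneg: "AE (t, x) in spacetime. 0 \<le> \<rho> t x"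
    and kinetic: "L_infinity_L2 (\<lambda>t x. sqrt (\<rho> t x) *\<^sub>R u t x)"
    and gradient: "has_weak_gradient u G" and G_L2: "L2 spacetime (\<lambda>(t, x). G t x)"
    and mass: "weak_mass \<rho>\<^sub>0 \<rho> u" and incompressible: "weak_incompressible u"
    and \<rho>\<^sub>0_measurable: "\<rho>\<^sub>0 \<in> borel_measurable lebesgue"
    and \<rho>\<^sub>0_bounds: "AE x in lebesgue. c\<^sub>0 \<le> \<rho>\<^sub>0 x \<and> \<rho>\<^sub>0 x \<le> C\<^sub>0" and c\<^sub>0_pos: "0 < c\<^sub>0"
begin

abbreviation u' :: "real \<times> (real^'n) \<Rightarrow> real^'n" where "u' p \<equiv> u (fst p) (snd p)"

lemma incompressible_test:
  fixes \<Phi> :: "real \<times> (real^'n) \<Rightarrow> real"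
  assumes "Cc_infinity \<Phi>"
  shows "integrable spacetime (\<lambda>p. frechet_derivative \<Phi> (at p) (0, u' p))"
    and "(\<integral>p. frechet_derivative \<Phi> (at p) (0, u' p) \<partial>spacetime) = 0"
proof -
  have "test_closed (\<lambda>t x. \<Phi> (t, x))" using assms by (simp add: test_closed_def)
  note this[THEN incompressible[unfolded weak_incompressible_def, rule_format]]
  moreover have "(\<lambda>(s, x). u s x \<bullet> grad (\<lambda>x. \<Phi> (s, x)) x) = (\<lambda>p. frechet_derivative \<Phi> (at p) (0, u' p))"
    by (simp add: fun_eq_iff grad_slice(2)[OF Cc_infinity_smooth[OF assms]])
  ultimately show "integrable spacetime (\<lambda>p. frechet_derivative \<Phi> (at p) (0, u' p))"
    "(\<integral>p. frechet_derivative \<Phi> (at p) (0, u' p) \<partial>spacetime) = 0" by simp_all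
qed

text \<open>The integrability clause of \<open>weak_incompressible\<close> reaches down to t = 0,
  unlike \<open>L2_loc\<close>, whose compact sets stay away from the initial time.\<close>

lemma u_ball_integrable: "integrable spacetime (\<lambda>p. indicat_real (ball 0 (real n)) p * (u' p $ k))"
proof -
  let ?\<Phi> = "\<lambda>p::real \<times> (real^'n). (snd p $ k) * box_bump (- (real (Suc n) *\<^sub>R One)) (real (Suc n) *\<^sub>R One) 1 p"
  have "integrable spacetime (\<lambda>p. indicat_real (ball 0 (real n)) p * frechet_derivative ?\<Phi> (at p) (0, u' p))"
  proof (rule Bochner_Integration.integrable_bound)
    show int: "integrable spacetime (\<lambda>p. frechet_derivative ?\<Phi> (at p) (0, u' p))"
      by (rule incompressible_test(1)[OF coordinate_test_function(1)])
    have "indicat_real (ball (0 :: real \<times> (real^'n)) (real n)) \<in> borel_measurable lborel"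
      by (rule borel_measurable_indicator) simp
    then have "indicat_real (ball (0 :: real \<times> (real^'n)) (real n)) \<in> borel_measurable spacetime"
      by (intro measurable_restrict_space1 measurable_completion)
    then show "(\<lambda>p. indicat_real (ball 0 (real n)) p * frechet_derivative ?\<Phi> (at p) (0, u' p)) \<in> borel_measurable spacetime"
      using borel_measurable_integrable[OF int] by (rule borel_measurable_times)
    show "AE p in spacetime. norm (indicat_real (ball 0 (real n)) p * frechet_derivative ?\<Phi> (at p) (0, u' p))
        \<le> norm (frechet_derivative ?\<Phi> (at p) (0, u' p))"
      by (rule AE_I2) (simp add: indicator_def)
  qed
  moreover have "(\<lambda>p. indicat_real (ball 0 (real n)) p * frechet_derivative ?\<Phi> (at p) (0, u' p))
      = (\<lambda>p. indicat_real (ball 0 (real n)) p * (u' p $ k))"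
  proof
    fix p
    show "indicat_real (ball 0 (real n)) p * frechet_derivative ?\<Phi> (at p) (0, u' p) = indicat_real (ball 0 (real n)) p * (u' p $ k)"
      using coordinate_test_function(2)[of p n k "u' p"] by (cases "norm p < real n") simp_all
  qed
  ultimately show ?thesis by simp
qed

text \<open>Each component is the pointwise limit of its restrictions to balls, which are integrable
  and hence measurable.\<close>

lemma u_measurable: "u' \<in> borel_measurable spacetime"
proof (rule borel_measurable_euclidean_space[THEN iffD2], rule ballI)
  fix i :: "real^'n" assume "i \<in> Basis"
  then obtain k where i: "i = axis k 1" by (metis axis_index)
  have "(\<lambda>p. u' p $ k) \<in> borel_measurable spacetime"
  proof (rule borel_measurable_LIMSEQ_metric)
    show "(\<lambda>p. indicat_real (ball 0 (real n)) p * (u' p $ k)) \<in> borel_measurable spacetime" for n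
      by (rule borel_measurable_integrable[OF u_ball_integrable])
    fix p :: "real \<times> (real^'n)"
    obtain N where N: "norm p < real N" using reals_Archimedean2 by blast
    have "\<forall>\<^sub>F n in sequentially. indicat_real (ball 0 (real n)) p * (u' p $ k) = u' p $ k"
      using eventually_ge_at_top[of N]
    proof eventually_elim
      case (elim n)
      then have "norm p < real n" using N by linarith
      then show ?case by simp
    qed
    then show "(\<lambda>n. indicat_real (ball 0 (real n)) p * (u' p $ k)) \<longlonglongrightarrow> u' p $ k" by (rule tendsto_eventually)
  qed
  then show "(\<lambda>p. u' p \<bullet> i) \<in> borel_measurable spacetime" by (simp add: i inner_axis)
qed

text \<open>Borel representatives are fixed once by choice, as constants of the locale, so that they
  can be declared measurable and used in the definitions below.\<close>

definition U\<^sub>B :: "real \<times> (real^'n) \<Rightarrow> real^'n" where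
  "U\<^sub>B = (SOME f. f \<in> borel_measurable borel \<and> (AE p in lborel. p \<in> half \<longrightarrow> u' p = f p))"

definition G\<^sub>B :: "real \<times> (real^'n) \<Rightarrow> real^'n^'n" where
  "G\<^sub>B = (SOME f. f \<in> borel_measurable borel \<and> (AE p in lborel. p \<in> half \<longrightarrow> G (fst p) (snd p) = f p))"

definition \<rho>\<^sub>B :: "real \<times> (real^'n) \<Rightarrow> real" where
  "\<rho>\<^sub>B = (SOME f. f \<in> borel_measurable borel \<and> (AE p in lborel. p \<in> half \<longrightarrow> \<rho> (fst p) (snd p) = f p))"

definition init :: "real^'n \<Rightarrow> real" where
  "init = (SOME f. f \<in> borel_measurable borel \<and> (AE x in lborel. \<rho>\<^sub>0 x = f x))"

lemma U\<^sub>B: "U\<^sub>B \<in> borel_measurable borel" "AE p in lborel. p \<in> half \<longrightarrow> u' p = U\<^sub>B p"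
  using someI_ex[OF spacetime_ex_borel[OF u_measurable, unfolded Bex_def], folded U\<^sub>B_def] by (rule conjunct1, rule conjunct2)

lemma G\<^sub>B: "G\<^sub>B \<in> borel_measurable borel" "AE p in lborel. p \<in> half \<longrightarrow> G (fst p) (snd p) = G\<^sub>B p"
proof -
  have "(\<lambda>p. G (fst p) (snd p)) \<in> borel_measurable spacetime"
    using G_L2 by (simp add: L2_def split_beta')
  from someI_ex[OF spacetime_ex_borel[OF this, unfolded Bex_def], folded G\<^sub>B_def]
  show "G\<^sub>B \<in> borel_measurable borel" "AE p in lborel. p \<in> half \<longrightarrow> G (fst p) (snd p) = G\<^sub>B p"
    by (rule conjunct1, rule conjunct2)
qed

lemma \<rho>\<^sub>B: "\<rho>\<^sub>B \<in> borel_measurable borel" "AE p in lborel. p \<in> half \<longrightarrow> \<rho> (fst p) (snd p) = \<rho>\<^sub>B p"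
proof -
  have "(\<lambda>p. \<rho> (fst p) (snd p)) \<in> borel_measurable spacetime"
    using \<rho>_bounded by (simp add: L_infinity_def split_beta')
  from someI_ex[OF spacetime_ex_borel[OF this, unfolded Bex_def], folded \<rho>\<^sub>B_def]
  show "\<rho>\<^sub>B \<in> borel_measurable borel" "AE p in lborel. p \<in> half \<longrightarrow> \<rho> (fst p) (snd p) = \<rho>\<^sub>B p"
    by (rule conjunct1, rule conjunct2)
qed

lemma init: "init \<in> borel_measurable borel" "AE x in lborel. \<rho>\<^sub>0 x = init x"
  using someI_ex[OF lebesgue_ex_borel[OF \<rho>\<^sub>0_measurable, unfolded Bex_def], folded init_def] by (rule conjunct1, rule conjunct2)

declare U\<^sub>B(1) [measurable] G\<^sub>B(1) [measurable] \<rho>\<^sub>B(1) [measurable] init(1) [measurable]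

text \<open>The maximum with \<open>C\<^sub>0\<close> makes D bound the density at negative times
  too.\<close>

definition D :: real where
  "D = max C\<^sub>0 (SOME B. AE p in spacetime. norm (\<rho> (fst p) (snd p)) \<le> B)"

text \<open>The whole space is not a null set, so the bounds on the initial density hold together at
  some point.\<close>

lemma c\<^sub>0_le_C\<^sub>0: "c\<^sub>0 \<le> C\<^sub>0"
proof -
  have "AE x in (lborel :: (real^'n) measure). c\<^sub>0 \<le> C\<^sub>0"
    using \<rho>\<^sub>0_bounds unfolding AE_completion_iff by eventually_elim simp
  then have "{x :: real^'n. \<not> c\<^sub>0 \<le> C\<^sub>0} \<in> null_sets lborel" by (simp add: AE_iff_null)
  then show ?thesis by (cases "c\<^sub>0 \<le> C\<^sub>0") (auto simp: null_sets_def)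
qed

lemma \<rho>_le_D: "AE p in lborel. p \<in> half \<longrightarrow> \<rho> (fst p) (snd p) \<le> D"
proof -
  have "\<exists>B. AE p in spacetime. norm (\<rho> (fst p) (snd p)) \<le> B"
    using \<rho>_bounded by (simp add: L_infinity_def split_beta')
  from someI_ex[OF this] have "AE p in lborel. p \<in> half \<longrightarrow> norm (\<rho> (fst p) (snd p)) \<le> (SOME B. AE p in spacetime. norm (\<rho> (fst p) (snd p)) \<le> B)"
    unfolding AE_spacetime_iff .
  then show ?thesis by eventually_elim (auto simp: D_def)
qed

definition uu :: "real \<times> (real^'n) \<Rightarrow> real^'n" where
  "uu p = indicator half p *\<^sub>R U\<^sub>B p"

text \<open>Indexed by basis vectors, as \<open>transport\<close> expects; \<open>axis_index\<close>
  recovers the coordinate, and the row of the gradient is the partial derivative of the whole vector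
  u.\<close>

definition gg :: "real^'n \<Rightarrow> real \<times> (real^'n) \<Rightarrow> real^'n" where
  "gg i p = indicator half p *\<^sub>R (G\<^sub>B p $ axis_index i)"

text \<open>The density is extended by its initial value to negative times; the truncations only
  change it on a null set.\<close>

definition rr :: "real \<times> (real^'n) \<Rightarrow> real" where
  "rr p = (if fst p \<le> 0 then max c\<^sub>0 (min C\<^sub>0 (init (snd p))) else max 0 (min D (\<rho>\<^sub>B p)))"

lemma uu_measurable [measurable]: "uu \<in> borel_measurable borel"
  unfolding uu_def[abs_def] by measurable

lemma gg_measurable [measurable]: "gg i \<in> borel_measurable borel"
proof -
  have "(\<lambda>p. G\<^sub>B p $ axis_index i) \<in> borel_measurable borel"
    using measurable_compose[OF G\<^sub>B(1) borel_measurable_continuous_onI[OF continuous_on_component[OF continuous_on_id]]] .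
  then show ?thesis unfolding gg_def[abs_def] by measurable
qed

lemma rr_measurable [measurable]: "rr \<in> borel_measurable borel"
  unfolding rr_def[abs_def] by measurable

lemma uu_eq: "AE p in lborel. p \<in> half \<longrightarrow> u' p = uu p"
  using U\<^sub>B(2) by eventually_elim (simp add: uu_def)

lemma gg_eq: "AE p in lborel. p \<in> half \<longrightarrow> (\<forall>i. G (fst p) (snd p) $ axis_index i = gg i p)"
  using G\<^sub>B(2) by eventually_elim (simp add: gg_def)

lemma rr_eq: "AE p in lborel. p \<in> half \<longrightarrow> \<rho> (fst p) (snd p) = rr p"
proof -
  have "AE p in lborel. p \<in> half \<longrightarrow> 0 \<le> \<rho> (fst p) (snd p)"
    using \<rho>_nonneg unfolding AE_spacetime_iff by (simp add: split_beta')
  with \<rho>_le_D \<rho>\<^sub>B(2) show ?thesis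
  proof eventually_elim
    case (elim p)
    show ?case
    proof
      assume p: "p \<in> half"
      then have "0 < fst p" by (cases p) auto
      then show "\<rho> (fst p) (snd p) = rr p" using elim p by (simp add: rr_def)
    qed
  qed
qed

lemma rr_initial: "AE x in lborel. \<rho>\<^sub>0 x = rr (0, x)"
proof -
  have "AE x in lborel. c\<^sub>0 \<le> \<rho>\<^sub>0 x \<and> \<rho>\<^sub>0 x \<le> C\<^sub>0" using \<rho>\<^sub>0_bounds by (simp only: AE_completion_iff)
  with init(2) show ?thesis by eventually_elim (simp add: rr_def)
qed

lemma uu_L1_loc: "L1_loc uu"
  unfolding L1_loc_def
proof safe
  have [measurable]: "ball (0 :: real \<times> (real^'n)) r \<in> sets borel" "cball (0 :: real \<times> (real^'n)) r \<in> sets borel" for r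
    by simp_all
  fix S :: real
  obtain n where n: "S < real n" using reals_Archimedean2 by blast
  have "integrable lborel (\<lambda>p. (indicat_real (ball 0 (real n)) p * (uu p \<bullet> i)) *\<^sub>R i)" if i: "i \<in> Basis" for i
  proof (rule integrable_scaleR_left)
    obtain k where k: "i = axis k 1" using i by (metis axis_index)
    have "integrable lborel (\<lambda>p. indicator half p *\<^sub>R (indicat_real (ball 0 (real n)) p * (uu p \<bullet> i)))"
    proof (rule spacetime_integrable_iff[THEN iffD1, OF _ _ u_ball_integrable])
      show "AE p in lborel. p \<in> half \<longrightarrow> indicat_real (ball 0 (real n)) p * (u' p $ k) = indicat_real (ball 0 (real n)) p * (uu p \<bullet> i)"
        using uu_eq by eventually_elim (simp add: k inner_axis)
    qed measurable
    moreover have "indicator half p *\<^sub>R (indicat_real (ball 0 (real n)) p * (uu p \<bullet> i)) = indicat_real (ball 0 (real n)) p * (uu p \<bullet> i)" for p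
      by (cases "p \<in> half") (simp_all add: uu_def)
    ultimately show "integrable lborel (\<lambda>p. indicat_real (ball 0 (real n)) p * (uu p \<bullet> i))" by (simp only:)
  qed
  then have "integrable lborel (\<lambda>p. \<Sum>i\<in>Basis. (indicat_real (ball 0 (real n)) p * (uu p \<bullet> i)) *\<^sub>R i)"
    by (rule Bochner_Integration.integrable_sum)
  moreover have "(\<Sum>i\<in>Basis. (indicat_real (ball 0 (real n)) p * (uu p \<bullet> i)) *\<^sub>R i) = indicat_real (ball 0 (real n)) p *\<^sub>R uu p" for p
    by (simp add: scaleR_scaleR[symmetric] scaleR_sum_right[symmetric] euclidean_representation del: scaleR_scaleR)
  ultimately have int: "integrable lborel (\<lambda>p. indicat_real (ball 0 (real n)) p *\<^sub>R uu p)" by simp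
  show "integrable lborel (\<lambda>p. indicat_real (cball 0 S) p *\<^sub>R uu p)"
  proof (rule Bochner_Integration.integrable_bound[OF int])
    have "norm (indicat_real (cball 0 S) p *\<^sub>R uu p) \<le> norm (indicat_real (ball 0 (real n)) p *\<^sub>R uu p)" for p
      using n by (cases "norm p \<le> S") simp_all
    then show "AE p in lborel. norm (indicat_real (cball 0 S) p *\<^sub>R uu p) \<le> norm (indicat_real (ball 0 (real n)) p *\<^sub>R uu p)"
      by (rule AE_I2)
  qed measurable
qed measurable

end

section \<open>Verification of the hypotheses on the extended data\<close>

context weak_density
begin

lemma half_iff: "p \<in> half \<longleftrightarrow> 0 < fst p"
  by (cases p) auto

lemma gg_L2:
  shows "integrable lborel (\<lambda>p. (norm (gg i p))\<^sup>2)"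
proof (rule Bochner_Integration.integrable_bound)
  have "integrable spacetime (\<lambda>p. (norm (G (fst p) (snd p)))\<^sup>2)"
    using G_L2 by (simp add: L2_def split_beta')
  then show "integrable lborel (\<lambda>p. indicator half p *\<^sub>R (norm (G\<^sub>B p))\<^sup>2)"
  proof (rule spacetime_integrable_iff[THEN iffD1, rotated 2])
    show "AE p in lborel. p \<in> half \<longrightarrow> (norm (G (fst p) (snd p)))\<^sup>2 = (norm (G\<^sub>B p))\<^sup>2"
      using G\<^sub>B(2) by eventually_elim simp
  qed measurable
  show "AE p in lborel. norm ((norm (gg i p))\<^sup>2) \<le> norm (indicator half p *\<^sub>R (norm (G\<^sub>B p))\<^sup>2)"
  proof (rule AE_I2)
    fix p
    have "(norm (G\<^sub>B p $ axis_index i))\<^sup>2 \<le> (norm (G\<^sub>B p))\<^sup>2"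
      by (intro power_mono Finite_Cartesian_Product.norm_nth_le) simp
    then show "norm ((norm (gg i p))\<^sup>2) \<le> norm (indicator half p *\<^sub>R (norm (G\<^sub>B p))\<^sup>2)"
      by (cases "p \<in> half") (simp_all add: gg_def)
  qed
qed measurable

lemma gg_L1_loc: "L1_loc (gg i)"
  by (rule L1_locI_L2[OF gg_measurable gg_L2])

text \<open>The weak gradient is defined through test functions supported in t > 0. A smooth factor
  in time that is 0 up to 1/n and 1 from 2/n on makes any test function admissible, and it commutes
  with spatial derivatives.\<close>

lemma gradient_test_open:
  fixes \<Phi> :: "real \<times> (real^'n) \<Rightarrow> real"
  assumes \<Phi>: "Cc_infinity \<Phi>" and i: "i \<in> Basis" and j: "j \<in> Basis" and n: "0 < (n::nat)"
  shows "(\<integral>p. smooth_step (real n * fst p - 1) * ((uu p \<bullet> j) * frechet_derivative \<Phi> (at p) (0, i)) \<partial>lborel)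
    = - (\<integral>p. smooth_step (real n * fst p - 1) * ((gg i p \<bullet> j) * \<Phi> p) \<partial>lborel)"
proof -
  obtain k l where i': "i = axis k 1" and j': "j = axis l 1" using i j by (metis axis_index)
  note sm = Cc_infinity_smooth[OF \<Phi>]
  note [measurable] = smooth_measurable[OF sm] smooth_measurable_derivative[OF sm] smooth_measurable[OF smooth_smooth_step]
  define s where "s t = smooth_step (real n * t - 1)" for t :: real
  have [measurable]: "s \<in> borel_measurable borel" unfolding s_def[abs_def] by measurable
  define \<phi> where "\<phi> t x = s t * \<Phi> (t, x)" for t x
  have \<phi>_eq: "(\<lambda>(t, x). \<phi> t x) = (\<lambda>p. s (fst p) * \<Phi> p)" by (auto simp: \<phi>_def)
  have out: "s t = 0" if "t \<le> 1 / real n" for t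
    unfolding s_def using that n by (intro smooth_step_eq_0) (simp add: field_simps)
  have "smooth (\<lambda>p::real \<times> (real^'n). s (fst p))"
  proof -
    have "bounded_linear (\<lambda>p::real \<times> (real^'n). real n * fst p)"
      by (intro bounded_linear_const_mult bounded_linear_fst)
    from smooth_affine[OF smooth_smooth_step this, of "-1"] show ?thesis by (simp add: s_def)
  qed
  then have "smooth (\<lambda>p. s (fst p) * \<Phi> p)" by (intro smooth_mult sm)
  then have Cc: "Cc_infinity (\<lambda>p. s (fst p) * \<Phi> p)"
    by (rule Cc_infinityI[where S = "{p. \<Phi> p \<noteq> 0}"]) (use \<Phi> in \<open>auto simp: Cc_infinity_iff\<close>)
  have "closure {p :: real \<times> (real^'n). s (fst p) * \<Phi> p \<noteq> 0} \<subseteq> {1 / real n..} \<times> UNIV"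
  proof (rule closure_minimal)
    show "{p :: real \<times> (real^'n). s (fst p) * \<Phi> p \<noteq> 0} \<subseteq> {1 / real n..} \<times> UNIV"
    proof (rule subsetI)
      fix p :: "real \<times> (real^'n)" assume "p \<in> {p. s (fst p) * \<Phi> p \<noteq> 0}"
      then have "s (fst p) \<noteq> 0" by simp
      then have "1 / real n \<le> fst p" using out[of "fst p"] by (cases "fst p \<le> 1 / real n") simp_all
      then show "p \<in> {1 / real n..} \<times> UNIV" by (simp add: mem_Times_iff)
    qed
  qed (intro closed_Times closed_atLeast closed_UNIV)
  also have "{1 / real n..} \<times> (UNIV :: (real^'n) set) \<subseteq> half" 
  proof
    fix p :: "real \<times> (real^'n)" assume "p \<in> {1 / real n..} \<times> UNIV"
    then have "1 / real n \<le> fst p" by (cases p) simp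
    moreover have "0 < 1 / real n" using n by simp
    ultimately show "p \<in> half" unfolding half_iff by linarith
  qed
  finally have "test_open \<phi>"
    unfolding test_open_def
  proof -
    assume *: "closure {p. s (fst p) * \<Phi> p \<noteq> 0} \<subseteq> half"
    have set_eq: "{(t, x). \<phi> t x \<noteq> 0} = {p. s (fst p) * \<Phi> p \<noteq> 0}" by (auto simp: \<phi>_def)
    show "Cc_infinity (\<lambda>(t, x). \<phi> t x) \<and> closure {(t, x). \<phi> t x \<noteq> 0} \<subseteq> half"
      unfolding \<phi>_eq set_eq using Cc * by blast
  qed
  then have eq: "(LINT (t, x)|spacetime. u t x $ l * grad (\<phi> t) x $ k) = - (LINT (t, x)|spacetime. G t x $ k $ l * \<phi> t x)"
    using gradient[unfolded has_weak_gradient_def, rule_format, of \<phi> l k] by simp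
  have grad_eq: "grad (\<phi> t) x $ k = s t * frechet_derivative \<Phi> (at (t, x)) (0, i)" for t x
  proof -
    have "((\<lambda>x. \<Phi> (t, x)) has_derivative (\<lambda>v. frechet_derivative \<Phi> (at (t, x)) (0, v))) (at x)"
    proof -
      have "((\<lambda>x. (t, x)) has_derivative (\<lambda>v. (0, v))) (at x)" by (auto intro!: derivative_eq_intros)
      from has_derivative_compose[OF this smooth_has_derivative[OF sm]] show ?thesis .
    qed
    from frechet_derivative_at[OF has_derivative_mult_right[OF this, of "s t"]]
    have "(\<lambda>v. s t * frechet_derivative \<Phi> (at (t, x)) (0, v)) = frechet_derivative (\<phi> t) (at x)"
      by (simp add: \<phi>_def[abs_def])
    from fun_cong[OF this, of "axis k 1"] show ?thesis by (simp add: grad_def i')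
  qed
  have "(LINT (t, x)|spacetime. u t x $ l * grad (\<phi> t) x $ k)
      = (\<integral>p. indicator half p *\<^sub>R (s (fst p) * ((uu p \<bullet> j) * frechet_derivative \<Phi> (at p) (0, i))) \<partial>lborel)"
  proof (rule spacetime_integral_eq)
    show "AE p in lborel. p \<in> half \<longrightarrow> (case p of (t, x) \<Rightarrow> u t x $ l * grad (\<phi> t) x $ k)
      = s (fst p) * ((uu p \<bullet> j) * frechet_derivative \<Phi> (at p) (0, i))"
      using uu_eq
    proof eventually_elim
      case (elim p)
      then show ?case by (cases p) (simp add: grad_eq j' inner_axis)
    qed
  qed measurable
  moreover have "(LINT (t, x)|spacetime. G t x $ k $ l * \<phi> t x)
      = (\<integral>p. indicator half p *\<^sub>R (s (fst p) * ((gg i p \<bullet> j) * \<Phi> p)) \<partial>lborel)"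
  proof (rule spacetime_integral_eq)
    show "AE p in lborel. p \<in> half \<longrightarrow> (case p of (t, x) \<Rightarrow> G t x $ k $ l * \<phi> t x) = s (fst p) * ((gg i p \<bullet> j) * \<Phi> p)"
      using gg_eq
    proof eventually_elim
      case (elim p)
      have "G (fst p) (snd p) $ k = gg i p" if "p \<in> half"
        using elim[rule_format, OF that, of i] by (simp add: i')
      then show ?case by (cases p) (simp add: \<phi>_def j' inner_axis)
    qed
  qed measurable
  ultimately have "(\<integral>p. indicator half p *\<^sub>R (s (fst p) * ((uu p \<bullet> j) * frechet_derivative \<Phi> (at p) (0, i))) \<partial>lborel)
      = - (\<integral>p. indicator half p *\<^sub>R (s (fst p) * ((gg i p \<bullet> j) * \<Phi> p)) \<partial>lborel)"
    using eq by simp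
  moreover have "indicator half p *\<^sub>R (s (fst p) * ((uu p \<bullet> j) * frechet_derivative \<Phi> (at p) (0, i)))
      = s (fst p) * ((uu p \<bullet> j) * frechet_derivative \<Phi> (at p) (0, i))" for p
    by (cases "p \<in> half") (simp_all add: uu_def)
  moreover have "indicator half p *\<^sub>R (s (fst p) * ((gg i p \<bullet> j) * \<Phi> p)) = s (fst p) * ((gg i p \<bullet> j) * \<Phi> p)" for p
    by (cases "p \<in> half") (simp_all add: gg_def)
  ultimately show ?thesis by (simp only: s_def)
qed

text \<open>At each positive time the factor is eventually 1, and at other times f vanishes; f
  itself is the majorant.\<close>

lemma smooth_step_limit:
  fixes f :: "real \<times> (real^'n) \<Rightarrow> real"
  assumes f: "integrable lborel f" and "\<And>p. p \<notin> half \<Longrightarrow> f p = 0"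
  shows "(\<lambda>n. \<integral>p. smooth_step (real (Suc n) * fst p - 1) * f p \<partial>lborel) \<longlonglongrightarrow> (\<integral>p. f p \<partial>lborel)"
proof (rule integral_dominated_convergence)
  note [measurable] = smooth_measurable[OF smooth_smooth_step]
  have [measurable]: "f \<in> borel_measurable borel" using borel_measurable_integrable[OF f] by simp
  show "integrable lborel (\<lambda>p. norm (f p))" using f by (rule integrable_norm)
  show "AE p in lborel. norm (smooth_step (real (Suc n) * fst p - 1) * f p) \<le> norm (f p)" for n
  proof (rule AE_I2)
    fix p
    have "\<bar>smooth_step (real (Suc n) * fst p - 1)\<bar> * \<bar>f p\<bar> \<le> 1 * \<bar>f p\<bar>"
      using smooth_step_nonneg smooth_step_le_1 by (intro mult_right_mono) auto
    then show "norm (smooth_step (real (Suc n) * fst p - 1) * f p) \<le> norm (f p)" by (simp only: real_norm_def abs_mult mult_1_left)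
  qed
  show "AE p in lborel. (\<lambda>n. smooth_step (real (Suc n) * fst p - 1) * f p) \<longlonglongrightarrow> f p"
  proof (rule AE_I2)
    fix p
    show "(\<lambda>n. smooth_step (real (Suc n) * fst p - 1) * f p) \<longlonglongrightarrow> f p"
    proof (cases "p \<in> half")
      case True
      then have t: "0 < fst p" by (simp only: half_iff)
      obtain N where N: "2 / fst p < real N" using reals_Archimedean2 by blast
      have "\<forall>\<^sub>F n in sequentially. smooth_step (real (Suc n) * fst p - 1) * f p = f p"
        using eventually_ge_at_top[of N]
      proof eventually_elim
        case (elim n)
        then have "2 / fst p < real (Suc n)" using N by linarith
        then have "2 < real (Suc n) * fst p" using t by (simp add: divide_less_eq)
        then have "smooth_step (real (Suc n) * fst p - 1) = 1" by (intro smooth_step_eq_1) linarith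
        then show ?case by (simp only: mult_1_left)
      qed
      then show ?thesis by (rule tendsto_eventually)
    next
      case False
      then have "f p = 0" by (rule assms(2))
      then show ?thesis by (simp only: mult_zero_right tendsto_const)
    qed
  qed
qed (use borel_measurable_integrable[OF f] smooth_measurable[OF smooth_smooth_step] in measurable)

text \<open>The time factor is removed by n tending to infinity, with local integrability of the
  velocity up to t = 0 as domination. No term at t = 0 appears because no time derivative is
  involved.\<close>

lemma gradient_test:
  fixes \<Phi> :: "real \<times> (real^'n) \<Rightarrow> real"
  assumes \<Phi>: "Cc_infinity \<Phi>" and i: "i \<in> Basis" and j: "j \<in> Basis"
  shows "(\<integral>p. (uu p \<bullet> j) * frechet_derivative \<Phi> (at p) (0, i) \<partial>lborel) = - (\<integral>p. (gg i p \<bullet> j) * \<Phi> p \<partial>lborel)"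
proof -
  note sm = Cc_infinity_smooth[OF \<Phi>]
  note [measurable] = smooth_measurable[OF sm] smooth_measurable_derivative[OF sm]
  obtain S where S: "S > 0" "\<And>x. S < norm x \<Longrightarrow> \<Phi> x = 0"
    "\<And>x v. S < norm x \<Longrightarrow> frechet_derivative \<Phi> (at x) v = 0"
    using Cc_infinity_support[OF \<Phi>] by blast
  obtain K where K: "K > 0" "\<And>x. norm (\<Phi> x) \<le> K" "\<And>x v. norm (frechet_derivative \<Phi> (at x) v) \<le> K * norm v"
    using Cc_infinity_bounded[OF \<Phi>] by blast
  have iu: "integrable lborel (\<lambda>p. (uu p \<bullet> j) * frechet_derivative \<Phi> (at p) (0, i))"
    by (rule L1_loc_mult_real[OF L1_loc_inner[OF uu_L1_loc], of _ "K * norm (0::real, i)" S]) (use S K(3)[of _ "(0, i)"] in auto)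
  have ig: "integrable lborel (\<lambda>p. (gg i p \<bullet> j) * \<Phi> p)"
    by (rule L1_loc_mult_real[OF L1_loc_inner[OF gg_L1_loc], of _ K S]) (use S K in auto)
  have "(\<lambda>n. \<integral>p. smooth_step (real (Suc n) * fst p - 1) * ((uu p \<bullet> j) * frechet_derivative \<Phi> (at p) (0, i)) \<partial>lborel)
      \<longlonglongrightarrow> (\<integral>p. (uu p \<bullet> j) * frechet_derivative \<Phi> (at p) (0, i) \<partial>lborel)"
    by (rule smooth_step_limit[OF iu]) (simp add: uu_def)
  moreover have "(\<lambda>n. \<integral>p. smooth_step (real (Suc n) * fst p - 1) * ((gg i p \<bullet> j) * \<Phi> p) \<partial>lborel)
      \<longlonglongrightarrow> (\<integral>p. (gg i p \<bullet> j) * \<Phi> p \<partial>lborel)"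
    by (rule smooth_step_limit[OF ig]) (simp add: gg_def)
  from tendsto_minus[OF this]
  have "(\<lambda>n. \<integral>p. smooth_step (real (Suc n) * fst p - 1) * ((uu p \<bullet> j) * frechet_derivative \<Phi> (at p) (0, i)) \<partial>lborel)
      \<longlonglongrightarrow> - (\<integral>p. (gg i p \<bullet> j) * \<Phi> p \<partial>lborel)"
    by (simp only: gradient_test_open[OF \<Phi> i j zero_less_Suc])
  ultimately show ?thesis by (rule LIMSEQ_unique)
qed

lemma incompressible_lborel:
  fixes \<Phi> :: "real \<times> (real^'n) \<Rightarrow> real"
  assumes \<Phi>: "Cc_infinity \<Phi>"
  shows "(\<integral>p. frechet_derivative \<Phi> (at p) (0, uu p) \<partial>lborel) = 0"
proof -
  note sm = Cc_infinity_smooth[OF \<Phi>]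
  note [measurable] = smooth_measurable[OF sm] smooth_measurable_derivative[OF sm]
  have lin: "linear (frechet_derivative \<Phi> (at p))" for p
    by (rule has_derivative_linear[OF smooth_has_derivative[OF sm]])
  have expand: "frechet_derivative \<Phi> (at p) (0, v) = (\<Sum>i\<in>Basis. (v \<bullet> i) *\<^sub>R frechet_derivative \<Phi> (at p) (0, i))" for p v
  proof -
    have "(0::real, v) = (\<Sum>i\<in>Basis. (v \<bullet> i) *\<^sub>R (0, i))"
      by (simp add: prod_eq_iff fst_sum snd_sum euclidean_representation)
    then have "frechet_derivative \<Phi> (at p) (0, v) = frechet_derivative \<Phi> (at p) (\<Sum>i\<in>Basis. (v \<bullet> i) *\<^sub>R (0, i))"
      by (simp only:)
    then show ?thesis by (simp only: linear_sum[OF lin] linear_scale[OF lin])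
  qed
  have [measurable]: "(\<lambda>p. frechet_derivative \<Phi> (at p) (0, uu p)) \<in> borel_measurable borel"
    by (rule ssubst[OF ext[OF expand]]) measurable
  have zero: "frechet_derivative \<Phi> (at p) (0, 0) = 0" for p
    using linear_0[OF lin[of p]] by (simp add: zero_prod_def)
  have "(\<integral>p. frechet_derivative \<Phi> (at p) (0, u' p) \<partial>spacetime) = (\<integral>p. indicator half p *\<^sub>R frechet_derivative \<Phi> (at p) (0, uu p) \<partial>lborel)"
  proof (rule spacetime_integral_eq)
    show "AE p in lborel. p \<in> half \<longrightarrow> frechet_derivative \<Phi> (at p) (0, u' p) = frechet_derivative \<Phi> (at p) (0, uu p)"
      using uu_eq by eventually_elim simp
  qed measurable
  moreover have "indicator half p *\<^sub>R frechet_derivative \<Phi> (at p) (0, uu p) = frechet_derivative \<Phi> (at p) (0, uu p)" for p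
    by (cases "p \<in> half") (simp_all add: uu_def zero)
  ultimately show ?thesis using incompressible_test(2)[OF \<Phi>] by (simp only:)
qed

text \<open>Supplies the initial term of the weak formulation as an integral over negative
  times.\<close>

lemma integral_past:
  fixes \<theta> :: "real \<Rightarrow> real"
  assumes \<theta>: "Cc_infinity \<theta>"
  shows "integrable lborel (\<lambda>t. indicator {..0} t * frechet_derivative \<theta> (at t) 1)"
    and "(\<integral>t. indicator {..0} t * frechet_derivative \<theta> (at t) 1 \<partial>lborel) = \<theta> 0"
proof -
  note sm = Cc_infinity_smooth[OF \<theta>]
  obtain S where S: "S > 0" "\<And>x. S < norm x \<Longrightarrow> \<theta> x = 0"
    "\<And>x v. S < norm x \<Longrightarrow> frechet_derivative \<theta> (at x) v = 0"
    using Cc_infinity_support[OF \<theta>] by blast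
  let ?f = "\<lambda>t. frechet_derivative \<theta> (at t) 1"
  have lin: "?f t * h = frechet_derivative \<theta> (at t) h" for t h
    using linear_scale[OF has_derivative_linear[OF smooth_has_derivative[OF sm, of t]], of h 1]
    by (simp only: real_scaleR_def mult_1_right mult.commute[of h])
  have der: "(\<theta> has_real_derivative ?f t) (at t)" for t
    unfolding has_field_derivative_def lin by (rule smooth_has_derivative[OF sm])
  \<comment> \<open>The lower end -(S+1) lies outside the support of \<theta>, so the primitive
    contributes only its value at 0.\<close>
  have eq: "indicator {..0} t * ?f t = indicator {-(S+1)..0} t *\<^sub>R ?f t" for t
  proof (cases "S < norm t")
    case True
    then show ?thesis by (simp only: S(3) mult_zero_right scaleR_zero_right)
  next
    case False
    then show ?thesis by (cases "t \<le> 0") simp_all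
  qed
  have cont: "continuous_on {-(S+1)..0} ?f" by (rule smooth_continuous_on_derivative[OF sm])
  show "integrable lborel (\<lambda>t. indicator {..0} t * ?f t)"
    unfolding eq using borel_integrable_atLeastAtMost'[OF cont] by (simp add: set_integrable_def)
  have "(\<integral>t. indicator {-(S+1)..0} t *\<^sub>R ?f t \<partial>lborel) = \<theta> 0 - \<theta> (-(S+1))"
  proof (rule integral_FTC_atLeastAtMost)
    show "(\<theta> has_vector_derivative ?f t) (at t within {-(S+1)..0})" for t
      using has_field_derivative_at_within[OF der] by (simp add: has_real_derivative_iff_has_vector_derivative)
  qed (use S(1) cont in auto)
  then show "(\<integral>t. indicator {..0} t * ?f t \<partial>lborel) = \<theta> 0"
    unfolding eq using S(1) S(2)[of "-(S+1)"] by simp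
qed

lemma rr_bounds: "0 \<le> rr p" "rr p \<le> D"
proof -
  have "c\<^sub>0 \<le> D" using c\<^sub>0_le_C\<^sub>0 by (simp add: D_def)
  then have "0 \<le> D" using c\<^sub>0_pos by linarith
  moreover have "C\<^sub>0 \<le> D" by (simp add: D_def)
  ultimately show "0 \<le> rr p" "rr p \<le> D"
    using c\<^sub>0_pos \<open>c\<^sub>0 \<le> D\<close> by (cases "fst p \<le> 0"; simp only: rr_def if_True if_False; linarith)+
qed

text \<open>For t \<le> 0 the velocity vanishes and the density is constant in time, so the past
  contributes \<theta>(0) times the integral of the initial density against \<psi>. This is exactly
  the initial term of \<open>weak_mass\<close>.\<close>

lemma rr_transported: "transported uu rr"
  unfolding transported_def
proof (intro allI impI)
  fix \<theta> :: "real \<Rightarrow> real" and \<psi> :: "real^'n \<Rightarrow> real" assume \<theta>: "Cc_infinity \<theta>" and \<psi>: "Cc_infinity \<psi>"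
  note s\<theta> = Cc_infinity_smooth[OF \<theta>] and s\<psi> = Cc_infinity_smooth[OF \<psi>]
  note tensor = Cc_infinity_tensor[OF \<theta> \<psi>]
  note st = Cc_infinity_smooth[OF tensor]
  note [measurable] = smooth_measurable[OF s\<theta>] smooth_measurable[OF s\<psi>]
    smooth_measurable_derivative[OF s\<theta>] smooth_measurable_derivative[OF s\<psi>]
  let ?\<theta>' = "\<lambda>t. frechet_derivative \<theta> (at t) 1"
  let ?d\<psi> = "\<lambda>x v. frechet_derivative \<psi> (at x) v"
  obtain S where S: "S > 0" "\<And>x. S < norm x \<Longrightarrow> \<theta> x = 0" "\<And>x v. S < norm x \<Longrightarrow> frechet_derivative \<theta> (at x) v = 0"
    using Cc_infinity_support[OF \<theta>] by blast
  obtain K where K: "K > 0" "\<And>x. norm (\<theta> x) \<le> K" "\<And>x v. norm (frechet_derivative \<theta> (at x) v) \<le> K * norm v"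
    using Cc_infinity_bounded[OF \<theta>] by blast
  obtain S2 where S2: "S2 > 0" "\<And>x. S2 < norm x \<Longrightarrow> \<psi> x = 0" "\<And>x v. S2 < norm x \<Longrightarrow> frechet_derivative \<psi> (at x) v = 0"
    using Cc_infinity_support[OF \<psi>] by blast
  obtain K2 where K2: "K2 > 0" "\<And>x. norm (\<psi> x) \<le> K2" "\<And>x v. norm (frechet_derivative \<psi> (at x) v) \<le> K2 * norm v"
    using Cc_infinity_bounded[OF \<psi>] by blast
  have D: "0 \<le> D" by (rule order_trans[OF rr_bounds])
  have rr_abs: "\<bar>rr p\<bar> \<le> D" for p using rr_bounds[of p] by simp
  have out: "S < norm (fst p) \<or> S2 < norm (snd p)" if "S + S2 < norm p" for p :: "real \<times> (real^'n)"
  proof -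
    have "norm p \<le> norm (fst p) + norm (snd p)" using norm_Pair_le[of "fst p" "snd p"] by simp
    then show ?thesis using that by linarith
  qed
  have one: "L1_loc (\<lambda>p::real \<times> (real^'n). 1::real)"
  proof -
    have "integrable lborel (indicat_real (cball (0 :: real \<times> (real^'n)) R))" for R
      by (rule integrable_real_indicator) (simp_all add: emeasure_lborel_cball_finite[simplified])
    then show ?thesis by (simp add: L1_loc_def)
  qed
  have "integrable lborel (\<lambda>p. 1 * (rr p * (?\<theta>' (fst p) * \<psi> (snd p))))"
  proof (rule L1_loc_mult_real[OF one, where M = "D * (K * K2)" and R = "S + S2"])
    show "\<bar>rr p * (?\<theta>' (fst p) * \<psi> (snd p))\<bar> \<le> D * (K * K2)" for p
      unfolding abs_mult using D K K(3)[of "fst p" 1] K2(1) K2(2)[of "snd p"] by (intro mult_mono rr_abs) auto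
    show "rr p * (?\<theta>' (fst p) * \<psi> (snd p)) = 0" if "S + S2 < norm p" for p
      using out[OF that] S(3)[of "fst p"] S2(2)[of "snd p"] by auto
  qed measurable
  then have i1: "integrable lborel (\<lambda>p. rr p * (?\<theta>' (fst p) * \<psi> (snd p)))" by (simp only: mult_1_left)
  have lin: "linear (?d\<psi> x)" for x by (rule has_derivative_linear[OF smooth_has_derivative[OF s\<psi>]])
  have expand: "?d\<psi> x v = (\<Sum>i\<in>Basis. (v \<bullet> i) * ?d\<psi> x i)" for x v
  proof -
    have "?d\<psi> x v = ?d\<psi> x (\<Sum>i\<in>Basis. (v \<bullet> i) *\<^sub>R i)" by (simp only: euclidean_representation)
    then show ?thesis by (simp only: linear_sum[OF lin] linear_scale[OF lin] real_scaleR_def)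
  qed
  have [measurable]: "(\<lambda>p. ?d\<psi> (snd p) (uu p)) \<in> borel_measurable borel"
    by (rule ssubst[OF ext[OF expand]]) measurable
  have i2: "integrable lborel (\<lambda>p. rr p * (\<theta> (fst p) * ?d\<psi> (snd p) (uu p)))"
  proof -
    have "integrable lborel (\<lambda>p. (uu p \<bullet> i) * (rr p * (\<theta> (fst p) * ?d\<psi> (snd p) i)))" for i
    proof (rule L1_loc_mult_real[OF L1_loc_inner[OF uu_L1_loc], where M = "D * (K * (K2 * norm i))" and R = "S + S2"])
      show "\<bar>rr p * (\<theta> (fst p) * ?d\<psi> (snd p) i)\<bar> \<le> D * (K * (K2 * norm i))" for p
        unfolding abs_mult using D K(1) K(2)[of "fst p"] K2(1) K2(3)[of "snd p" i] by (intro mult_mono rr_abs) auto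
      show "rr p * (\<theta> (fst p) * ?d\<psi> (snd p) i) = 0" if "S + S2 < norm p" for p
        using out[OF that] S(2)[of "fst p"] S2(3)[of "snd p"] by auto
    qed measurable
    then have "integrable lborel (\<lambda>p. \<Sum>i\<in>Basis. (uu p \<bullet> i) * (rr p * (\<theta> (fst p) * ?d\<psi> (snd p) i)))"
      by (rule Bochner_Integration.integrable_sum)
    moreover have "(\<Sum>i\<in>Basis. (uu p \<bullet> i) * (rr p * (\<theta> (fst p) * ?d\<psi> (snd p) i))) = rr p * (\<theta> (fst p) * ?d\<psi> (snd p) (uu p))" for p
      unfolding expand[of "snd p" "uu p"] sum_distrib_left by (intro sum.cong refl) (simp add: mult_ac)
    ultimately show ?thesis by (simp only:)
  qed
  have "test_closed (\<lambda>t x. \<theta> t * \<psi> x)" using tensor by (simp add: test_closed_def split_beta')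
  then have eq: "- (LINT (s, x)|spacetime. \<rho> s x * dt (\<lambda>t x. \<theta> t * \<psi> x) s x)
      = (LINT (s, x)|spacetime. \<rho> s x * (u s x \<bullet> grad (\<lambda>x. \<theta> s * \<psi> x) x)) + (LINT x|lebesgue. \<rho>\<^sub>0 x * (\<theta> 0 * \<psi> x))"
    by (rule mass[unfolded weak_mass_def, rule_format])
  have dt_eq: "dt (\<lambda>t x. \<theta> t * \<psi> x) s x = ?\<theta>' s * \<psi> x" for s x
  proof -
    have "frechet_derivative \<theta> (at s) h * \<psi> x = h *\<^sub>R (?\<theta>' s * \<psi> x)" for h
      using linear_scale[OF has_derivative_linear[OF smooth_has_derivative[OF s\<theta>, of s]], of h 1] by simp
    then have "(\<lambda>h. frechet_derivative \<theta> (at s) h * \<psi> x) = (\<lambda>h. h *\<^sub>R (?\<theta>' s * \<psi> x))" by (rule ext)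
    with has_derivative_mult_left[OF smooth_has_derivative[OF s\<theta>, of s], of "\<psi> x"]
    have "((\<lambda>t. \<theta> t * \<psi> x) has_vector_derivative (?\<theta>' s * \<psi> x)) (at s)"
      unfolding has_vector_derivative_def by (rule back_subst)
    then show ?thesis unfolding dt_def by (rule vector_derivative_at)
  qed
  have lin0: "frechet_derivative \<theta> (at t) 0 = 0" for t
    by (rule linear_0[OF has_derivative_linear[OF smooth_has_derivative[OF s\<theta>]]])
  have grad_eq: "v \<bullet> grad (\<lambda>x. \<theta> s * \<psi> x) x = \<theta> s * ?d\<psi> x v" for s x v
    using grad_slice(2)[OF st, of v s x] by (simp add: frechet_derivative_tensor[OF s\<theta> s\<psi>] lin0)
  have e1: "(LINT (s, x)|spacetime. \<rho> s x * dt (\<lambda>t x. \<theta> t * \<psi> x) s x)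
      = (\<integral>p. indicator half p *\<^sub>R (rr p * (?\<theta>' (fst p) * \<psi> (snd p))) \<partial>lborel)"
  proof (rule spacetime_integral_eq)
    show "AE p in lborel. p \<in> half \<longrightarrow> (case p of (s, x) \<Rightarrow> \<rho> s x * dt (\<lambda>t x. \<theta> t * \<psi> x) s x) = rr p * (?\<theta>' (fst p) * \<psi> (snd p))"
      using rr_eq by eventually_elim (simp add: dt_eq split_beta')
  qed measurable
  have e2: "(LINT (s, x)|spacetime. \<rho> s x * (u s x \<bullet> grad (\<lambda>x. \<theta> s * \<psi> x) x))
      = (\<integral>p. indicator half p *\<^sub>R (rr p * (\<theta> (fst p) * ?d\<psi> (snd p) (uu p))) \<partial>lborel)"
  proof (rule spacetime_integral_eq)
    show "AE p in lborel. p \<in> half \<longrightarrow> (case p of (s, x) \<Rightarrow> \<rho> s x * (u s x \<bullet> grad (\<lambda>x. \<theta> s * \<psi> x) x))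
      = rr p * (\<theta> (fst p) * ?d\<psi> (snd p) (uu p))"
      using rr_eq uu_eq by eventually_elim (simp add: grad_eq split_beta')
  qed measurable
  have [measurable]: "(\<lambda>x. rr (0, x)) \<in> borel_measurable borel" by (rule borel_measurable_slice[OF rr_measurable])
  have e3: "(LINT x|lebesgue. \<rho>\<^sub>0 x * (\<theta> 0 * \<psi> x)) = \<theta> 0 * (\<integral>x. rr (0, x) * \<psi> x \<partial>lborel)"
  proof -
    have "(LINT x|lebesgue. \<rho>\<^sub>0 x * (\<theta> 0 * \<psi> x)) = (LINT x|lebesgue. \<theta> 0 * (rr (0, x) * \<psi> x))"
    proof (rule integral_cong_AE)
      show "AE x in lebesgue. \<rho>\<^sub>0 x * (\<theta> 0 * \<psi> x) = \<theta> 0 * (rr (0, x) * \<psi> x)"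
        unfolding AE_completion_iff using rr_initial by eventually_elim simp
      have "\<psi> \<in> borel_measurable lebesgue" by (rule measurable_completion) measurable
      then show "(\<lambda>x. \<rho>\<^sub>0 x * (\<theta> 0 * \<psi> x)) \<in> borel_measurable lebesgue" using \<rho>\<^sub>0_measurable by measurable
      show "(\<lambda>x. \<theta> 0 * (rr (0, x) * \<psi> x)) \<in> borel_measurable lebesgue" by (rule measurable_completion) measurable
    qed
    also have "\<dots> = (\<integral>x. \<theta> 0 * (rr (0, x) * \<psi> x) \<partial>lborel)" by (rule integral_completion) measurable
    finally show ?thesis by simp
  qed
  have half_sets: "half \<in> sets (lborel :: (real \<times> (real^'n)) measure)"
    unfolding sets_lborel by (rule half_measurable)
  have past_sets: "- half \<in> sets (lborel :: (real \<times> (real^'n)) measure)"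
    unfolding sets_lborel by (rule borel_comp[OF half_measurable])
  have past: "(\<integral>p. indicator (- half) p *\<^sub>R (rr p * (?\<theta>' (fst p) * \<psi> (snd p))) \<partial>lborel) = \<theta> 0 * (\<integral>x. rr (0, x) * \<psi> x \<partial>lborel)"
  proof -
    have ip: "integrable lborel (\<lambda>p. indicator (- half) p *\<^sub>R (rr p * (?\<theta>' (fst p) * \<psi> (snd p))))"
      by (rule integrable_mult_indicator[OF past_sets i1])
    have "(\<integral>p. indicator (- half) p *\<^sub>R (rr p * (?\<theta>' (fst p) * \<psi> (snd p))) \<partial>lborel)
      = (\<integral>x. \<integral>t. indicator (- half) (t, x) *\<^sub>R (rr (t, x) * (?\<theta>' t * \<psi> x)) \<partial>lborel \<partial>lborel)"
      using lborel_fubini_snd(1)[OF ip] by simp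
    also have "\<dots> = (\<integral>x. \<theta> 0 * (rr (0, x) * \<psi> x) \<partial>lborel)"
    proof (rule Bochner_Integration.integral_cong[OF refl])
      fix x
      have "(\<integral>t. indicator (- half) (t, x) *\<^sub>R (rr (t, x) * (?\<theta>' t * \<psi> x)) \<partial>lborel)
        = (\<integral>t. (indicator {..0} t * ?\<theta>' t) * (rr (0, x) * \<psi> x) \<partial>lborel)"
        by (intro Bochner_Integration.integral_cong refl) (simp add: indicator_def rr_def)
      also have "\<dots> = \<theta> 0 * (rr (0, x) * \<psi> x)"
        by (simp only: integral_mult_left_zero integral_past(2)[OF \<theta>])
      finally show "(\<integral>t. indicator (- half) (t, x) *\<^sub>R (rr (t, x) * (?\<theta>' t * \<psi> x)) \<partial>lborel) = \<theta> 0 * (rr (0, x) * \<psi> x)" .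
    qed
    finally show ?thesis by simp
  qed
  have ih: "integrable lborel (\<lambda>p. indicator half p *\<^sub>R (rr p * (?\<theta>' (fst p) * \<psi> (snd p))))"
    and ih': "integrable lborel (\<lambda>p. indicator (- half) p *\<^sub>R (rr p * (?\<theta>' (fst p) * \<psi> (snd p))))"
    by (rule integrable_mult_indicator[OF half_sets i1] integrable_mult_indicator[OF past_sets i1])+
  have split: "(\<integral>p. rr p * (?\<theta>' (fst p) * \<psi> (snd p)) \<partial>lborel)
      = (\<integral>p. indicator half p *\<^sub>R (rr p * (?\<theta>' (fst p) * \<psi> (snd p))) \<partial>lborel)
      + (\<integral>p. indicator (- half) p *\<^sub>R (rr p * (?\<theta>' (fst p) * \<psi> (snd p))) \<partial>lborel)"
    unfolding Bochner_Integration.integral_add[OF ih ih', symmetric]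
    by (intro Bochner_Integration.integral_cong refl) (auto simp: indicator_def mem_Times_iff)
  have u0: "?d\<psi> x 0 = 0" for x by (rule linear_0[OF lin])
  have "indicator half p *\<^sub>R (rr p * (\<theta> (fst p) * ?d\<psi> (snd p) (uu p))) = rr p * (\<theta> (fst p) * ?d\<psi> (snd p) (uu p))" for p
    by (cases "p \<in> half") (simp_all add: uu_def u0)
  with e2 have e2': "(LINT (s, x)|spacetime. \<rho> s x * (u s x \<bullet> grad (\<lambda>x. \<theta> s * \<psi> x) x))
      = (\<integral>p. rr p * (\<theta> (fst p) * ?d\<psi> (snd p) (uu p)) \<partial>lborel)" by (simp only:)
  have "(\<integral>p. rr p * (?\<theta>' (fst p) * \<psi> (snd p) + \<theta> (fst p) * ?d\<psi> (snd p) (uu p)) \<partial>lborel)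
      = (\<integral>p. rr p * (?\<theta>' (fst p) * \<psi> (snd p)) \<partial>lborel) + (\<integral>p. rr p * (\<theta> (fst p) * ?d\<psi> (snd p) (uu p)) \<partial>lborel)"
    unfolding distrib_left by (rule Bochner_Integration.integral_add[OF i1 i2])
  also have "\<dots> = 0" using eq unfolding e1 e2' e3 split past by linarith
  finally show "(\<integral>p. rr p * (?\<theta>' (fst p) * \<psi> (snd p) + \<theta> (fst p) * ?d\<psi> (snd p) (uu p)) \<partial>lborel) = 0" .
qed

text \<open>Fubini converts the almost everywhere equality with the Borel representatives into
  equality on almost every time slice. There the squared norm of the weighted velocity is the energy
  density, as the density is nonnegative.\<close>

lemma kinetic_bound: "\<exists>B\<ge>0. AE t in lborel. (\<integral>\<^sup>+x. ennreal (rr (t, x) * (norm (uu (t, x)))\<^sup>2) \<partial>lborel) \<le> ennreal B"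
proof -
  obtain B where B: "AE t in lebesgue_on {0<..}. L2 lebesgue (\<lambda>x. sqrt (\<rho> t x) *\<^sub>R u t x)
      \<and> (LINT x|lebesgue. (norm (sqrt (\<rho> t x) *\<^sub>R u t x))\<^sup>2) \<le> B"
    using kinetic unfolding L_infinity_L2_def by blast
  have "{0<..} \<inter> space lebesgue \<in> sets (lebesgue :: real measure)" by simp
  from B[unfolded AE_restrict_space_iff[OF this] AE_completion_iff]
  have B': "AE t in lborel. 0 < t \<longrightarrow> L2 lebesgue (\<lambda>x. sqrt (\<rho> t x) *\<^sub>R u t x)
      \<and> (LINT x|lebesgue. (norm (sqrt (\<rho> t x) *\<^sub>R u t x))\<^sup>2) \<le> B" by simp
  have "AE p in lborel. p \<in> half \<longrightarrow> (norm (sqrt (\<rho> (fst p) (snd p)) *\<^sub>R u' p))\<^sup>2 = rr p * (norm (uu p))\<^sup>2"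
    using rr_eq uu_eq by eventually_elim (simp add: power_mult_distrib rr_bounds)
  then have "AE p in lborel \<Otimes>\<^sub>M lborel. p \<in> half \<longrightarrow> (norm (sqrt (\<rho> (fst p) (snd p)) *\<^sub>R u' p))\<^sup>2 = rr p * (norm (uu p))\<^sup>2"
    by (simp only: lborel_prod)
  from lborel_pair.AE_pair[OF this]
  have slices: "AE t in lborel. AE x in lborel. 0 < t \<longrightarrow> (norm (sqrt (\<rho> t x) *\<^sub>R u t x))\<^sup>2 = rr (t, x) * (norm (uu (t, x)))\<^sup>2"
    by simp
  have "AE t in lborel. (\<integral>\<^sup>+x. ennreal (rr (t, x) * (norm (uu (t, x)))\<^sup>2) \<partial>lborel) \<le> ennreal (max 0 B)"
    using B' slices
  proof eventually_elim
    case (elim t)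
    show ?case
    proof (cases "0 < t")
      case True
      then have L: "L2 lebesgue (\<lambda>x. sqrt (\<rho> t x) *\<^sub>R u t x)" "(LINT x|lebesgue. (norm (sqrt (\<rho> t x) *\<^sub>R u t x))\<^sup>2) \<le> B"
        using elim(1) by blast+
      have "(\<integral>\<^sup>+x. ennreal (rr (t, x) * (norm (uu (t, x)))\<^sup>2) \<partial>lborel) = (\<integral>\<^sup>+x. ennreal ((norm (sqrt (\<rho> t x) *\<^sub>R u t x))\<^sup>2) \<partial>lborel)"
      proof (rule nn_integral_cong_AE)
        show "AE x in lborel. ennreal (rr (t, x) * (norm (uu (t, x)))\<^sup>2) = ennreal ((norm (sqrt (\<rho> t x) *\<^sub>R u t x))\<^sup>2)"
          using elim(2) by eventually_elim (simp only: True simp_thms)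
      qed
      also have "\<dots> = (\<integral>\<^sup>+x. ennreal ((norm (sqrt (\<rho> t x) *\<^sub>R u t x))\<^sup>2) \<partial>lebesgue)"
        by (rule nn_integral_completion[symmetric])
      also have "\<dots> = ennreal (LINT x|lebesgue. (norm (sqrt (\<rho> t x) *\<^sub>R u t x))\<^sup>2)"
        using L(1) unfolding L2_def by (intro nn_integral_eq_integral) simp_all
      also have "\<dots> \<le> ennreal (max 0 B)" using L(2) by (intro ennreal_leI) simp
      finally show ?thesis .
    next
      case False
      then show ?thesis by (simp add: uu_def)
    qed
  qed
  then show ?thesis by (intro exI[of _ "max 0 B"]) simp
qed

theorem density_bounds:
  "AE (t, x) in lebesgue_on ({0..} \<times> UNIV). 0 < c\<^sub>0 \<and> c\<^sub>0 \<le> \<rho> t x \<and> \<rho> t x \<le> C\<^sub>0"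
proof -
  obtain \<eta> :: "real^'n \<Rightarrow> real" and \<gamma> M R where m: "mollifier \<eta> \<gamma> M R"
    using mollifier_exists by blast
  obtain B where B: "0 \<le> B" "AE t in lborel. (\<integral>\<^sup>+x. ennreal (rr (t, x) * (norm (uu (t, x)))\<^sup>2) \<partial>lborel) \<le> ennreal B"
    using kinetic_bound by blast
  interpret moll: mollifier \<eta> \<gamma> M R by (rule m)
  interpret tr: transport \<eta> \<gamma> M R uu rr gg c\<^sub>0 C\<^sub>0 D B
  proof
    show "L1_loc uu" by (rule uu_L1_loc)
    show "uu (t, x) = 0" if "t \<le> 0" for t x using that by (simp add: uu_def)
    show "rr \<in> borel_measurable borel" by measurable
    show "0 \<le> rr p" "rr p \<le> D" for p by (rule rr_bounds)+
    show "rr (t, x) = rr (0, x)" if "t \<le> 0" for t x using that by (simp add: rr_def)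
    show "c\<^sub>0 \<le> rr (0, x)" "rr (0, x) \<le> C\<^sub>0" for x using c\<^sub>0_le_C\<^sub>0 by (simp_all add: rr_def)
    show "gg i \<in> borel_measurable borel" for i by measurable
  qed (use c\<^sub>0_pos rr_transported gg_L2 gradient_test incompressible_lborel B in auto)
  \<comment> \<open>The claim includes t = 0, whereas the extended density agrees with the given one
    for positive times only; the hyperplane t = 0 is a null set.\<close>
  have "AE p in (lborel :: (real \<times> (real^'n)) measure). fst p \<noteq> 0"
  proof (rule AE_lborel_prodI)
    show "AE t in lborel. fst (t, y :: real^'n) \<noteq> (0::real)" for y
      using AE_lborel_singleton[of "0::real"] by simp
  qed measurable
  with tr.density_bounds rr_eq
  have *: "AE p in lborel. p \<in> {0..} \<times> UNIV \<longrightarrow> 0 < c\<^sub>0 \<and> c\<^sub>0 \<le> \<rho> (fst p) (snd p) \<and> \<rho> (fst p) (snd p) \<le> C\<^sub>0"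
  proof eventually_elim
    case (elim p)
    show ?case
    proof
      assume "p \<in> {0::real..} \<times> (UNIV :: (real^'n) set)"
      then have "0 \<le> fst p" by (cases p) simp
      then have "p \<in> half" using elim(3) unfolding half_iff by simp
      then show "0 < c\<^sub>0 \<and> c\<^sub>0 \<le> \<rho> (fst p) (snd p) \<and> \<rho> (fst p) (snd p) \<le> C\<^sub>0" using elim(1,2) c\<^sub>0_pos by simp
    qed
  qed
  have "closed ({0::real..} \<times> (UNIV :: (real^'n) set))" by (intro closed_Times closed_atLeast closed_UNIV)
  then have "{0::real..} \<times> (UNIV :: (real^'n) set) \<inter> space lebesgue \<in> sets lebesgue"
    by (simp add: sets_completionI_sets borel_closed)
  from * show ?thesis
    unfolding AE_restrict_space_iff[OF \<open>{0::real..} \<times> (UNIV :: (real^'n) set) \<inter> space lebesgue \<in> sets lebesgue\<close>] AE_completion_iff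
    by (simp add: split_beta')
qed

end

theorem theorem1p8:
  fixes \<nu> c\<^sub>0 C\<^sub>0 :: real
    and \<rho>\<^sub>0 :: "real^'n \<Rightarrow> real" and u\<^sub>0 :: "real^'n \<Rightarrow> real^'n"
    and \<rho> :: "real \<Rightarrow> real^'n \<Rightarrow> real" and u :: "real \<Rightarrow> real^'n \<Rightarrow> real^'n"
  assumes "CARD('n) \<in> {2, 3}"
    and "\<nu> > 0"
    and "L_infinity lebesgue \<rho>\<^sub>0"
    and "L2_sigma u\<^sub>0"
    and "0 < c\<^sub>0" and "AE x in lebesgue. c\<^sub>0 \<le> \<rho>\<^sub>0 x \<and> \<rho>\<^sub>0 x \<le> C\<^sub>0"
    and "Leray_Hopf \<nu> \<rho>\<^sub>0 u\<^sub>0 \<rho> u"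
  shows "AE (t, x) in lebesgue_on ({0..} \<times> UNIV). 0 < c\<^sub>0 \<and> c\<^sub>0 \<le> \<rho> t x \<and> \<rho> t x \<le> C\<^sub>0"
proof -
  from assms(7) obtain G where "weak_density \<rho>\<^sub>0 \<rho> u G c\<^sub>0 C\<^sub>0"
    using assms(3,5,6) unfolding Leray_Hopf_def L_infinity_def weak_density_def by blast
  then show ?thesis by (rule weak_density.density_bounds)
qed

end
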